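(* Let $R$ be a measurable function on $\mathbb{T}$ with $|R(t)|\le 1$ and $\log(1-|R|)\in L^1(\mathbb{T})$; let $Z=\{\zeta_k\}\subset\mathbb{D}\setminus\{0\}$ be a (finite or countable) set of distinct points with $\sum_k(1-|\zeta_k|)<\infty$ and let $\nu$ be a positive measure supported on $Z$ with $\nu(\zeta_k)=\nu_k>0$. Put $\alpha=\{R,\nu\}$ and $\alpha_{-1}=\{\zeta^{-1}R(\zeta),\,|\zeta|^{-2}\nu(\zeta)\}$, and let $T$ and the dual data $\alpha^\tau=\{R^\tau,\nu^\tau\}$ be as defined in the context. Let $\check K^{\alpha_{-1}}$ and $\hat K^{\alpha^\tau}$ be the normalized reproducing kernels at the origin of $\check H^2(\alpha_{-1})$ and $\hat H^2(\alpha^\tau)$ respectively. Then $$T(0)\,\check K^{\alpha_{-1}}(0)\,\hat K^{\alpha^\tau}(0)=1 .$$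
   Context: $L^2=L^2(\mathbb{T})$ is taken with respect to normalized Lebesgue measure, $H^2$ is the Hardy space, $H^2_-=L^2\ominus H^2$, $P_-$ is the orthogonal projection onto $H^2_-$. **Outer function.** $T_e$ is the outer function on $\mathbb{D}$ with $|T_e|^2=1-|R|^2$ on $\mathbb{T}$ and $T_e(0)>0$. **The space $L^2_R$.** It is the closure of the vectors $\begin{bmatrix} f\\ -P_-Rf\end{bmatrix}$, $f\in L^2$, with respect to the metric $$\left\langle \begin{bmatrix}1&\bar R\\ R&1\end{bmatrix}\begin{bmatrix}f_1\\ f_2\end{bmatrix},\begin{bmatrix}f_1\\ f_2\end{bmatrix}\right\rangle .$$ Equivalently, $L^2_R$ consists of the pairs with $T_ef_1\in L^2$, $\bar T_ef_2\in H^2_-$, $Rf_1+f_2\in H^2$; the first component $f_1$ determines $f_2$ uniquely. **The space $L^2(\alpha)$.** It consists of functions $f$ on $\mathbb{T}\cup Z$ such that $f|_{\mathbb{T}}=f_1$ with $\begin{bmatrix}f_1\\ f_2\end{bmatrix}\in L^2_R$, and $f(\zeta_k)=f_k$ with $\{f_k\}\in L^2_\nu$ (i.e. $\sum_k|f_k|^2\nu_k<\infty$), with norm $$\|f\|^2_{L^2(\alpha)}=\left\|\begin{bmatrix}f_1\\ f_2\end{bmatrix}\right\|^2_{L^2_R}+\|\{f_k\}\|^2_{L^2_\nu};$$ that is, $L^2(\alpha)=L^2_R\oplus L^2_\nu$. **Hardy spaces.** $\check H^2(\alpha)$ is the closure in $L^2(\alpha)$ of the functions $f\in H^2$ that vanish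 at all points of $Z$ except for a finite number of them (a function in $H^2$ is naturally defined on $\mathbb{T}\cup Z$). $\hat H^2(\alpha)$ is the set of $f\in L^2(\alpha)$ such that $g:=T_ef|_{\mathbb{T}}\in H^2$ and $f(\zeta_k)=g(\zeta_k)/T_e(\zeta_k)$ for all $k$. One has $\check H^2(\alpha)\subset\hat H^2(\alpha)$. A function $f$ in either space is regarded as analytic in $\mathbb{D}$ via $f=g/T_e$, so $f(0)=g(0)/T_e(0)$. **Kernels.** Let $\check k^\alpha$ (resp. $\hat k^\alpha$) be the element of $\check H^2(\alpha)$ (resp. $\hat H^2(\alpha)$) with $\langle f,\check k^\alpha\rangle_{L^2(\alpha)}=f(0)$ for all $f\in\check H^2(\alpha)$ (resp. $\langle f,\hat k^\alpha\rangle_{L^2(\alpha)}=f(0)$ for all $f\in\hat H^2(\alpha)$), and let $\check K^\alpha=\check k^\alpha/\|\check k^\alpha\|$, $\hat K^\alpha=\hat k^\alpha/\|\hat k^\alpha\|$. **Shifted data.** $\alpha_{-1}$ consists of the symbol $t\mapsto t^{-1}R(t)$ on $\mathbb{T}$ and the measure with mass $|\zeta_k|^{-2}\nu_k$ at each $\zeta_k\in Z$. **Dual data.** Let $B(\zeta)=\prod_{\zeta_k\in Z}\frac{\zeta_k-\zeta}{1-\bar\zeta_k\zeta}\frac{|\zeta_k|}{\zeta_k}$ and $T=T_e/B$. Put $$R^\tau(\bar t)=-\frac{R(t)}{T_e(t)}\overline{T(t)},\quad t\in\mathbb{T},$$ and let $\nu^\tau$ be the measure supported on $Z^\tau:=\bar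 Z=\{\bar\zeta_k\}$ with $$\nu^\tau(\bar\zeta_k)\,\nu(\zeta_k)=\left|\left(\tfrac1T\right)'(\zeta_k)\right|^2 .$$ Set $\alpha^\tau=\{R^\tau,\nu^\tau\}$. **Spaces and kernels for $\alpha_{-1}$ and $\alpha^\tau$.** Let $\beta=\{S,\mu\}$ be either $\alpha_{-1}$ (symbol $S(t)=t^{-1}R(t)$, masses $\mu(\zeta_k)=|\zeta_k|^{-2}\nu_k$, support set $W=Z$, outer function $E=T_e$) or $\alpha^\tau$ (symbol $S=R^\tau$, measure $\mu=\nu^\tau$, support set $W=Z^\tau$, outer function $E=T_e^\tau$, where $T_e^\tau(\zeta)=\overline{T_e(\bar\zeta)}$); in both cases $|E|^2=1-|S|^2$ on $\mathbb{T}$ and $E(0)>0$. Then $L^2_S$ is the closure of the vectors $\begin{bmatrix} f\\ -P_-Sf\end{bmatrix}$, $f\in L^2$, with respect to the metric $$\left\langle \begin{bmatrix}1&\bar S\\ S&1\end{bmatrix}\begin{bmatrix}f_1\\ f_2\end{bmatrix},\begin{bmatrix}f_1\\ f_2\end{bmatrix}\right\rangle ,$$ equivalently the set of pairs with $Ef_1\in L^2$, $\bar Ef_2\in H^2_-$, $Sf_1+f_2\in H^2$ (and $f_1$ determines $f_2$ uniquely). The space $L^2(\beta)=L^2_S\oplus L^2_\mu$ consists of functions $f$ on $\mathbb{T}\cup W$ such that $f|_{\mathbb{T}}=f_1$ with $\begin{bmatrix}f_1\\ f_2\end{bmatrix}\in L^2_S$ and $\sum_{w\in W}|f(w)|^2\mu(w)<\infty$,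 with norm $$\|f\|^2_{L^2(\beta)}=\left\|\begin{bmatrix}f_1\\ f_2\end{bmatrix}\right\|^2_{L^2_S}+\sum_{w\in W}|f(w)|^2\mu(w).$$ $\check H^2(\beta)$ is the closure in $L^2(\beta)$ of the functions $f\in H^2$ that vanish at all points of $W$ except for a finite number of them; $\hat H^2(\beta)$ is the set of $f\in L^2(\beta)$ such that $g:=Ef|_{\mathbb{T}}\in H^2$ and $f(w)=g(w)/E(w)$ for all $w\in W$. A function $f$ in either space is regarded as analytic in $\mathbb{D}$ via $f=g/E$, so $f(0)=g(0)/E(0)$. Let $\check k^\beta\in\check H^2(\beta)$ and $\hat k^\beta\in\hat H^2(\beta)$ be the elements with $\langle f,\check k^\beta\rangle_{L^2(\beta)}=f(0)$ for all $f\in\check H^2(\beta)$ and $\langle f,\hat k^\beta\rangle_{L^2(\beta)}=f(0)$ for all $f\in\hat H^2(\beta)$, and put $\check K^\beta=\check k^\beta/\|\check k^\beta\|$, $\hat K^\beta=\hat k^\beta/\|\hat k^\beta\|$.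
   Formalization: The dual masses are normalized by ν^τ(ζ̄_k)ν(ζ_k) = 1/|(1/T)'(ζ_k)|² instead of |(1/T)'(ζ_k)|²; with the latter the identity fails already for R = 0 and Z a single point. *)

theory Defs
  imports "HOL-Analysis.Analysis"
begin

section \<open>The Hardy space on the unit circle\<close>

text \<open>Functions on the circle are functions on the complex plane. The complement of the circle is a
  null set of the completed measure \<open>circle\<close>, so measurability, integrals and almost-everywhere
  statements ignore the values off the circle; those values are free to encode the
  values of a function at points of the open disc. Elements of function spaces are representatives,
  and the sets below are closed under almost-everywhere equality on the circle.\<close>

definition circle :: "complex measure" where
  "circle = completion (distr (uniform_measure lborel {0..<2 * pi}) borel cis)"

definition L2 :: "(complex \<Rightarrow> complex) set" where
  "L2 = {f. f \<in> borel_measurable circle \<and> integrable circle (\<lambda>t. (cmod (f t))\<^sup>2)}"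

definition L2_inner :: "(complex \<Rightarrow> complex) \<Rightarrow> (complex \<Rightarrow> complex) \<Rightarrow> complex" where
  "L2_inner f g = (LINT t|circle. f t * cnj (g t))"

definition fourier_coeff :: "(complex \<Rightarrow> complex) \<Rightarrow> int \<Rightarrow> complex" where
  "fourier_coeff f n = L2_inner f (\<lambda>t. t powi n)"

definition H2 :: "(complex \<Rightarrow> complex) set" where
  "H2 = {f \<in> L2. \<forall>n<0. fourier_coeff f n = 0}"

definition H2_minus :: "(complex \<Rightarrow> complex) set" where
  "H2_minus = {f \<in> L2. \<forall>h\<in>H2. L2_inner f h = 0}"

definition P_minus :: "(complex \<Rightarrow> complex) \<Rightarrow> complex \<Rightarrow> complex" where
  "P_minus f = (SOME g. g \<in> H2_minus \<and> (\<lambda>t. f t - g t) \<in> H2)"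

text \<open>The analytic function in the disc that corresponds to an element of \<open>H2\<close>, and conversely the
  boundary function on the circle of an analytic function in the disc. The latter is determined
  almost everywhere, and is the almost-everywhere radial limit.\<close>

definition disc_ext :: "(complex \<Rightarrow> complex) \<Rightarrow> complex \<Rightarrow> complex" where
  "disc_ext f z = (\<Sum>n. fourier_coeff f (int n) * z ^ n)"

definition boundary :: "(complex \<Rightarrow> complex) \<Rightarrow> complex \<Rightarrow> complex" where
  "boundary F = (SOME f. f \<in> H2 \<and> (\<forall>z\<in>ball 0 1. disc_ext f z = F z))"

text \<open>The logarithm takes the value \<open>-\<infinity>\<close> at 0, whereas \<^term>\<open>ln (0::real) = 0\<close>; hence the explicit
  requirement that the weight be positive almost everywhere.\<close>

definition log_integrable :: "(complex \<Rightarrow> real) \<Rightarrow> bool" where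
  "log_integrable w \<longleftrightarrow> (AE t in circle. 0 < w t) \<and> integrable circle (\<lambda>t. ln (w t))"

text \<open>The outer function with modulus \<open>w\<close> on the circle and positive value at the origin.\<close>

definition outer :: "(complex \<Rightarrow> real) \<Rightarrow> complex \<Rightarrow> complex" where
  "outer w z = exp (LINT t|circle. (t + z) / (t - z) * complex_of_real (ln (w t)))"

definition blaschke :: "complex set \<Rightarrow> complex \<Rightarrow> complex" where
  "blaschke Z z = Lim (finite_subsets_at_top Z)
     (\<lambda>F. \<Prod>w\<in>F. (w - z) / (1 - cnj w * z) * (complex_of_real (cmod w) / w))"


section \<open>Scattering data\<close>

text \<open>The measure supported on the set \<open>points\<close> is given by its masses; the values of \<open>mass\<close> outside
  this set play no role.\<close>

record scattering_data =
  symbol :: "complex \<Rightarrow> complex"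
  points :: "complex set"
  mass :: "complex \<Rightarrow> real"

definition Te :: "scattering_data \<Rightarrow> complex \<Rightarrow> complex" where
  "Te \<alpha> = outer (\<lambda>t. sqrt (1 - (cmod (symbol \<alpha> t))\<^sup>2))"

definition Te_bd :: "scattering_data \<Rightarrow> complex \<Rightarrow> complex" where
  "Te_bd \<alpha> = boundary (Te \<alpha>)"

definition T :: "scattering_data \<Rightarrow> complex \<Rightarrow> complex" where
  "T \<alpha> z = Te \<alpha> z / blaschke (points \<alpha>) z"

definition T_bd :: "scattering_data \<Rightarrow> complex \<Rightarrow> complex" where
  "T_bd \<alpha> t = Te_bd \<alpha> t / boundary (blaschke (points \<alpha>)) t"

definition shift :: "scattering_data \<Rightarrow> scattering_data" where
  "shift \<alpha> = \<lparr>symbol = (\<lambda>t. inverse t * symbol \<alpha> t),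
              points = points \<alpha>,
              mass = (\<lambda>z. mass \<alpha> z / (cmod z)\<^sup>2)\<rparr>"

text \<open>At a point \<open>z\<close> of the support, \<open>T\<close> has a pole, \<open>1 / T\<close> has a zero, and the
  convention \<open>x / 0 = 0\<close> gives \<open>1 / T\<close> the correct value there, so that \<^const>\<open>deriv\<close>
  is the derivative of the analytic function \<open>1 / T\<close>.

  The dual masses are normalized by \<open>mass\<^sup>\<tau> (cnj z) * mass z = 1 / \<bar>(1 / T)' z\<bar>\<^sup>2\<close>. The reciprocal
  on the right-hand side is essential: without it the identity between the kernels at the origin
  already fails for the zero symbol and a single point. In that case both Hardy spaces are \<open>H2\<close>
  with one extra point mass, and for the point 1/2 with mass 1 (so that \<open>\<bar>(1 / T)'\<bar> = 4/3\<close>) the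
  squared product of \<open>T 0\<close> and the two normalized kernels at 0 is
  \<open>4 * (7/19) * (19/28) = 1\<close> for the dual mass 9/16, but \<open>4 * (7/19) * (43/91) \<noteq> 1\<close> for the dual
  mass 16/9.\<close>

definition dual :: "scattering_data \<Rightarrow> scattering_data" where
  "dual \<alpha> = \<lparr>symbol = (\<lambda>s. - (symbol \<alpha> (cnj s) / Te_bd \<alpha> (cnj s)) * cnj (T_bd \<alpha> (cnj s))),
             points = cnj ` points \<alpha>,
             mass = (\<lambda>w. 1 / ((cmod (deriv (\<lambda>z. 1 / T \<alpha> z) (cnj w)))\<^sup>2 * mass \<alpha> (cnj w)))\<rparr>"


section \<open>The spaces associated with scattering data\<close>

text \<open>The pointwise form given by the matrix with rows \<open>(1, cnj S)\<close> and \<open>(S, 1)\<close>. For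
  \<open>\<bar>S\<bar> \<le> 1\<close> it is positive semidefinite.\<close>

definition metric_form ::
  "(complex \<Rightarrow> complex) \<Rightarrow> (complex \<Rightarrow> complex) \<times> (complex \<Rightarrow> complex) \<Rightarrow>
   (complex \<Rightarrow> complex) \<times> (complex \<Rightarrow> complex) \<Rightarrow> complex \<Rightarrow> complex" where
  "metric_form S f g t =
     (fst f t + cnj (S t) * snd f t) * cnj (fst g t) + (S t * fst f t + snd f t) * cnj (snd g t)"

text \<open>The closure is taken in the space of all pairs of measurable functions. The pointwise form
  need not be integrable for arbitrary pairs, hence the nonnegative extended integral.\<close>

definition L2_pairs :: "(complex \<Rightarrow> complex) \<Rightarrow> ((complex \<Rightarrow> complex) \<times> (complex \<Rightarrow> complex)) set" where
  "L2_pairs S = {(f1, f2). f1 \<in> borel_measurable circle \<and> f2 \<in> borel_measurable circle \<and>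
     (\<forall>e>0. \<exists>h\<in>L2.
        let d = (\<lambda>t. f1 t - h t, \<lambda>t. f2 t - (- P_minus (\<lambda>s. S s * h s) t))
        in (\<integral>\<^sup>+t. ennreal (Re (metric_form S d d t)) \<partial>circle) < ennreal e)}"

text \<open>The second component is determined almost everywhere by the first one.\<close>

definition companion :: "(complex \<Rightarrow> complex) \<Rightarrow> (complex \<Rightarrow> complex) \<Rightarrow> complex \<Rightarrow> complex" where
  "companion S f1 = (SOME f2. (f1, f2) \<in> L2_pairs S)"

text \<open>An element of the following space is a function on the union of the circle and the points of
  the support; its values elsewhere play no role.\<close>

definition L2_data :: "scattering_data \<Rightarrow> (complex \<Rightarrow> complex) set" where
  "L2_data \<beta> = {f. (\<exists>f2. (f, f2) \<in> L2_pairs (symbol \<beta>)) \<and>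
     (\<lambda>w. (cmod (f w))\<^sup>2 * mass \<beta> w) summable_on points \<beta>}"

definition inner_data :: "scattering_data \<Rightarrow> (complex \<Rightarrow> complex) \<Rightarrow> (complex \<Rightarrow> complex) \<Rightarrow> complex" where
  "inner_data \<beta> f g =
     (LINT t|circle. metric_form (symbol \<beta>) (f, companion (symbol \<beta>) f) (g, companion (symbol \<beta>) g) t)
     + (\<Sum>\<^sub>\<infinity>w\<in>points \<beta>. f w * cnj (g w) * complex_of_real (mass \<beta> w))"

definition norm_data :: "scattering_data \<Rightarrow> (complex \<Rightarrow> complex) \<Rightarrow> real" where
  "norm_data \<beta> f = sqrt (Re (inner_data \<beta> f f))"

definition H2_core :: "scattering_data \<Rightarrow> (complex \<Rightarrow> complex) set" where
  "H2_core \<beta> = {f \<in> H2. (\<forall>w\<in>points \<beta>. f w = disc_ext f w) \<and> finite {w \<in> points \<beta>. f w \<noteq> 0}}"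

definition H2_check :: "scattering_data \<Rightarrow> (complex \<Rightarrow> complex) set" where
  "H2_check \<beta> = {f \<in> L2_data \<beta>. \<forall>e>0. \<exists>h\<in>H2_core \<beta>. norm_data \<beta> (\<lambda>z. f z - h z) < e}"

definition H2_hat :: "scattering_data \<Rightarrow> (complex \<Rightarrow> complex) set" where
  "H2_hat \<beta> = {f \<in> L2_data \<beta>. (\<lambda>t. Te_bd \<beta> t * f t) \<in> H2 \<and>
     (\<forall>w\<in>points \<beta>. f w = disc_ext (\<lambda>t. Te_bd \<beta> t * f t) w / Te \<beta> w)}"

text \<open>The value at the origin is that of the analytic function \<open>g / Te\<close>; the value \<open>f 0\<close> of the
  representative is meaningless.\<close>

definition value_at_0 :: "scattering_data \<Rightarrow> (complex \<Rightarrow> complex) \<Rightarrow> complex" where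
  "value_at_0 \<beta> f = disc_ext (\<lambda>t. Te_bd \<beta> t * f t) 0 / Te \<beta> 0"

definition k_check :: "scattering_data \<Rightarrow> complex \<Rightarrow> complex" where
  "k_check \<beta> = (SOME k. k \<in> H2_check \<beta> \<and> (\<forall>f\<in>H2_check \<beta>. inner_data \<beta> f k = value_at_0 \<beta> f))"

definition k_hat :: "scattering_data \<Rightarrow> complex \<Rightarrow> complex" where
  "k_hat \<beta> = (SOME k. k \<in> H2_hat \<beta> \<and> (\<forall>f\<in>H2_hat \<beta>. inner_data \<beta> f k = value_at_0 \<beta> f))"

definition K_check :: "scattering_data \<Rightarrow> complex \<Rightarrow> complex" where
  "K_check \<beta> = (\<lambda>z. k_check \<beta> z / complex_of_real (norm_data \<beta> (k_check \<beta>)))"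

definition K_hat :: "scattering_data \<Rightarrow> complex \<Rightarrow> complex" where
  "K_hat \<beta> = (\<lambda>z. k_hat \<beta> z / complex_of_real (norm_data \<beta> (k_hat \<beta>)))"

end

theory Submission
  imports Defs "HOL-Complex_Analysis.Complex_Analysis"
begin

text \<open>Write \<open>S\<close>, \<open>m\<close> for the symbol and the masses of the shifted data, \<open>E\<close> for the outer function and
  \<open>b\<close> for the Blaschke product, and let \<open>d = (1/T)'\<close>. The map that sends \<open>(f\<^sub>1, f\<^sub>2)\<close> and the values \<open>f(w)\<close>
  to \<open>(cnj b (f\<^sub>1 + cnj S f\<^sub>2) / cnj E, t (S f\<^sub>1 + f\<^sub>2) / E)\<close> and \<open>- cnj w m(w) cnj d(w) f(w)\<close>, all
  reflected by \<open>t \<mapsto> cnj t\<close>, is unitary from the space of the shifted data onto that of the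
  dual data. Let \<open>\<kappa>\<close> be the image of the check kernel \<open>k\<close>. Testing \<open>k\<close> against core functions
  divisible by \<open>b\<close>, and against those vanishing on all of \<open>Z\<close> but one point, shows that \<open>\<kappa>\<close> lies in the hat
  space and that \<open>\<kappa>(0) = b(0) / E(0) = 1 / T(0)\<close>. Conversely, an element of the hat space that
  vanishes at 0 comes from a vector orthogonal to the check space, so that \<open>\<kappa>\<close> is a multiple of the hat
  kernel. Hence the normalized hat kernel takes the value \<open>\<kappa>(0) / \<parallel>\<kappa>\<parallel> = 1 / (T(0) \<parallel>k\<parallel>)\<close> at 0, and
  \<open>\<parallel>k\<parallel>\<close> is the value at 0 of the normalized check kernel.\<close>

section \<open>The circle\<close>

text \<open>What makes the map unitary is that the metric splits in two ways: as |E|^2 = 1 - |S|^2,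
  the form is |E f1|^2 + |S f1 + f2|^2 and also |E f2|^2 + |f1 + cnj S f2|^2. The map trades one
  splitting for the other. Reflection alone would send \<open>H2_minus\<close> only onto the
  functions of \<open>H2\<close> vanishing at 0; the extra factor t repairs this, and it explains
  the shifted data, since t S is the original symbol. The factor \<open>cnj b\<close> is there
  because the map tests against multiples of b on one side, while nothing on the other side has to
  vanish on the support. Two obstacles shape the development. The spaces are closures, and the
  components of their elements need not be in \<open>L2\<close>; the explicit description of the
  closure rests on Smirnov's theorem, for which the outer function comes with bounded analytic
  \<open>p n\<close> such that \<open>p n * E\<close> tends boundedly to 1. Moreover the kernels are
  picked by \<open>SOME\<close>, so their existence must be shown: the check kernel is a rescaled
  element of least norm, the hat kernel a multiple of \<kappa>.\<close>

lemma measurable_cis_borel [measurable]: "cis \<in> borel_measurable borel"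
  by (intro borel_measurable_continuous_onI continuous_intros)

lemma measurable_cnj_borel [measurable]: "cnj \<in> borel_measurable borel"
  by (intro borel_measurable_continuous_onI continuous_intros)

lemma space_circle [simp]: "space circle = UNIV"
  by (simp add: circle_def)

lemma borel_measurable_circleI: "f \<in> borel_measurable borel \<Longrightarrow> f \<in> borel_measurable circle"
  unfolding circle_def by (rule measurable_completion) simp

lemma sets_circleI: "A \<in> sets borel \<Longrightarrow> A \<in> sets circle"
  unfolding circle_def by (rule sets_completionI_sets) simp

lemma emeasure_lborel_arc: "emeasure lborel {0..<2 * pi} = ennreal (2 * pi)"
  by simp

lemma AE_circleI:
  assumes "AE x in lborel. P (cis x)" "{x. P x} \<in> sets borel"
  shows "AE t in circle. P t"
proof -
  have "AE x in uniform_measure lborel {0..<2 * pi}. P (cis x)"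
    unfolding uniform_measure_def
    by (subst AE_density) (use assms(1) in auto)
  then have "AE t in distr (uniform_measure lborel {0..<2 * pi}) borel cis. P t"
    using assms(2) by (subst AE_distr_iff) auto
  then show ?thesis
    unfolding circle_def by (rule AE_completion)
qed

lemma AE_circle_norm: "AE t in circle. cmod t = 1"
  by (rule AE_circleI) auto

lemma nn_integral_circle:
  assumes [measurable]: "f \<in> borel_measurable borel"
  shows "(\<integral>\<^sup>+t. f t \<partial>circle) = (\<integral>\<^sup>+x. f (cis x) * indicator {0..<2 * pi} x \<partial>lborel) / ennreal (2 * pi)"
proof -
  show ?thesis
    unfolding circle_def nn_integral_completion
    by (simp add: nn_integral_distr nn_integral_uniform_measure)
qed

lemma emeasure_circle_UNIV: "emeasure circle UNIV = 1"
proof -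
  have "emeasure circle UNIV = (\<integral>\<^sup>+t. 1 \<partial>circle)"
    by simp
  also have "\<dots> = 1"
    by (subst nn_integral_circle) (auto simp: divide_ennreal)
  finally show ?thesis .
qed

interpretation circle: finite_measure circle
  by standard (simp add: emeasure_circle_UNIV)

text \<open>Completeness keeps every modification on a null set measurable. Functions in the data
  spaces are altered on the support, a null set, in exactly this way.\<close>

interpretation circle: complete_measure circle
  unfolding circle_def
  by standard (metis null_sets_completion_iff2 null_sets_completion_subset null_setsD2)

lemma measure_circle_UNIV [simp]: "measure circle UNIV = 1"
  by (simp add: measure_def emeasure_circle_UNIV)

lemma integral_circle:
  fixes f :: "complex \<Rightarrow> complex"
  assumes [measurable]: "f \<in> borel_measurable borel"
  shows "(LINT t|circle. f t) = (LINT x:{0..<2 * pi}|lborel. f (cis x)) / (2 * pi)"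
proof -
  have eq: "uniform_measure lborel {0..<2 * pi} = density lborel (\<lambda>x. ennreal (indicator {0..<2 * pi} x / (2 * pi)))"
    unfolding uniform_measure_def emeasure_lborel_arc
    by (intro density_cong) (auto simp: indicator_def divide_ennreal[symmetric] ennreal_divide_numeral)
  have "(LINT t|circle. f t) = (LINT x|uniform_measure lborel {0..<2 * pi}. f (cis x))"
    unfolding circle_def by (simp add: integral_completion integral_distr)
  also have "\<dots> = (LINT x|lborel. (indicator {0..<2 * pi} x / (2 * pi)) *\<^sub>R f (cis x))"
    unfolding eq by (subst integral_density) auto
  also have "\<dots> = (LINT x|lborel. (1 / (2 * pi)) *\<^sub>R (indicator {0..<2 * pi} x *\<^sub>R f (cis x)))"
    by (intro Bochner_Integration.integral_cong) auto
  also have "\<dots> = (1 / (2 * pi)) *\<^sub>R (LINT x|lborel. indicator {0..<2 * pi} x *\<^sub>R f (cis x))"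
    by (rule integral_scaleR_right)
  finally show ?thesis
    by (simp add: set_lebesgue_integral_def scaleR_conv_of_real)
qed

lemma integral_circle_powi: "(LINT t|circle. t powi n) = (if n = 0 then 1 else 0)"
proof (cases "n = 0")
  case False
  have [measurable]: "(\<lambda>t::complex. t powi n) \<in> borel_measurable borel"
    unfolding power_int_def by measurable
  define F where "F = (\<lambda>x. cis (of_int n * x) / (\<i> * of_int n))"
  have 1: "cis x powi n = cis (of_int n * x)" for x
    by (simp add: cis_power_int)
  \<comment> \<open>The fundamental theorem of calculus is applied on a closed interval; the added
    endpoint is a null set.\<close>
  have "(LINT x:{0..<2 * pi}|lborel. cis x powi n) = (LINT x:{0..2 * pi}|lborel. cis x powi n)"
    unfolding set_lebesgue_integral_def
    by (rule integral_cong_AE, unfold 1, measurable)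
       (use AE_lborel_singleton[of "2*pi"] in \<open>auto elim!: eventually_mono simp: indicator_def\<close>)
  also have "\<dots> = (LINT x|lborel. indicator {0..2 * pi} x *\<^sub>R cis (of_int n * x))"
    unfolding set_lebesgue_integral_def 1 ..
  also have "\<dots> = F (2 * pi) - F 0"
  proof (rule integral_FTC_Icc)
    fix x
    show "(F has_vector_derivative cis (of_int n * x)) (at x within {0..2 * pi})"
      unfolding F_def cis_conv_exp has_field_derivative_def using False
      by (auto intro!: derivative_eq_intros has_vector_derivative_real_field simp: field_simps)
  qed (auto intro!: continuous_intros)
  also have "\<dots> = 0"
    using False by (auto simp: F_def cis_conv_exp algebra_simps)
  finally show ?thesis
    using False by (subst integral_circle) auto
qed simp

section \<open>Invariance of the measure under conjugation\<close>

text \<open>The substitution of 2 * pi - x for x turns [0, 2 pi) into (0, 2 pi]; the two intervals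
  differ by a null set, which the almost-everywhere step absorbs.\<close>

lemma nn_integral_circle_cnj:
  assumes [measurable]: "f \<in> borel_measurable borel"
  shows "(\<integral>\<^sup>+t. f (cnj t) \<partial>circle) = (\<integral>\<^sup>+t. f t \<partial>circle)"
proof -
  have "(\<integral>\<^sup>+x. f (cis x) * indicator {0..<2 * pi} x \<partial>lborel)
      = (\<integral>\<^sup>+x. f (cis (2 * pi + (-1) * x)) * indicator {0..<2 * pi} (2 * pi + (-1) * x) \<partial>lborel)"
    by (subst nn_integral_real_affine[where c = "-1" and t = "2 * pi"]) auto
  also have "\<dots> = (\<integral>\<^sup>+x. f (cis (-x)) * indicator {0..<2 * pi} x \<partial>lborel)"
  proof (rule nn_integral_cong_AE)
    have "AE x in lborel. x \<noteq> 0 \<and> x \<noteq> 2 * pi"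
      using AE_lborel_singleton[of "2*pi"] AE_lborel_singleton[of "0::real"] by auto
    then show "AE x in lborel. f (cis (2 * pi + (-1) * x)) * indicator {0..<2 * pi} (2 * pi + (-1) * x)
        = f (cis (-x)) * indicator {0..<2 * pi} x"
    proof eventually_elim
      fix x :: real assume "x \<noteq> 0 \<and> x \<noteq> 2 * pi"
      moreover have "cis (2 * pi + (-1) * x) = cis (-x)"
        by (simp add: cis_inverse inverse_eq_divide flip: cis_divide) (metis cis_inverse inverse_eq_divide)
      ultimately show "f (cis (2 * pi + (-1) * x)) * indicator {0..<2 * pi} (2 * pi + (-1) * x)
        = f (cis (-x)) * indicator {0..<2 * pi} x"
        by (auto simp: indicator_def)
    qed
  qed
  finally show ?thesis
    by (subst (1 2) nn_integral_circle) (auto simp: cis_cnj)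
qed

lemma emeasure_circle_borel_cnj:
  assumes "A \<in> sets borel"
  shows "emeasure circle (cnj -` A) = emeasure circle A"
proof -
  have m: "cnj -` A \<in> sets borel"
    using measurable_sets[OF measurable_cnj_borel assms] by simp
  have "(\<integral>\<^sup>+t. indicator A (cnj t) \<partial>circle) = (\<integral>\<^sup>+t. indicator A t \<partial>circle)"
    using assms by (intro nn_integral_circle_cnj) auto
  moreover have "(\<lambda>t. indicator A (cnj t)) = (indicator (cnj -` A) :: _ \<Rightarrow> ennreal)"
    by (auto simp: indicator_def)
  ultimately show ?thesis
    using m assms by (simp add: sets_circleI)
qed

text \<open>Borel statements about the circle reach all sets of the completion through this
  approximation.\<close>

lemma circle_sandwich:
  assumes "A \<in> sets circle"
  obtains S N where "S \<in> sets borel" "N \<in> sets borel" "emeasure circle N = 0" "S \<subseteq> A" "A \<subseteq> S \<union> N"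
proof -
  let ?M = "distr (uniform_measure lborel {0..<2 * pi}) borel cis"
  from assms obtain S N N' where *: "A = S \<union> N" "N \<subseteq> N'" "N' \<in> null_sets ?M" "S \<in> sets ?M"
    unfolding circle_def by (auto elim!: sets_completionE)
  have "emeasure circle N' = 0"
    using *(3) null_sets_completionI unfolding circle_def by blast
  with * show ?thesis
    by (intro that[of S N']) auto
qed

text \<open>For the completed measure, conjugation must also pull subsets of null sets back to
  measurable sets. This follows from the invariance of Borel null sets, so measurability and
  invariance are proved together.\<close>

lemma measurable_cnj_circle [measurable]: "cnj \<in> measurable circle circle"
  and emeasure_circle_cnj: "A \<in> sets circle \<Longrightarrow> emeasure circle (cnj -` A) = emeasure circle A"
proof -
  have *: "cnj -` A \<in> sets circle \<and> emeasure circle (cnj -` A) = emeasure circle A"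
    if A: "A \<in> sets circle" for A
  proof -
    obtain S N where SN: "S \<in> sets borel" "N \<in> sets borel" "emeasure circle N = 0" "S \<subseteq> A" "A \<subseteq> S \<union> N"
      using circle_sandwich[OF A] by blast
    have m: "cnj -` S \<in> sets borel" "cnj -` N \<in> sets borel"
      using measurable_sets[OF measurable_cnj_borel SN(1)] measurable_sets[OF measurable_cnj_borel SN(2)] by auto
    have N0: "cnj -` N \<in> null_sets circle"
      using SN(2,3) m emeasure_circle_borel_cnj[of N] by (auto intro: sets_circleI)
    have N1: "N \<in> null_sets circle"
      using SN by (auto intro: sets_circleI)
    have s: "cnj -` A \<in> sets circle"
    proof -
      have "cnj -` A = cnj -` S \<union> (cnj -` A - cnj -` S)"
        using SN(4) by auto
      moreover have "cnj -` A - cnj -` S \<subseteq> cnj -` N"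
        using SN(5) by auto
      ultimately show ?thesis
        using circle.complete[OF _ N0] m(1) by (metis sets.Un sets_circleI)
    qed
    have "emeasure circle (cnj -` A) = emeasure circle (cnj -` S)"
      by (rule emeasure_eq_AE) (use AE_not_in[OF N0] SN s m in \<open>auto intro: sets_circleI\<close>)
    also have "\<dots> = emeasure circle S"
      by (rule emeasure_circle_borel_cnj) fact
    also have "\<dots> = emeasure circle A"
      by (rule emeasure_eq_AE) (use AE_not_in[OF N1] SN A in \<open>auto intro: sets_circleI\<close>)
    finally show ?thesis using s by blast
  qed
  show "cnj \<in> measurable circle circle"
    by (rule measurableI) (use * in auto)
  show "emeasure circle (cnj -` A) = emeasure circle A" if "A \<in> sets circle"
    using * that by blast
qed

lemma distr_circle_cnj: "distr circle circle cnj = circle"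
  by (rule measure_eqI) (auto simp: emeasure_distr emeasure_circle_cnj)

lemma integral_circle_cnj:
  fixes f :: "complex \<Rightarrow> 'a::{banach, second_countable_topology}"
  assumes "f \<in> borel_measurable circle"
  shows "(LINT t|circle. f (cnj t)) = (LINT t|circle. f t)"
  by (subst (2) distr_circle_cnj[symmetric]) (simp add: integral_distr assms)

lemma integrable_circle_cnj:
  fixes f :: "complex \<Rightarrow> 'a::{banach, second_countable_topology}"
  assumes "integrable circle f"
  shows "integrable circle (\<lambda>t. f (cnj t))"
  using assms by (metis distr_circle_cnj integrable_distr measurable_cnj_circle)

lemma AE_circle_cnj:
  assumes "AE t in circle. P t"
  shows "AE t in circle. P (cnj t)"
  using AE_distrD[OF measurable_cnj_circle] assms distr_circle_cnj by metis

section \<open>Semi-inner products and minimizers\<close>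

lemma mult_cnj_cmod: "z * cnj z = of_real ((cmod z)\<^sup>2)"
  by (rule complex_norm_square[symmetric])

text \<open>Vectors are representatives of functions, hence the form is only semidefinite, and they
  form a subset of a type: instances are functions in \<open>L2\<close> and pairs with values on the
  support. \<open>lin x c y\<close> stands for x + c y, and scaling by c is expressed as
  \<open>lin x (c - 1) x\<close>.\<close>

locale semi_inner =
  fixes V :: "'v set" and lin :: "'v \<Rightarrow> complex \<Rightarrow> 'v \<Rightarrow> 'v" and ip :: "'v \<Rightarrow> 'v \<Rightarrow> complex"
  assumes lin_closed: "x \<in> V \<Longrightarrow> y \<in> V \<Longrightarrow> lin x c y \<in> V"
    and ip_lin: "x \<in> V \<Longrightarrow> y \<in> V \<Longrightarrow> z \<in> V \<Longrightarrow> ip (lin x c y) z = ip x z + c * ip y z"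
    and ip_cnj: "x \<in> V \<Longrightarrow> y \<in> V \<Longrightarrow> ip y x = cnj (ip x y)"
    and ip_pos: "x \<in> V \<Longrightarrow> 0 \<le> Re (ip x x)"
begin

lemma Re_cnj_scaled: "Re (cnj (of_real (-t) * z) * z) = - t * (cmod z)\<^sup>2"
proof -
  have "cnj (of_real (-t) * z) * z = of_real (- t * (cmod z)\<^sup>2)"
    using mult_cnj_cmod[of z] by (simp add: algebra_simps)
  then show ?thesis by (simp only: Re_complex_of_real)
qed

definition sq :: "'v \<Rightarrow> real" where
  "sq x = Re (ip x x)"

definition dst :: "'v \<Rightarrow> 'v \<Rightarrow> real" where
  "dst x y = sq (lin x (-1) y)"

lemma ip_lin_right:
  assumes "x \<in> V" "y \<in> V" "z \<in> V"
  shows "ip z (lin x c y) = ip z x + cnj c * ip z y"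
  using assms by (simp add: ip_cnj[of _ z] lin_closed ip_lin)

lemma sq_nonneg: "x \<in> V \<Longrightarrow> 0 \<le> sq x"
  by (simp add: sq_def ip_pos)

lemma ip_self: "x \<in> V \<Longrightarrow> ip x x = of_real (sq x)"
  using ip_cnj[of x x] by (auto simp: sq_def complex_eq_iff)

lemma sq_lin:
  assumes "x \<in> V" "y \<in> V"
  shows "sq (lin x c y) = sq x + 2 * Re (cnj c * ip x y) + (cmod c)\<^sup>2 * sq y"
proof -
  have "ip (lin x c y) (lin x c y) = ip x x + cnj c * ip x y + cnj (cnj c * ip x y) + c * cnj c * ip y y"
    using assms by (simp add: ip_lin_right ip_lin lin_closed ip_cnj[of x y] algebra_simps)
  also have "\<dots> = of_real (sq x) + 2 * Re (cnj c * ip x y) + (c * cnj c) * of_real (sq y)"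
    using assms by (simp add: ip_self complex_eq_iff)
  also have "\<dots> = of_real (sq x + 2 * Re (cnj c * ip x y) + (cmod c)\<^sup>2 * sq y)"
    unfolding mult_cnj_cmod by simp
  finally show ?thesis
    unfolding sq_def[of "lin x c y"] by (simp only: Re_complex_of_real)
qed

lemma Cauchy_Schwarz:
  assumes "x \<in> V" "y \<in> V"
  shows "(cmod (ip x y))\<^sup>2 \<le> sq x * sq y"
proof -
  have *: "0 \<le> sq x + 2 * Re (cnj c * ip x y) + (cmod c)\<^sup>2 * sq y" for c
    using sq_nonneg[OF lin_closed[OF assms, of c]] sq_lin[OF assms, of c] by simp
  let ?a = "(cmod (ip x y))\<^sup>2"
  have r: "0 \<le> sq x - 2 * t * ?a + t\<^sup>2 * ?a * sq y" for t :: real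
  proof -
    have "Re (cnj (of_real (-t) * ip x y) * ip x y) = - t * ?a"
      by (rule Re_cnj_scaled)
    then show ?thesis
      using *[of "of_real (-t) * ip x y"] by (simp add: norm_mult power_mult_distrib)
  qed
  show ?thesis
  proof (cases "sq y = 0")
    case True
    show ?thesis
    proof (rule ccontr)
      assume "\<not> ?thesis"
      with True have "?a > 0" by auto
      \<comment> \<open>For \<open>sq y = 0\<close> the bound \<open>r\<close> is affine in t; this
        t turns its right-hand side into - sq x - 2, which is negative.\<close>
      have "(sq x + 1) / ?a * ?a = sq x + 1"
        using \<open>?a > 0\<close> by simp
      then have "2 * ((sq x + 1) / ?a) * ?a = 2 * (sq x + 1)"
        by (simp only: mult.assoc)
      with r[of "(sq x + 1) / ?a"] True sq_nonneg[OF assms(1)] show False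
        by (simp only: mult_zero_right) (simp add: algebra_simps)
    qed
  next
    case False
    with sq_nonneg[OF assms(2)] have "sq y > 0" by simp
    with r[of "1 / sq y"] show ?thesis
      by (simp add: field_simps power2_eq_square)
  qed
qed

lemma cmod_ip_le:
  assumes "x \<in> V" "y \<in> V"
  shows "cmod (ip x y) \<le> sqrt (sq x) * sqrt (sq y)"
  using real_sqrt_le_mono[OF Cauchy_Schwarz[OF assms]] by (simp add: real_sqrt_mult)

lemma dst_eq:
  assumes "x \<in> V" "y \<in> V"
  shows "dst x y = sq x - 2 * Re (ip x y) + sq y"
  using assms by (simp add: dst_def sq_lin)

lemma dst_nonneg: "x \<in> V \<Longrightarrow> y \<in> V \<Longrightarrow> 0 \<le> dst x y"
  by (simp add: dst_def sq_nonneg lin_closed)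

lemma dst_sym: "x \<in> V \<Longrightarrow> y \<in> V \<Longrightarrow> dst x y = dst y x"
  by (simp add: dst_eq ip_cnj[of x y])

lemma sq_triangle:
  assumes "x \<in> V" "y \<in> V" "cmod c = 1"
  shows "sqrt (sq (lin x c y)) \<le> sqrt (sq x) + sqrt (sq y)"
proof (rule real_le_lsqrt)
  have "Re (cnj c * ip x y) \<le> cmod (cnj c * ip x y)"
    by (rule complex_Re_le_cmod)
  also have "\<dots> \<le> sqrt (sq x) * sqrt (sq y)"
    using cmod_ip_le[OF assms(1,2)] assms(3) by (simp add: norm_mult)
  finally show "sq (lin x c y) \<le> (sqrt (sq x) + sqrt (sq y))\<^sup>2"
    using assms by (simp add: sq_lin power2_sum sq_nonneg)
qed (use assms in \<open>auto simp: sq_nonneg\<close>)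

lemma dst_triangle:
  assumes "x \<in> V" "y \<in> V" "z \<in> V"
  shows "sqrt (dst x z) \<le> sqrt (dst x y) + sqrt (dst y z)"
proof -
  have "dst x z = sq (lin (lin x (-1) y) 1 (lin y (-1) z))"
    using assms by (simp add: dst_eq sq_lin lin_closed ip_lin ip_lin_right ip_self)
  also have "sqrt \<dots> \<le> sqrt (dst x y) + sqrt (dst y z)"
    unfolding dst_def by (rule sq_triangle) (use assms lin_closed in auto)
  finally show ?thesis .
qed

lemma ip_diff_le:
  assumes "x \<in> V" "y \<in> V" "z \<in> V"
  shows "cmod (ip x z - ip y z) \<le> sqrt (dst x y) * sqrt (sq z)"
proof -
  have "ip x z - ip y z = ip (lin x (-1) y) z"
    using assms by (simp add: ip_lin)
  then show ?thesis
    using cmod_ip_le[of "lin x (-1) y" z] assms by (simp add: lin_closed dst_def)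
qed

lemma tendsto_ip:
  assumes "\<And>n. s n \<in> V" "x \<in> V" "y \<in> V" "(\<lambda>n. dst (s n) x) \<longlonglongrightarrow> 0"
  shows "(\<lambda>n. ip (s n) y) \<longlonglongrightarrow> ip x y"
proof (rule LIM_zero_cancel, rule Lim_null_comparison)
  show "\<forall>\<^sub>F n in sequentially. norm (ip (s n) y - ip x y) \<le> sqrt (dst (s n) x) * sqrt (sq y)"
    using assms by (intro always_eventually allI ip_diff_le)
  show "(\<lambda>n. sqrt (dst (s n) x) * sqrt (sq y)) \<longlonglongrightarrow> 0"
    using tendsto_mult_left_zero[of "\<lambda>n. sqrt (dst (s n) x)" sequentially "sqrt (sq y)"] tendsto_real_sqrt[OF assms(4)] by simp
qed

lemma tendsto_sq:
  assumes "\<And>n. s n \<in> V" "x \<in> V" "(\<lambda>n. dst (s n) x) \<longlonglongrightarrow> 0"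
  shows "(\<lambda>n. sq (s n)) \<longlonglongrightarrow> sq x"
proof -
  have "sq (s n) = dst (s n) x + 2 * Re (ip (s n) x) - sq x" for n
    using assms by (simp add: dst_eq)
  moreover have "(\<lambda>n. dst (s n) x + 2 * Re (ip (s n) x) - sq x) \<longlonglongrightarrow> 0 + 2 * Re (ip x x) - sq x"
    using assms by (intro tendsto_intros tendsto_ip) auto
  ultimately show ?thesis by (simp add: sq_def)
qed

text \<open>The classical projection argument, for a set C that need not be closed or linear: the
  element of least norm is a limit of C, and it is orthogonal to every direction along which C is
  invariant. The minimizing sequence is returned too, since it is what places x in a closure. The
  term in \<open>mid\<close> is the midpoint of x and y.\<close>

theorem minimizer:
  assumes "C \<subseteq> V" "C \<noteq> {}"
    and mid: "\<And>x y. x \<in> C \<Longrightarrow> y \<in> C \<Longrightarrow> lin (lin x (-1/2) x) (1/2) y \<in> C"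
    and complete: "\<And>s. (\<And>n. s n \<in> C) \<Longrightarrow> (\<And>e. e > 0 \<Longrightarrow> \<exists>N. \<forall>m\<ge>N. \<forall>n\<ge>N. dst (s m) (s n) < e)
            \<Longrightarrow> \<exists>x\<in>V. (\<lambda>n. dst (s n) x) \<longlonglongrightarrow> 0"
  obtains x s where "x \<in> V" "\<And>n. s n \<in> C" "(\<lambda>n. dst (s n) x) \<longlonglongrightarrow> 0"
    "\<And>y. y \<in> V \<Longrightarrow> (\<And>z c. z \<in> C \<Longrightarrow> lin z c y \<in> C) \<Longrightarrow> ip x y = 0"
proof -
  define d where "d = (INF x\<in>C. sq x)"
  have bdd: "bdd_below (sq ` C)"
    using assms(1) sq_nonneg by (intro bdd_belowI[of _ 0]) auto
  have d_le: "d \<le> sq x" if "x \<in> C" for x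
    unfolding d_def using bdd that by (rule cINF_lower)
  have "\<exists>x\<in>C. sq x < d + 1 / Suc n" for n
    using cINF_less_iff[of C sq "d + 1 / Suc n"] assms(2) bdd unfolding d_def by auto
  then obtain s where s: "\<And>n. s n \<in> C" "\<And>n. sq (s n) < d + 1 / Suc n"
    by metis
  have sV: "s n \<in> V" for n
    using s(1) assms(1) by blast
  \<comment> \<open>Parallelogram law: the midpoint lies in C, so its squared norm is at least
    d.\<close>
  have par: "dst x y \<le> 2 * sq x + 2 * sq y - 4 * d" if "x \<in> C" "y \<in> C" for x y
  proof -
    have V: "x \<in> V" "y \<in> V" using that assms(1) by auto
    have "d \<le> sq (lin (lin x (-1/2) x) (1/2) y)"
      using that mid d_le by blast
    also have "\<dots> = (sq x + sq y) / 2 - dst x y / 4"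
      using V by (simp add: sq_lin lin_closed ip_lin ip_self dst_eq power2_eq_square field_simps)
    finally show ?thesis by (simp add: field_simps)
  qed
  have "\<exists>x\<in>V. (\<lambda>n. dst (s n) x) \<longlonglongrightarrow> 0"
  proof (rule complete)
    fix e :: real assume "e > 0"
    then obtain N where N: "1 / Suc N < e / 4"
      by (metis divide_pos_pos nat_approx_posE zero_less_numeral)
    have "dst (s m) (s n) < e" if "m \<ge> N" "n \<ge> N" for m n
    proof -
      have "1 / real (Suc m) \<le> 1 / Suc N" "1 / real (Suc n) \<le> 1 / Suc N"
        using that by (auto intro!: divide_left_mono)
      with par[OF s(1) s(1), of m n] s(2)[of m] s(2)[of n] N show ?thesis
        by linarith
    qed
    then show "\<exists>N. \<forall>m\<ge>N. \<forall>n\<ge>N. dst (s m) (s n) < e" by blast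
  qed (use s in auto)
  then obtain x where x: "x \<in> V" "(\<lambda>n. dst (s n) x) \<longlonglongrightarrow> 0" by blast
  have lim: "(\<lambda>n. sq (s n)) \<longlonglongrightarrow> sq x"
    using sV x by (intro tendsto_sq)
  have "(\<lambda>n. d + 1 / Suc n) \<longlonglongrightarrow> d + 0"
    by (intro tendsto_intros LIMSEQ_Suc[OF lim_1_over_n])
  then have xd: "sq x \<le> d"
    using LIMSEQ_le[OF lim, of "\<lambda>n. d + 1 / Suc n" "d + 0"] s(2) less_imp_le by auto
  show ?thesis
  proof (rule that[OF x(1) s(1) x(2)])
    fix y assume y: "y \<in> V" "\<And>z c. z \<in> C \<Longrightarrow> lin z c y \<in> C"
    \<comment> \<open>x need not lie in C, so the variation is carried out on the sequence:
      \<open>lin (s n) c y\<close> stays in C, and its squared norms converge.\<close>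
    have *: "0 \<le> 2 * Re (cnj c * ip x y) + (cmod c)\<^sup>2 * sq y" for c
    proof -
      have "(\<lambda>n. sq (lin (s n) c y)) \<longlonglongrightarrow> sq x + 2 * Re (cnj c * ip x y) + (cmod c)\<^sup>2 * sq y"
        unfolding sq_lin[OF sV y(1)]
        by (intro tendsto_intros lim tendsto_ip sV x y)
      then have "d \<le> sq x + 2 * Re (cnj c * ip x y) + (cmod c)\<^sup>2 * sq y"
        using y(2) s(1) d_le by (intro LIMSEQ_le_const) blast+
      with xd show ?thesis by simp
    qed
    show "ip x y = 0"
    proof (rule ccontr)
      assume "ip x y \<noteq> 0"
      \<comment> \<open>Small enough that the gain, linear in t, exceeds the loss t^2 * sq
        y.\<close>
      define t where "t = 1 / (sq y + 1)"
      have t: "t > 0" "t * sq y < 1"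
        using sq_nonneg[OF y(1)] by (auto simp: t_def)
      have "Re (cnj (of_real (-t) * ip x y) * ip x y) = - t * (cmod (ip x y))\<^sup>2"
        by (rule Re_cnj_scaled)
      then have "2 * t * (cmod (ip x y))\<^sup>2 \<le> t * (t * sq y) * (cmod (ip x y))\<^sup>2"
        using *[of "of_real (-t) * ip x y"]
        by (simp add: norm_mult power_mult_distrib power2_eq_square algebra_simps)
      then have "2 * t \<le> t * (t * sq y)"
        using \<open>ip x y \<noteq> 0\<close> by (simp add: mult_le_cancel_right)
      with t show False
        by simp
    qed
  qed
qed

end

section \<open>Square-integrable functions\<close>

lemma L2_measurable: "f \<in> L2 \<Longrightarrow> f \<in> borel_measurable circle"
  by (simp add: L2_def)

lemma L2_square_integrable: "f \<in> L2 \<Longrightarrow> integrable circle (\<lambda>t. (cmod (f t))\<^sup>2)"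
  by (simp add: L2_def)

lemma L2_I:
  assumes [measurable]: "f \<in> borel_measurable circle" and "integrable circle g" "AE t in circle. (cmod (f t))\<^sup>2 \<le> g t"
  shows "f \<in> L2"
  unfolding L2_def
  using assms(3) by (auto intro!: Bochner_Integration.integrable_bound[OF assms(2)] elim!: eventually_mono)

lemma L2_dominated:
  assumes "f \<in> borel_measurable circle" "g \<in> L2" "AE t in circle. cmod (f t) \<le> cmod (g t)"
  shows "f \<in> L2"
  by (rule L2_I[OF assms(1) L2_square_integrable[OF assms(2)]])
     (use assms(3) in \<open>auto elim!: eventually_mono intro: power_mono\<close>)

lemma L2_cong_AE:
  assumes "f \<in> L2" "g \<in> borel_measurable circle" "AE t in circle. g t = f t"
  shows "g \<in> L2"
  by (rule L2_dominated[OF assms(2,1)]) (use assms(3) in \<open>auto elim!: eventually_mono\<close>)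

lemma L2_lin:
  assumes "f \<in> L2" "g \<in> L2"
  shows "(\<lambda>t. f t + c * g t) \<in> L2"
proof (rule L2_I)
  note [measurable] = L2_measurable[OF assms(1)] L2_measurable[OF assms(2)]
  show "(\<lambda>t. f t + c * g t) \<in> borel_measurable circle" by measurable
  show "integrable circle (\<lambda>t. 2 * (cmod (f t))\<^sup>2 + 2 * (cmod c)\<^sup>2 * (cmod (g t))\<^sup>2)"
    using assms by (auto intro!: L2_square_integrable)
  have "(cmod (f t + c * g t))\<^sup>2 \<le> 2 * (cmod (f t))\<^sup>2 + 2 * (cmod c)\<^sup>2 * (cmod (g t))\<^sup>2" for t
  proof -
    have "(cmod (f t + c * g t))\<^sup>2 \<le> (cmod (f t) + cmod (c * g t))\<^sup>2"
      by (intro power_mono norm_triangle_ineq norm_ge_zero)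
    also have "\<dots> \<le> 2 * (cmod (f t))\<^sup>2 + 2 * (cmod (c * g t))\<^sup>2"
      using zero_le_power2[of "cmod (f t) - cmod (c * g t)"] by (simp add: power2_sum power2_diff)
    finally show ?thesis by (simp add: norm_mult power_mult_distrib)
  qed
  then show "AE t in circle. (cmod (f t + c * g t))\<^sup>2 \<le> 2 * (cmod (f t))\<^sup>2 + 2 * (cmod c)\<^sup>2 * (cmod (g t))\<^sup>2"
    by simp
qed

lemma L2_bounded:
  assumes "f \<in> borel_measurable circle" "AE t in circle. cmod (f t) \<le> C"
  shows "f \<in> L2"
  by (rule L2_I[OF assms(1), where g = "\<lambda>_. C\<^sup>2"])
     (use assms(2) in \<open>auto elim!: eventually_mono intro: power_mono\<close>)

lemma L2_const: "(\<lambda>t. c) \<in> L2"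
  by (rule L2_bounded[where C = "cmod c"]) auto

lemma L2_add: "f \<in> L2 \<Longrightarrow> g \<in> L2 \<Longrightarrow> (\<lambda>t. f t + g t) \<in> L2"
  using L2_lin[of f g 1] by simp

lemma L2_diff: "f \<in> L2 \<Longrightarrow> g \<in> L2 \<Longrightarrow> (\<lambda>t. f t - g t) \<in> L2"
  using L2_lin[of f g "-1"] by simp

lemma L2_scale: "f \<in> L2 \<Longrightarrow> (\<lambda>t. c * f t) \<in> L2"
  using L2_lin[OF L2_const[of 0], of f c] by simp

lemma L2_mult_bounded:
  assumes "f \<in> L2" "g \<in> borel_measurable circle" "AE t in circle. cmod (g t) \<le> C"
  shows "(\<lambda>t. g t * f t) \<in> L2"
proof (rule L2_dominated)
  note [measurable] = L2_measurable[OF assms(1)] assms(2)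
  show "(\<lambda>t. g t * f t) \<in> borel_measurable circle" by measurable
  show "(\<lambda>t. of_real C * f t) \<in> L2" using assms(1) by (rule L2_scale)
  show "AE t in circle. cmod (g t * f t) \<le> cmod (of_real C * f t)"
    using assms(3) by eventually_elim (auto simp: norm_mult intro!: mult_right_mono)
qed

lemma L2_cnj: "f \<in> L2 \<Longrightarrow> (\<lambda>t. cnj (f t)) \<in> L2"
  by (rule L2_dominated[where g = f]) (auto dest: L2_measurable)

lemma L2_reflect: "f \<in> L2 \<Longrightarrow> (\<lambda>t. f (cnj t)) \<in> L2"
  using integrable_circle_cnj[of "\<lambda>t. (cmod (f t))\<^sup>2"]
  unfolding L2_def by (auto intro: measurable_compose[OF measurable_cnj_circle])

lemma L2_sum: "(\<And>i. i \<in> I \<Longrightarrow> f i \<in> L2) \<Longrightarrow> (\<lambda>t. \<Sum>i\<in>I. f i t) \<in> L2"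
  by (induction I rule: infinite_finite_induct) (auto intro!: L2_add L2_const)

lemma integrable_L2_mult:
  assumes "f \<in> L2" "g \<in> L2"
  shows "integrable circle (\<lambda>t. f t * g t)"
proof (rule Bochner_Integration.integrable_bound)
  note [measurable] = L2_measurable[OF assms(1)] L2_measurable[OF assms(2)]
  show "integrable circle (\<lambda>t. (cmod (f t))\<^sup>2 + (cmod (g t))\<^sup>2)"
    using assms by (auto intro!: L2_square_integrable)
  have "cmod (f t) * cmod (g t) \<le> (cmod (f t))\<^sup>2 + (cmod (g t))\<^sup>2" for t
  proof -
    have "0 \<le> cmod (f t) * cmod (g t)" by simp
    moreover have "2 * (cmod (f t) * cmod (g t)) \<le> (cmod (f t))\<^sup>2 + (cmod (g t))\<^sup>2"
      using zero_le_power2[of "cmod (f t) - cmod (g t)"] by (simp add: power2_diff)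
    ultimately show ?thesis by linarith
  qed
  then show "AE t in circle. norm (f t * g t) \<le> norm ((cmod (f t))\<^sup>2 + (cmod (g t))\<^sup>2)"
    by (simp add: norm_mult)
  show "(\<lambda>t. f t * g t) \<in> borel_measurable circle" by measurable
qed

lemma integrable_L2: "f \<in> L2 \<Longrightarrow> integrable circle f"
  using integrable_L2_mult[of f "\<lambda>_. 1"] by (simp add: L2_const)

lemma integrable_L2_inner: "f \<in> L2 \<Longrightarrow> g \<in> L2 \<Longrightarrow> integrable circle (\<lambda>t. f t * cnj (g t))"
  by (intro integrable_L2_mult L2_cnj)

lemma L2_inner_self: "L2_inner f f = of_real (LINT t|circle. (cmod (f t))\<^sup>2)"
  unfolding L2_inner_def mult_cnj_cmod by (rule integral_complex_of_real)

interpretation L2: semi_inner L2 "\<lambda>f c g t. f t + c * g t" L2_inner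
proof
  fix f g h :: "complex \<Rightarrow> complex" and c
  assume *: "f \<in> L2" "g \<in> L2"
  show "(\<lambda>t. f t + c * g t) \<in> L2" using * by (rule L2_lin)
  show "L2_inner g f = cnj (L2_inner f g)"
    unfolding L2_inner_def using Bochner_Integration.integral_cnj[of circle "\<lambda>t. f t * cnj (g t)"]
    by (simp add: mult.commute)
  assume "h \<in> L2"
  then show "L2_inner (\<lambda>t. f t + c * g t) h = L2_inner f h + c * L2_inner g h"
    using * by (simp add: L2_inner_def ring_distribs mult.assoc integrable_L2_inner)
next
  fix f assume "f \<in> L2"
  show "0 \<le> Re (L2_inner f f)"
    by (simp add: L2_inner_self)
qed

abbreviation nsq :: "(complex \<Rightarrow> complex) \<Rightarrow> real" where
  "nsq \<equiv> semi_inner.sq L2_inner"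

abbreviation L2_dist :: "(complex \<Rightarrow> complex) \<Rightarrow> (complex \<Rightarrow> complex) \<Rightarrow> real" where
  "L2_dist \<equiv> semi_inner.dst (\<lambda>f c g t. f t + c * g t) L2_inner"

lemma nsq_eq: "nsq f = (LINT t|circle. (cmod (f t))\<^sup>2)"
  by (simp add: L2.sq_def L2_inner_self)

lemma L2_dist_eq: "L2_dist f g = (LINT t|circle. (cmod (f t - g t))\<^sup>2)"
  by (simp add: L2.dst_def nsq_eq)

lemma nsq_mono:
  assumes "f \<in> borel_measurable circle" "g \<in> L2" "AE t in circle. cmod (f t) \<le> cmod (g t)"
  shows "nsq f \<le> nsq g"
  unfolding nsq_eq
  by (rule integral_mono_AE)
     (use assms L2_dominated[OF assms] in \<open>auto intro!: L2_square_integrable elim!: eventually_mono intro: power_mono\<close>)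

lemma nsq_bounded:
  assumes "f \<in> borel_measurable circle" "AE t in circle. cmod (f t) \<le> C" "0 \<le> C"
  shows "nsq f \<le> C\<^sup>2"
proof -
  have "nsq f \<le> nsq (\<lambda>_. of_real C)"
    using assms by (intro nsq_mono L2_const) auto
  then show ?thesis by (simp add: nsq_eq)
qed

lemma L2_inner_cong_AE:
  assumes "AE t in circle. f t = f' t" "AE t in circle. g t = g' t"
    "f \<in> borel_measurable circle" "f' \<in> borel_measurable circle"
    "g \<in> borel_measurable circle" "g' \<in> borel_measurable circle"
  shows "L2_inner f g = L2_inner f' g'"
  unfolding L2_inner_def
proof (rule integral_cong_AE)
  note [measurable] = assms(3-6)
  show "(\<lambda>t. f t * cnj (g t)) \<in> borel_measurable circle"
    by (intro borel_measurable_times measurable_compose[OF assms(5) measurable_cnj_borel] assms)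
  show "(\<lambda>t. f' t * cnj (g' t)) \<in> borel_measurable circle"
    by (intro borel_measurable_times measurable_compose[OF assms(6) measurable_cnj_borel] assms)
  show "AE t in circle. f t * cnj (g t) = f' t * cnj (g' t)"
    using assms(1,2) by eventually_elim simp
qed

lemma integral_cmod_le:
  assumes "f \<in> L2"
  shows "(LINT t|circle. cmod (f t)) \<le> sqrt (nsq f)"
proof -
  have f: "(\<lambda>t. of_real (cmod (f t))) \<in> L2"
    by (rule L2_dominated[OF _ assms]) (use L2_measurable[OF assms] in auto)
  have "cmod (L2_inner (\<lambda>t. of_real (cmod (f t))) (\<lambda>_. 1))
      \<le> sqrt (nsq (\<lambda>t. of_real (cmod (f t)))) * sqrt (nsq (\<lambda>_. 1))"
    by (intro L2.cmod_ip_le f L2_const)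
  moreover have "L2_inner (\<lambda>t. of_real (cmod (f t))) (\<lambda>_. 1) = of_real (LINT t|circle. cmod (f t))"
    unfolding L2_inner_def by (simp add: integral_complex_of_real)
  ultimately show ?thesis by (simp add: nsq_eq)
qed

text \<open>The circle has mass 1, so convergence in \<open>L2\<close> implies convergence in the
  mean, which has an almost everywhere convergent subsequence.\<close>

lemma L2_AE_subseq:
  assumes "\<And>n. s n \<in> L2" "f \<in> L2" "(\<lambda>n. L2_dist (s n) f) \<longlonglongrightarrow> 0"
  obtains r :: "nat \<Rightarrow> nat" where "strict_mono r" "AE t in circle. (\<lambda>n. s (r n) t) \<longlonglongrightarrow> f t"
proof -
  have d: "(\<lambda>t. s n t - f t) \<in> L2" for n
    using assms by (intro L2_diff)
  have "(\<lambda>n. LINT t|circle. norm (s n t - f t)) \<longlonglongrightarrow> 0"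
  proof (rule tendsto_sandwich[OF _ _ tendsto_const])
    show "(\<lambda>n. sqrt (L2_dist (s n) f)) \<longlonglongrightarrow> 0"
      using tendsto_real_sqrt[OF assms(3)] by simp
    show "\<forall>\<^sub>F n in sequentially. (LINT t|circle. norm (s n t - f t)) \<le> sqrt (L2_dist (s n) f)"
      using integral_cmod_le[OF d] by (simp add: L2.dst_def)
  qed simp
  from tendsto_L1_AE_subseq[OF integrable_L2[OF d] this] obtain r
    where "strict_mono r" "AE t in circle. (\<lambda>n. s (r n) t - f t) \<longlonglongrightarrow> 0"
    by auto
  then show ?thesis
    by (intro that[of r]) (auto elim!: eventually_mono simp: LIM_zero_iff)
qed

text \<open>A rapidly converging subsequence converges almost everywhere; Fatou's lemma then bounds
  the distance of the whole sequence to its pointwise limit.\<close>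

theorem L2_complete:
  assumes s: "\<And>n. s n \<in> L2"
    and Cauchy: "\<And>e. e > 0 \<Longrightarrow> \<exists>N. \<forall>m\<ge>N. \<forall>n\<ge>N. L2_dist (s m) (s n) < e"
  obtains f where "f \<in> L2" "(\<lambda>n. L2_dist (s n) f) \<longlonglongrightarrow> 0"
proof -
  note [measurable] = L2_measurable[OF s]
  \<comment> \<open>\<open>L2_dist\<close> is a squared distance: (1/4)^k gives steps of mean at
    most (1/2)^k, which are summable.\<close>
  have "\<forall>k. \<exists>N. \<forall>m\<ge>N. \<forall>n\<ge>N. L2_dist (s m) (s n) < (1/4)^k"
    using Cauchy[of "(1/4)^k" for k] by simp
  from choice[OF this] obtain N
    where N: "\<And>k m n. m \<ge> N k \<Longrightarrow> n \<ge> N k \<Longrightarrow> L2_dist (s m) (s n) < (1/4)^k"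
    by auto
  define r where "r = rec_nat (N 0) (\<lambda>k m. max (Suc m) (N (Suc k)))"
  have r_Suc: "r (Suc k) = max (Suc (r k)) (N (Suc k))" for k
    by (simp add: r_def)
  have r_ge: "r k \<ge> N k" for k
    by (cases k) (auto simp: r_def)
  have r_mono: "strict_mono r"
    by (rule strict_monoI_Suc) (simp add: r_Suc)
  define D where "D k t = cmod (s (r (Suc k)) t - s (r k) t)" for k t
  have [measurable]: "D k \<in> borel_measurable circle" for k
    unfolding D_def by measurable
  have Dint: "integrable circle (D k)" for k
    unfolding D_def by (intro integrable_norm integrable_L2 L2_diff s)
  have "(LINT t|circle. D k t) \<le> (1/2)^k" for k
  proof -
    have "(LINT t|circle. D k t) \<le> sqrt (L2_dist (s (r (Suc k))) (s (r k)))"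
      unfolding D_def L2.dst_def using integral_cmod_le[OF L2_diff[OF s s], of "r (Suc k)" "r k"] by simp
    also have "\<dots> \<le> sqrt ((1/4)^k)"
      using N[of k "r (Suc k)" "r k"] r_ge[of k] strict_monoD[OF r_mono, of k "Suc k"] by simp
    also have "\<dots> = (1/2)^k"
      by (simp add: real_sqrt_power real_sqrt_divide)
    finally show ?thesis .
  qed
  note D_le = this
  have le: "(\<integral>\<^sup>+t. ennreal (D k t) \<partial>circle) \<le> ennreal ((1/2)^k)" for k
    using D_le by (subst nn_integral_eq_integral[OF Dint]) (auto simp: D_def[abs_def] intro!: ennreal_leI)
  have "(\<integral>\<^sup>+t. (\<Sum>k. ennreal (D k t)) \<partial>circle) = (\<Sum>k. \<integral>\<^sup>+t. ennreal (D k t) \<partial>circle)"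
    by (rule nn_integral_suminf) measurable
  also have "\<dots> \<le> (\<Sum>k. ennreal ((1/2)^k))"
    by (intro suminf_le le) auto
  also have "\<dots> = ennreal (\<Sum>k. (1/2)^k)"
    by (intro suminf_ennreal2) auto
  also have "\<dots> < \<infinity>" by simp
  finally have "AE t in circle. (\<Sum>k. ennreal (D k t)) \<noteq> \<infinity>"
    by (intro nn_integral_noteq_infinite) auto
  then have ae: "AE t in circle. convergent (\<lambda>k. s (r k) t)"
  proof eventually_elim
    fix t assume "(\<Sum>k. ennreal (D k t)) \<noteq> \<infinity>"
    then have "summable (\<lambda>k. D k t)"
      by (intro summable_suminf_not_top) (auto simp: D_def)
    then have "summable (\<lambda>k. s (r (Suc k)) t - s (r k) t)"
      unfolding D_def by (rule summable_norm_cancel)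
    then have "convergent (\<lambda>n. \<Sum>k<n. s (r (Suc k)) t - s (r k) t)"
      by (simp add: summable_iff_convergent)
    then have "convergent (\<lambda>n. s (r n) t - s (r 0) t)"
      by (simp add: sum_lessThan_telescope[of "\<lambda>k. s (r k) t"])
    from convergent_add[OF this convergent_const[of "s (r 0) t"]] show "convergent (\<lambda>k. s (r k) t)" by simp
  qed
  define f where "f t = lim (\<lambda>k. s (r k) t)" for t
  have [measurable]: "f \<in> borel_measurable circle"
    unfolding f_def by measurable
  have lim: "AE t in circle. (\<lambda>k. s (r k) t) \<longlonglongrightarrow> f t"
    using ae by eventually_elim (simp add: f_def convergent_LIMSEQ_iff)
  \<comment> \<open>Fatou along the subsequence, with the index m of the other function held
    fixed.\<close>
  have dist: "\<exists>N. \<forall>m\<ge>N. (\<integral>\<^sup>+t. ennreal ((cmod (s m t - f t))\<^sup>2) \<partial>circle) \<le> ennreal e" if e: "e > 0" for e :: real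
  proof -
    obtain K where K: "\<And>m n. m \<ge> K \<Longrightarrow> n \<ge> K \<Longrightarrow> L2_dist (s m) (s n) < e"
      using Cauchy[OF e] by auto
    have "(\<integral>\<^sup>+t. ennreal ((cmod (s m t - f t))\<^sup>2) \<partial>circle) \<le> ennreal e" if m: "m \<ge> K" for m
    proof -
      have "(\<integral>\<^sup>+t. ennreal ((cmod (s m t - f t))\<^sup>2) \<partial>circle)
          = (\<integral>\<^sup>+t. liminf (\<lambda>k. ennreal ((cmod (s m t - s (r k) t))\<^sup>2)) \<partial>circle)"
      proof (rule nn_integral_cong_AE, use lim in eventually_elim)
        fix t assume "(\<lambda>k. s (r k) t) \<longlonglongrightarrow> f t"
        then have "(\<lambda>k. ennreal ((cmod (s m t - s (r k) t))\<^sup>2)) \<longlonglongrightarrow> ennreal ((cmod (s m t - f t))\<^sup>2)"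
          by (intro tendsto_intros tendsto_ennrealI)
        then show "ennreal ((cmod (s m t - f t))\<^sup>2) = liminf (\<lambda>k. ennreal ((cmod (s m t - s (r k) t))\<^sup>2))"
          using lim_imp_Liminf[OF trivial_limit_sequentially] by metis
      qed
      also have "\<dots> \<le> liminf (\<lambda>k. \<integral>\<^sup>+t. ennreal ((cmod (s m t - s (r k) t))\<^sup>2) \<partial>circle)"
        by (rule nn_integral_liminf) measurable
      also have "\<dots> \<le> ennreal e"
      proof (rule Liminf_le)
        show "\<forall>\<^sub>F k in sequentially. (\<integral>\<^sup>+t. ennreal ((cmod (s m t - s (r k) t))\<^sup>2) \<partial>circle) \<le> ennreal e"
          using eventually_ge_at_top[of K]
        proof eventually_elim
          fix k assume "k \<ge> K"
          then have "r k \<ge> K"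
            using seq_suble[OF r_mono, of k] by linarith
          then have "L2_dist (s m) (s (r k)) < e" using K m by blast
          then show "(\<integral>\<^sup>+t. ennreal ((cmod (s m t - s (r k) t))\<^sup>2) \<partial>circle) \<le> ennreal e"
            by (subst nn_integral_eq_integral) (auto simp: L2_dist_eq intro!: L2_square_integrable L2_diff s ennreal_leI)
        qed
      qed simp
      finally show ?thesis .
    qed
    then show ?thesis by blast
  qed
  obtain K where K: "(\<integral>\<^sup>+t. ennreal ((cmod (s K t - f t))\<^sup>2) \<partial>circle) \<le> ennreal 1"
    using dist[of 1] by force
  have "integrable circle (\<lambda>t. (cmod (s K t - f t))\<^sup>2)"
    by (rule integrableI_bounded) (use K in \<open>auto intro: le_less_trans\<close>)
  then have "(\<lambda>t. s K t - f t) \<in> L2"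
    by (simp add: L2_def)
  from L2_diff[OF s this, of K] have "(\<lambda>t. s K t - (s K t - f t)) \<in> L2" .
  then have f: "f \<in> L2" by simp
  have "(\<lambda>n. L2_dist (s n) f) \<longlonglongrightarrow> 0"
  proof (rule LIMSEQ_I)
    fix e :: real assume "e > 0"
    then obtain K where K: "\<And>m. m \<ge> K \<Longrightarrow> (\<integral>\<^sup>+t. ennreal ((cmod (s m t - f t))\<^sup>2) \<partial>circle) \<le> ennreal (e / 2)"
      using dist[of "e / 2"] by auto
    have "norm (L2_dist (s n) f - 0) < e" if "n \<ge> K" for n
    proof -
      have "ennreal (L2_dist (s n) f) \<le> ennreal (e / 2)"
        unfolding L2_dist_eq using K[OF that]
        by (subst nn_integral_eq_integral[symmetric]) (auto intro!: L2_square_integrable L2_diff s f)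
      with \<open>e > 0\<close> have "L2_dist (s n) f < e"
        by (simp add: ennreal_le_iff)
      then show ?thesis
        using L2.dst_nonneg[OF s f, of n] by simp
    qed
    then show "\<exists>no. \<forall>n\<ge>no. norm (L2_dist (s n) f - 0) < e" by blast
  qed
  with f show ?thesis by (rule that)
qed

section \<open>Fourier series\<close>

lemma measurable_powi_borel [measurable]: "(\<lambda>t::complex. t powi n) \<in> borel_measurable borel"
  unfolding power_int_def by measurable

lemma measurable_id_circle [measurable]: "(\<lambda>t. t) \<in> borel_measurable circle"
  by (rule borel_measurable_circleI) measurable

lemma cnj_powi: "cmod t = 1 \<Longrightarrow> cnj (t powi n) = t powi (- n)"
proof -
  assume t: "cmod t = 1"
  then have "cnj t = inverse t"
    by (metis complex_norm_square inverse_unique of_real_1 one_power2)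
  then show ?thesis
    by (simp add: power_int_minus power_int_inverse)
qed

section \<open>Completeness of the trigonometric system\<close>

lemma integrable_mult_bounded:
  fixes f g :: "complex \<Rightarrow> complex"
  assumes "integrable circle f" "g \<in> borel_measurable circle" "AE t in circle. cmod (g t) \<le> C"
  shows "integrable circle (\<lambda>t. f t * g t)"
proof (rule Bochner_Integration.integrable_bound)
  note [measurable] = borel_measurable_integrable[OF assms(1)] assms(2)
  show "integrable circle (\<lambda>t. of_real C * f t)" using assms(1) by simp
  show "(\<lambda>t. f t * g t) \<in> borel_measurable circle" by measurable
  show "AE t in circle. norm (f t * g t) \<le> norm (of_real C * f t)"
    using assms(3)
  proof eventually_elim
    fix t assume "cmod (g t) \<le> C"
    then have "cmod (f t) * cmod (g t) \<le> cmod (f t) * \<bar>C\<bar>"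
      by (intro mult_left_mono) auto
    then show "norm (f t * g t) \<le> norm (of_real C * f t)"
      by (simp add: norm_mult mult.commute)
  qed
qed

lemma AE_continuous_bounded:
  fixes \<phi> :: "complex \<Rightarrow> real"
  assumes "continuous_on (sphere 0 1) \<phi>"
  obtains C where "AE t in circle. \<bar>\<phi> t\<bar> \<le> C"
proof -
  have "bounded (\<phi> ` sphere 0 1)"
    by (intro compact_imp_bounded compact_continuous_image assms) simp
  then obtain C where "\<forall>x\<in>\<phi> ` sphere 0 1. norm x \<le> C"
    unfolding bounded_iff by blast
  then have C: "\<bar>\<phi> t\<bar> \<le> C" if "cmod t = 1" for t
    using that by simp
  show ?thesis
    by (rule that[of C]) (use AE_circle_norm C in \<open>auto elim!: eventually_mono\<close>)
qed

lemma measurable_real_polynomial: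
  fixes p :: "complex \<Rightarrow> real"
  assumes "real_polynomial_function p"
  shows "p \<in> borel_measurable circle"
  using assms by (intro borel_measurable_circleI borel_measurable_continuous_onI continuous_on_polymonial_function)
    (simp add: real_polynomial_function_eq)

text \<open>On the circle a real-linear function is a combination of t and 1/t, which only shift the
  exponent n. The induction is generalized over g, so that a product is handled by applying the
  second hypothesis to g times the first factor, which is again orthogonal to all powers.\<close>

lemma polynomial_orthogonal:
  fixes p :: "complex \<Rightarrow> real"
  assumes "real_polynomial_function p" "integrable circle g" "\<And>n. (LINT t|circle. g t * t powi n) = 0"
  shows "integrable circle (\<lambda>t. g t * of_real (p t))" "(LINT t|circle. (g t * of_real (p t)) * t powi n) = 0"
proof -
  have int: "integrable circle (\<lambda>t. g t * of_real (p t))"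
    if p: "real_polynomial_function p" and g: "integrable circle g" for g :: "complex \<Rightarrow> complex" and p :: "complex \<Rightarrow> real"
  proof -
    obtain C where "AE t in circle. \<bar>p t\<bar> \<le> C"
      using AE_continuous_bounded[of p] p
      by (meson continuous_on_polymonial_function real_polynomial_function_eq)
    then show ?thesis
      by (intro integrable_mult_bounded[where C = C] g) (use measurable_real_polynomial[OF p] in auto)
  qed
  have intp: "integrable circle (\<lambda>t. g t * t powi n)" if "integrable circle g" for g :: "complex \<Rightarrow> complex" and n
    by (rule integrable_mult_bounded[where C = 1, OF that])
       (use AE_circle_norm in \<open>auto elim!: eventually_mono simp: norm_power_int\<close>)
  show "integrable circle (\<lambda>t. g t * of_real (p t))"
    using assms(1,2) by (rule int)
  have "\<forall>g. integrable circle g \<longrightarrow> (\<forall>n. (LINT t|circle. g t * t powi n) = 0) \<longrightarrow>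
    (\<forall>n. (LINT t|circle. (g t * of_real (p t)) * t powi n) = 0)"
    using assms(1)
  proof (induction p)
    case (linear p)
    interpret bounded_linear p by fact
    \<comment> \<open>From Re t = (t + 1/t) / 2 and Im t = (t - 1/t) / (2 i) on the circle.\<close>
    define a where "a = of_real (p 1) / 2 + of_real (p \<i>) / (2 * \<i>)"
    define b where "b = of_real (p 1) / 2 - of_real (p \<i>) / (2 * \<i>)"
    have p: "of_real (p t) = a * t + b * inverse t" if "cmod t = 1" for t
    proof -
      have inv: "inverse t = cnj t"
        using that by (metis complex_norm_square inverse_unique of_real_1 one_power2)
      have "p t = p (Re t *\<^sub>R 1 + Im t *\<^sub>R \<i>)"
        by (rule arg_cong[of _ _ p]) (simp add: complex_eq_iff)
      also have "\<dots> = Re t * p 1 + Im t * p \<i>"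
        by (simp only: add scaleR real_scaleR_def)
      finally show ?thesis
        unfolding inv a_def b_def by (simp add: complex_eq_iff field_simps)
    qed
    show ?case
    proof (intro allI impI)
      fix g n assume g: "integrable circle g" "\<forall>n. (LINT t|circle. g t * t powi n) = 0"
      note [measurable] = borel_measurable_integrable[OF g(1)] measurable_real_polynomial[OF real_polynomial_function.intros(1)[OF bounded_linear_axioms]]
      have "(LINT t|circle. (g t * of_real (p t)) * t powi n)
          = (LINT t|circle. a * (g t * t powi (n + 1)) + b * (g t * t powi (n - 1)))"
      proof (rule integral_cong_AE)
        show "AE t in circle. (g t * of_real (p t)) * t powi n = a * (g t * t powi (n + 1)) + b * (g t * t powi (n - 1))"
          using AE_circle_norm
        proof eventually_elim
          fix t assume t: "cmod t = 1"
          then have "t \<noteq> 0" by auto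
          then have "t powi (n + 1) = t powi n * t" "t powi (n - 1) = t powi n * inverse t"
            by (auto simp: power_int_add power_int_diff divide_inverse)
          with p[OF t] show "(g t * of_real (p t)) * t powi n = a * (g t * t powi (n + 1)) + b * (g t * t powi (n - 1))"
            by (simp add: algebra_simps)
        qed
      qed measurable
      also have "\<dots> = 0"
        using g by (subst Bochner_Integration.integral_add) (auto intro!: intp)
      finally show "(LINT t|circle. (g t * of_real (p t)) * t powi n) = 0" .
    qed
  next
    case (const c)
    then show ?case by (simp add: mult.assoc mult.left_commute[of _ "of_real c"])
  next
    case (add p q)
    show ?case
    proof (intro allI impI)
      fix g n assume g: "integrable circle g" "\<forall>n. (LINT t|circle. g t * t powi n) = 0"
      have "(LINT t|circle. (g t * of_real (p t + q t)) * t powi n)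
         = (LINT t|circle. (g t * of_real (p t)) * t powi n + (g t * of_real (q t)) * t powi n)"
        by (intro Bochner_Integration.integral_cong) (auto simp: algebra_simps)
      also have "\<dots> = 0"
        using add g by (subst Bochner_Integration.integral_add) (auto intro!: intp int)
      finally show "(LINT t|circle. (g t * of_real (p t + q t)) * t powi n) = 0" .
    qed
  next
    case (mult p q)
    show ?case
    proof (intro allI impI)
      fix g n assume g: "integrable circle g" "\<forall>n. (LINT t|circle. g t * t powi n) = 0"
      have "(LINT t|circle. ((g t * of_real (p t)) * of_real (q t)) * t powi n) = 0"
        using mult g int[OF mult.hyps(1) g(1)] by blast
      then show "(LINT t|circle. (g t * of_real (p t * q t)) * t powi n) = 0"
        by (simp add: mult.assoc)
    qed
  qed
  then show "(LINT t|circle. (g t * of_real (p t)) * t powi n) = 0"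
    using assms(2,3) by blast
qed

text \<open>Stone-Weierstrass on the compact circle; a uniform error e costs at most e times the
  mean of |g|.\<close>

lemma continuous_orthogonal:
  fixes \<phi> :: "complex \<Rightarrow> real"
  assumes cont: "continuous_on UNIV \<phi>" and g: "integrable circle g" "\<And>n. (LINT t|circle. g t * t powi n) = 0"
  shows "(LINT t|circle. g t * of_real (\<phi> t)) = 0"
proof -
  have cont': "continuous_on (sphere 0 1) \<phi>"
    using cont continuous_on_subset by blast
  have [measurable]: "\<phi> \<in> borel_measurable circle"
    by (intro borel_measurable_circleI borel_measurable_continuous_onI cont)
  note [measurable] = borel_measurable_integrable[OF g(1)]
  obtain C where C: "AE t in circle. \<bar>\<phi> t\<bar> \<le> C"
    using AE_continuous_bounded[OF cont'] .
  have int: "integrable circle (\<lambda>t. g t * of_real (\<phi> t))"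
    by (rule integrable_mult_bounded[OF g(1), where C = C]) (use C in auto)
  have "cmod (LINT t|circle. g t * of_real (\<phi> t)) \<le> e * (LINT t|circle. cmod (g t))" if e: "e > 0" for e
  proof -
    obtain p where p: "real_polynomial_function p" "\<And>x. x \<in> sphere 0 1 \<Longrightarrow> \<bar>\<phi> x - p x\<bar> < e"
      using Stone_Weierstrass_real_polynomial_function[OF compact_sphere cont' e] by blast
    note [measurable] = measurable_real_polynomial[OF p(1)]
    have "(LINT t|circle. g t * of_real (p t)) = 0"
      using polynomial_orthogonal(2)[OF p(1) g, of 0] by simp
    then have "(LINT t|circle. g t * of_real (\<phi> t)) = (LINT t|circle. g t * of_real (\<phi> t) - g t * of_real (p t))"
      by (subst Bochner_Integration.integral_diff[OF int polynomial_orthogonal(1)[OF p(1) g]]) simp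
    also have "cmod \<dots> \<le> (LINT t|circle. cmod (g t * of_real (\<phi> t) - g t * of_real (p t)))"
      by (rule integral_norm_bound)
    also have "\<dots> \<le> (LINT t|circle. e * cmod (g t))"
    proof (rule integral_mono_AE)
      show "integrable circle (\<lambda>t. cmod (g t * of_real (\<phi> t) - g t * of_real (p t)))"
        by (intro integrable_norm Bochner_Integration.integrable_diff int polynomial_orthogonal(1)[OF p(1) g])
      show "integrable circle (\<lambda>t. e * cmod (g t))" using g by auto
      show "AE t in circle. cmod (g t * of_real (\<phi> t) - g t * of_real (p t)) \<le> e * cmod (g t)"
        using AE_circle_norm
      proof eventually_elim
        fix t :: complex assume "cmod t = 1"
        then have "\<bar>\<phi> t - p t\<bar> < e" using p(2) by auto
        then have "cmod (g t) * \<bar>\<phi> t - p t\<bar> \<le> cmod (g t) * e"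
          by (intro mult_left_mono) auto
        moreover have "g t * of_real (\<phi> t) - g t * of_real (p t) = g t * of_real (\<phi> t - p t)"
          by (simp add: algebra_simps)
        ultimately show "cmod (g t * of_real (\<phi> t) - g t * of_real (p t)) \<le> e * cmod (g t)"
          by (simp add: norm_mult mult.commute del: of_real_diff)
      qed
    qed
    finally show ?thesis by simp
  qed
  note le = this
  let ?I = "LINT t|circle. cmod (g t)"
  have I: "0 \<le> ?I" by simp
  have "cmod (LINT t|circle. g t * of_real (\<phi> t)) \<le> 0"
  proof (rule field_le_epsilon)
    fix e :: real assume "e > 0"
    \<comment> \<open>The summand 1 avoids a division by the mean of |g|, which may vanish.\<close>
    then have "e / (?I + 1) > 0"
      using add_nonneg_pos[OF I zero_less_one] by (rule divide_pos_pos)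
    from le[OF this] have "cmod (LINT t|circle. g t * of_real (\<phi> t)) \<le> e * (?I / (?I + 1))"
      by simp
    also have "\<dots> \<le> e * 1"
      using \<open>e > 0\<close> add_nonneg_pos[OF I zero_less_one]
      by (intro mult_left_mono divide_le_eq_1_pos[THEN iffD2]) simp_all
    finally show "cmod (LINT t|circle. g t * of_real (\<phi> t)) \<le> 0 + e" by simp
  qed
  then show ?thesis by simp
qed

text \<open>Tents of slope k around A decrease to its indicator, so dominated convergence applies.
  The empty set is treated apart because \<open>infdist\<close> to it is 0, so that its tents would
  be constantly 1.\<close>

lemma closed_orthogonal:
  assumes "closed A" and g: "integrable circle g" "\<And>n. (LINT t|circle. g t * t powi n) = 0"
  shows "(LINT t:A|circle. g t) = 0"
proof (cases "A = {}")
  case False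
  define \<phi> where "\<phi> k t = max 0 (1 - real k * infdist t A)" for k and t :: complex
  have cont: "continuous_on UNIV (\<phi> k)" for k
    unfolding \<phi>_def by (intro continuous_intros)
  have [measurable]: "\<phi> k \<in> borel_measurable circle" for k
    by (intro borel_measurable_circleI borel_measurable_continuous_onI cont)
  have [measurable]: "A \<in> sets circle"
    using assms(1) by (intro sets_circleI) simp
  note [measurable] = borel_measurable_integrable[OF g(1)]
  have lim: "(\<lambda>k. g t * of_real (\<phi> k t)) \<longlonglongrightarrow> indicator A t *\<^sub>R g t" for t
  proof (cases "t \<in> A")
    case True
    then show ?thesis by (simp add: \<phi>_def)
  next
    case False
    then have pos: "infdist t A > 0"
      using assms(1) \<open>A \<noteq> {}\<close> by (metis in_closed_iff_infdist_zero infdist_nonneg less_eq_real_def)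
    obtain N :: nat where N: "1 < real N * infdist t A"
      using ex_less_of_nat_mult[OF pos] by blast
    have "\<forall>\<^sub>F k in sequentially. g t * of_real (\<phi> k t) = 0"
      using eventually_ge_at_top[of N]
    proof eventually_elim
      fix k assume "k \<ge> N"
      then have "real N * infdist t A \<le> real k * infdist t A"
        using pos by (intro mult_right_mono) auto
      with N have "\<phi> k t = 0" by (simp add: \<phi>_def)
      then show "g t * of_real (\<phi> k t) = 0" by simp
    qed
    then show ?thesis using False by (simp add: tendsto_eventually)
  qed
  have "(\<lambda>k. LINT t|circle. g t * of_real (\<phi> k t)) \<longlonglongrightarrow> (LINT t|circle. indicator A t *\<^sub>R g t)"
  proof (rule integral_dominated_convergence[where w = "\<lambda>t. cmod (g t)"])
    have "cmod (g t * of_real (\<phi> k t)) \<le> cmod (g t)" for k t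
    proof -
      have "0 \<le> \<phi> k t" "\<phi> k t \<le> 1"
        by (auto simp: \<phi>_def infdist_nonneg)
      then show ?thesis
        using mult_left_mono[of "\<phi> k t" 1 "cmod (g t)"] by (simp add: norm_mult)
    qed
    then show "AE t in circle. norm (g t * of_real (\<phi> k t)) \<le> cmod (g t)" for k by simp
    show "integrable circle (\<lambda>t. cmod (g t))" using g by auto
    show "AE t in circle. (\<lambda>k. g t * of_real (\<phi> k t)) \<longlonglongrightarrow> indicator A t *\<^sub>R g t"
      using lim by simp
  qed measurable
  then have "(\<lambda>k. 0 :: complex) \<longlonglongrightarrow> (LINT t|circle. indicator A t *\<^sub>R g t)"
    by (simp add: continuous_orthogonal[OF cont g])
  then show ?thesis
    unfolding set_lebesgue_integral_def using LIMSEQ_unique tendsto_const by blast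
qed (simp add: set_lebesgue_integral_def)

text \<open>Closed sets are stable under intersection and generate the Borel sets, so vanishing
  integrals over closed sets extend to all Borel sets, and by \<open>circle_sandwich\<close> to the
  completion. A function whose integral over every measurable set is 0 vanishes almost
  everywhere.\<close>

lemma trig_complete:
  assumes g: "integrable circle g" "\<And>n. (LINT t|circle. g t * t powi n) = 0"
  shows "AE t in circle. g t = 0"
proof (rule circle.density_zero[OF g(1)])
  note [measurable] = borel_measurable_integrable[OF g(1)]
  have si: "set_integrable circle A g" if "A \<in> sets circle" for A
    unfolding set_integrable_def using that g by (intro integrable_mult_indicator)
  have borel: "(LINT t:A|circle. g t) = 0" if "A \<in> sets borel" for A
  proof -
    have "Int_stable (Collect closed :: complex set set)" "Collect closed \<subseteq> Pow (UNIV :: complex set)"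
      "A \<in> sigma_sets UNIV (Collect closed)"
      using that by (auto simp: borel_eq_closed Int_stable_def)
    then show ?thesis
    proof (induction A rule: sigma_sets_induct_disjoint)
      case (basic A)
      then show ?case using closed_orthogonal g by simp
    next
      case (compl A)
      then have A: "A \<in> sets circle"
        by (intro sets_circleI) (simp add: borel_eq_closed)
      have "(LINT t:UNIV - A|circle. g t) = (LINT t|circle. g t - indicator A t *\<^sub>R g t)"
        unfolding set_lebesgue_integral_def
        by (intro Bochner_Integration.integral_cong) (auto simp: indicator_def)
      also have "\<dots> = (LINT t|circle. g t) - (LINT t:A|circle. g t)"
        unfolding set_lebesgue_integral_def
        using g si[OF A] by (intro Bochner_Integration.integral_diff) (auto simp: set_integrable_def)
      finally show ?case using compl g(2)[of 0] by simp
    next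
      case (union A)
      then have A: "A i \<in> sets circle" for i
        by (intro sets_circleI) (auto simp: borel_eq_closed)
      have "(LINT t:(\<Union>i. A i)|circle. g t) = (\<Sum>i. LINT t:A i|circle. g t)"
        using A union(1) by (intro lebesgue_integral_countable_add si) (auto simp: disjoint_family_on_def)
      then show ?case using union by simp
    qed (simp add: set_lebesgue_integral_def)
  qed
  fix A assume A: "A \<in> sets circle"
  obtain S N where SN: "S \<in> sets borel" "N \<in> sets borel" "emeasure circle N = 0" "S \<subseteq> A" "A \<subseteq> S \<union> N"
    using circle_sandwich[OF A] by blast
  have N: "N \<in> null_sets circle"
    using SN by (auto intro: sets_circleI)
  have [measurable]: "S \<in> sets circle" "A \<in> sets circle"
    using SN A by (auto intro: sets_circleI)
  have "(LINT t:A|circle. g t) = (LINT t:S|circle. g t)"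
    unfolding set_lebesgue_integral_def
    by (rule integral_cong_AE, measurable)
       (use AE_not_in[OF N] SN in \<open>auto elim!: eventually_mono simp: indicator_def\<close>)
  then show "(LINT t:A|circle. g t) = 0" using borel SN by simp
qed


section \<open>Fourier coefficients and mean-square convergence\<close>

lemma powi_L2: "(\<lambda>t. t powi n) \<in> L2"
  by (rule L2_bounded[where C = 1])
     (use AE_circle_norm in \<open>auto elim!: eventually_mono simp: norm_power_int\<close>)

lemma L2_powi_mult: "f \<in> L2 \<Longrightarrow> (\<lambda>t. t powi n * f t) \<in> L2"
  by (rule L2_mult_bounded[where C = 1])
     (use AE_circle_norm in \<open>auto elim!: eventually_mono simp: norm_power_int\<close>)

lemma fourier_coeff_eq:
  assumes "f \<in> borel_measurable circle"
  shows "fourier_coeff f n = (LINT t|circle. f t * t powi (- n))"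
  unfolding fourier_coeff_def L2_inner_def
  by (rule integral_cong_AE)
     (use assms AE_circle_norm in \<open>auto elim!: eventually_mono simp: cnj_powi simp del: complex_cnj_power_int\<close>)

lemma fourier_coeff_lin:
  "f \<in> L2 \<Longrightarrow> g \<in> L2 \<Longrightarrow> fourier_coeff (\<lambda>t. f t + c * g t) n = fourier_coeff f n + c * fourier_coeff g n"
  unfolding fourier_coeff_def by (intro L2.ip_lin powi_L2)

lemma fourier_coeff_scale: "fourier_coeff (\<lambda>t. c * f t) n = c * fourier_coeff f n"
  unfolding fourier_coeff_def L2_inner_def by (simp add: mult.assoc)

lemma fourier_coeff_powi: "fourier_coeff (\<lambda>t. t powi m) n = (if m = n then 1 else 0)"
proof -
  have "fourier_coeff (\<lambda>t. t powi m) n = (LINT t|circle. t powi m * t powi (- n))"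
    by (rule fourier_coeff_eq) measurable
  also have "\<dots> = (LINT t|circle. t powi (m - n))"
  proof (rule integral_cong_AE)
    show "AE t in circle. t powi m * t powi (- n) = t powi (m - n)"
      using AE_circle_norm
    proof eventually_elim
      fix t :: complex assume "cmod t = 1"
      then have "t \<noteq> 0" by auto
      then show "t powi m * t powi (- n) = t powi (m - n)"
        using power_int_add[of t m "-n"] by simp
    qed
  qed measurable
  finally show ?thesis by (simp add: integral_circle_powi)
qed

lemma fourier_coeff_shift:
  assumes [measurable]: "f \<in> borel_measurable circle"
  shows "fourier_coeff (\<lambda>t. t powi k * f t) n = fourier_coeff f (n - k)"
proof -
  have "fourier_coeff (\<lambda>t. t powi k * f t) n = (LINT t|circle. (t powi k * f t) * t powi (- n))"
    by (rule fourier_coeff_eq) measurable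
  also have "\<dots> = (LINT t|circle. f t * t powi (- (n - k)))"
  proof (rule integral_cong_AE)
    show "AE t in circle. (t powi k * f t) * t powi (- n) = f t * t powi (- (n - k))"
      using AE_circle_norm
    proof eventually_elim
      fix t :: complex assume "cmod t = 1"
      then have "t \<noteq> 0" by auto
      then show "(t powi k * f t) * t powi (- n) = f t * t powi (- (n - k))"
        using power_int_add[of t k "-n"] by simp
    qed
  qed measurable
  finally show ?thesis by (simp add: fourier_coeff_eq assms)
qed

lemma fourier_coeff_cong_AE:
  assumes "AE t in circle. f t = g t" "f \<in> borel_measurable circle" "g \<in> borel_measurable circle"
  shows "fourier_coeff f n = fourier_coeff g n"
  unfolding fourier_coeff_def by (rule L2_inner_cong_AE) (use assms in auto)

lemma fourier_coeff_cnj: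
  assumes [measurable]: "f \<in> borel_measurable circle"
  shows "fourier_coeff (\<lambda>t. cnj (f t)) n = cnj (fourier_coeff f (- n))"
proof -
  have "cnj (fourier_coeff f (- n)) = (LINT t|circle. cnj (f t * t powi n))"
    by (subst fourier_coeff_eq) (simp_all del: complex_cnj_power_int complex_cnj_mult)
  also have "\<dots> = (LINT t|circle. cnj (f t) * t powi (- n))"
    by (rule integral_cong_AE, measurable)
       (use AE_circle_norm in \<open>auto elim!: eventually_mono simp: cnj_powi simp del: complex_cnj_power_int\<close>)
  finally show ?thesis by (simp add: fourier_coeff_eq)
qed

lemma fourier_coeff_reflect:
  assumes [measurable]: "f \<in> borel_measurable circle"
  shows "fourier_coeff (\<lambda>t. f (cnj t)) n = fourier_coeff f (- n)"
proof -
  have "fourier_coeff f (- n) = (LINT t|circle. f t * t powi n)"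
    by (simp add: fourier_coeff_eq)
  also have "\<dots> = (LINT t|circle. f (cnj t) * (cnj t) powi n)"
    by (rule integral_circle_cnj[symmetric]) measurable
  finally show ?thesis by (simp add: fourier_coeff_def L2_inner_def)
qed

lemma nsq_powi: "nsq (\<lambda>t. t powi n) = 1"
  using fourier_coeff_powi[of n n] by (simp add: L2.sq_def fourier_coeff_def)

lemma fourier_coeff_bound: "f \<in> L2 \<Longrightarrow> cmod (fourier_coeff f n) \<le> sqrt (nsq f)"
  using L2.cmod_ip_le[of f "\<lambda>t. t powi n"] by (simp add: fourier_coeff_def powi_L2 nsq_powi)

lemma tendsto_fourier_coeff:
  assumes "\<And>n. s n \<in> L2" "f \<in> L2" "(\<lambda>n. L2_dist (s n) f) \<longlonglongrightarrow> 0"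
  shows "(\<lambda>n. fourier_coeff (s n) k) \<longlonglongrightarrow> fourier_coeff f k"
  unfolding fourier_coeff_def using L2.tendsto_ip[of s f "\<lambda>t. t powi k"] assms powi_L2 by blast

theorem fourier_unique:
  assumes "f \<in> L2" "g \<in> L2" "\<And>n. fourier_coeff f n = fourier_coeff g n"
  shows "AE t in circle. f t = g t"
proof -
  have d: "(\<lambda>t. f t - g t) \<in> L2" using assms by (intro L2_diff)
  have "AE t in circle. f t - g t = 0"
  proof (rule trig_complete)
    show "integrable circle (\<lambda>t. f t - g t)" by (rule integrable_L2[OF d])
    fix n
    have "fourier_coeff (\<lambda>t. f t - g t) (- n) = 0"
      using fourier_coeff_lin[OF assms(1,2), of "-1" "-n"] assms(3) by simp
    then show "(LINT t|circle. (f t - g t) * t powi n) = 0"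
      using fourier_coeff_eq[OF L2_measurable[OF d], of "-n"] by simp
  qed
  then show ?thesis by simp
qed

definition trig :: "(int \<Rightarrow> complex) \<Rightarrow> nat \<Rightarrow> complex \<Rightarrow> complex" where
  "trig c N t = (\<Sum>k=-int N..int N. c k * t powi k)"

lemma trig_L2: "trig c N \<in> L2"
  unfolding trig_def[abs_def] by (intro L2_sum L2_scale powi_L2)

lemma L2_inner_sum:
  assumes "\<And>k. k \<in> K \<Longrightarrow> f k \<in> L2" "g \<in> L2"
  shows "L2_inner (\<lambda>t. \<Sum>k\<in>K. f k t) g = (\<Sum>k\<in>K. L2_inner (f k) g)"
  unfolding L2_inner_def sum_distrib_right
  by (intro Bochner_Integration.integral_sum integrable_L2_inner assms)

lemma L2_inner_trig:
  assumes "g \<in> L2"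
  shows "L2_inner (trig c N) g = (\<Sum>k=-int N..int N. c k * cnj (fourier_coeff g k))"
proof -
  have "L2_inner (trig c N) g = (\<Sum>k=-int N..int N. L2_inner (\<lambda>t. c k * t powi k) g)"
    unfolding trig_def[abs_def] by (intro L2_inner_sum L2_scale powi_L2 assms)
  also have "\<dots> = (\<Sum>k=-int N..int N. c k * cnj (fourier_coeff g k))"
  proof (rule sum.cong[OF refl])
    fix k
    have "L2_inner (\<lambda>t. c k * t powi k) g = c k * L2_inner (\<lambda>t. t powi k) g"
      unfolding L2_inner_def by (simp add: mult.assoc del: complex_cnj_power_int)
    then show "L2_inner (\<lambda>t. c k * t powi k) g = c k * cnj (fourier_coeff g k)"
      unfolding fourier_coeff_def using L2.ip_cnj[OF assms powi_L2] by simp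
  qed
  finally show ?thesis .
qed

lemma fourier_coeff_trig: "fourier_coeff (trig c N) n = (if \<bar>n\<bar> \<le> int N then c n else 0)"
proof -
  have "fourier_coeff (trig c N) n = (\<Sum>k=-int N..int N. c k * cnj (fourier_coeff (\<lambda>t. t powi n) k))"
    unfolding fourier_coeff_def[of "trig c N"] by (rule L2_inner_trig[OF powi_L2])
  also have "\<dots> = (\<Sum>k=-int N..int N. if k = n then c k else 0)"
    by (intro sum.cong) (auto simp: fourier_coeff_powi)
  finally show ?thesis by auto
qed

lemma L2_inner_trig_trig:
  "L2_inner (trig c N) (trig c M) = of_real (\<Sum>k=-int (min M N)..int (min M N). (cmod (c k))\<^sup>2)"
proof -
  have "L2_inner (trig c N) (trig c M) = (\<Sum>k=-int N..int N. if \<bar>k\<bar> \<le> int M then c k * cnj (c k) else 0)"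
    unfolding L2_inner_trig[OF trig_L2] by (intro sum.cong) (auto simp: fourier_coeff_trig)
  also have "\<dots> = (\<Sum>k\<in>{-int N..int N} \<inter> {k. \<bar>k\<bar> \<le> int M}. c k * cnj (c k))"
    by (subst sum.inter_restrict) auto
  also have "{-int N..int N} \<inter> {k. \<bar>k\<bar> \<le> int M} = {-int (min M N)..int (min M N)}"
    by auto
  finally show ?thesis by (simp only: mult_cnj_cmod of_real_sum)
qed

lemma nsq_trig: "nsq (trig c N) = (\<Sum>k=-int N..int N. (cmod (c k))\<^sup>2)"
  unfolding L2.sq_def L2_inner_trig_trig by simp

theorem Riesz_Fischer:
  assumes C: "\<And>N. (\<Sum>k=-int N..int N. (cmod (c k))\<^sup>2) \<le> C"
  obtains f where "f \<in> L2" "\<And>n. fourier_coeff f n = c n" "(\<lambda>N. L2_dist (trig c N) f) \<longlonglongrightarrow> 0"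
proof -
  define S where "S N = (\<Sum>k=-int N..int N. (cmod (c k))\<^sup>2)" for N :: nat
  \<comment> \<open>By orthogonality the squared distance of two partial sums is the difference of
    their squared norms, so the Cauchy property is that of a bounded monotone real sequence.\<close>
  have dist: "L2_dist (trig c M) (trig c N) = \<bar>S M - S N\<bar>" for M N
  proof -
    have mono: "S M \<le> S N" if "M \<le> N" for M N
      unfolding S_def using that by (intro sum_mono2) auto
    have "L2_dist (trig c M) (trig c N) = S M - 2 * S (min M N) + S N"
      unfolding L2.dst_eq[OF trig_L2 trig_L2] L2_inner_trig_trig nsq_trig S_def
      by (simp add: min.commute)
    then show ?thesis using mono[of M N] mono[of N M] by (auto simp: min_def)
  qed
  have "convergent S"
    by (rule Bseq_mono_convergent)
       (use C in \<open>auto intro!: BseqI'[of _ C] sum_mono2 simp: S_def sum_nonneg\<close>)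
  then have "Cauchy S" by (rule convergent_Cauchy)
  then have Cau: "\<exists>N. \<forall>m\<ge>N. \<forall>n\<ge>N. L2_dist (trig c m) (trig c n) < e" if "e > 0" for e
    using that unfolding dist Cauchy_def dist_real_def by blast
  obtain f where f: "f \<in> L2" "(\<lambda>N. L2_dist (trig c N) f) \<longlonglongrightarrow> 0"
    using L2_complete[of "trig c"] trig_L2 Cau by blast
  have "fourier_coeff f n = c n" for n
  proof (rule LIMSEQ_unique)
    show "(\<lambda>N. fourier_coeff (trig c N) n) \<longlonglongrightarrow> fourier_coeff f n"
      using trig_L2 f by (rule tendsto_fourier_coeff)
    have "\<forall>\<^sub>F N in sequentially. fourier_coeff (trig c N) n = c n"
      using eventually_ge_at_top[of "nat \<bar>n\<bar>"] by eventually_elim (auto simp: fourier_coeff_trig)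
    then show "(\<lambda>N. fourier_coeff (trig c N) n) \<longlonglongrightarrow> c n"
      by (rule tendsto_eventually)
  qed
  with f show ?thesis by (intro that)
qed

lemma Bessel:
  assumes "f \<in> L2"
  shows "(\<Sum>k=-int N..int N. (cmod (fourier_coeff f k))\<^sup>2) \<le> nsq f"
proof -
  let ?S = "\<Sum>k=-int N..int N. (cmod (fourier_coeff f k))\<^sup>2"
  have "L2_inner (trig (fourier_coeff f) N) f = of_real ?S"
    by (simp only: L2_inner_trig[OF assms] mult_cnj_cmod of_real_sum)
  then have "L2_dist (trig (fourier_coeff f) N) f = ?S - 2 * ?S + nsq f"
    by (simp only: L2.dst_eq[OF trig_L2 assms] nsq_trig Re_complex_of_real)
  with L2.dst_nonneg[OF trig_L2 assms, of "fourier_coeff f" N] show ?thesis by simp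
qed

lemma L2_dist_cong_AE:
  assumes "AE t in circle. f t = f' t" "AE t in circle. g t = g' t"
    "f \<in> borel_measurable circle" "f' \<in> borel_measurable circle"
    "g \<in> borel_measurable circle" "g' \<in> borel_measurable circle"
  shows "L2_dist f g = L2_dist f' g'"
  unfolding L2_dist_eq
proof (rule integral_cong_AE)
  note [measurable] = assms(3-6)
  show "(\<lambda>t. (cmod (f t - g t))\<^sup>2) \<in> borel_measurable circle"
    "(\<lambda>t. (cmod (f' t - g' t))\<^sup>2) \<in> borel_measurable circle" by measurable
  show "AE t in circle. (cmod (f t - g t))\<^sup>2 = (cmod (f' t - g' t))\<^sup>2"
    using assms(1,2) by eventually_elim simp
qed

text \<open>No summation kernel is involved: by Bessel and Riesz-Fischer the partial sums converge
  to some function with the coefficients of f, and uniqueness identifies it with f.\<close>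

theorem fourier_series_tendsto:
  assumes "f \<in> L2"
  shows "(\<lambda>N. L2_dist (trig (fourier_coeff f) N) f) \<longlonglongrightarrow> 0"
proof -
  obtain g where g: "g \<in> L2" "\<And>n. fourier_coeff g n = fourier_coeff f n"
    "(\<lambda>N. L2_dist (trig (fourier_coeff f) N) g) \<longlonglongrightarrow> 0"
    using Riesz_Fischer[OF Bessel[OF assms]] by blast
  have "AE t in circle. g t = f t"
    by (rule fourier_unique[OF g(1) assms g(2)])
  then have "L2_dist (trig (fourier_coeff f) N) g = L2_dist (trig (fourier_coeff f) N) f" for N
    by (intro L2_dist_cong_AE) (auto intro!: L2_measurable trig_L2 g assms)
  with g(3) show ?thesis by simp
qed

section \<open>Hardy space\<close>

lemma H2_L2: "f \<in> H2 \<Longrightarrow> f \<in> L2"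
  by (simp add: H2_def)

lemma H2_coeff: "f \<in> H2 \<Longrightarrow> n < 0 \<Longrightarrow> fourier_coeff f n = 0"
  by (simp add: H2_def)

lemma H2_I: "f \<in> L2 \<Longrightarrow> (\<And>n. n < 0 \<Longrightarrow> fourier_coeff f n = 0) \<Longrightarrow> f \<in> H2"
  by (simp add: H2_def)

lemma H2_lin: "f \<in> H2 \<Longrightarrow> g \<in> H2 \<Longrightarrow> (\<lambda>t. f t + c * g t) \<in> H2"
  by (simp add: H2_def L2_lin fourier_coeff_lin)

lemma H2_cong_AE:
  assumes "f \<in> H2" "g \<in> borel_measurable circle" "AE t in circle. g t = f t"
  shows "g \<in> H2"
proof (rule H2_I)
  show g: "g \<in> L2" by (rule L2_cong_AE[OF H2_L2[OF assms(1)] assms(2,3)])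
  show "fourier_coeff g n = 0" if "n < 0" for n
    using fourier_coeff_cong_AE[OF assms(3,2) L2_measurable[OF H2_L2[OF assms(1)]]] H2_coeff[OF assms(1) that] by simp
qed

lemma powi_H2: "0 \<le> n \<Longrightarrow> (\<lambda>t. t powi n) \<in> H2"
  by (rule H2_I) (auto simp: powi_L2 fourier_coeff_powi)

lemma const_H2: "(\<lambda>t. c) \<in> H2"
  using H2_lin[of "\<lambda>t. t powi 0" "\<lambda>t. t powi 0" "c - 1"] powi_H2[of 0] by simp

lemma H2_scale: "f \<in> H2 \<Longrightarrow> (\<lambda>t. c * f t) \<in> H2"
  using H2_lin[OF const_H2[of 0], of f c] by simp

lemma H2_diff: "f \<in> H2 \<Longrightarrow> g \<in> H2 \<Longrightarrow> (\<lambda>t. f t - g t) \<in> H2"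
  using H2_lin[of f g "-1"] by simp

lemma H2_sum: "(\<And>i. i \<in> I \<Longrightarrow> f i \<in> H2) \<Longrightarrow> (\<lambda>t. \<Sum>i\<in>I. f i t) \<in> H2"
proof (induction I rule: infinite_finite_induct)
  case (insert i I)
  then show ?case using H2_lin[of "f i" "\<lambda>t. \<Sum>i\<in>I. f i t" 1] by simp
qed (auto intro: const_H2)

lemma H2_closed:
  assumes "\<And>n. s n \<in> H2" "f \<in> L2" "(\<lambda>n. L2_dist (s n) f) \<longlonglongrightarrow> 0"
  shows "f \<in> H2"
proof (rule H2_I[OF assms(2)])
  fix k :: int assume "k < 0"
  then have "(\<lambda>n. fourier_coeff (s n) k) = (\<lambda>n. 0)"
    using H2_coeff[OF assms(1)] by auto
  then show "fourier_coeff f k = 0"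
    using tendsto_fourier_coeff[OF H2_L2[OF assms(1)] assms(2,3), of k] LIMSEQ_unique tendsto_const by metis
qed

text \<open>Powers of t as test functions give one direction. Conversely, the partial Fourier sums
  of f share no frequency with h, and they converge to f.\<close>

lemma H2_minus_iff: "f \<in> H2_minus \<longleftrightarrow> f \<in> L2 \<and> (\<forall>n\<ge>0. fourier_coeff f n = 0)"
proof safe
  assume f: "f \<in> H2_minus"
  then show "f \<in> L2" by (simp add: H2_minus_def)
  show "fourier_coeff f n = 0" if "n \<ge> 0" for n
    using f powi_H2[OF that] by (simp add: H2_minus_def fourier_coeff_def)
next
  assume f: "f \<in> L2" "\<forall>n\<ge>0. fourier_coeff f n = 0"
  have "L2_inner f h = 0" if h: "h \<in> H2" for h
  proof (rule LIMSEQ_unique)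
    show "(\<lambda>N. L2_inner (trig (fourier_coeff f) N) h) \<longlonglongrightarrow> L2_inner f h"
      using L2.tendsto_ip[of "trig (fourier_coeff f)" f h] trig_L2 f(1) H2_L2[OF h] fourier_series_tendsto[OF f(1)]
      by blast
    have "fourier_coeff f k * cnj (fourier_coeff h k) = 0" for k
      using f(2) H2_coeff[OF h, of k] by (cases "k \<ge> 0") auto
    then show "(\<lambda>N. L2_inner (trig (fourier_coeff f) N) h) \<longlonglongrightarrow> 0"
      unfolding L2_inner_trig[OF H2_L2[OF h]] by (simp only: sum.neutral_const tendsto_const)
  qed
  with f show "f \<in> H2_minus" by (simp add: H2_minus_def)
qed

lemma H2_minus_L2: "f \<in> H2_minus \<Longrightarrow> f \<in> L2"
  by (simp add: H2_minus_def)

lemma H2_orthogonal: "f \<in> H2_minus \<Longrightarrow> h \<in> H2 \<Longrightarrow> L2_inner f h = 0"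
  by (simp add: H2_minus_def)

lemma H2_orthogonal': "f \<in> H2_minus \<Longrightarrow> h \<in> H2 \<Longrightarrow> L2_inner h f = 0"
  using L2.ip_cnj[OF H2_minus_L2 H2_L2] H2_orthogonal by (metis complex_cnj_zero)

lemma H2_minus_lin: "f \<in> H2_minus \<Longrightarrow> g \<in> H2_minus \<Longrightarrow> (\<lambda>t. f t + c * g t) \<in> H2_minus"
  by (simp add: H2_minus_iff L2_lin fourier_coeff_lin)

lemma H2_minus_cong_AE:
  assumes "f \<in> H2_minus" "g \<in> borel_measurable circle" "AE t in circle. g t = f t"
  shows "g \<in> H2_minus"
  unfolding H2_minus_iff
proof safe
  show g: "g \<in> L2" by (rule L2_cong_AE[OF H2_minus_L2[OF assms(1)] assms(2,3)])
  show "fourier_coeff g n = 0" if "n \<ge> 0" for n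
    using fourier_coeff_cong_AE[OF assms(3,2) L2_measurable[OF H2_minus_L2[OF assms(1)]]] assms(1) that
    by (simp add: H2_minus_iff)
qed

lemma H2_minus_closed:
  assumes "\<And>n. s n \<in> H2_minus" "f \<in> L2" "(\<lambda>n. L2_dist (s n) f) \<longlonglongrightarrow> 0"
  shows "f \<in> H2_minus"
  unfolding H2_minus_iff
proof safe
  fix k :: int assume "k \<ge> 0"
  then have "(\<lambda>n. fourier_coeff (s n) k) = (\<lambda>n. 0)"
    using assms(1) by (auto simp: H2_minus_iff)
  then show "fourier_coeff f k = 0"
    using tendsto_fourier_coeff[OF H2_minus_L2[OF assms(1)] assms(2,3), of k] LIMSEQ_unique tendsto_const by metis
qed fact

lemma H2_Int_H2_minus:
  assumes "f \<in> H2" "f \<in> H2_minus"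
  shows "AE t in circle. f t = 0"
proof (rule fourier_unique)
  show "fourier_coeff f n = fourier_coeff (\<lambda>t. 0) n" for n
    using H2_coeff[OF assms(1), of n] assms(2) H2_minus_iff[of f] fourier_coeff_scale[of 0 "\<lambda>t. 0" n]
    by (cases "n < 0") auto
qed (use H2_L2[OF assms(1)] L2_const in auto)

lemma P_minus_props:
  assumes "f \<in> L2"
  shows "P_minus f \<in> H2_minus" "(\<lambda>t. f t - P_minus f t) \<in> H2"
proof -
  define c where "c n = (if n < 0 then fourier_coeff f n else 0)" for n
  have "(\<Sum>k=-int N..int N. (cmod (c k))\<^sup>2) \<le> nsq f" for N
    by (rule order_trans[OF sum_mono Bessel[OF assms, of N]]) (auto simp: c_def)
  then obtain g where g: "g \<in> L2" "\<And>n. fourier_coeff g n = c n"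
    using Riesz_Fischer by blast
  have "g \<in> H2_minus \<and> (\<lambda>t. f t - g t) \<in> H2"
    using g fourier_coeff_lin[OF assms g(1), of "-1"]
    by (auto simp: H2_minus_iff c_def intro!: H2_I L2_diff assms)
  then have "P_minus f \<in> H2_minus \<and> (\<lambda>t. f t - P_minus f t) \<in> H2"
    unfolding P_minus_def by (rule someI[of "\<lambda>g. g \<in> H2_minus \<and> (\<lambda>t. f t - g t) \<in> H2"])
  then show "P_minus f \<in> H2_minus" "(\<lambda>t. f t - P_minus f t) \<in> H2" by auto
qed

section \<open>Extension to the disc and multiplication\<close>

lemma disc_ext_summable:
  assumes "f \<in> L2" "cmod z < 1"
  shows "summable (\<lambda>n. fourier_coeff f (int n) * z ^ n)"
    and "cmod (disc_ext f z) \<le> sqrt (nsq f) / (1 - cmod z)"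
proof -
  have g: "(\<lambda>n. sqrt (nsq f) * cmod z ^ n) sums (sqrt (nsq f) * (1 / (1 - cmod z)))"
    using assms by (intro sums_mult geometric_sums) auto
  have le: "norm (fourier_coeff f (int n) * z ^ n) \<le> sqrt (nsq f) * cmod z ^ n" for n
    using fourier_coeff_bound[OF assms(1), of "int n"] by (simp add: norm_mult norm_power mult_right_mono)
  show "summable (\<lambda>n. fourier_coeff f (int n) * z ^ n)"
    using sums_summable[OF g] le by (rule summable_comparison_test') 
  have "cmod (disc_ext f z) \<le> (\<Sum>n. sqrt (nsq f) * cmod z ^ n)"
    unfolding disc_ext_def by (rule norm_suminf_le[OF le sums_summable[OF g]])
  then show "cmod (disc_ext f z) \<le> sqrt (nsq f) / (1 - cmod z)"
    using sums_unique[OF g] by simp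
qed

lemma disc_ext_lin:
  assumes "f \<in> L2" "g \<in> L2" "cmod z < 1"
  shows "disc_ext (\<lambda>t. f t + c * g t) z = disc_ext f z + c * disc_ext g z"
proof -
  have "disc_ext (\<lambda>t. f t + c * g t) z
     = (\<Sum>n. fourier_coeff f (int n) * z ^ n + c * (fourier_coeff g (int n) * z ^ n))"
    unfolding disc_ext_def using assms by (simp add: fourier_coeff_lin algebra_simps)
  also have "\<dots> = disc_ext f z + c * disc_ext g z"
    unfolding disc_ext_def using assms disc_ext_summable(1)
    by (subst suminf_add[symmetric]) (auto simp: suminf_mult intro!: summable_mult)
  finally show ?thesis .
qed

lemma disc_ext_0: "disc_ext f 0 = fourier_coeff f 0"
  unfolding disc_ext_def using powser_sums_zero_iff[of "\<lambda>n. fourier_coeff f (int n)"] by (simp add: sums_iff)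

lemma disc_ext_cong_AE:
  assumes "AE t in circle. f t = g t" "f \<in> borel_measurable circle" "g \<in> borel_measurable circle"
  shows "disc_ext f z = disc_ext g z"
  unfolding disc_ext_def by (simp add: fourier_coeff_cong_AE[OF assms])

lemma disc_ext_powi:
  assumes "0 \<le> n" "cmod z < 1"
  shows "disc_ext (\<lambda>t. t powi n) z = z powi n"
proof -
  have "(\<lambda>m. fourier_coeff (\<lambda>t. t powi n) (int m) * z ^ m) = (\<lambda>m. if m = nat n then z ^ nat n else 0)"
    using assms by (auto simp: fourier_coeff_powi)
  then have "disc_ext (\<lambda>t. t powi n) z = z ^ nat n"
    unfolding disc_ext_def using sums_single[of "nat n" "\<lambda>_. z ^ nat n"] by (simp add: sums_iff)
  then show ?thesis using assms by (simp add: power_int_def)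
qed

lemma disc_ext_scale:
  assumes "f \<in> L2" "cmod z < 1"
  shows "disc_ext (\<lambda>t. c * f t) z = c * disc_ext f z"
  unfolding disc_ext_def fourier_coeff_scale mult.assoc
  by (rule suminf_mult) (rule disc_ext_summable(1)[OF assms])

lemma disc_ext_const: "cmod z < 1 \<Longrightarrow> disc_ext (\<lambda>t. c) z = c"
  using disc_ext_scale[OF powi_L2[of 0], of z c] disc_ext_powi[of 0 z] by simp

lemma tendsto_disc_ext:
  assumes "\<And>n. s n \<in> L2" "f \<in> L2" "(\<lambda>n. L2_dist (s n) f) \<longlonglongrightarrow> 0" "cmod z < 1"
  shows "(\<lambda>n. disc_ext (s n) z) \<longlonglongrightarrow> disc_ext f z"
proof (rule LIM_zero_cancel, rule Lim_null_comparison)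
  have "disc_ext (s n) z - disc_ext f z = disc_ext (\<lambda>t. s n t + (-1) * f t) z" for n
    using disc_ext_lin[OF assms(1,2,4), of n "-1"] by simp
  then show "\<forall>\<^sub>F n in sequentially. norm (disc_ext (s n) z - disc_ext f z) \<le> sqrt (L2_dist (s n) f) / (1 - cmod z)"
    using disc_ext_summable(2)[OF L2_lin[OF assms(1,2)] assms(4), of _ "-1"] by (simp add: L2.dst_def)
  have "(\<lambda>n. sqrt (L2_dist (s n) f) / (1 - cmod z)) \<longlonglongrightarrow> sqrt 0 / (1 - cmod z)"
    using assms by (intro tendsto_intros) auto
  then show "(\<lambda>n. sqrt (L2_dist (s n) f) / (1 - cmod z)) \<longlonglongrightarrow> 0" by simp
qed

text \<open>A difference with a nonzero coefficient could be divided by z^m, m being the least index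
  of such a coefficient, and the limit at 0 would be that coefficient. Boundary functions obtained
  by choice are compared through this lemma.\<close>

lemma disc_ext_unique:
  assumes "f \<in> H2" "g \<in> H2" "\<And>z. cmod z < 1 \<Longrightarrow> disc_ext f z = disc_ext g z"
  shows "AE t in circle. f t = g t"
proof (rule fourier_unique[OF H2_L2[OF assms(1)] H2_L2[OF assms(2)]])
  define d where "d t = f t + (-1) * g t" for t
  have d: "d \<in> L2" unfolding d_def[abs_def] using assms by (intro L2_lin H2_L2)
  have dz: "disc_ext d z = 0" if "cmod z < 1" for z
    unfolding d_def[abs_def] using disc_ext_lin[OF H2_L2[OF assms(1)] H2_L2[OF assms(2)] that, of "-1"] assms(3)[OF that]
    by simp
  have c: "fourier_coeff d n = fourier_coeff f n - fourier_coeff g n" for n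
    unfolding d_def[abs_def] using fourier_coeff_lin[OF H2_L2[OF assms(1)] H2_L2[OF assms(2)], of "-1"] by simp
  have "fourier_coeff d (int n) = 0" for n
  proof (rule ccontr)
    assume n: "fourier_coeff d (int n) \<noteq> 0"
    define m where "m = (LEAST n. fourier_coeff d (int n) \<noteq> 0)"
    have m: "fourier_coeff d (int m) \<noteq> 0"
      unfolding m_def by (rule LeastI[of "\<lambda>n. fourier_coeff d (int n) \<noteq> 0", OF n])
    have lt: "fourier_coeff d (int k) = 0" if "k < m" for k
      using not_less_Least[of k "\<lambda>n. fourier_coeff d (int n) \<noteq> 0"] that unfolding m_def by blast
    have sums: "(\<lambda>k. fourier_coeff d (int (k + m)) * z ^ k) sums 0" if z: "z \<noteq> 0" "cmod z < 1" for z
    proof -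
      have "(\<lambda>n. fourier_coeff d (int n) * z ^ n) sums 0"
        using summable_sums[OF disc_ext_summable(1)[OF d z(2)]] dz[OF z(2)] by (simp add: disc_ext_def)
      then have "(\<lambda>k. fourier_coeff d (int (k + m)) * z ^ (k + m)) sums 0"
        using lt by (subst sums_iff_shift) auto
      then have "(\<lambda>k. fourier_coeff d (int (k + m)) * z ^ (k + m) / z ^ m) sums (0 / z ^ m)"
        by (rule sums_divide)
      then show ?thesis using z by (simp add: power_add)
    qed
    have "fourier_coeff d (int (0 + m)) = 0"
    proof (rule LIM_unique)
      show "(\<lambda>z::complex. 0) \<midarrow>0\<rightarrow> fourier_coeff d (int (0 + m))"
        by (rule powser_limit_0_strong[of 1 "\<lambda>k. fourier_coeff d (int (k + m))"]) (use sums in auto)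
    qed simp
    with m show False by simp
  qed
  then have "fourier_coeff d n = 0" if "n \<ge> 0" for n
    using that by (metis int_nat_eq)
  then show "fourier_coeff f n = fourier_coeff g n" for n
    using c[of n] H2_coeff[OF assms(1), of n] H2_coeff[OF assms(2), of n] by (cases "n < 0") auto
qed

lemma disc_ext_differentiable:
  assumes "f \<in> L2" "cmod z < 1"
  shows "disc_ext f field_differentiable (at z)"
proof -
  obtain r where r: "cmod z < r" "r < 1" using dense[OF assms(2)] by blast
  have "0 \<le> r" using r(1) norm_ge_zero[of z] by linarith
  then have s: "summable (\<lambda>n. fourier_coeff f (int n) * (of_real r) ^ n)"
    using r by (intro disc_ext_summable(1)[OF assms(1)]) auto
  have "((\<lambda>z. \<Sum>n. fourier_coeff f (int n) * z ^ n) has_field_derivative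
      (\<Sum>n. diffs (\<lambda>n. fourier_coeff f (int n)) n * z ^ n)) (at z)"
    by (rule termdiffs_strong[OF s]) (use r \<open>0 \<le> r\<close> in auto)
  then show ?thesis
    unfolding disc_ext_def[abs_def] field_differentiable_def by blast
qed

text \<open>The Fourier coefficients of a product are obtained by multiplying \<open>g\<close> with the partial
  Fourier sums of \<open>f\<close>; for functions in \<open>H2\<close> the resulting convolution is a finite sum.\<close>

theorem H2_mult:
  assumes f: "f \<in> H2" and g: "g \<in> H2" and C: "AE t in circle. cmod (g t) \<le> C"
  shows "(\<lambda>t. g t * f t) \<in> H2"
    and "cmod z < 1 \<Longrightarrow> disc_ext (\<lambda>t. g t * f t) z = disc_ext g z * disc_ext f z"
proof -
  note [measurable] = L2_measurable[OF H2_L2[OF g]] L2_measurable[OF H2_L2[OF f]]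
  have gf: "(\<lambda>t. g t * h t) \<in> L2" if "h \<in> L2" for h
    using L2_mult_bounded[OF that _ C] by measurable
  define s where "s N = trig (fourier_coeff f) N" for N
  have s: "s N \<in> L2" for N unfolding s_def by (rule trig_L2)
  have lim: "(\<lambda>N. L2_dist (s N) f) \<longlonglongrightarrow> 0"
    unfolding s_def by (rule fourier_series_tendsto[OF H2_L2[OF f]])
  have dist: "(\<lambda>N. L2_dist (\<lambda>t. g t * s N t) (\<lambda>t. g t * f t)) \<longlonglongrightarrow> 0"
  proof (rule tendsto_sandwich[OF _ _ tendsto_const])
    show "\<forall>\<^sub>F N in sequentially. L2_dist (\<lambda>t. g t * s N t) (\<lambda>t. g t * f t) \<le> C\<^sup>2 * L2_dist (s N) f"
    proof (intro always_eventually allI)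
      fix N
      note [measurable] = L2_measurable[OF s]
      have "nsq (\<lambda>t. g t * (s N t - f t)) \<le> nsq (\<lambda>t. of_real C * (s N t - f t))"
      proof (rule nsq_mono)
        show "(\<lambda>t. of_real C * (s N t - f t)) \<in> L2"
          by (intro L2_scale L2_diff s H2_L2 f)
        show "AE t in circle. cmod (g t * (s N t - f t)) \<le> cmod (of_real C * (s N t - f t))"
          using C by eventually_elim (auto simp: norm_mult intro!: mult_right_mono)
      qed measurable
      also have "\<dots> = C\<^sup>2 * nsq (\<lambda>t. s N t - f t)"
        by (simp add: nsq_eq norm_mult power_mult_distrib)
      finally show "L2_dist (\<lambda>t. g t * s N t) (\<lambda>t. g t * f t) \<le> C\<^sup>2 * L2_dist (s N) f"
        by (simp add: L2_dist_eq nsq_eq algebra_simps)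
    qed
    show "(\<lambda>N. C\<^sup>2 * L2_dist (s N) f) \<longlonglongrightarrow> 0"
      using tendsto_mult_right_zero[OF lim] by simp
    show "\<forall>\<^sub>F N in sequentially. 0 \<le> L2_dist (\<lambda>t. g t * s N t) (\<lambda>t. g t * f t)"
      by (intro always_eventually allI L2.dst_nonneg gf s H2_L2[OF f])
  qed
  have coeff_s: "fourier_coeff (\<lambda>t. g t * s N t) n = (\<Sum>k=-int N..int N. fourier_coeff f k * fourier_coeff g (n - k))" for N n
  proof -
    have eq: "(\<lambda>t. g t * s N t) = (\<lambda>t. \<Sum>k=-int N..int N. fourier_coeff f k * (t powi k * g t))"
      unfolding s_def trig_def[abs_def] sum_distrib_left by (simp add: mult_ac)
    have "fourier_coeff (\<lambda>t. g t * s N t) n = L2_inner (\<lambda>t. \<Sum>k=-int N..int N. fourier_coeff f k * (t powi k * g t)) (\<lambda>t. t powi n)"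
      unfolding eq by (rule fourier_coeff_def)
    also have "\<dots> = (\<Sum>k=-int N..int N. fourier_coeff (\<lambda>t. fourier_coeff f k * (t powi k * g t)) n)"
      unfolding fourier_coeff_def[of "\<lambda>t. fourier_coeff f k * (t powi k * g t)" for k]
      by (intro L2_inner_sum L2_scale L2_powi_mult powi_L2 H2_L2 g)
    finally show ?thesis
      by (simp add: fourier_coeff_scale fourier_coeff_shift)
  qed
  have coeff: "fourier_coeff (\<lambda>t. g t * f t) n = (\<Sum>k\<in>{0..n}. fourier_coeff f k * fourier_coeff g (n - k))" for n
  proof (rule LIMSEQ_unique)
    show "(\<lambda>N. fourier_coeff (\<lambda>t. g t * s N t) n) \<longlonglongrightarrow> fourier_coeff (\<lambda>t. g t * f t) n"
      by (intro tendsto_fourier_coeff gf s H2_L2 f dist)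
    have "\<forall>\<^sub>F N in sequentially. fourier_coeff (\<lambda>t. g t * s N t) n = (\<Sum>k\<in>{0..n}. fourier_coeff f k * fourier_coeff g (n - k))"
      using eventually_ge_at_top[of "nat \<bar>n\<bar>"]
    proof eventually_elim
      fix N assume "nat \<bar>n\<bar> \<le> N"
      then show "fourier_coeff (\<lambda>t. g t * s N t) n = (\<Sum>k\<in>{0..n}. fourier_coeff f k * fourier_coeff g (n - k))"
        unfolding coeff_s
        by (intro sum.mono_neutral_right) (auto simp: H2_coeff[OF f] H2_coeff[OF g])
    qed
    then show "(\<lambda>N. fourier_coeff (\<lambda>t. g t * s N t) n) \<longlonglongrightarrow> (\<Sum>k\<in>{0..n}. fourier_coeff f k * fourier_coeff g (n - k))"
      by (rule tendsto_eventually)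
  qed
  show "(\<lambda>t. g t * f t) \<in> H2"
    by (rule H2_I[OF gf[OF H2_L2[OF f]]]) (simp add: coeff)
  assume z: "cmod z < 1"
  let ?a = "\<lambda>n. fourier_coeff f (int n) * z ^ n" and ?b = "\<lambda>n. fourier_coeff g (int n) * z ^ n"
  have norm_sum: "summable (\<lambda>n. norm (fourier_coeff h (int n) * z ^ n))" if "h \<in> L2" for h
  proof (rule summable_comparison_test')
    show "summable (\<lambda>n. sqrt (nsq h) * cmod z ^ n)"
      using z by (intro summable_mult summable_geometric) auto
    show "norm (norm (fourier_coeff h (int n) * z ^ n)) \<le> sqrt (nsq h) * cmod z ^ n" for n
      using fourier_coeff_bound[OF that, of "int n"] by (simp add: norm_mult norm_power mult_right_mono)
  qed
  have "fourier_coeff (\<lambda>t. g t * f t) (int n) * z ^ n = (\<Sum>k\<le>n. ?a k * ?b (n - k))" for n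
  proof -
    have "(\<Sum>k\<in>{0..int n}. fourier_coeff f k * fourier_coeff g (int n - k))
        = (\<Sum>k\<le>n. fourier_coeff f (int k) * fourier_coeff g (int (n - k)))"
      by (rule sum.reindex_bij_witness[of _ int nat]) auto
    then show ?thesis
      unfolding coeff by (auto simp: sum_distrib_right intro!: sum.cong simp flip: power_add)
  qed
  then have "disc_ext (\<lambda>t. g t * f t) z = (\<Sum>n. \<Sum>k\<le>n. ?a k * ?b (n - k))"
    unfolding disc_ext_def by simp
  also have "\<dots> = (\<Sum>n. ?a n) * (\<Sum>n. ?b n)"
    using Cauchy_product[of ?a ?b] norm_sum[OF H2_L2[OF f]] norm_sum[OF H2_L2[OF g]] by simp
  finally show "disc_ext (\<lambda>t. g t * f t) z = disc_ext g z * disc_ext f z"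
    unfolding disc_ext_def by (simp add: mult.commute)
qed

section \<open>Blaschke products\<close>

lemma L2_dominated_tendsto:
  assumes [measurable]: "\<And>n. s n \<in> borel_measurable circle" "f \<in> borel_measurable circle"
    and g: "g \<in> L2" and bound: "\<And>n. AE t in circle. cmod (s n t) \<le> cmod (g t)"
    and lim: "AE t in circle. (\<lambda>n. s n t) \<longlonglongrightarrow> f t"
  shows "f \<in> L2" "s n \<in> L2" "(\<lambda>n. L2_dist (s n) f) \<longlonglongrightarrow> 0"
proof -
  have all: "AE t in circle. \<forall>n. cmod (s n t) \<le> cmod (g t)"
    using bound by (simp add: AE_all_countable)
  have fg: "AE t in circle. cmod (f t) \<le> cmod (g t)"
    using all lim
  proof eventually_elim
    fix t assume *: "\<forall>n. cmod (s n t) \<le> cmod (g t)" "(\<lambda>n. s n t) \<longlonglongrightarrow> f t"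
    show "cmod (f t) \<le> cmod (g t)"
      by (rule LIMSEQ_le_const2[OF tendsto_norm[OF *(2)]], rule exI[of _ 0]) (simp add: *(1))
  qed
  show f: "f \<in> L2" by (rule L2_dominated[OF _ g fg]) measurable
  show "s n \<in> L2" for n by (rule L2_dominated[OF _ g bound]) measurable
  have "(\<lambda>n. LINT t|circle. (cmod (s n t - f t))\<^sup>2) \<longlonglongrightarrow> (LINT t|circle. 0)"
  proof (rule integral_dominated_convergence[where w = "\<lambda>t. 4 * (cmod (g t))\<^sup>2"])
    show "integrable circle (\<lambda>t. 4 * (cmod (g t))\<^sup>2)"
      using L2_square_integrable[OF g] by simp
    show "AE t in circle. (\<lambda>n. (cmod (s n t - f t))\<^sup>2) \<longlonglongrightarrow> 0"
      using lim
    proof eventually_elim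
      fix t assume "(\<lambda>n. s n t) \<longlonglongrightarrow> f t"
      then have "(\<lambda>n. (cmod (s n t - f t))\<^sup>2) \<longlonglongrightarrow> (cmod (f t - f t))\<^sup>2"
        by (intro tendsto_intros)
      then show "(\<lambda>n. (cmod (s n t - f t))\<^sup>2) \<longlonglongrightarrow> 0" by simp
    qed
    show "AE t in circle. norm ((cmod (s n t - f t))\<^sup>2) \<le> 4 * (cmod (g t))\<^sup>2" for n
      using bound[of n] fg
    proof eventually_elim
      fix t assume "cmod (s n t) \<le> cmod (g t)" "cmod (f t) \<le> cmod (g t)"
      then have "cmod (s n t - f t) \<le> 2 * cmod (g t)"
        using norm_triangle_ineq4[of "s n t" "f t"] by linarith
      then have "(cmod (s n t - f t))\<^sup>2 \<le> (2 * cmod (g t))\<^sup>2"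
        by (intro power_mono) auto
      then show "norm ((cmod (s n t - f t))\<^sup>2) \<le> 4 * (cmod (g t))\<^sup>2"
        by (simp add: power_mult_distrib)
    qed
  qed measurable
  then show "(\<lambda>n. L2_dist (s n) f) \<longlonglongrightarrow> 0"
    by (simp add: L2_dist_eq)
qed

lemma borel_measurable_cong_AE:
  fixes f g :: "complex \<Rightarrow> 'b::topological_space"
  assumes f: "f \<in> borel_measurable circle" and eq: "AE t in circle. g t = f t"
  shows "g \<in> borel_measurable circle"
proof (rule measurableI)
  fix A :: "'b set" assume A: "A \<in> sets borel"
  show "g -` A \<inter> space circle \<in> sets circle"
  proof (rule circle.in_sets_AE[OF _ measurable_sets[OF f A]])
    show "AE t in circle. (t \<in> f -` A \<inter> space circle) = (t \<in> g -` A \<inter> space circle)"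
      using eq by eventually_elim simp
  qed simp
qed simp

lemma nsq_unimodular:
  assumes [measurable]: "f \<in> borel_measurable circle" and "AE t in circle. cmod (f t) = 1"
  shows "nsq f = 1"
proof -
  have "nsq f = (LINT t|circle. 1)"
    unfolding nsq_eq by (rule integral_cong_AE) (use assms(2) in auto)
  then show ?thesis by simp
qed

lemma cmod_circle_diff:
  assumes "cmod t = 1"
  shows "1 - cmod w \<le> cmod (t - w)" "1 - cmod w \<le> cmod (1 - cnj w * t)"
  using assms norm_triangle_ineq2[of t w] norm_triangle_ineq2[of 1 "cnj w * t"] by (auto simp: norm_mult)

lemma affine_H2:
  shows "(\<lambda>t. a + b * t) \<in> H2" "AE t in circle. cmod (a + b * t) \<le> cmod a + cmod b"
    "cmod z < 1 \<Longrightarrow> disc_ext (\<lambda>t. a + b * t) z = a + b * z"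
proof -
  have id: "(\<lambda>t. t) \<in> H2" using powi_H2[of 1] by simp
  show "(\<lambda>t. a + b * t) \<in> H2" by (rule H2_lin[OF const_H2 id])
  show "AE t in circle. cmod (a + b * t) \<le> cmod a + cmod b"
    using AE_circle_norm
  proof eventually_elim
    fix t :: complex assume "cmod t = 1"
    then show "cmod (a + b * t) \<le> cmod a + cmod b"
      using norm_triangle_ineq[of a "b * t"] by (simp add: norm_mult)
  qed
  show "disc_ext (\<lambda>t. a + b * t) z = a + b * z" if "cmod z < 1"
    using disc_ext_lin[OF L2_const H2_L2[OF id] that, of a b] disc_ext_const[OF that] disc_ext_powi[of 1, OF _ that]
    by simp
qed

lemma AE_circle_neq:
  assumes "cmod w < 1"
  shows "AE t in circle. t \<noteq> w"
  using AE_circle_norm by eventually_elim (use assms in auto)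

text \<open>With q = h / (t - w), comparing coefficients gives q(n-1) = h(n) + w q(n). Unrolled N
  times at n = 0, this expresses the coefficient of index -1 as a partial sum of h(w) = 0 plus a
  remainder of order |w|^N, so it vanishes; the recursion then carries 0 down to all negative
  indices.\<close>

lemma H2_divide:
  assumes h: "h \<in> H2" and w: "cmod w < 1" and 0: "disc_ext h w = 0"
  shows "(\<lambda>t. h t / (t - w)) \<in> H2"
    and "cmod z < 1 \<Longrightarrow> (z - w) * disc_ext (\<lambda>t. h t / (t - w)) z = disc_ext h z"
proof -
  define q where "q t = h t / (t - w)" for t
  note [measurable] = L2_measurable[OF H2_L2[OF h]]
  have q: "q \<in> L2"
  proof (rule L2_cong_AE)
    show "(\<lambda>t. (1 / (t - w)) * h t) \<in> L2"
    proof (rule L2_mult_bounded[OF H2_L2[OF h]])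
      show "AE t in circle. cmod (1 / (t - w)) \<le> 1 / (1 - cmod w)"
        using AE_circle_norm
        by eventually_elim (use w cmod_circle_diff(1)[of _ w] in \<open>auto simp: norm_divide intro!: divide_left_mono mult_pos_pos order.strict_trans2[OF _ cmod_circle_diff(1)]\<close>)
    qed measurable
  qed (auto simp: q_def[abs_def])
  note [measurable] = L2_measurable[OF q]
  have hq: "AE t in circle. h t = (- w + 1 * t) * q t"
    using AE_circle_neq[OF w] by eventually_elim (simp add: q_def)
  have rec: "fourier_coeff q (n - 1) = fourier_coeff h n + w * fourier_coeff q n" for n
  proof -
    have "fourier_coeff h n = fourier_coeff (\<lambda>t. t powi 1 * q t + (- w) * q t) n"
      by (rule fourier_coeff_cong_AE) (use hq in \<open>auto elim!: eventually_mono simp: algebra_simps\<close>)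
    also have "\<dots> = fourier_coeff q (n - 1) + (- w) * fourier_coeff q n"
      by (subst fourier_coeff_lin) (auto intro: L2_powi_mult q simp: fourier_coeff_shift simp del: power_int_1_right)
    finally show ?thesis by simp
  qed
  have "fourier_coeff q (-1) = (\<Sum>k<N. fourier_coeff h (int k) * w ^ k) + w ^ N * fourier_coeff q (int N - 1)" for N
  proof (induction N)
    case (Suc N)
    then show ?case using rec[of "int N"] by (simp add: algebra_simps)
  qed simp
  moreover have "(\<lambda>N. (\<Sum>k<N. fourier_coeff h (int k) * w ^ k) + w ^ N * fourier_coeff q (int N - 1)) \<longlonglongrightarrow> 0 + 0"
  proof (rule tendsto_add)
    show "(\<lambda>N. \<Sum>k<N. fourier_coeff h (int k) * w ^ k) \<longlonglongrightarrow> 0"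
      using summable_LIMSEQ[OF disc_ext_summable(1)[OF H2_L2[OF h] w]] 0 by (simp add: disc_ext_def)
    show "(\<lambda>N. w ^ N * fourier_coeff q (int N - 1)) \<longlonglongrightarrow> 0"
    proof (rule Lim_null_comparison)
      show "\<forall>\<^sub>F N in sequentially. norm (w ^ N * fourier_coeff q (int N - 1)) \<le> cmod w ^ N * sqrt (nsq q)"
        using fourier_coeff_bound[OF q] by (intro always_eventually) (auto simp: norm_mult norm_power intro!: mult_left_mono)
      show "(\<lambda>N. cmod w ^ N * sqrt (nsq q)) \<longlonglongrightarrow> 0"
        using w by (intro tendsto_mult_left_zero LIMSEQ_power_zero) auto
    qed
  qed
  ultimately have base: "fourier_coeff q (-1) = 0"
    using LIMSEQ_unique[OF tendsto_const, of "fourier_coeff q (-1)"] by simp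
  have neg: "fourier_coeff q (- 1 - int m) = 0" for m
  proof (induction m)
    case (Suc m)
    then show ?case using rec[of "- 1 - int m"] H2_coeff[OF h, of "- 1 - int m"] by simp
  qed (simp add: base)
  have qH: "q \<in> H2"
  proof (rule H2_I[OF q])
    fix n :: int assume "n < 0"
    then have "n = - 1 - int (nat (- 1 - n))" by simp
    then show "fourier_coeff q n = 0" using neg by metis
  qed
  then show "(\<lambda>t. h t / (t - w)) \<in> H2" by (simp add: q_def[abs_def])
  assume z: "cmod z < 1"
  have "disc_ext h z = disc_ext (\<lambda>t. (- w + 1 * t) * q t) z"
    by (rule disc_ext_cong_AE[OF hq]) measurable
  also have "\<dots> = (z - w) * disc_ext q z"
    using H2_mult(2)[OF qH affine_H2(1,2) z, of "-w" 1] affine_H2(3)[OF z, of "-w" 1] by simp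
  finally show "(z - w) * disc_ext (\<lambda>t. h t / (t - w)) z = disc_ext h z"
    by (simp add: q_def[abs_def])
qed

section \<open>Blaschke factors, finite and infinite products\<close>

definition bfac :: "complex \<Rightarrow> complex \<Rightarrow> complex" where
  "bfac w z = (w - z) / (1 - cnj w * z) * (complex_of_real (cmod w) / w)"

definition bprod :: "complex set \<Rightarrow> complex \<Rightarrow> complex" where
  "bprod F z = (\<Prod>w\<in>F. bfac w z)"

lemma blaschke_eq: "blaschke Z z = Lim (finite_subsets_at_top Z) (\<lambda>F. bprod F z)"
  by (simp add: blaschke_def bprod_def bfac_def)

lemma cmod_bfac:
  assumes "cmod w < 1" "w \<noteq> 0" "cmod t = 1"
  shows "cmod (bfac w t) = 1"
proof -
  have "1 - cnj w * t = t * cnj (t - w)"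
    using assms(3) mult_cnj_cmod[of t] by (simp add: algebra_simps)
  then have "cmod (1 - cnj w * t) = cmod (w - t)"
    using assms(3) by (metis complex_mod_cnj mult_1 norm_minus_commute norm_mult)
  moreover have "cmod (w - t) \<noteq> 0" using assms by auto
  ultimately show ?thesis using assms(2) by (simp add: bfac_def norm_mult norm_divide)
qed

text \<open>The Szego kernel at w. Its coefficients of negative index satisfy e(n) = cnj w e(n-1),
  hence e(n) = (cnj w)^N e(n-N) for all N, and boundedness of the coefficients forces e(n) =
  0.\<close>

lemma inverse_affine_H2:
  assumes w: "cmod w < 1"
  shows "(\<lambda>t. 1 / (1 - cnj w * t)) \<in> H2"
    and "cmod z < 1 \<Longrightarrow> disc_ext (\<lambda>t. 1 / (1 - cnj w * t)) z = 1 / (1 - cnj w * z)"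
proof -
  define e where "e t = 1 / (1 - cnj w * t)" for t
  have eL2: "e \<in> L2"
  proof (rule L2_bounded)
    show "AE t in circle. cmod (e t) \<le> 1 / (1 - cmod w)"
      unfolding e_def using AE_circle_norm
      by eventually_elim (use w cmod_circle_diff(2)[of _ w] in \<open>auto simp: norm_divide intro!: divide_left_mono mult_pos_pos order.strict_trans2[OF _ cmod_circle_diff(2)]\<close>)
  qed (simp add: e_def[abs_def])
  note [measurable] = L2_measurable[OF eL2]
  have ne: "1 - cnj w * t \<noteq> 0" if "cmod t \<le> 1" for t
  proof
    assume "1 - cnj w * t = 0"
    then have "1 = cmod w * cmod t"
      by (metis complex_mod_cnj eq_iff_diff_eq_0 norm_mult norm_one)
    moreover have "cmod w * cmod t \<le> cmod w * 1" using that by (intro mult_left_mono) auto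
    ultimately show False using w by simp
  qed
  have e1: "AE t in circle. (1 + (- cnj w) * t) * e t = 1"
    using AE_circle_norm by eventually_elim (use ne in \<open>auto simp: e_def\<close>)
  have rec: "fourier_coeff e n = cnj w * fourier_coeff e (n - 1)" if "n < 0" for n
  proof -
    have "fourier_coeff (\<lambda>t. t powi 0) n = fourier_coeff (\<lambda>t. e t + (- cnj w) * (t powi 1 * e t)) n"
      by (rule fourier_coeff_cong_AE) (use e1 in \<open>auto elim!: eventually_mono simp: algebra_simps\<close>)
    also have "\<dots> = fourier_coeff e n + (- cnj w) * fourier_coeff e (n - 1)"
      by (subst fourier_coeff_lin) (auto intro: L2_powi_mult eL2 simp: fourier_coeff_shift simp del: power_int_1_right)
    finally show ?thesis using that by (simp add: fourier_coeff_powi del: power_int_0_right)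
  qed
  have eH: "e \<in> H2"
  proof (rule H2_I[OF eL2])
    fix n :: int assume n: "n < 0"
    have it: "fourier_coeff e n = cnj w ^ N * fourier_coeff e (n - int N)" for N
    proof (induction N)
      case (Suc N)
      then show ?case using rec[of "n - int N"] n by (simp add: algebra_simps)
    qed simp
    have "(\<lambda>N. cnj w ^ N * fourier_coeff e (n - int N)) \<longlonglongrightarrow> 0"
    proof (rule Lim_null_comparison)
      show "\<forall>\<^sub>F N in sequentially. norm (cnj w ^ N * fourier_coeff e (n - int N)) \<le> cmod w ^ N * sqrt (nsq e)"
        using fourier_coeff_bound[OF eL2] by (intro always_eventually) (auto simp: norm_mult norm_power intro!: mult_left_mono)
      show "(\<lambda>N. cmod w ^ N * sqrt (nsq e)) \<longlonglongrightarrow> 0"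
        using w by (intro tendsto_mult_left_zero LIMSEQ_power_zero) auto
    qed
    then show "fourier_coeff e n = 0"
      unfolding it[symmetric] using LIMSEQ_unique tendsto_const by blast
  qed
  then show "(\<lambda>t. 1 / (1 - cnj w * t)) \<in> H2" by (simp add: e_def[abs_def])
  assume z: "cmod z < 1"
  have "1 = disc_ext (\<lambda>t. (1 + (- cnj w) * t) * e t) z"
    using disc_ext_cong_AE[OF e1, of z] disc_ext_const[OF z, of 1] by simp
  also have "\<dots> = (1 + (- cnj w) * z) * disc_ext e z"
    using H2_mult(2)[OF eH affine_H2(1,2) z, of 1 "- cnj w"] affine_H2(3)[OF z, of 1 "- cnj w"] by simp
  finally have "1 = (1 - cnj w * z) * disc_ext e z" by simp
  then show "disc_ext (\<lambda>t. 1 / (1 - cnj w * t)) z = 1 / (1 - cnj w * z)"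
    using ne[of z] z by (simp add: e_def[abs_def] field_simps)
qed

lemma bfac_H2:
  assumes w: "cmod w < 1" "w \<noteq> 0"
  shows "bfac w \<in> H2" "AE t in circle. cmod (bfac w t) = 1" "cmod z < 1 \<Longrightarrow> disc_ext (bfac w) z = bfac w z"
proof -
  define c where "c = complex_of_real (cmod w) / w"
  have eq: "bfac w = (\<lambda>t. (c * w + (- c) * t) * (1 / (1 - cnj w * t)))"
    by (auto simp: bfac_def c_def field_simps)
  show "bfac w \<in> H2"
    unfolding eq by (rule H2_mult(1)[OF inverse_affine_H2(1)[OF w(1)] affine_H2(1,2)])
  show "AE t in circle. cmod (bfac w t) = 1"
    using AE_circle_norm by eventually_elim (rule cmod_bfac[OF w])
  show "disc_ext (bfac w) z = bfac w z" if z: "cmod z < 1"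
    unfolding eq using H2_mult(2)[OF inverse_affine_H2(1)[OF w(1)] affine_H2(1,2) z, of "c * w" "- c"]
      affine_H2(3)[OF z, of "c * w" "- c"] inverse_affine_H2(2)[OF w(1) z] by simp
qed

lemma bprod_H2:
  assumes "finite F" "F \<subseteq> ball 0 1 - {0}"
  shows "bprod F \<in> H2 \<and> (AE t in circle. cmod (bprod F t) = 1) \<and> (\<forall>z. cmod z < 1 \<longrightarrow> disc_ext (bprod F) z = bprod F z)"
  using assms
proof (induction F)
  case empty
  then show ?case by (auto simp: bprod_def[abs_def] const_H2 disc_ext_const)
next
  case (insert w F)
  then have w: "cmod w < 1" "w \<noteq> 0" by auto
  have eq: "bprod (insert w F) = (\<lambda>t. bfac w t * bprod F t)"
    using insert by (auto simp: bprod_def)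
  have b: "AE t in circle. cmod (bfac w t) \<le> 1"
    using bfac_H2(2)[OF w] by eventually_elim simp
  have IH: "bprod F \<in> H2" "AE t in circle. cmod (bprod F t) = 1" "\<forall>z. cmod z < 1 \<longrightarrow> disc_ext (bprod F) z = bprod F z"
    using insert by auto
  show ?case
    unfolding eq
  proof (intro conjI allI impI)
    show "(\<lambda>t. bfac w t * bprod F t) \<in> H2"
      by (rule H2_mult(1)[OF IH(1) bfac_H2(1)[OF w] b])
    show "AE t in circle. cmod (bfac w t * bprod F t) = 1"
      using bfac_H2(2)[OF w] IH(2) by eventually_elim (simp add: norm_mult)
    show "disc_ext (\<lambda>t. bfac w t * bprod F t) z = bfac w z * bprod F z" if "cmod z < 1" for z
      using H2_mult(2)[OF IH(1) bfac_H2(1)[OF w] b that] bfac_H2(3)[OF w that] IH(3) that by simp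
  qed
qed

lemma bprod_0: "0 \<notin> F \<Longrightarrow> bprod F 0 = of_real (\<Prod>w\<in>F. cmod w)"
  unfolding bprod_def of_real_prod by (rule prod.cong) (auto simp: bfac_def)

text \<open>On the circle a unimodular factor is divided out by multiplying with its conjugate. The
  zeros are removed one at a time by \<open>H2_divide\<close>, and what is left of the factor is an
  affine polynomial.\<close>

lemma H2_divide_bprod:
  assumes "finite F" "F \<subseteq> ball 0 1 - {0}" "h \<in> H2" "\<And>w. w \<in> F \<Longrightarrow> disc_ext h w = 0"
  shows "(\<lambda>t. h t * cnj (bprod F t)) \<in> H2"
  using assms
proof (induction F)
  case empty
  then show ?case by (simp add: bprod_def)
next
  case (insert w F)
  then have w: "cmod w < 1" "w \<noteq> 0" by auto
  define h1 where "h1 t = h t * cnj (bprod F t)" for t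
  have h1: "h1 \<in> H2" using insert unfolding h1_def by auto
  have F: "bprod F \<in> H2" "AE t in circle. cmod (bprod F t) = 1" "\<And>z. cmod z < 1 \<Longrightarrow> disc_ext (bprod F) z = bprod F z"
    using bprod_H2[of F] insert by auto
  note [measurable] = L2_measurable[OF H2_L2[OF h1]] L2_measurable[OF H2_L2[OF F(1)]] L2_measurable[OF H2_L2[OF insert.prems(2)]]
  have b: "AE t in circle. cmod (bprod F t) \<le> 1" using F(2) by eventually_elim simp
  have "AE t in circle. h t = bprod F t * h1 t"
    using F(2)
  proof eventually_elim
    fix t assume "cmod (bprod F t) = 1"
    then have "bprod F t * cnj (bprod F t) = 1" by (simp add: mult_cnj_cmod)
    then show "h t = bprod F t * h1 t" by (simp add: h1_def mult_ac)
  qed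
  then have "disc_ext h w = disc_ext (\<lambda>t. bprod F t * h1 t) w"
    by (rule disc_ext_cong_AE) measurable
  also have "\<dots> = bprod F w * disc_ext h1 w"
    using H2_mult(2)[OF h1 F(1) b w(1)] F(3)[OF w(1)] by simp
  finally have "bprod F w * disc_ext h1 w = 0" using insert by simp
  \<comment> \<open>The points are distinct, so the factors already removed do not vanish at w, and
    the quotient inherits the zero of h there.\<close>
  moreover have "bprod F w \<noteq> 0"
    unfolding bprod_def using insert w
  proof (subst prod_zero_iff, simp, safe)
    fix v assume v: "v \<in> F" "bfac v w = 0"
    then have "v \<noteq> 0" "cmod v < 1" "v \<noteq> w" using insert by auto
    then have "1 - cnj v * w = 0" using v by (simp add: bfac_def)
    then have "1 = cmod v * cmod w"
      by (metis complex_mod_cnj eq_iff_diff_eq_0 norm_mult norm_one)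
    moreover have "cmod v * cmod w \<le> cmod v * 1" using w by (intro mult_left_mono) auto
    ultimately show False using \<open>cmod v < 1\<close> by simp
  qed
  ultimately have 0: "disc_ext h1 w = 0" by simp
  \<comment> \<open>The inverse of the unimodular constant in \<open>bfac w\<close>; on the circle 1
    / \<open>bfac w\<close> is c (cnj w t - 1) / (t - w).\<close>
  define c where "c = w / of_real (cmod w)"
  have "(\<lambda>t. (- c + (c * cnj w) * t) * (h1 t / (t - w))) \<in> H2"
    by (rule H2_mult(1)[OF H2_divide(1)[OF h1 w(1) 0] affine_H2(1,2)])
  then show ?case
  proof (rule H2_cong_AE)
    show "AE t in circle. h t * cnj (bprod (insert w F) t) = (- c + (c * cnj w) * t) * (h1 t / (t - w))"
      using AE_circle_norm
    proof eventually_elim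
      fix t :: complex assume t: "cmod t = 1"
      have ne: "t - w \<noteq> 0" "1 - cnj w * t \<noteq> 0"
        using cmod_circle_diff[OF t, of w] w by auto
      have "bfac w t * cnj (bfac w t) = 1"
        using cmod_bfac[OF w t] by (simp add: mult_cnj_cmod)
      moreover have "bfac w t * ((- c + (c * cnj w) * t) / (t - w)) = 1"
        using ne w by (simp add: bfac_def c_def divide_simps) (simp add: algebra_simps)
      moreover have "bfac w t \<noteq> 0" using calculation by auto
      ultimately have "cnj (bfac w t) = (- c + (c * cnj w) * t) / (t - w)"
        by (metis mult_cancel_left)
      then show "h t * cnj (bprod (insert w F) t) = (- c + (c * cnj w) * t) * (h1 t / (t - w))"
        using insert by (simp add: bprod_def h1_def mult_ac)
    qed
    show "(\<lambda>t. h t * cnj (bprod (insert w F) t)) \<in> borel_measurable circle"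
    proof -
      have "bprod (insert w F) \<in> H2" using bprod_H2[of "insert w F"] insert by auto
      note [measurable] = L2_measurable[OF H2_L2[OF this]]
      show ?thesis by measurable
    qed
  qed
qed

text \<open>Weierstrass's product inequality; it turns the Blaschke condition into lower bounds for
  tail products.\<close>

lemma one_minus_sum_le_prod:
  fixes f :: "'a \<Rightarrow> real"
  assumes "finite D" "\<And>x. x \<in> D \<Longrightarrow> 0 \<le> f x" "\<And>x. x \<in> D \<Longrightarrow> f x \<le> 1"
  shows "1 - (\<Sum>x\<in>D. 1 - f x) \<le> (\<Prod>x\<in>D. f x)"
  using assms
proof (induction D)
  case (insert x D)
  have "(\<Prod>x\<in>D. f x) \<le> 1" "0 \<le> (\<Prod>x\<in>D. f x)"
    using insert by (auto intro!: prod_le_1 prod_nonneg)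
  then have "(1 - f x) * (\<Prod>x\<in>D. f x) \<le> (1 - f x) * 1"
    using insert by (intro mult_left_mono) auto
  then have "(\<Prod>x\<in>D. f x) - (1 - f x) \<le> f x * (\<Prod>x\<in>D. f x)"
    by (simp add: algebra_simps)
  moreover have "1 - (\<Sum>x\<in>D. 1 - f x) \<le> (\<Prod>x\<in>D. f x)"
    using insert by auto
  ultimately show ?case using insert(1,2) by simp
qed simp

lemma summable_on_tail:
  fixes f :: "'a \<Rightarrow> real"
  assumes "f summable_on Z" "e > 0"
  obtains F where "finite F" "F \<subseteq> Z" "\<And>G. finite G \<Longrightarrow> F \<subseteq> G \<Longrightarrow> G \<subseteq> Z \<Longrightarrow> \<bar>sum f (G - F)\<bar> < e"
proof -
  obtain S where "(f has_sum S) Z" using assms(1) by (auto simp: summable_on_def)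
  then have "\<forall>\<^sub>F F in finite_subsets_at_top Z. dist (sum f F) S < e / 2"
    unfolding has_sum_def using assms(2) by (intro tendstoD) auto
  then obtain F where F: "finite F" "F \<subseteq> Z" "\<forall>G. finite G \<and> F \<subseteq> G \<and> G \<subseteq> Z \<longrightarrow> dist (sum f G) S < e / 2"
    unfolding eventually_finite_subsets_at_top by (elim exE conjE)
  show ?thesis
  proof (rule that[OF F(1,2)])
    fix G assume G: "finite G" "F \<subseteq> G" "G \<subseteq> Z"
    have "sum f (G - F) = sum f G - sum f F" using G by (simp add: sum_diff)
    moreover have "dist (sum f G) S < e / 2" "dist (sum f F) S < e / 2" using F G by auto
    ultimately show "\<bar>sum f (G - F)\<bar> < e"
      unfolding dist_real_def by (simp add: abs_diff_less_iff) argo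
  qed
qed

text \<open>Finite products are unimodular on the circle, so for F contained in G the squared
  distance of their products is 2 (1 - Re q(0)), where q is the product over G - F. The unimodular
  constant in each factor makes q(0) the product of the moduli, which is close to 1 for tails. Hence
  the net of finite products converges in \<open>L2\<close> and pointwise in the disc, and division
  by b is the limit of division by finite products.\<close>

theorem blaschke_H2:
  assumes Z: "Z \<subseteq> ball 0 1 - {0}" and sum: "(\<lambda>z. 1 - cmod z) summable_on Z"
  obtains b where "b \<in> H2" "AE t in circle. cmod (b t) = 1"
    "\<And>z. cmod z < 1 \<Longrightarrow> disc_ext b z = blaschke Z z"
    "0 < Re (blaschke Z 0)" "Im (blaschke Z 0) = 0"
    "\<And>w. w \<in> Z \<Longrightarrow> disc_ext b w = 0"
    "\<And>h. h \<in> H2 \<Longrightarrow> (\<And>w. w \<in> Z \<Longrightarrow> disc_ext h w = 0) \<Longrightarrow> (\<lambda>t. h t * cnj (b t)) \<in> H2"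
proof -
  note BP = bprod_H2[OF _ subset_trans[OF _ Z]]
  have L2: "bprod F \<in> L2" if "finite F" "F \<subseteq> Z" for F
    using BP[OF that] H2_L2 by blast
  have tail: "\<exists>F. finite F \<and> F \<subseteq> Z \<and> (\<forall>G. finite G \<longrightarrow> F \<subseteq> G \<longrightarrow> G \<subseteq> Z \<longrightarrow> 1 - (\<Prod>w\<in>G-F. cmod w) < e)"
    if e: "e > 0" for e
  proof -
    obtain F where F: "finite F" "F \<subseteq> Z" "\<And>G. finite G \<Longrightarrow> F \<subseteq> G \<Longrightarrow> G \<subseteq> Z \<Longrightarrow> \<bar>\<Sum>z\<in>G-F. 1 - cmod z\<bar> < e"
      using summable_on_tail[OF sum e] by blast
    have "1 - (\<Prod>w\<in>G-F. cmod w) < e" if G: "finite G" "F \<subseteq> G" "G \<subseteq> Z" for G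
    proof -
      have "1 - (\<Sum>w\<in>G-F. 1 - cmod w) \<le> (\<Prod>w\<in>G-F. cmod w)"
        using G Z by (intro one_minus_sum_le_prod) auto
      with F(3)[OF G] show ?thesis by linarith
    qed
    with F show ?thesis by blast
  qed
  have dist: "L2_dist (bprod F) (bprod G) \<le> 2 * (1 - (\<Prod>w\<in>G-F. cmod w))"
    if G: "finite G" "F \<subseteq> G" "G \<subseteq> Z" for F G
  proof -
    have fin: "finite F" "F \<subseteq> Z" "finite (G - F)" "G - F \<subseteq> Z" using G finite_subset by auto
    note [measurable] = L2_measurable[OF L2[OF fin(1,2)]] L2_measurable[OF L2[OF fin(3,4)]] L2_measurable[OF L2[OF G(1,3)]]
    have eq: "bprod G t = bprod F t * bprod (G - F) t" for t
      unfolding bprod_def using prod.subset_diff[OF G(2,1)] by (simp add: mult.commute)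
    have "L2_dist (bprod F) (bprod G) = L2_dist (\<lambda>t. 1) (bprod (G - F))"
      unfolding L2_dist_eq
    proof (rule integral_cong_AE)
      have "AE t in circle. cmod (bprod F t) = 1" using BP[OF fin(1,2)] by blast
      then show "AE t in circle. (cmod (bprod F t - bprod G t))\<^sup>2 = (cmod (1 - bprod (G - F) t))\<^sup>2"
      proof eventually_elim
        fix t assume "cmod (bprod F t) = 1"
        moreover have "bprod F t - bprod G t = bprod F t * (1 - bprod (G - F) t)"
          by (simp add: eq algebra_simps)
        ultimately show "(cmod (bprod F t - bprod G t))\<^sup>2 = (cmod (1 - bprod (G - F) t))\<^sup>2"
          by (simp add: norm_mult)
      qed
    qed measurable
    also have "\<dots> = 1 - 2 * Re (L2_inner (\<lambda>t. 1) (bprod (G - F))) + 1"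
      using nsq_unimodular[of "\<lambda>t. 1"] nsq_unimodular[of "bprod (G - F)"] BP[OF fin(3,4)]
      by (simp add: L2.dst_eq[OF L2_const L2[OF fin(3,4)]])
    also have "L2_inner (\<lambda>t. 1) (bprod (G - F)) = cnj (L2_inner (bprod (G - F)) (\<lambda>t. 1))"
      by (rule L2.ip_cnj[OF L2[OF fin(3,4)] L2_const])
    also have "L2_inner (bprod (G - F)) (\<lambda>t. 1) = disc_ext (bprod (G - F)) 0"
      by (simp add: disc_ext_0 fourier_coeff_def)
    also have "\<dots> = of_real (\<Prod>w\<in>G-F. cmod w)"
      using BP[OF fin(3,4)] bprod_0[of "G - F"] fin(4) Z by auto
    finally show ?thesis by (simp del: of_real_prod)
  qed
  \<comment> \<open>\<open>dist\<close> contributes a factor 2, and the square root then leaves a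
    distance of at most 1 / (n + 1).\<close>
  have "\<forall>n. \<exists>F. finite F \<and> F \<subseteq> Z \<and> (\<forall>G. finite G \<longrightarrow> F \<subseteq> G \<longrightarrow> G \<subseteq> Z \<longrightarrow> 1 - (\<Prod>w\<in>G-F. cmod w) < 1 / (2 * real (Suc n) ^ 2))"
    by (intro allI tail) simp
  from choice[OF this] obtain F where F': "\<forall>n. finite (F n) \<and> F n \<subseteq> Z \<and> (\<forall>G. finite G \<longrightarrow> F n \<subseteq> G \<longrightarrow> G \<subseteq> Z \<longrightarrow> 1 - (\<Prod>w\<in>G-F n. cmod w) < 1 / (2 * real (Suc n) ^ 2))"
    by (rule exE)
  have F: "\<And>n. finite (F n)" "\<And>n. F n \<subseteq> Z"
    "\<And>n G. finite G \<Longrightarrow> F n \<subseteq> G \<Longrightarrow> G \<subseteq> Z \<Longrightarrow> 1 - (\<Prod>w\<in>G-F n. cmod w) < 1 / (2 * real (Suc n) ^ 2)"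
    using F' by blast+
  have dF: "sqrt (L2_dist (bprod (F n)) (bprod G)) \<le> 1 / Suc n" if "finite G" "F n \<subseteq> G" "G \<subseteq> Z" for n G
  proof (rule real_le_lsqrt)
    have "2 * (1 - (\<Prod>w\<in>G-F n. cmod w)) \<le> 2 * (1 / (2 * real (Suc n) ^ 2))"
      using F(3)[OF that] by simp
    with dist[OF that] show "L2_dist (bprod (F n)) (bprod G) \<le> (1 / Suc n)\<^sup>2"
      by (simp add: power_divide)
  qed simp
  \<comment> \<open>\<open>F m\<close> and \<open>F n\<close> need not be nested; both are compared
    with their union.\<close>
  have dFF: "sqrt (L2_dist (bprod (F m)) (bprod (F n))) \<le> 1 / Suc m + 1 / Suc n" for m n
  proof -
    have U: "finite (F m \<union> F n)" "F m \<union> F n \<subseteq> Z" using F by auto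
    have "sqrt (L2_dist (bprod (F m)) (bprod (F n))) \<le> sqrt (L2_dist (bprod (F m)) (bprod (F m \<union> F n)))
        + sqrt (L2_dist (bprod (F m \<union> F n)) (bprod (F n)))"
      by (intro L2.dst_triangle L2 F U)
    also have "L2_dist (bprod (F m \<union> F n)) (bprod (F n)) = L2_dist (bprod (F n)) (bprod (F m \<union> F n))"
      by (intro L2.dst_sym L2 F U)
    finally show ?thesis
      using dF[of "F m \<union> F n" m] dF[of "F m \<union> F n" n] U by auto
  qed
  have small: "\<exists>N. \<forall>n\<ge>N. 1 / real (Suc n) < e" if e: "e > 0" for e :: real
  proof -
    obtain N where N: "1 / real (Suc N) < e" using nat_approx_posE[OF e] by blast
    have "1 / real (Suc n) \<le> 1 / real (Suc N)" if "n \<ge> N" for n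
      using that by (intro divide_left_mono) auto
    with N show ?thesis using le_less_trans by blast
  qed
  have "\<exists>N. \<forall>m\<ge>N. \<forall>n\<ge>N. L2_dist (bprod (F m)) (bprod (F n)) < e" if e: "e > 0" for e
  proof -
    obtain N where N: "\<And>n. n \<ge> N \<Longrightarrow> 1 / real (Suc n) < sqrt e / 2"
      using small[of "sqrt e / 2"] e by auto
    have "L2_dist (bprod (F m)) (bprod (F n)) < e" if "m \<ge> N" "n \<ge> N" for m n
    proof -
      have "sqrt (L2_dist (bprod (F m)) (bprod (F n))) < sqrt e"
        using dFF[of m n] N[OF that(1)] N[OF that(2)] by linarith
      then show ?thesis by simp
    qed
    then show ?thesis by blast
  qed
  note Cau = this
  obtain b where b: "b \<in> L2" "(\<lambda>n. L2_dist (bprod (F n)) b) \<longlonglongrightarrow> 0"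
    by (rule L2_complete[of "\<lambda>n. bprod (F n)", OF L2[OF F(1,2)] Cau])
  note [measurable] = L2_measurable[OF b(1)] L2_measurable[OF L2[OF F(1,2)]]
  have bH: "b \<in> H2"
    by (rule H2_closed[OF conjunct1[OF BP[OF F(1,2)]] b])
  obtain r where r: "strict_mono r" "AE t in circle. (\<lambda>n. bprod (F (r n)) t) \<longlonglongrightarrow> b t"
    by (rule L2_AE_subseq[of "\<lambda>n. bprod (F n)", OF L2[OF F(1,2)] b])
  have uni: "AE t in circle. \<forall>n. cmod (bprod (F n) t) = 1"
    unfolding AE_all_countable using BP[OF F(1,2)] by blast
  have b1: "AE t in circle. cmod (b t) = 1"
    using r(2) uni
  proof eventually_elim
    fix t assume "(\<lambda>n. bprod (F (r n)) t) \<longlonglongrightarrow> b t" "\<forall>n. cmod (bprod (F n) t) = 1"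
    then have "(\<lambda>n. 1) \<longlonglongrightarrow> cmod (b t)" using tendsto_norm by force
    then show "cmod (b t) = 1" using LIMSEQ_unique tendsto_const by blast
  qed
  have lim: "((\<lambda>G. bprod G z) \<longlongrightarrow> disc_ext b z) (finite_subsets_at_top Z)" if z: "cmod z < 1" for z
  proof (rule tendstoI)
    fix e :: real assume "e > 0"
    define d where "d = e * (1 - cmod z) / 2"
    have d: "d > 0" using \<open>e > 0\<close> z by (simp add: d_def)
    obtain N1 where N1: "\<And>n. n \<ge> N1 \<Longrightarrow> 1 / real (Suc n) < d" using small[OF d] by auto
    have "(\<lambda>n. sqrt (L2_dist (bprod (F n)) b)) \<longlonglongrightarrow> 0"
      using tendsto_real_sqrt[OF b(2)] by simp
    then have "\<forall>\<^sub>F n in sequentially. sqrt (L2_dist (bprod (F n)) b) < d"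
      using d by (intro order_tendstoD)
    then obtain N2 where N2: "\<And>n. n \<ge> N2 \<Longrightarrow> sqrt (L2_dist (bprod (F n)) b) < d"
      by (auto simp: eventually_sequentially)
    define n where "n = max N1 N2"
    have "dist (bprod G z) (disc_ext b z) < e" if G: "finite G" "F n \<subseteq> G" "G \<subseteq> Z" for G
    proof -
      have "sqrt (L2_dist (bprod G) b) \<le> sqrt (L2_dist (bprod G) (bprod (F n))) + sqrt (L2_dist (bprod (F n)) b)"
        by (intro L2.dst_triangle L2 F G b)
      also have "L2_dist (bprod G) (bprod (F n)) = L2_dist (bprod (F n)) (bprod G)"
        by (intro L2.dst_sym L2 F G)
      finally have le: "sqrt (L2_dist (bprod G) b) < e * (1 - cmod z)"
        using dF[OF G] N1[of n] N2[of n] unfolding n_def d_def by simp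
      have "bprod G z - disc_ext b z = disc_ext (\<lambda>t. bprod G t + (-1) * b t) z"
        using disc_ext_lin[OF L2[OF G(1,3)] b(1) z, of "-1"] BP[OF G(1,3)] z by simp
      then have "cmod (bprod G z - disc_ext b z) \<le> sqrt (L2_dist (bprod G) b) / (1 - cmod z)"
        using disc_ext_summable(2)[OF L2_lin[OF L2[OF G(1,3)] b(1), of "-1"] z] by (simp add: L2.dst_def)
      also have "\<dots> < e" using le z by (simp add: divide_less_eq)
      finally show ?thesis by (simp add: dist_norm)
    qed
    then show "\<forall>\<^sub>F G in finite_subsets_at_top Z. dist (bprod G z) (disc_ext b z) < e"
      unfolding eventually_finite_subsets_at_top using F(1,2)[of n] by blast
  qed
  have ext: "disc_ext b z = blaschke Z z" if "cmod z < 1" for z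
    unfolding blaschke_eq using tendsto_Lim[OF _ lim[OF that]] by simp
  have lim0: "((\<lambda>G. bprod G 0) \<longlongrightarrow> blaschke Z 0) (finite_subsets_at_top Z)"
    using lim[of 0] ext[of 0] by simp
  have evZ: "\<forall>\<^sub>F G in finite_subsets_at_top Z. bprod G 0 = of_real (\<Prod>w\<in>G. cmod w)"
    unfolding eventually_finite_subsets_at_top using Z by (intro exI[of _ "{}"]) (auto intro!: bprod_0 simp del: of_real_prod)
  have Im: "Im (blaschke Z 0) = 0"
  proof (rule tendsto_unique[OF _ tendsto_Im[OF lim0]])
    show "((\<lambda>G. Im (bprod G 0)) \<longlongrightarrow> 0) (finite_subsets_at_top Z)"
      by (rule tendsto_eventually) (use evZ in \<open>eventually_elim, simp_all del: of_real_prod\<close>)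
  qed simp
  \<comment> \<open>Outside \<open>F0\<close> the product of moduli exceeds 1/2, which keeps the
    limit at 0 away from 0.\<close>
  obtain F0 where F0: "finite F0" "F0 \<subseteq> Z" "\<And>G. finite G \<Longrightarrow> F0 \<subseteq> G \<Longrightarrow> G \<subseteq> Z \<Longrightarrow> 1 - (\<Prod>w\<in>G-F0. cmod w) < 1 / 2"
    using tail[of "1/2"] by auto
  have pos: "0 < (\<Prod>w\<in>F0. cmod w)" using F0 Z by (intro prod_pos) auto
  have "(\<Prod>w\<in>F0. cmod w) / 2 \<le> Re (blaschke Z 0)"
  proof (rule tendsto_lowerbound[OF tendsto_Re[OF lim0]])
    have ge: "\<forall>\<^sub>F G in finite_subsets_at_top Z. (\<Prod>w\<in>F0. cmod w) / 2 \<le> (\<Prod>w\<in>G. cmod w)"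
      unfolding eventually_finite_subsets_at_top
    proof (intro exI[of _ F0] conjI allI impI)
      fix G assume G: "finite G \<and> F0 \<subseteq> G \<and> G \<subseteq> Z"
      then have "(\<Prod>w\<in>F0. cmod w) * (1 / 2) \<le> (\<Prod>w\<in>F0. cmod w) * (\<Prod>w\<in>G-F0. cmod w)"
        using F0(3)[of G] pos by (intro mult_left_mono) auto
      also have "\<dots> = (\<Prod>w\<in>G. cmod w)"
        using prod.subset_diff[of F0 G cmod] G by (simp add: mult.commute)
      finally show "(\<Prod>w\<in>F0. cmod w) / 2 \<le> (\<Prod>w\<in>G. cmod w)" by simp
    qed (use F0 in auto)
    show "\<forall>\<^sub>F G in finite_subsets_at_top Z. (\<Prod>w\<in>F0. cmod w) / 2 \<le> Re (bprod G 0)"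
      using ge evZ by eventually_elim (simp del: of_real_prod)
  qed simp
  then have Re: "0 < Re (blaschke Z 0)" using pos by linarith
  have zero: "disc_ext b w = 0" if "w \<in> Z" for w
  proof (rule tendsto_unique[OF _ lim])
    show "((\<lambda>G. bprod G w) \<longlongrightarrow> 0) (finite_subsets_at_top Z)"
    proof (rule tendsto_eventually)
      show "\<forall>\<^sub>F G in finite_subsets_at_top Z. bprod G w = 0"
        unfolding eventually_finite_subsets_at_top bprod_def
        using that by (intro exI[of _ "{w}"]) (auto intro!: prod_zero bexI[of _ w] simp: bfac_def)
    qed
  qed (use that Z in auto)
  have div: "(\<lambda>t. h t * cnj (b t)) \<in> H2" if h: "h \<in> H2" "\<And>w. w \<in> Z \<Longrightarrow> disc_ext h w = 0" for h
  proof -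
    note [measurable] = L2_measurable[OF H2_L2[OF h(1)]]
    let ?s = "\<lambda>n t. h t * cnj (bprod (F (r n)) t)"
    have s: "?s n \<in> H2" for n
      using F(1,2)[of "r n"] Z h by (intro H2_divide_bprod) auto
    have bound: "AE t in circle. cmod (?s n t) \<le> cmod (h t)" for n
      using uni by eventually_elim (simp add: norm_mult)
    have conv: "AE t in circle. (\<lambda>n. ?s n t) \<longlonglongrightarrow> h t * cnj (b t)"
      using r(2) by eventually_elim (intro tendsto_intros)
    have "(\<lambda>t. h t * cnj (b t)) \<in> L2" "(\<lambda>n. L2_dist (?s n) (\<lambda>t. h t * cnj (b t))) \<longlonglongrightarrow> 0"
      by (rule L2_dominated_tendsto(1)[OF _ _ H2_L2[OF h(1)] bound conv], measurable)
         (rule L2_dominated_tendsto(3)[OF _ _ H2_L2[OF h(1)] bound conv], measurable)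
    then show ?thesis by (rule H2_closed[OF s])
  qed
  show ?thesis
    by (rule that[OF bH b1 ext Re Im zero div])
qed

section \<open>Outer functions\<close>

definition herglotz :: "(complex \<Rightarrow> real) \<Rightarrow> complex \<Rightarrow> complex" where
  "herglotz l z = (LINT t|circle. (t + z) / (t - z) * complex_of_real (l t))"

lemma outer_eq: "outer w z = exp (herglotz (\<lambda>t. ln (w t)) z)"
  by (simp add: outer_def herglotz_def)

lemma herglotz_kernel_bound:
  assumes "cmod t = 1" "cmod z < 1"
  shows "cmod ((t + z) / (t - z)) \<le> 2 / (1 - cmod z)"
proof -
  have "cmod (t + z) \<le> 2" using norm_triangle_ineq[of t z] assms by linarith
  moreover have "1 - cmod z \<le> cmod (t - z)" by (rule cmod_circle_diff(1)[OF assms(1)])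
  ultimately show ?thesis
    unfolding norm_divide using assms(2) by (intro frac_le) auto
qed

lemma integrable_herglotz:
  assumes "integrable circle l" "cmod z < 1"
  shows "integrable circle (\<lambda>t. (t + z) / (t - z) * complex_of_real (l t))"
proof -
  have "integrable circle (\<lambda>t. complex_of_real (l t) * ((t + z) / (t - z)))"
  proof (rule integrable_mult_bounded)
    show "AE t in circle. cmod ((t + z) / (t - z)) \<le> 2 / (1 - cmod z)"
      using AE_circle_norm by eventually_elim (rule herglotz_kernel_bound[OF _ assms(2)])
  qed (use assms in auto)
  then show ?thesis by (simp add: mult.commute)
qed

lemma herglotz_lin:
  assumes "integrable circle l" "integrable circle m" "cmod z < 1"
  shows "herglotz (\<lambda>t. l t + c * m t) z = herglotz l z + of_real c * herglotz m z"
proof -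
  have "herglotz (\<lambda>t. l t + c * m t) z = (LINT t|circle. (t + z) / (t - z) * complex_of_real (l t)
      + of_real c * ((t + z) / (t - z) * complex_of_real (m t)))"
    unfolding herglotz_def by (intro Bochner_Integration.integral_cong) (auto simp: algebra_simps)
  also have "\<dots> = herglotz l z + of_real c * herglotz m z"
    unfolding herglotz_def
    by (subst Bochner_Integration.integral_add[OF integrable_herglotz[OF assms(1,3)]
          integrable_mult_right[OF integrable_herglotz[OF assms(2,3)]]])
       (simp only: integral_mult_right_zero)
  finally show ?thesis .
qed

lemma herglotz_0:
  assumes [measurable]: "l \<in> borel_measurable circle"
  shows "herglotz l 0 = of_real (LINT t|circle. l t)"
proof -
  have "herglotz l 0 = (LINT t|circle. complex_of_real (l t))"
    unfolding herglotz_def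
  proof (rule integral_cong_AE)
    have "AE t in circle. t \<noteq> 0" by (rule AE_circle_neq) simp
    then show "AE t in circle. (t + 0) / (t - 0) * complex_of_real (l t) = complex_of_real (l t)"
      by eventually_elim simp
  qed measurable
  then show ?thesis by simp
qed

text \<open>The kernel is -1 + 2 times the sum of (z/t)^n over n >= 0, and integrating against l
  gives the Fourier coefficients. The series is cut at N with an exact remainder of order |z|^N, so
  that sum and integral need not be exchanged.\<close>

lemma herglotz_eq_disc_ext:
  assumes l: "(\<lambda>t. complex_of_real (l t)) \<in> L2" and z: "cmod z < 1"
  shows "herglotz l z = 2 * disc_ext (\<lambda>t. of_real (l t)) z - fourier_coeff (\<lambda>t. of_real (l t)) 0"
proof -
  let ?L = "\<lambda>t. complex_of_real (l t)"
  note [measurable] = L2_measurable[OF l]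
  have int: "integrable circle ?L" by (rule integrable_L2[OF l])
  define R where "R N = (LINT t|circle. ?L t * (t powi (- int N) * (t / (t - z))))" for N :: nat
  have bnd: "AE t in circle. cmod (t powi n * (t / (t - z))) \<le> 1 / (1 - cmod z)" for n
    using AE_circle_norm
  proof eventually_elim
    fix t :: complex assume t: "cmod t = 1"
    have "1 / cmod (t - z) \<le> 1 / (1 - cmod z)"
      using cmod_circle_diff(1)[OF t, of z] z by (intro frac_le) auto
    then show "cmod (t powi n * (t / (t - z))) \<le> 1 / (1 - cmod z)"
      using t by (simp add: norm_mult norm_divide norm_power_int)
  qed
  have Rint: "integrable circle (\<lambda>t. ?L t * (t powi n * (t / (t - z))))" for n
    by (rule integrable_mult_bounded[OF int _ bnd]) measurable
  have pint: "integrable circle (\<lambda>t. ?L t * t powi n)" for n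
    by (rule integrable_L2_mult[OF l powi_L2])
  have eq: "herglotz l z = - fourier_coeff ?L 0 + 2 * (\<Sum>n<N. fourier_coeff ?L (int n) * z ^ n) + 2 * z ^ N * R N" for N
  proof -
    have "herglotz l z = (LINT t|circle. (- (?L t * t powi 0) + 2 * (\<Sum>n<N. (?L t * t powi (- int n)) * z ^ n))
        + (2 * z ^ N) * (?L t * (t powi (- int N) * (t / (t - z)))))"
      unfolding herglotz_def
    proof (rule integral_cong_AE)
      show "AE t in circle. (t + z) / (t - z) * ?L t = (- (?L t * t powi 0) + 2 * (\<Sum>n<N. (?L t * t powi (- int n)) * z ^ n))
        + (2 * z ^ N) * (?L t * (t powi (- int N) * (t / (t - z))))"
        using AE_circle_norm
      proof eventually_elim
        fix t :: complex assume t: "cmod t = 1"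
        then have ne: "t \<noteq> 0" "t - z \<noteq> 0" using z by auto
        \<comment> \<open>With y = 1 / (1 - x) the expansion is a finite geometric sum plus the
          remainder x^N y.\<close>
        define x where "x = z / t"
        have x1: "1 - x \<noteq> 0" using ne by (simp add: x_def divide_simps)
        have pw: "t powi (- int n) * z ^ n = x ^ n" for n
          using ne by (simp add: x_def power_int_minus divide_inverse power_mult_distrib power_inverse)
        have tz: "t / (t - z) = 1 / (1 - x)" "(t + z) / (t - z) = (1 + x) / (1 - x)"
          using ne by (auto simp: x_def divide_simps)
        define y where "y = 1 / (1 - x)"
        have "y * (1 - x) = 1" using x1 by (simp add: y_def)
        then have y: "(1 + x) * y = 2 * y - 1" by (simp add: algebra_simps)
        have S: "(\<Sum>n<N. x ^ n) = y * (1 - x ^ N)"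
          using x1 sum_gp_strict[of x N] by (auto simp: y_def)
        have "(1 + x) / (1 - x) = (1 + x) * y" by (simp add: y_def)
        also have "\<dots> = - 1 + 2 * (y * (1 - x ^ N)) + 2 * (x ^ N * y)"
          unfolding y by (simp add: algebra_simps)
        finally have "(1 + x) / (1 - x) = - 1 + 2 * (\<Sum>n<N. x ^ n) + 2 * (x ^ N * (1 / (1 - x)))"
          unfolding S y_def .
        note K = this
        have "(t + z) / (t - z) * ?L t = - ?L t + 2 * (?L t * (\<Sum>n<N. x ^ n)) + 2 * (?L t * (x ^ N * (t / (t - z))))"
          unfolding tz K by (simp only: ring_distribs mult_ac mult_minus_left mult_1_right mult_1_left)
        then have "(t + z) / (t - z) * ?L t = - ?L t + 2 * (\<Sum>n<N. ?L t * (t powi (- int n) * z ^ n)) + 2 * (?L t * ((t powi (- int N) * z ^ N) * (t / (t - z))))"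
          unfolding pw sum_distrib_left[of "?L t"] .
        then show "(t + z) / (t - z) * ?L t = (- (?L t * t powi 0) + 2 * (\<Sum>n<N. (?L t * t powi (- int n)) * z ^ n))
        + (2 * z ^ N) * (?L t * (t powi (- int N) * (t / (t - z))))"
          by (simp add: mult_ac)
      qed
    qed measurable
    also have "\<dots> = (- (LINT t|circle. ?L t * t powi 0) + 2 * (\<Sum>n<N. (LINT t|circle. ?L t * t powi (- int n)) * z ^ n))
        + (2 * z ^ N) * R N"
      unfolding R_def
      by (subst Bochner_Integration.integral_add Bochner_Integration.integral_sum
            | intro Bochner_Integration.integrable_add Bochner_Integration.integrable_minus
                Bochner_Integration.integrable_sum integrable_mult_right integrable_mult_left Rint pint
            | simp only: Bochner_Integration.integral_minus integral_mult_right_zero integral_mult_left_zero)+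
    finally show ?thesis
      using fourier_coeff_eq[OF L2_measurable[OF l]] by (simp del: power_int_0_right)
  qed
  have "(\<lambda>N. - fourier_coeff ?L 0 + 2 * (\<Sum>n<N. fourier_coeff ?L (int n) * z ^ n) + 2 * z ^ N * R N)
     \<longlonglongrightarrow> - fourier_coeff ?L 0 + 2 * disc_ext ?L z + 0"
  proof (intro tendsto_add tendsto_mult tendsto_const)
    show "(\<lambda>N. \<Sum>n<N. fourier_coeff ?L (int n) * z ^ n) \<longlonglongrightarrow> disc_ext ?L z"
      unfolding disc_ext_def by (rule summable_LIMSEQ[OF disc_ext_summable(1)[OF l z]])
    define K where "K = (LINT t|circle. cmod (?L t) * (1 / (1 - cmod z)))"
    have RK: "cmod (R N) \<le> K" for N
    proof -
      have "cmod (R N) \<le> (LINT t|circle. cmod (?L t * (t powi (- int N) * (t / (t - z)))))"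
        unfolding R_def by (rule integral_norm_bound)
      also have "\<dots> \<le> K"
        unfolding K_def
      proof (rule integral_mono_AE)
        show "integrable circle (\<lambda>t. cmod (?L t) * (1 / (1 - cmod z)))"
          by (intro integrable_mult_left integrable_norm int)
        show "AE t in circle. cmod (?L t * (t powi (- int N) * (t / (t - z)))) \<le> cmod (?L t) * (1 / (1 - cmod z))"
          using bnd[of "- int N"]
          by eventually_elim (subst norm_mult, rule mult_left_mono, auto)
      qed (rule integrable_norm[OF Rint])
      finally show ?thesis .
    qed
    show "(\<lambda>N. 2 * z ^ N * R N) \<longlonglongrightarrow> 0"
    proof (rule Lim_null_comparison)
      show "\<forall>\<^sub>F N in sequentially. norm (2 * z ^ N * R N) \<le> cmod z ^ N * (2 * K)"
      proof (intro always_eventually allI)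
        fix N
        have "cmod z ^ N * cmod (R N) \<le> cmod z ^ N * K" by (intro mult_left_mono RK) simp
        then show "norm (2 * z ^ N * R N) \<le> cmod z ^ N * (2 * K)"
          by (simp add: norm_mult norm_power)
      qed
      show "(\<lambda>N. cmod z ^ N * (2 * K)) \<longlonglongrightarrow> 0"
        using z by (intro tendsto_mult_left_zero LIMSEQ_power_zero) auto
    qed
  qed
  then have "(\<lambda>N::nat. herglotz l z) \<longlonglongrightarrow> - fourier_coeff ?L 0 + 2 * disc_ext ?L z + 0"
    using eq by simp
  then show ?thesis
    using LIMSEQ_unique[OF tendsto_const] by fastforce
qed

text \<open>The real part of the Herglotz kernel is the Poisson kernel, which is nonnegative and has
  integral 1.\<close>

lemma Re_herglotz_le:
  assumes l: "l \<in> borel_measurable circle" and C: "AE t in circle. \<bar>l t\<bar> \<le> C" and z: "cmod z < 1"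
  shows "Re (herglotz l z) \<le> C"
proof -
  have int: "integrable circle l"
    by (rule circle.integrable_const_bound[where B = C]) (use C l in auto)
  have "herglotz (\<lambda>t. C) z = of_real C"
  proof -
    have "herglotz (\<lambda>t. C) z = 2 * disc_ext (\<lambda>t. of_real C) z - fourier_coeff (\<lambda>t. of_real C) 0"
      by (rule herglotz_eq_disc_ext[OF L2_const z])
    then show ?thesis
      using disc_ext_const[OF z, of "of_real C"] disc_ext_const[of 0 "of_real C"] by (simp add: disc_ext_0)
  qed
  then have "Re (herglotz l z) - C = Re (herglotz l z + of_real (- 1) * herglotz (\<lambda>t. C) z)"
    by simp
  also have "\<dots> = Re (herglotz (\<lambda>t. l t + (-1) * C) z)"
    by (subst herglotz_lin[OF int _ z]) auto
  also have "\<dots> = (LINT t|circle. Re ((t + z) / (t - z) * complex_of_real (l t + (-1) * C)))"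
    unfolding herglotz_def
    by (rule integral_Re[symmetric]) (rule integrable_herglotz[OF _ z], use int in auto)
  also have "\<dots> \<le> (LINT t|circle. 0)"
  proof (rule integral_mono_AE)
    show "integrable circle (\<lambda>t. Re ((t + z) / (t - z) * complex_of_real (l t + (-1) * C)))"
      by (intro integrable_Re integrable_herglotz[OF _ z]) (use int in auto)
    show "AE t in circle. Re ((t + z) / (t - z) * complex_of_real (l t + (-1) * C)) \<le> 0"
      using AE_circle_norm C
    proof eventually_elim
      fix t assume t: "cmod t = 1" and lt: "\<bar>l t\<bar> \<le> C"
      have "(t + z) / (t - z) = (t + z) * cnj (t - z) / of_real ((cmod (t - z))\<^sup>2)"
        by (rule complex_div_cnj)
      moreover have "Re ((t + z) * cnj (t - z)) = (cmod t)\<^sup>2 - (cmod z)\<^sup>2"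
        unfolding cmod_power2 by (simp add: power2_eq_square algebra_simps)
      ultimately have "Re ((t + z) / (t - z)) = (1 - (cmod z)\<^sup>2) / (cmod (t - z))\<^sup>2"
        using t by (simp only: Re_divide_of_real) simp
      moreover have "(cmod z)\<^sup>2 \<le> 1" using z by (simp add: power_le_one)
      ultimately have "0 \<le> Re ((t + z) / (t - z))" by simp
      then have "Re ((t + z) / (t - z)) * (l t + (-1) * C) \<le> 0"
        using lt by (intro mult_nonneg_nonpos) auto
      then show "Re ((t + z) / (t - z) * complex_of_real (l t + (-1) * C)) \<le> 0"
        by (simp only: Re_complex_of_real Im_complex_of_real times_complex.simps mult_zero_right diff_zero)
    qed
  qed simp
  finally show ?thesis by simp
qed

section \<open>Radial dilates and the construction of outer functions\<close>

text \<open>On a smaller circle the series converges absolutely and uniformly, so its partial sums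
  are dominated by a constant. F is given by a power series instead of an element of
  \<open>H2\<close>, because the lemma is also applied to an exponential that is not yet known to
  have a boundary function.\<close>

lemma dilate_H2:
  assumes F: "\<And>z. cmod z < 1 \<Longrightarrow> (\<lambda>n. a n * z ^ n) sums F z" and r: "0 \<le> r" "r < 1"
  shows "(\<lambda>t. F (of_real r * t)) \<in> H2" "fourier_coeff (\<lambda>t. F (of_real r * t)) (int n) = a n * of_real r ^ n"
proof -
  define c where "c n = (if n < 0 then 0 else a (nat n) * of_real r ^ nat n)" for n :: int
  have sm: "summable (\<lambda>n. cmod (a n) * r ^ n)"
  proof -
    obtain s where s: "r < s" "s < 1" using dense[OF r(2)] by blast
    have "summable (\<lambda>n. a n * (of_real s) ^ n)"
      using F[of "of_real s"] s r by (auto simp: sums_iff)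
    then have "summable (\<lambda>n. norm (a n * (of_real r) ^ n))"
      by (rule powser_insidea) (use s r in auto)
    then show ?thesis using r by (simp add: norm_mult norm_power)
  qed
  have trig_eq: "trig c N t = (\<Sum>k<Suc N. a k * (of_real r * t) ^ k)" for N t
  proof -
    have "trig c N t = (\<Sum>k\<in>{0..int N}. c k * t powi k)"
      unfolding trig_def by (rule sum.mono_neutral_right) (auto simp: c_def)
    also have "\<dots> = (\<Sum>k<Suc N. a k * (of_real r * t) ^ k)"
      by (rule sum.reindex_bij_witness[of _ int nat])
         (auto simp: c_def power_int_def power_mult_distrib)
    finally show ?thesis .
  qed
  have lim: "AE t in circle. (\<lambda>N. trig c N t) \<longlonglongrightarrow> F (of_real r * t)"
    using AE_circle_norm
  proof eventually_elim
    fix t :: complex assume "cmod t = 1"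
    then have "cmod (of_real r * t) < 1" using r by (simp add: norm_mult)
    from LIMSEQ_Suc[OF F[OF this, unfolded sums_def]] show "(\<lambda>N. trig c N t) \<longlonglongrightarrow> F (of_real r * t)"
      by (simp add: trig_eq)
  qed
  define K where "K = (\<Sum>n. cmod (a n) * r ^ n)"
  have bound: "AE t in circle. cmod (trig c N t) \<le> cmod (of_real K)" for N
    using AE_circle_norm
  proof eventually_elim
    fix t :: complex assume t: "cmod t = 1"
    have "cmod (trig c N t) \<le> (\<Sum>k<Suc N. cmod (a k * (of_real r * t) ^ k))"
      unfolding trig_eq by (rule norm_sum)
    also have "\<dots> = (\<Sum>k<Suc N. cmod (a k) * r ^ k)"
      using t r by (simp add: norm_mult norm_power)
    also have "\<dots> \<le> K"
      unfolding K_def using r by (intro sum_le_suminf sm) auto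
    finally show "cmod (trig c N t) \<le> cmod (of_real K)" by simp
  qed
  have meas: "(\<lambda>t. F (of_real r * t)) \<in> borel_measurable circle"
  proof -
    have "(\<lambda>t. lim (\<lambda>N. trig c N t)) \<in> borel_measurable circle"
      using L2_measurable[OF trig_L2] by (intro borel_measurable_lim_metric) auto
    moreover have "AE t in circle. F (of_real r * t) = lim (\<lambda>N. trig c N t)"
      using lim by eventually_elim (simp add: limI)
    ultimately show ?thesis
      by (rule borel_measurable_cong_AE)
  qed
  note dom = L2_dominated_tendsto[OF L2_measurable[OF trig_L2] meas L2_const bound lim]
  have coeff: "fourier_coeff (\<lambda>t. F (of_real r * t)) n = c n" for n
  proof (rule LIMSEQ_unique)
    show "(\<lambda>N. fourier_coeff (trig c N) n) \<longlonglongrightarrow> fourier_coeff (\<lambda>t. F (of_real r * t)) n"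
      by (rule tendsto_fourier_coeff[OF trig_L2 dom(1,3)])
    have "\<forall>\<^sub>F N in sequentially. fourier_coeff (trig c N) n = c n"
      using eventually_ge_at_top[of "nat \<bar>n\<bar>"] by eventually_elim (auto simp: fourier_coeff_trig)
    then show "(\<lambda>N. fourier_coeff (trig c N) n) \<longlonglongrightarrow> c n"
      by (rule tendsto_eventually)
  qed
  show "(\<lambda>t. F (of_real r * t)) \<in> H2"
    by (rule H2_I[OF dom(1)]) (simp add: coeff c_def)
  show "fourier_coeff (\<lambda>t. F (of_real r * t)) (int n) = a n * of_real r ^ n"
    by (simp add: coeff c_def)
qed

lemma disc_ext_sums:
  assumes "f \<in> L2" "cmod z < 1"
  shows "(\<lambda>n. fourier_coeff f (int n) * z ^ n) sums disc_ext f z"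
  unfolding disc_ext_def by (rule summable_sums[OF disc_ext_summable(1)[OF assms]])

lemma H2_sums_nsq:
  assumes f: "f \<in> H2" and g: "g \<in> L2"
  shows "(\<lambda>n. fourier_coeff f (int n) * cnj (fourier_coeff g (int n))) sums L2_inner f g"
proof -
  have "(\<lambda>N. L2_inner (trig (fourier_coeff f) N) g) \<longlonglongrightarrow> L2_inner f g"
    using L2.tendsto_ip[of "trig (fourier_coeff f)" f g] trig_L2 H2_L2[OF f] g fourier_series_tendsto[OF H2_L2[OF f]]
    by blast
  moreover have "L2_inner (trig (fourier_coeff f) N) g = (\<Sum>n\<le>N. fourier_coeff f (int n) * cnj (fourier_coeff g (int n)))" for N
  proof -
    have "L2_inner (trig (fourier_coeff f) N) g = (\<Sum>k\<in>{0..int N}. fourier_coeff f k * cnj (fourier_coeff g k))"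
      unfolding L2_inner_trig[OF g] by (rule sum.mono_neutral_right) (auto simp: H2_coeff[OF f])
    also have "\<dots> = (\<Sum>n\<le>N. fourier_coeff f (int n) * cnj (fourier_coeff g (int n)))"
      by (rule sum.reindex_bij_witness[of _ int nat]) auto
    finally show ?thesis .
  qed
  ultimately show ?thesis by (simp add: sums_def_le)
qed

definition rad :: "nat \<Rightarrow> real" where
  "rad j = 1 - 1 / (real j + 1)"

lemma rad: "0 \<le> rad j" "rad j < 1" "rad \<longlonglongrightarrow> 1"
proof -
  show "0 \<le> rad j" "rad j < 1" by (auto simp: rad_def divide_simps)
  have "(\<lambda>j. 1 - 1 / (real j + 1)) \<longlonglongrightarrow> 1 - 0"
    by (intro tendsto_intros) (use LIMSEQ_Suc[OF lim_1_over_n] in \<open>simp add: add.commute\<close>)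
  then show "rad \<longlonglongrightarrow> 1" by (simp add: rad_def[abs_def])
qed

text \<open>Dilation shrinks every coefficient, so the squared distance is at most 2
  (\<open>nsq f\<close> - S(r)) with S(r) the sum of r^n |f(n)|^2. Finitely many terms of S(r)
  exhaust \<open>nsq f\<close> as r tends to 1.\<close>

lemma dilate_tendsto:
  assumes f: "f \<in> H2"
  shows "(\<lambda>j. L2_dist (\<lambda>t. disc_ext f (of_real (rad j) * t)) f) \<longlonglongrightarrow> 0"
proof -
  let ?D = "\<lambda>j t. disc_ext f (of_real (rad j) * t)"
  define b where "b n = (cmod (fourier_coeff f (int n)))\<^sup>2" for n
  have D: "?D j \<in> H2" "fourier_coeff (?D j) (int n) = fourier_coeff f (int n) * of_real (rad j) ^ n" for j n
    by (rule dilate_H2(1)[OF _ rad(1,2)], rule disc_ext_sums[OF H2_L2[OF f]], assumption,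
        rule dilate_H2(2)[OF _ rad(1,2)], rule disc_ext_sums[OF H2_L2[OF f]])
  have bsum: "b sums nsq f"
    using sums_Re[OF H2_sums_nsq[OF f H2_L2[OF f]]] by (simp only: mult_cnj_cmod Re_complex_of_real b_def[abs_def] L2.sq_def)
  have ip: "(\<lambda>n. rad j ^ n * b n) sums Re (L2_inner (?D j) f)" for j
  proof -
    have "fourier_coeff (?D j) (int n) * cnj (fourier_coeff f (int n)) = of_real (rad j ^ n * b n)" for n
    proof -
      have "fourier_coeff (?D j) (int n) * cnj (fourier_coeff f (int n))
          = of_real (rad j) ^ n * (fourier_coeff f (int n) * cnj (fourier_coeff f (int n)))"
        by (subst D(2)) (simp add: algebra_simps)
      then show ?thesis unfolding mult_cnj_cmod b_def by simp
    qed
    then show ?thesis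
      using sums_Re[OF H2_sums_nsq[OF D(1) H2_L2[OF f]], of j] by (simp only: Re_complex_of_real)
  qed
  have nsqD: "nsq (?D j) \<le> nsq f" for j
  proof -
    have "(\<lambda>n. (cmod (fourier_coeff (?D j) (int n)))\<^sup>2) sums nsq (?D j)"
      using sums_Re[OF H2_sums_nsq[OF D(1)[of j] H2_L2[OF D(1)[of j]]]] by (simp only: mult_cnj_cmod Re_complex_of_real L2.sq_def)
    then show ?thesis
    proof (rule sums_le[rotated, OF _ bsum])
      fix n
      have "cmod (fourier_coeff (?D j) (int n)) \<le> cmod (fourier_coeff f (int n)) * 1"
        unfolding D(2) norm_mult norm_power using rad(1,2)[of j]
        by (intro mult_left_mono power_le_one) auto
      then show "(cmod (fourier_coeff (?D j) (int n)))\<^sup>2 \<le> b n"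
        unfolding b_def by (intro power_mono) auto
    qed
  qed
  show ?thesis
  proof (rule LIMSEQ_I)
    fix e :: real assume e: "e > 0"
    \<comment> \<open>Two errors of e / 4, one from cutting the series and one from r < 1, both
      counted twice in the distance.\<close>
    have "(\<lambda>N. \<Sum>n<N. b n) \<longlonglongrightarrow> nsq f" using bsum by (simp add: sums_def)
    then have "\<forall>\<^sub>F N in sequentially. nsq f - e / 4 < (\<Sum>n<N. b n)"
      using e by (intro order_tendstoD) auto
    then obtain N where N: "nsq f - e / 4 < (\<Sum>n<N. b n)"
      by (auto simp: eventually_sequentially)
    have "(\<lambda>j. \<Sum>n<N. rad j ^ n * b n) \<longlonglongrightarrow> (\<Sum>n<N. 1 ^ n * b n)"
      by (intro tendsto_intros rad)
    then have "\<forall>\<^sub>F j in sequentially. (\<Sum>n<N. b n) - e / 4 < (\<Sum>n<N. rad j ^ n * b n)"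
      using e by (intro order_tendstoD) auto
    then obtain J where J: "\<And>j. j \<ge> J \<Longrightarrow> (\<Sum>n<N. b n) - e / 4 < (\<Sum>n<N. rad j ^ n * b n)"
      by (auto simp: eventually_sequentially)
    have "norm (L2_dist (?D j) f - 0) < e" if "j \<ge> J" for j
    proof -
      have "(\<Sum>n<N. rad j ^ n * b n) \<le> Re (L2_inner (?D j) f)"
        unfolding sums_unique[OF ip] using rad(1)[of j]
        by (intro sum_le_suminf sums_summable[OF ip]) (auto simp: b_def)
      moreover have "L2_dist (?D j) f = nsq (?D j) - 2 * Re (L2_inner (?D j) f) + nsq f"
        by (rule L2.dst_eq[OF H2_L2[OF D(1)] H2_L2[OF f]])
      moreover have "0 \<le> L2_dist (?D j) f"
        by (rule L2.dst_nonneg[OF H2_L2[OF D(1)] H2_L2[OF f]])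
      ultimately show ?thesis
        using J[OF that] N nsqD[of j] by simp
    qed
    then show "\<exists>no. \<forall>j\<ge>no. norm (L2_dist (?D j) f - 0) < e" by blast
  qed
qed

text \<open>H is the boundary function of the Herglotz integral, l plus i times its harmonic
  conjugate. H need not be bounded, but Re H = l is, and the Poisson bound carries this to the disc;
  hence the dilates of exp H are uniformly bounded and converge almost everywhere along a
  subsequence, which puts the limit into \<open>H2\<close>.\<close>

theorem outer_bounded:
  fixes l :: "complex \<Rightarrow> real"
  assumes l [measurable]: "l \<in> borel_measurable circle" and C: "AE t in circle. \<bar>l t\<bar> \<le> C"
  obtains f where "f \<in> H2" "AE t in circle. cmod (f t) = exp (l t)"
    "\<And>z. cmod z < 1 \<Longrightarrow> disc_ext f z = exp (herglotz l z)"
proof -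
  define L where "L t = complex_of_real (l t)" for t
  have L: "L \<in> L2"
    by (rule L2_bounded[where C = C]) (use C in \<open>auto simp: L_def[abs_def]\<close>)
  note [measurable] = L2_measurable[OF L] L2_measurable[OF H2_minus_L2[OF P_minus_props(1)[OF L]]]
  \<comment> \<open>Twice the analytic part of l, with the coefficient of index 0 counted only
    once.\<close>
  define H where "H t = - fourier_coeff L 0 + 2 * (L t - P_minus L t)" for t
  have H: "H \<in> H2"
    unfolding H_def[abs_def] by (rule H2_lin[OF const_H2 P_minus_props(2)[OF L]])
  note [measurable] = L2_measurable[OF H2_L2[OF H]]
  have Hc: "fourier_coeff H n = (if n = 0 then fourier_coeff L 0 else 2 * fourier_coeff L n)" if "n \<ge> 0" for n
  proof -
    have "fourier_coeff H n = fourier_coeff (\<lambda>t. - fourier_coeff L 0) n + 2 * fourier_coeff (\<lambda>t. L t - P_minus L t) n"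
      unfolding H_def[abs_def]
      by (rule fourier_coeff_lin[OF L2_const H2_L2[OF P_minus_props(2)[OF L]]])
    also have "fourier_coeff (\<lambda>t. L t - P_minus L t) n = fourier_coeff L n"
      using fourier_coeff_lin[OF L H2_minus_L2[OF P_minus_props(1)[OF L]], of "-1" n]
        P_minus_props(1)[OF L] that by (simp add: H2_minus_iff)
    also have "fourier_coeff (\<lambda>t. - fourier_coeff L 0) n = (if n = 0 then - fourier_coeff L 0 else 0)"
      using fourier_coeff_scale[of "- fourier_coeff L 0" "\<lambda>t. t powi 0" n] fourier_coeff_powi[of 0 n] by simp
    finally show ?thesis by simp
  qed
  have Hz: "disc_ext H z = herglotz l z" if z: "cmod z < 1" for z
  proof -
    have "disc_ext H z = disc_ext (\<lambda>t. - fourier_coeff L 0) z + 2 * disc_ext (\<lambda>t. L t - P_minus L t) z"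
      unfolding H_def[abs_def]
      by (rule disc_ext_lin[OF L2_const H2_L2[OF P_minus_props(2)[OF L]] z])
    also have "disc_ext (\<lambda>t. L t - P_minus L t) z = disc_ext L z"
      unfolding disc_ext_def
      using fourier_coeff_lin[OF L H2_minus_L2[OF P_minus_props(1)[OF L]], of "-1"] P_minus_props(1)[OF L]
      by (simp add: H2_minus_iff)
    also have "disc_ext (\<lambda>t. - fourier_coeff L 0) z = - fourier_coeff L 0"
      by (rule disc_ext_const[OF z])
    finally show ?thesis
      using herglotz_eq_disc_ext[of l, folded L_def[abs_def], OF L z] by simp
  qed
  have ReH: "AE t in circle. Re (H t) = l t"
  proof -
    \<comment> \<open>l is real, so its coefficients are conjugate symmetric; therefore H + cnj H
      recovers 2 l.\<close>
    have cL: "fourier_coeff L (- n) = cnj (fourier_coeff L n)" for n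
      using fourier_coeff_cnj[of L "- n"] by (simp add: L_def[abs_def])
    have "AE t in circle. H t + 1 * cnj (H t) = 2 * L t"
    proof (rule fourier_unique)
      show "fourier_coeff (\<lambda>t. H t + 1 * cnj (H t)) n = fourier_coeff (\<lambda>t. 2 * L t) n" for n
      proof -
        have "fourier_coeff (\<lambda>t. H t + 1 * cnj (H t)) n = fourier_coeff H n + cnj (fourier_coeff H (- n))"
          by (subst fourier_coeff_lin[OF H2_L2[OF H] L2_cnj[OF H2_L2[OF H]]]) (simp add: fourier_coeff_cnj)
        also have "\<dots> = 2 * fourier_coeff L n"
        proof (cases "n = 0")
          case True
          then show ?thesis using Hc[of 0] cL[of 0] by simp
        next
          case False
          then show ?thesis
            using Hc[of n] Hc[of "-n"] H2_coeff[OF H, of n] H2_coeff[OF H, of "-n"] cL[of n]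
            by (cases "n > 0") auto
        qed
        finally show ?thesis by (simp add: fourier_coeff_scale)
      qed
    qed (intro L2_lin L2_cnj L2_scale H2_L2[OF H] L)+
    then show ?thesis
      by eventually_elim (auto simp: L_def complex_eq_iff)
  qed
  define E where "E z = exp (disc_ext H z)" for z
  define a where "a n = (deriv ^^ n) E 0 / fact n" for n
  have "disc_ext H holomorphic_on ball 0 1"
    unfolding holomorphic_on_def
    by (rule ballI, rule field_differentiable_at_within, rule disc_ext_differentiable[OF H2_L2[OF H]]) simp
  then have "E holomorphic_on ball 0 1"
    unfolding E_def[abs_def] by (intro holomorphic_intros)
  then have E: "(\<lambda>n. a n * z ^ n) sums E z" if "cmod z < 1" for z
    using holomorphic_power_series[of E 0 1 z] that by (simp add: a_def)
  have D: "(\<lambda>t. E (of_real (rad j) * t)) \<in> H2"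
    "fourier_coeff (\<lambda>t. E (of_real (rad j) * t)) (int n) = a n * of_real (rad j) ^ n" for j n
    by (rule dilate_H2(1)[OF _ rad(1,2)], rule E, assumption, rule dilate_H2(2)[OF _ rad(1,2)], rule E)
  have Ebound: "cmod (E z) \<le> exp C" if "cmod z < 1" for z
    unfolding E_def norm_exp_eq_Re Hz[OF that] using Re_herglotz_le[OF l C that] by simp
  have DH: "(\<lambda>t. disc_ext H (of_real (rad j) * t)) \<in> H2" for j
    by (rule dilate_H2(1)[OF _ rad(1,2)], rule disc_ext_sums[OF H2_L2[OF H]])
  define U where "U j t = disc_ext H (of_real (rad j) * t)" for j t
  have UL2: "U j \<in> L2" for j
    unfolding U_def[abs_def] by (rule H2_L2[OF DH])
  have Ulim: "(\<lambda>j. L2_dist (U j) H) \<longlonglongrightarrow> 0"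
    unfolding U_def[abs_def] by (rule dilate_tendsto[OF H])
  obtain r where r: "strict_mono r" "AE t in circle. (\<lambda>j. U (r j) t) \<longlonglongrightarrow> H t"
    by (rule L2_AE_subseq[of U, OF UL2 H2_L2[OF H] Ulim])
  let ?s = "\<lambda>j t. E (of_real (rad (r j)) * t)"
  define f where "f t = exp (H t)" for t
  have [measurable]: "f \<in> borel_measurable circle"
    unfolding f_def[abs_def] by (rule measurable_compose[OF L2_measurable[OF H2_L2[OF H]]]) (intro borel_measurable_continuous_onI continuous_intros)
  have conv: "AE t in circle. (\<lambda>j. ?s j t) \<longlonglongrightarrow> f t"
    using r(2) unfolding E_def f_def U_def by eventually_elim (rule tendsto_exp)
  have bound: "AE t in circle. cmod (?s j t) \<le> cmod (of_real (exp C))" for j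
    using AE_circle_norm
  proof eventually_elim
    fix t :: complex assume "cmod t = 1"
    then have "cmod (of_real (rad (r j)) * t) < 1" using rad(1,2)[of "r j"] by (simp add: norm_mult)
    from Ebound[OF this] show "cmod (?s j t) \<le> cmod (of_real (exp C))" by simp
  qed
  have fm: "f \<in> borel_measurable circle" by measurable
  note dom = L2_dominated_tendsto[OF L2_measurable[OF H2_L2[OF D(1)]] fm L2_const bound conv]
  have fH: "f \<in> H2" by (rule H2_closed[OF D(1) dom(1,3)])
  have coeff: "fourier_coeff f (int n) = a n" for n
  proof (rule LIMSEQ_unique)
    show "(\<lambda>j. fourier_coeff (?s j) (int n)) \<longlonglongrightarrow> fourier_coeff f (int n)"
      by (rule tendsto_fourier_coeff[OF H2_L2[OF D(1)] dom(1,3)])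
    have "(\<lambda>j. a n * of_real (rad (r j)) ^ n) \<longlonglongrightarrow> a n * of_real 1 ^ n"
      by (intro tendsto_intros LIMSEQ_subseq_LIMSEQ[OF rad(3) r(1), unfolded o_def])
    then show "(\<lambda>j. fourier_coeff (?s j) (int n)) \<longlonglongrightarrow> a n"
      by (simp add: D(2))
  qed
  show ?thesis
  proof (rule that[OF fH])
    show "AE t in circle. cmod (f t) = exp (l t)"
      using ReH by eventually_elim (simp add: f_def)
    show "disc_ext f z = exp (herglotz l z)" if "cmod z < 1" for z
      using sums_unique[OF E[OF that]] Hz[OF that] by (simp add: disc_ext_def coeff E_def)
  qed
qed


text \<open>For unbounded l the truncations at -n have outer functions f n with analytic inverses q
  n, and f n converges in \<open>L2\<close>. A subsequence of the q n is returned as p: bounded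
  analytic functions with p n * E at most 1 in modulus and tending to 1. This is the form in which
  outerness is used later, in Smirnov's theorem.\<close>

theorem outer_H2:
  fixes l :: "complex \<Rightarrow> real"
  assumes int: "integrable circle l" and neg: "AE t in circle. l t \<le> 0"
  obtains E p where "E \<in> H2" "AE t in circle. cmod (E t) = exp (l t)"
    "\<And>z. cmod z < 1 \<Longrightarrow> disc_ext E z = exp (herglotz l z)"
    "\<And>n::nat. p n \<in> H2" "\<And>n. \<exists>C. AE t in circle. cmod (p n t) \<le> C"
    "\<And>n. AE t in circle. cmod (p n t * E t) \<le> 1"
    "AE t in circle. (\<lambda>n. p n t * E t) \<longlonglongrightarrow> 1"
proof -
  note [measurable] = borel_measurable_integrable[OF int]
  define L where "L n t = max (l t) (- real n)" for n t
  have [measurable]: "L n \<in> borel_measurable circle" for n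
    unfolding L_def[abs_def] by measurable
  have Lb: "AE t in circle. \<bar>L n t\<bar> \<le> real n" for n
    using neg by eventually_elim (auto simp: L_def)
  have Lb': "AE t in circle. \<bar>- L n t\<bar> \<le> real n" for n
    using Lb by simp
  have Ll: "AE t in circle. \<bar>L n t\<bar> \<le> \<bar>l t\<bar>" for n
    using neg by eventually_elim (auto simp: L_def)
  have Lint: "integrable circle (L n)" for n
    by (rule Bochner_Integration.integrable_bound[OF int]) (use Ll in auto)
  have Llim: "(\<lambda>n. L n t) \<longlonglongrightarrow> l t" for t
  proof (rule tendsto_eventually)
    obtain N where N: "- l t < real N" using reals_Archimedean2 by blast
    show "\<forall>\<^sub>F n in sequentially. L n t = l t"
      using eventually_ge_at_top[of N] by eventually_elim (use N in \<open>auto simp: L_def max_def\<close>)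
  qed
  have "\<exists>f. f \<in> H2 \<and> (AE t in circle. cmod (f t) = exp (L n t)) \<and> (\<forall>z. cmod z < 1 \<longrightarrow> disc_ext f z = exp (herglotz (L n) z))" for n
    by (rule outer_bounded[of "L n" "real n"]) (use Lb in auto)
  then have "\<exists>f. \<forall>n. f n \<in> H2 \<and> (AE t in circle. cmod (f n t) = exp (L n t)) \<and> (\<forall>z. cmod z < 1 \<longrightarrow> disc_ext (f n) z = exp (herglotz (L n) z))"
    by (intro choice allI)
  then obtain f where f': "\<forall>n. f n \<in> H2 \<and> (AE t in circle. cmod (f n t) = exp (L n t)) \<and> (\<forall>z. cmod z < 1 \<longrightarrow> disc_ext (f n) z = exp (herglotz (L n) z))"
    by (rule exE)
  then have f: "f n \<in> H2" "AE t in circle. cmod (f n t) = exp (L n t)" "cmod z < 1 \<Longrightarrow> disc_ext (f n) z = exp (herglotz (L n) z)" for n z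
    by auto
  have "\<exists>f. f \<in> H2 \<and> (AE t in circle. cmod (f t) = exp (- L n t)) \<and> (\<forall>z. cmod z < 1 \<longrightarrow> disc_ext f z = exp (herglotz (\<lambda>t. - L n t) z))" for n
    by (rule outer_bounded[of "\<lambda>t. - L n t" "real n"]) (use Lb' in auto)
  then have "\<exists>q. \<forall>n. q n \<in> H2 \<and> (AE t in circle. cmod (q n t) = exp (- L n t)) \<and> (\<forall>z. cmod z < 1 \<longrightarrow> disc_ext (q n) z = exp (herglotz (\<lambda>t. - L n t) z))"
    by (intro choice allI)
  then obtain q where q': "\<forall>n. q n \<in> H2 \<and> (AE t in circle. cmod (q n t) = exp (- L n t)) \<and> (\<forall>z. cmod z < 1 \<longrightarrow> disc_ext (q n) z = exp (herglotz (\<lambda>t. - L n t) z))"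
    by (rule exE)
  have q: "q n \<in> H2" "AE t in circle. cmod (q n t) = exp (- L n t)" for n
    using q' by auto
  have qz: "disc_ext (q n) z = exp (- herglotz (L n) z)" if "cmod z < 1" for n z
    using q' that herglotz_lin[of "\<lambda>_. 0" "L n" z "-1", OF _ Lint that] by (simp add: herglotz_def)
  note [measurable] = L2_measurable[OF H2_L2[OF f(1)]] L2_measurable[OF H2_L2[OF q(1)]]
  have f1: "AE t in circle. cmod (f n t) \<le> 1" for n
    using f(2)[of n] neg by eventually_elim (auto simp: L_def)
  have qb: "AE t in circle. cmod (q n t) \<le> exp (real n)" for n
    using q(2)[of n] Lb[of n] by eventually_elim auto
  \<comment> \<open>The exponents cancel in the disc, and the boundary values follow by
    uniqueness.\<close>
  have fq: "AE t in circle. f n t * q n t = 1" for n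
  proof (rule disc_ext_unique[OF H2_mult(1)[OF q(1) f(1) f1] const_H2])
    show "disc_ext (\<lambda>t. f n t * q n t) z = disc_ext (\<lambda>t. 1) z" if "cmod z < 1" for z
      using H2_mult(2)[OF q(1) f(1) f1 that] that by (simp add: f(3) qz disc_ext_const flip: exp_add)
  qed
  define I where "I n = (LINT t|circle. L n t)" for n
  \<comment> \<open>For m <= n the quotient u = f n / f m has modulus at most 1, so |f m - f n| <=
    |1 - u|. The squared norm of 1 - u is at most 2 - 2 Re u(0), and u(0) = exp (I n - I m), which
    is at least 1 + I n - I m.\<close>
  have dist: "L2_dist (f m) (f n) \<le> 2 * (I m - I n)" if mn: "m \<le> n" for m n
  proof -
    define u where "u t = q m t * f n t" for t
    have u: "u \<in> H2" unfolding u_def[abs_def] by (rule H2_mult(1)[OF f(1) q(1) qb])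
    note [measurable] = L2_measurable[OF H2_L2[OF u]]
    have u1: "AE t in circle. cmod (u t) \<le> 1"
      using f(2)[of n] q(2)[of m]
    proof eventually_elim
      fix t assume "cmod (f n t) = exp (L n t)" "cmod (q m t) = exp (- L m t)"
      then have "cmod (u t) = exp (L n t - L m t)" by (simp add: u_def norm_mult flip: exp_add)
      moreover have "L n t \<le> L m t" using mn by (auto simp: L_def)
      ultimately show "cmod (u t) \<le> 1" by simp
    qed
    have "nsq u \<le> 1" using nsq_bounded[of u 1] u1 by simp
    have "L2_inner u (\<lambda>t. 1) = disc_ext u 0"
      by (simp add: disc_ext_0 fourier_coeff_def)
    also have "\<dots> = exp (- herglotz (L m) 0) * exp (herglotz (L n) 0)"
      unfolding u_def[abs_def] using H2_mult(2)[OF f(1) q(1) qb, of 0 m n] qz[of 0 m] f(3)[of 0 n] by simp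
    also have "\<dots> = of_real (exp (I n - I m))"
      by (simp add: herglotz_0 I_def exp_diff exp_minus divide_inverse exp_of_real mult.commute)
    finally have ip: "Re (L2_inner u (\<lambda>t. 1)) = exp (I n - I m)" by (simp only: Re_complex_of_real)
    have "L2_dist (f m) (f n) = nsq (\<lambda>t. f m t - f n t)"
      by (simp add: L2.dst_def)
    also have "\<dots> \<le> nsq (\<lambda>t. u t + (-1) * 1)"
    proof (rule nsq_mono)
      show "(\<lambda>t. u t + (-1) * 1) \<in> L2" by (rule L2_lin[OF H2_L2[OF u] L2_const])
      show "AE t in circle. cmod (f m t - f n t) \<le> cmod (u t + (-1) * 1)"
        using fq[of m] f1[of m]
      proof eventually_elim
        fix t assume *: "f m t * q m t = 1" "cmod (f m t) \<le> 1"
        have "f m t - f n t = f m t - (f m t * q m t) * f n t" using *(1) by simp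
        also have "\<dots> = f m t * (1 - u t)" by (simp add: u_def algebra_simps)
        finally have "cmod (f m t - f n t) = cmod (f m t) * cmod (1 - u t)"
          by (simp add: norm_mult)
        also have "\<dots> \<le> 1 * cmod (1 - u t)" using *(2) by (intro mult_right_mono) auto
        finally show "cmod (f m t - f n t) \<le> cmod (u t + (-1) * 1)"
          by (simp add: norm_minus_commute)
      qed
    qed measurable
    also have "\<dots> = nsq u - 2 * exp (I n - I m) + 1"
      using L2.dst_eq[OF H2_L2[OF u] L2_const, of 1] nsq_unimodular[of "\<lambda>t. 1"] ip by (simp add: L2.dst_def)
    also have "\<dots> \<le> 2 - 2 * exp (I n - I m)"
      using \<open>nsq u \<le> 1\<close> by simp
    also have "\<dots> \<le> 2 * (I m - I n)"
    proof -
      have aux: "1 + a \<le> x \<Longrightarrow> 2 - 2 * x \<le> 2 * (- a)" for a x :: real by simp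
      from aux[OF exp_ge_add_one_self[of "I n - I m"]] show ?thesis by simp
    qed
    finally show ?thesis .
  qed
  have "I \<longlonglongrightarrow> (LINT t|circle. l t)"
    unfolding I_def[abs_def]
    by (rule integral_dominated_convergence[where w = "\<lambda>t. \<bar>l t\<bar>"]) (use Ll Llim int in auto)
  then have "Cauchy I" by (rule LIMSEQ_imp_Cauchy)
  note Cau = CauchyD[OF this, unfolded real_norm_def]
  have Cauf: "\<exists>N. \<forall>m\<ge>N. \<forall>n\<ge>N. L2_dist (f m) (f n) < e" if e: "e > 0" for e
  proof -
    obtain N where N: "\<And>m n. m \<ge> N \<Longrightarrow> n \<ge> N \<Longrightarrow> \<bar>I m - I n\<bar> < e / 2"
      using Cau[of "e / 2"] e by auto
    have "L2_dist (f m) (f n) < e" if mn: "m \<ge> N" "n \<ge> N" for m n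
    proof -
      have "L2_dist (f m) (f n) \<le> 2 * \<bar>I m - I n\<bar>"
      proof (cases "m \<le> n")
        case True
        show ?thesis by (rule order_trans[OF dist[OF True] mult_left_mono[OF abs_ge_self]]) simp
      next
        case False
        then have "n \<le> m" by simp
        from order_trans[OF dist[OF this] mult_left_mono[OF abs_ge_self]]
        have "L2_dist (f n) (f m) \<le> 2 * \<bar>I n - I m\<bar>" by simp
        then show ?thesis
          using L2.dst_sym[OF H2_L2[OF f(1)] H2_L2[OF f(1)], of m n] by (simp add: abs_minus_commute)
      qed
      with N[OF mn] show ?thesis by simp
    qed
    then show ?thesis by blast
  qed
  obtain E where E: "E \<in> L2" "(\<lambda>n. L2_dist (f n) E) \<longlonglongrightarrow> 0"
    by (rule L2_complete[of f, OF H2_L2[OF f(1)] Cauf])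
  obtain r where r: "strict_mono r" "AE t in circle. (\<lambda>n. f (r n) t) \<longlonglongrightarrow> E t"
    by (rule L2_AE_subseq[of f, OF H2_L2[OF f(1)] E])
  have fall: "AE t in circle. \<forall>n. cmod (f n t) = exp (L n t)"
    unfolding AE_all_countable using f(2) by blast
  have Emod: "AE t in circle. cmod (E t) = exp (l t)"
    using r(2) fall
  proof eventually_elim
    fix t assume *: "(\<lambda>n. f (r n) t) \<longlonglongrightarrow> E t" "\<forall>n. cmod (f n t) = exp (L n t)"
    have "(\<lambda>n. cmod (f (r n) t)) \<longlonglongrightarrow> exp (l t)"
      using tendsto_exp[OF LIMSEQ_subseq_LIMSEQ[OF Llim[of t] r(1)]] *(2) by (simp add: o_def)
    then show "cmod (E t) = exp (l t)"
      using LIMSEQ_unique tendsto_norm[OF *(1)] by blast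
  qed
  have Ez: "disc_ext E z = exp (herglotz l z)" if z: "cmod z < 1" for z
  proof (rule LIMSEQ_unique)
    show "(\<lambda>n. disc_ext (f n) z) \<longlonglongrightarrow> disc_ext E z"
      by (rule tendsto_disc_ext[OF H2_L2[OF f(1)] E z])
    have "(\<lambda>n. herglotz (L n) z) \<longlonglongrightarrow> herglotz l z"
      unfolding herglotz_def
    proof (rule integral_dominated_convergence[where w = "\<lambda>t. 2 / (1 - cmod z) * \<bar>l t\<bar>"])
      show "integrable circle (\<lambda>t. 2 / (1 - cmod z) * \<bar>l t\<bar>)" using int by auto
      show "AE t in circle. (\<lambda>n. (t + z) / (t - z) * complex_of_real (L n t)) \<longlonglongrightarrow> (t + z) / (t - z) * complex_of_real (l t)"
        by (intro AE_I2 tendsto_mult tendsto_const tendsto_of_real Llim)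
      show "AE t in circle. norm ((t + z) / (t - z) * complex_of_real (L n t)) \<le> 2 / (1 - cmod z) * \<bar>l t\<bar>" for n
        using AE_circle_norm Ll[of n]
      proof eventually_elim
        fix t assume "cmod t = 1" "\<bar>L n t\<bar> \<le> \<bar>l t\<bar>"
        then have "cmod ((t + z) / (t - z)) * \<bar>L n t\<bar> \<le> 2 / (1 - cmod z) * \<bar>l t\<bar>"
          using z by (intro mult_mono herglotz_kernel_bound) auto
        then show "norm ((t + z) / (t - z) * complex_of_real (L n t)) \<le> 2 / (1 - cmod z) * \<bar>l t\<bar>"
          by (simp only: norm_mult norm_of_real)
      qed
    qed measurable
    then show "(\<lambda>n. disc_ext (f n) z) \<longlonglongrightarrow> exp (herglotz l z)"
      unfolding f(3)[OF z] by (rule tendsto_exp)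
  qed
  have fqall: "AE t in circle. \<forall>n. f n t * q n t = 1"
    unfolding AE_all_countable using fq by blast
  show ?thesis
  proof (rule that[of E "\<lambda>n. q (r n)", OF H2_closed[OF f(1) E] Emod Ez q(1)])
    show "\<exists>C. AE t in circle. cmod (q (r n) t) \<le> C" for n
      using qb by blast
    show "AE t in circle. cmod (q (r n) t * E t) \<le> 1" for n
      using Emod q(2)[of "r n"]
    proof eventually_elim
      fix t assume "cmod (E t) = exp (l t)" "cmod (q (r n) t) = exp (- L (r n) t)"
      then have "cmod (q (r n) t * E t) = exp (l t - L (r n) t)"
        by (simp add: norm_mult flip: exp_add)
      also have "\<dots> \<le> 1" by (simp add: L_def)
      finally show "cmod (q (r n) t * E t) \<le> 1" .
    qed
    show "AE t in circle. (\<lambda>n. q (r n) t * E t) \<longlonglongrightarrow> 1"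
      using r(2) fqall Emod
    proof eventually_elim
      fix t assume *: "(\<lambda>n. f (r n) t) \<longlonglongrightarrow> E t" "\<forall>n. f n t * q n t = 1" "cmod (E t) = exp (l t)"
      have E0: "E t \<noteq> 0" using *(3) by auto
      have "q n t = inverse (f n t)" for n
        using *(2) by (metis inverse_unique)
      moreover have "(\<lambda>n. inverse (f (r n) t) * E t) \<longlonglongrightarrow> inverse (E t) * E t"
        using *(1) E0 by (intro tendsto_intros)
      ultimately have "(\<lambda>n. q (r n) t * E t) \<longlonglongrightarrow> inverse (E t) * E t" by simp
      then show "(\<lambda>n. q (r n) t * E t) \<longlonglongrightarrow> 1" using E0 by simp
    qed
  qed
qed

section \<open>The metric of a symbol\<close>

lemma nsq_nn_integral:
  assumes [measurable]: "f \<in> borel_measurable circle" and le: "AE t in circle. (cmod (f t))\<^sup>2 \<le> g t"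
    and g: "(\<integral>\<^sup>+t. ennreal (g t) \<partial>circle) < ennreal e"
  shows "f \<in> L2" "nsq f < e"
proof -
  have lt: "(\<integral>\<^sup>+t. ennreal ((cmod (f t))\<^sup>2) \<partial>circle) < ennreal e"
    using le by (intro le_less_trans[OF nn_integral_mono_AE g]) (auto elim!: eventually_mono intro: ennreal_leI)
  have "integrable circle (\<lambda>t. (cmod (f t))\<^sup>2)"
    by (rule integrableI_bounded) (use order.strict_trans[OF lt] in auto)
  then show "f \<in> L2" by (simp add: L2_def)
  have "ennreal (nsq f) = (\<integral>\<^sup>+t. ennreal ((cmod (f t))\<^sup>2) \<partial>circle)"
    unfolding nsq_eq by (rule nn_integral_eq_integral[symmetric]) (auto intro: L2_square_integrable \<open>f \<in> L2\<close>)
  with lt have "ennreal (nsq f) < ennreal e" by simp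
  then show "nsq f < e"
    using ennreal_less_iff[OF L2.sq_nonneg[OF \<open>f \<in> L2\<close>]] by blast
qed

text \<open>Completing the square in either component. The first version describes the given space,
  the second is what turns into the first one for the dual data.\<close>

lemma metric_form_eq:
  assumes "(cmod e)\<^sup>2 = 1 - (cmod (S t))\<^sup>2"
  shows "metric_form S (f, f2) (g, g2) t
    = (e * f t) * cnj (e * g t) + (S t * f t + f2 t) * cnj (S t * g t + g2 t)" (is ?A)
    and "metric_form S (f, f2) (g, g2) t
    = (cnj e * f2 t) * cnj (cnj e * g2 t) + (f t + cnj (S t) * f2 t) * cnj (g t + cnj (S t) * g2 t)" (is ?B)
proof -
  have "e * cnj e = of_real (1 - (cmod (S t))\<^sup>2)" using assms by (simp only: mult_cnj_cmod)
  then have e: "e * cnj e = 1 - S t * cnj (S t)" by (simp only: mult_cnj_cmod of_real_diff of_real_1)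
  have a: "(e * f t) * cnj (e * g t) = (e * cnj e) * (f t * cnj (g t))"
    "(cnj e * f2 t) * cnj (cnj e * g2 t) = (e * cnj e) * (f2 t * cnj (g2 t))" by (simp_all add: mult_ac)
  show ?A ?B
    unfolding metric_form_def a unfolding e by (simp_all add: algebra_simps)
qed

lemma metric_form_self:
  assumes "(cmod e)\<^sup>2 = 1 - (cmod (S t))\<^sup>2"
  shows "Re (metric_form S (f, f2) (f, f2) t) = (cmod (e * f t))\<^sup>2 + (cmod (S t * f t + f2 t))\<^sup>2"
    and "Re (metric_form S (f, f2) (f, f2) t) = (cmod (cnj e * f2 t))\<^sup>2 + (cmod (f t + cnj (S t) * f2 t))\<^sup>2"
proof -
  have "metric_form S (f, f2) (f, f2) t = of_real ((cmod (e * f t))\<^sup>2 + (cmod (S t * f t + f2 t))\<^sup>2)"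
    by (subst metric_form_eq(1)[of e S t f f2 f f2, OF assms]) (simp only: mult_cnj_cmod of_real_add)
  then show "Re (metric_form S (f, f2) (f, f2) t) = (cmod (e * f t))\<^sup>2 + (cmod (S t * f t + f2 t))\<^sup>2"
    by (simp only: Re_complex_of_real)
  have "metric_form S (f, f2) (f, f2) t = of_real ((cmod (cnj e * f2 t))\<^sup>2 + (cmod (f t + cnj (S t) * f2 t))\<^sup>2)"
    by (subst metric_form_eq(2)[of e S t f f2 f f2, OF assms]) (simp only: mult_cnj_cmod of_real_add)
  then show "Re (metric_form S (f, f2) (f, f2) t) = (cmod (cnj e * f2 t))\<^sup>2 + (cmod (f t + cnj (S t) * f2 t))\<^sup>2"
    by (simp only: Re_complex_of_real)
qed

text \<open>The sequence p encodes that E is outer: p n is bounded analytic and p n * E tends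
  boundedly to 1, so division by E can be approximated by multiplication with elements of
  \<open>H2\<close>.\<close>

locale outer_symbol =
  fixes S E :: "complex \<Rightarrow> complex" and p :: "nat \<Rightarrow> complex \<Rightarrow> complex"
  assumes S_measurable [measurable]: "S \<in> borel_measurable circle"
    and E_H2: "E \<in> H2"
    and E_S: "AE t in circle. (cmod (E t))\<^sup>2 = 1 - (cmod (S t))\<^sup>2"
    and E_nonzero: "AE t in circle. E t \<noteq> 0"
    and p_H2: "p n \<in> H2"
    and p_bounded: "\<exists>C. AE t in circle. cmod (p n t) \<le> C"
    and p_E: "AE t in circle. cmod (p n t * E t) \<le> 1"
    and p_E_tendsto: "AE t in circle. (\<lambda>n. p n t * E t) \<longlonglongrightarrow> 1"
begin

lemma E_measurable [measurable]: "E \<in> borel_measurable circle"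
  by (rule L2_measurable[OF H2_L2[OF E_H2]])

lemma E_le_1: "AE t in circle. cmod (E t) \<le> 1"
  using E_S by eventually_elim (simp add: abs_square_le_1[of "cmod _", simplified] power2_le_imp_le)

lemma S_le_1: "AE t in circle. cmod (S t) \<le> 1"
  using E_S
proof eventually_elim
  fix t assume "(cmod (E t))\<^sup>2 = 1 - (cmod (S t))\<^sup>2"
  then have "(cmod (S t))\<^sup>2 \<le> 1\<^sup>2" using zero_le_power2[of "cmod (E t)"] by simp
  then show "cmod (S t) \<le> 1" by (rule power2_le_imp_le) simp
qed

text \<open>p n * g = (p n * E) * h lies in \<open>H2\<close>, is dominated by |h| and tends to
  h.\<close>

theorem Smirnov:
  assumes g: "g \<in> H2" and h: "h \<in> L2" and eq: "AE t in circle. g t = E t * h t"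
  shows "h \<in> H2"
proof -
  note [measurable] = L2_measurable[OF h] L2_measurable[OF H2_L2[OF g]] L2_measurable[OF H2_L2[OF p_H2]]
  let ?s = "\<lambda>n t. p n t * g t"
  have s: "?s n \<in> H2" for n
    using p_bounded[of n] H2_mult(1)[OF g p_H2] by blast
  have b: "AE t in circle. cmod (?s n t) \<le> cmod (h t)" for n
    using p_E[of n] eq
  proof eventually_elim
    fix t assume *: "cmod (p n t * E t) \<le> 1" "g t = E t * h t"
    have "cmod (?s n t) = cmod (p n t * E t) * cmod (h t)" using *(2) by (simp add: norm_mult)
    also have "\<dots> \<le> 1 * cmod (h t)" using *(1) by (rule mult_right_mono) simp
    finally show "cmod (?s n t) \<le> cmod (h t)" by simp
  qed
  have c: "AE t in circle. (\<lambda>n. ?s n t) \<longlonglongrightarrow> h t"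
    using p_E_tendsto eq
  proof eventually_elim
    fix t assume *: "(\<lambda>n. p n t * E t) \<longlonglongrightarrow> 1" "g t = E t * h t"
    have "(\<lambda>n. (p n t * E t) * h t) \<longlonglongrightarrow> 1 * h t" by (intro tendsto_intros *(1))
    then show "(\<lambda>n. ?s n t) \<longlonglongrightarrow> h t" using *(2) by (simp add: mult_ac)
  qed
  have "(\<lambda>n. L2_dist (?s n) h) \<longlonglongrightarrow> 0"
    by (rule L2_dominated_tendsto(3)[OF _ _ h b c]) measurable
  then show ?thesis by (rule H2_closed[OF s h])
qed

lemma E_mult_L2: "f \<in> L2 \<Longrightarrow> (\<lambda>t. E t * f t) \<in> L2"
  using L2_mult_bounded[OF _ E_measurable E_le_1] .

lemma S_mult_L2: "f \<in> L2 \<Longrightarrow> (\<lambda>t. S t * f t) \<in> L2"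
  using L2_mult_bounded[OF _ S_measurable S_le_1] .

lemma cnj_E_mult_L2: "f \<in> L2 \<Longrightarrow> (\<lambda>t. cnj (E t) * f t) \<in> L2"
  using L2_mult_bounded[of f "\<lambda>t. cnj (E t)" 1] E_le_1 by simp

text \<open>Conjugation followed by one shift exchanges \<open>H2_minus\<close> and
  \<open>H2\<close>; multiplication by \<open>cnj E\<close> and Smirnov's theorem are transferred to
  \<open>H2_minus\<close> this way.\<close>

lemma H2_minus_cnj:
  assumes "f \<in> H2_minus"
  shows "(\<lambda>t. t powi (-1) * cnj (f t)) \<in> H2"
proof (rule H2_I)
  note f = H2_minus_L2[OF assms]
  note [measurable] = L2_measurable[OF f]
  show "(\<lambda>t. t powi (-1) * cnj (f t)) \<in> L2"
    by (intro L2_powi_mult L2_cnj f)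
  show "fourier_coeff (\<lambda>t. t powi (-1) * cnj (f t)) n = 0" if "n < 0" for n
  proof -
    have "fourier_coeff (\<lambda>t. t powi (-1) * cnj (f t)) n = fourier_coeff (\<lambda>t. cnj (f t)) (n - (-1))"
      by (rule fourier_coeff_shift) measurable
    also have "\<dots> = cnj (fourier_coeff f (- (n - (-1))))"
      by (rule fourier_coeff_cnj) measurable
    finally show ?thesis using assms that by (simp add: H2_minus_iff)
  qed
qed

lemma H2_cnj:
  assumes "(\<lambda>t. t powi (-1) * cnj (f t)) \<in> H2" "f \<in> L2"
  shows "f \<in> H2_minus"
  unfolding H2_minus_iff
proof (intro conjI allI impI)
  fix n :: int assume "n \<ge> 0"
  note [measurable] = L2_measurable[OF assms(2)]
  have "0 = fourier_coeff (\<lambda>t. t powi (-1) * cnj (f t)) (- n - 1)"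
    using H2_coeff[OF assms(1)] \<open>n \<ge> 0\<close> by simp
  also have "\<dots> = fourier_coeff (\<lambda>t. cnj (f t)) (- n - 1 - (-1))"
    by (rule fourier_coeff_shift) measurable
  also have "\<dots> = cnj (fourier_coeff f n)"
    by (subst fourier_coeff_cnj) auto
  finally show "fourier_coeff f n = 0" by simp
qed fact

lemma cnj_E_mult_H2_minus:
  assumes "f \<in> H2_minus"
  shows "(\<lambda>t. cnj (E t) * f t) \<in> H2_minus"
proof (rule H2_cnj[OF _ cnj_E_mult_L2[OF H2_minus_L2[OF assms]]])
  have "(\<lambda>t. E t * (t powi (-1) * cnj (f t))) \<in> H2"
    by (rule H2_mult(1)[OF H2_minus_cnj[OF assms] E_H2 E_le_1])
  then show "(\<lambda>t. t powi (-1) * cnj (cnj (E t) * f t)) \<in> H2"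
    by (simp add: mult_ac)
qed

text \<open>The explicit description of the closure; agreement with \<open>L2_pairs\<close> is shown
  in \<open>L2_pairs_iff\<close>. Neither component has to be in \<open>L2\<close>, only the
  combinations that occur in the metric.\<close>

definition pair :: "(complex \<Rightarrow> complex) \<Rightarrow> (complex \<Rightarrow> complex) \<Rightarrow> bool" where
  "pair f f2 \<longleftrightarrow> f \<in> borel_measurable circle \<and> f2 \<in> borel_measurable circle \<and>
     (\<lambda>t. E t * f t) \<in> L2 \<and> (\<lambda>t. S t * f t + f2 t) \<in> H2 \<and> (\<lambda>t. cnj (E t) * f2 t) \<in> H2_minus"

lemma pair_D:
  assumes "pair f f2"
  shows "f \<in> borel_measurable circle" "f2 \<in> borel_measurable circle" "(\<lambda>t. E t * f t) \<in> L2"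
    "(\<lambda>t. S t * f t + f2 t) \<in> H2" "(\<lambda>t. cnj (E t) * f2 t) \<in> H2_minus"
  using assms by (auto simp: pair_def)

lemma pair_lin:
  assumes "pair f f2" "pair g g2"
  shows "pair (\<lambda>t. f t + c * g t) (\<lambda>t. f2 t + c * g2 t)"
proof -
  note [measurable] = pair_D(1,2)[OF assms(1)] pair_D(1,2)[OF assms(2)]
  show ?thesis
    unfolding pair_def
    using L2_lin[OF pair_D(3)[OF assms(1)] pair_D(3)[OF assms(2)], of c]
      H2_lin[OF pair_D(4)[OF assms(1)] pair_D(4)[OF assms(2)], of c]
      H2_minus_lin[OF pair_D(5)[OF assms(1)] pair_D(5)[OF assms(2)], of c]
    by (simp add: algebra_simps)
qed

text \<open>The difference d of two companions is in \<open>H2\<close>, while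
  \<open>cnj E * d\<close> is in \<open>H2_minus\<close>. Smirnov's theorem, applied to the
  conjugate, removes \<open>cnj E\<close>, so d lies in both spaces and vanishes.\<close>

lemma pair_unique:
  assumes "pair f f2" "pair f f2'"
  shows "AE t in circle. f2 t = f2' t"
proof -
  define d where "d t = f2 t - f2' t" for t
  have "pair (\<lambda>t. f t + (-1) * f t) (\<lambda>t. f2 t + (-1) * f2' t)"
    by (rule pair_lin[OF assms])
  then have p: "pair (\<lambda>t. 0) d" by (simp add: d_def[abs_def])
  have dH: "d \<in> H2" using pair_D(4)[OF p] by simp
  note [measurable] = pair_D(2)[OF p]
  have "(\<lambda>t. t powi (-1) * cnj (d t)) \<in> H2"
  proof (rule Smirnov[OF H2_minus_cnj[OF pair_D(5)[OF p]]])
    show "(\<lambda>t. t powi (-1) * cnj (d t)) \<in> L2" by (intro L2_powi_mult L2_cnj H2_L2[OF dH])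
    show "AE t in circle. t powi (-1) * cnj (cnj (E t) * d t) = E t * (t powi (-1) * cnj (d t))"
      by (simp add: mult_ac)
  qed
  from H2_Int_H2_minus[OF dH H2_cnj[OF this H2_L2[OF dH]]] show ?thesis
    by eventually_elim (simp add: d_def)
qed

definition ip :: "(complex \<Rightarrow> complex) \<times> (complex \<Rightarrow> complex) \<Rightarrow> (complex \<Rightarrow> complex) \<times> (complex \<Rightarrow> complex) \<Rightarrow> complex" where
  "ip x y = L2_inner (\<lambda>t. E t * fst x t) (\<lambda>t. E t * fst y t)
     + L2_inner (\<lambda>t. S t * fst x t + snd x t) (\<lambda>t. S t * fst y t + snd y t)"

lemma integral_metric_form:
  assumes "pair f f2" "pair g g2"
  shows "(LINT t|circle. metric_form S (f, f2) (g, g2) t) = ip (f, f2) (g, g2)"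
proof -
  note [measurable] = pair_D(1,2)[OF assms(1)] pair_D(1,2)[OF assms(2)]
  have "(LINT t|circle. metric_form S (f, f2) (g, g2) t)
    = (LINT t|circle. (E t * f t) * cnj (E t * g t) + (S t * f t + f2 t) * cnj (S t * g t + g2 t))"
  proof (rule integral_cong_AE)
    show "(\<lambda>t. metric_form S (f, f2) (g, g2) t) \<in> borel_measurable circle"
      unfolding metric_form_def fst_conv snd_conv by measurable
    show "AE t in circle. metric_form S (f, f2) (g, g2) t
        = (E t * f t) * cnj (E t * g t) + (S t * f t + f2 t) * cnj (S t * g t + g2 t)"
      using E_S by eventually_elim (rule metric_form_eq(1))
  qed measurable
  also have "\<dots> = ip (f, f2) (g, g2)"
    unfolding ip_def L2_inner_def fst_conv snd_conv
    by (intro Bochner_Integration.integral_add integrable_L2_inner H2_L2 pair_D(3)[OF assms(1)]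
        pair_D(3)[OF assms(2)] pair_D(4)[OF assms(1)] pair_D(4)[OF assms(2)])
  finally show ?thesis .
qed

lemma cnj_E_snd_le:
  assumes "(cmod (E t))\<^sup>2 = 1 - (cmod (S t))\<^sup>2"
  shows "(cmod (cnj (E t) * f2 t))\<^sup>2 \<le> (cmod (E t * f t))\<^sup>2 + (cmod (S t * f t + f2 t))\<^sup>2"
    "(cmod (f t + cnj (S t) * f2 t))\<^sup>2 \<le> (cmod (E t * f t))\<^sup>2 + (cmod (S t * f t + f2 t))\<^sup>2"
proof -
  have "(cmod (E t * f t))\<^sup>2 + (cmod (S t * f t + f2 t))\<^sup>2 = (cmod (cnj (E t) * f2 t))\<^sup>2 + (cmod (f t + cnj (S t) * f2 t))\<^sup>2"
    using metric_form_self[of "E t" S t f f2, OF assms] by simp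
  then show "(cmod (cnj (E t) * f2 t))\<^sup>2 \<le> (cmod (E t * f t))\<^sup>2 + (cmod (S t * f t + f2 t))\<^sup>2"
    "(cmod (f t + cnj (S t) * f2 t))\<^sup>2 \<le> (cmod (E t * f t))\<^sup>2 + (cmod (S t * f t + f2 t))\<^sup>2"
    by (auto simp: zero_le_power2)
qed

lemma pair_add_cnj_S_L2:
  assumes "pair f f2"
  shows "(\<lambda>t. f t + cnj (S t) * f2 t) \<in> L2"
proof (rule L2_I)
  note [measurable] = pair_D(1,2)[OF assms]
  show "(\<lambda>t. f t + cnj (S t) * f2 t) \<in> borel_measurable circle" by measurable
  show "integrable circle (\<lambda>t. (cmod (E t * f t))\<^sup>2 + (cmod (S t * f t + f2 t))\<^sup>2)"
    by (intro Bochner_Integration.integrable_add L2_square_integrable pair_D(3)[OF assms] H2_L2[OF pair_D(4)[OF assms]])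
  show "AE t in circle. (cmod (f t + cnj (S t) * f2 t))\<^sup>2 \<le> (cmod (E t * f t))\<^sup>2 + (cmod (S t * f t + f2 t))\<^sup>2"
    using E_S by eventually_elim (rule cnj_E_snd_le(2))
qed

lemma ip_eq':
  assumes "pair f f2" "pair g g2"
  shows "ip (f, f2) (g, g2) = L2_inner (\<lambda>t. cnj (E t) * f2 t) (\<lambda>t. cnj (E t) * g2 t)
     + L2_inner (\<lambda>t. f t + cnj (S t) * f2 t) (\<lambda>t. g t + cnj (S t) * g2 t)"
proof -
  note [measurable] = pair_D(1,2)[OF assms(1)] pair_D(1,2)[OF assms(2)]
  have "ip (f, f2) (g, g2) = (LINT t|circle. metric_form S (f, f2) (g, g2) t)"
    by (rule integral_metric_form[OF assms, symmetric])
  also have "\<dots> = (LINT t|circle. (cnj (E t) * f2 t) * cnj (cnj (E t) * g2 t)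
      + (f t + cnj (S t) * f2 t) * cnj (g t + cnj (S t) * g2 t))"
  proof (rule integral_cong_AE)
    show "(\<lambda>t. metric_form S (f, f2) (g, g2) t) \<in> borel_measurable circle"
      unfolding metric_form_def fst_conv snd_conv by measurable
    show "AE t in circle. metric_form S (f, f2) (g, g2) t = (cnj (E t) * f2 t) * cnj (cnj (E t) * g2 t)
      + (f t + cnj (S t) * f2 t) * cnj (g t + cnj (S t) * g2 t)"
      using E_S by eventually_elim (rule metric_form_eq(2))
  qed measurable
  also have "\<dots> = L2_inner (\<lambda>t. cnj (E t) * f2 t) (\<lambda>t. cnj (E t) * g2 t)
     + L2_inner (\<lambda>t. f t + cnj (S t) * f2 t) (\<lambda>t. g t + cnj (S t) * g2 t)"
    unfolding L2_inner_def
    by (intro Bochner_Integration.integral_add integrable_L2_inner pair_add_cnj_S_L2 assms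
        H2_minus_L2[OF pair_D(5)[OF assms(1)]] H2_minus_L2[OF pair_D(5)[OF assms(2)]])
  finally show ?thesis .
qed

text \<open>The form is read as (f + cnj S f2) against h plus (S f + f2) against q. The latter term
  is an element of \<open>H2\<close> against one of \<open>H2_minus\<close>, so a generator sees
  only f + cnj S f2.\<close>

lemma ip_generator:
  assumes "pair f f2" "h \<in> L2" "q \<in> H2_minus" "(\<lambda>t. S t * h t + q t) \<in> H2"
  shows "pair h q" "ip (f, f2) (h, q) = L2_inner (\<lambda>t. f t + cnj (S t) * f2 t) h"
proof -
  note [measurable] = pair_D(1,2)[OF assms(1)] L2_measurable[OF assms(2)] L2_measurable[OF H2_minus_L2[OF assms(3)]]
  show hq: "pair h q"
    unfolding pair_def using assms E_mult_L2 cnj_E_mult_H2_minus by auto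
  have 0: "L2_inner (\<lambda>t. S t * f t + f2 t) q = 0"
    by (rule H2_orthogonal'[OF assms(3) pair_D(4)[OF assms(1)]])
  have "L2_inner (\<lambda>t. f t + cnj (S t) * f2 t) h + L2_inner (\<lambda>t. S t * f t + f2 t) q
     = (LINT t|circle. (f t + cnj (S t) * f2 t) * cnj (h t) + (S t * f t + f2 t) * cnj (q t))"
    unfolding L2_inner_def
    by (intro Bochner_Integration.integral_add[symmetric] integrable_L2_inner pair_add_cnj_S_L2[OF assms(1)]
        assms(2) H2_L2[OF pair_D(4)[OF assms(1)]] H2_minus_L2[OF assms(3)])
  also have "\<dots> = (LINT t|circle. metric_form S (f, f2) (h, q) t)"
    by (simp add: metric_form_def)
  also have "\<dots> = ip (f, f2) (h, q)"
    by (rule integral_metric_form[OF assms(1) hq])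
  finally show "ip (f, f2) (h, q) = L2_inner (\<lambda>t. f t + cnj (S t) * f2 t) h"
    using 0 by simp
qed

end

section \<open>Completeness of the data space\<close>

lemma nonneg_comparison_summable_on:
  fixes f g :: "'a \<Rightarrow> real"
  assumes "g summable_on A" "\<And>x. x \<in> A \<Longrightarrow> 0 \<le> f x" "\<And>x. x \<in> A \<Longrightarrow> f x \<le> g x"
  shows "f summable_on A"
proof (rule nonneg_bdd_above_summable_on)
  show "bdd_above (sum f ` {F. F \<subseteq> A \<and> finite F})"
  proof (rule bdd_aboveI2)
    fix F assume F: "F \<in> {F. F \<subseteq> A \<and> finite F}"
    have "sum f F \<le> sum g F" using F assms(3) by (intro sum_mono) auto
    also have "\<dots> \<le> infsum g A"
    proof (rule finite_sum_le_infsum[OF assms(1)])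
      show "0 \<le> g x" if "x \<in> A - F" for x
        using that assms(2)[of x] assms(3)[of x] by auto
    qed (use F in auto)
    finally show "sum f F \<le> infsum g A" .
  qed
qed (use assms in auto)

section \<open>Square-summable values on the support\<close>

definition weighted_l2 :: "complex set \<Rightarrow> (complex \<Rightarrow> real) \<Rightarrow> (complex \<Rightarrow> complex) \<Rightarrow> bool" where
  "weighted_l2 Z m f \<longleftrightarrow> (\<lambda>w. (cmod (f w))\<^sup>2 * m w) summable_on Z"

definition weighted_inner :: "complex set \<Rightarrow> (complex \<Rightarrow> real) \<Rightarrow> (complex \<Rightarrow> complex) \<Rightarrow> (complex \<Rightarrow> complex) \<Rightarrow> complex" where
  "weighted_inner Z m f g = (\<Sum>\<^sub>\<infinity>w\<in>Z. f w * cnj (g w) * of_real (m w))"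

context
  fixes Z :: "complex set" and m :: "complex \<Rightarrow> real"
  assumes m: "\<And>w. w \<in> Z \<Longrightarrow> 0 \<le> m w"
begin

lemma weighted_l2_lin:
  assumes "weighted_l2 Z m f" "weighted_l2 Z m g"
  shows "weighted_l2 Z m (\<lambda>w. f w + c * g w)"
  unfolding weighted_l2_def
proof (rule nonneg_comparison_summable_on)
  show "(\<lambda>w. 2 * ((cmod (f w))\<^sup>2 * m w) + 2 * (cmod c)\<^sup>2 * ((cmod (g w))\<^sup>2 * m w)) summable_on Z"
    using assms unfolding weighted_l2_def by (intro summable_on_add summable_on_cmult_right)
  fix w assume w: "w \<in> Z"
  have "(cmod (f w + c * g w))\<^sup>2 \<le> (cmod (f w) + cmod (c * g w))\<^sup>2"
    by (intro power_mono norm_triangle_ineq norm_ge_zero)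
  also have "\<dots> \<le> 2 * (cmod (f w))\<^sup>2 + 2 * (cmod (c * g w))\<^sup>2"
    using zero_le_power2[of "cmod (f w) - cmod (c * g w)"] by (simp add: power2_sum power2_diff)
  finally have "(cmod (f w + c * g w))\<^sup>2 * m w \<le> (2 * (cmod (f w))\<^sup>2 + 2 * (cmod (c * g w))\<^sup>2) * m w"
    using m[OF w] by (rule mult_right_mono)
  then show "(cmod (f w + c * g w))\<^sup>2 * m w \<le> 2 * ((cmod (f w))\<^sup>2 * m w) + 2 * (cmod c)\<^sup>2 * ((cmod (g w))\<^sup>2 * m w)"
    by (simp add: norm_mult power_mult_distrib algebra_simps)
qed (use m in auto)

lemma weighted_inner_summable:
  assumes "weighted_l2 Z m f" "weighted_l2 Z m g"
  shows "(\<lambda>w. f w * cnj (g w) * of_real (m w)) summable_on Z"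
proof (rule abs_summable_summable, rule nonneg_comparison_summable_on)
  show "(\<lambda>w. (cmod (f w))\<^sup>2 * m w + (cmod (g w))\<^sup>2 * m w) summable_on Z"
    using assms unfolding weighted_l2_def by (rule summable_on_add)
  fix w assume w: "w \<in> Z"
  have "0 \<le> cmod (f w) * cmod (g w)" by simp
  moreover have "2 * (cmod (f w) * cmod (g w)) \<le> (cmod (f w))\<^sup>2 + (cmod (g w))\<^sup>2"
    using zero_le_power2[of "cmod (f w) - cmod (g w)"] by (simp add: power2_diff)
  ultimately have "cmod (f w) * cmod (g w) \<le> (cmod (f w))\<^sup>2 + (cmod (g w))\<^sup>2" by linarith
  then have "cmod (f w) * cmod (g w) * m w \<le> ((cmod (f w))\<^sup>2 + (cmod (g w))\<^sup>2) * m w"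
    using m[OF w] by (rule mult_right_mono)
  then show "norm (f w * cnj (g w) * of_real (m w)) \<le> (cmod (f w))\<^sup>2 * m w + (cmod (g w))\<^sup>2 * m w"
    using m[OF w] by (simp add: norm_mult algebra_simps)
qed auto

lemma weighted_inner_lin:
  assumes "weighted_l2 Z m f" "weighted_l2 Z m g" "weighted_l2 Z m h"
  shows "weighted_inner Z m (\<lambda>w. f w + c * g w) h = weighted_inner Z m f h + c * weighted_inner Z m g h"
proof -
  have "weighted_inner Z m (\<lambda>w. f w + c * g w) h
     = (\<Sum>\<^sub>\<infinity>w\<in>Z. f w * cnj (h w) * of_real (m w) + c * (g w * cnj (h w) * of_real (m w)))"
    unfolding weighted_inner_def by (rule infsum_cong) (simp add: algebra_simps)
  also have "\<dots> = weighted_inner Z m f h + c * weighted_inner Z m g h"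
    unfolding weighted_inner_def
    by (subst infsum_add[OF weighted_inner_summable[OF assms(1,3)]
          summable_on_cmult_right[OF weighted_inner_summable[OF assms(2,3)]]])
       (simp add: infsum_cmult_right')
  finally show ?thesis .
qed

lemma weighted_inner_cnj:
  assumes "weighted_l2 Z m f" "weighted_l2 Z m g"
  shows "weighted_inner Z m g f = cnj (weighted_inner Z m f g)"
proof -
  have "((\<lambda>w. cnj (f w * cnj (g w) * of_real (m w))) has_sum cnj (weighted_inner Z m f g)) Z"
    unfolding weighted_inner_def
    by (rule has_sum_bounded_linear[OF bounded_linear_cnj has_sum_infsum[OF weighted_inner_summable[OF assms]]])
  then show ?thesis
    unfolding weighted_inner_def[of _ _ g f] by (intro infsumI) (simp add: mult_ac)
qed

lemma weighted_inner_self: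
  assumes "weighted_l2 Z m f"
  shows "weighted_inner Z m f f = of_real (\<Sum>\<^sub>\<infinity>w\<in>Z. (cmod (f w))\<^sup>2 * m w)"
proof -
  have "((\<lambda>w. of_real ((cmod (f w))\<^sup>2 * m w)) has_sum complex_of_real (\<Sum>\<^sub>\<infinity>w\<in>Z. (cmod (f w))\<^sup>2 * m w)) Z"
    by (rule has_sum_of_real) (use assms in \<open>simp add: weighted_l2_def\<close>)
  then show ?thesis
    unfolding weighted_inner_def mult_cnj_cmod of_real_mult[symmetric] by (rule infsumI)
qed

text \<open>Positive masses make the values Cauchy at every point. The bounds pass to the limit on
  finite subsets first, and from there to the infinite sum.\<close>

lemma weighted_l2_complete:
  assumes s: "\<And>n. weighted_l2 Z m (s n)" and pos: "\<And>w. w \<in> Z \<Longrightarrow> 0 < m w"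
    and Cau: "\<And>e. e > 0 \<Longrightarrow> \<exists>N. \<forall>i\<ge>N. \<forall>j\<ge>N. (\<Sum>\<^sub>\<infinity>w\<in>Z. (cmod (s i w - s j w))\<^sup>2 * m w) < e"
  obtains v where "weighted_l2 Z m v" "(\<lambda>n. \<Sum>\<^sub>\<infinity>w\<in>Z. (cmod (s n w - v w))\<^sup>2 * m w) \<longlonglongrightarrow> 0"
proof -
  have d: "(\<lambda>w. (cmod (s i w - s j w))\<^sup>2 * m w) summable_on Z" for i j
    using weighted_l2_lin[OF s[of i] s[of j], of "-1"] by (simp add: weighted_l2_def)
  have fin: "(\<Sum>w\<in>F. (cmod (s i w - s j w))\<^sup>2 * m w) \<le> (\<Sum>\<^sub>\<infinity>w\<in>Z. (cmod (s i w - s j w))\<^sup>2 * m w)"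
    if "finite F" "F \<subseteq> Z" for F i j
    by (rule finite_sum_le_infsum[OF d that]) (use m in auto)
  have "Cauchy (\<lambda>n. s n w)" if w: "w \<in> Z" for w
  proof (rule CauchyI)
    fix e :: real assume "e > 0"
    then have "e\<^sup>2 * m w > 0" using pos[OF w] by simp
    from Cau[OF this] obtain N where N: "\<forall>i\<ge>N. \<forall>j\<ge>N. (\<Sum>\<^sub>\<infinity>w\<in>Z. (cmod (s i w - s j w))\<^sup>2 * m w) < e\<^sup>2 * m w"
      by blast
    have "norm (s i w - s j w) < e" if "i \<ge> N" "j \<ge> N" for i j
    proof -
      have "(\<Sum>\<^sub>\<infinity>w\<in>Z. (cmod (s i w - s j w))\<^sup>2 * m w) < e\<^sup>2 * m w" using N that by blast
      with fin[of "{w}" i j] w have "(cmod (s i w - s j w))\<^sup>2 * m w < e\<^sup>2 * m w" by simp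
      then have "(cmod (s i w - s j w))\<^sup>2 < e\<^sup>2" using pos[OF w] by (simp add: mult_less_cancel_right)
      then show ?thesis by (rule power2_less_imp_less) (use \<open>e > 0\<close> in simp)
    qed
    then show "\<exists>M. \<forall>i\<ge>M. \<forall>j\<ge>M. norm (s i w - s j w) < e" by blast
  qed
  then have conv: "(\<lambda>n. s n w) \<longlonglongrightarrow> lim (\<lambda>n. s n w)" if "w \<in> Z" for w
    using that by (intro convergent_LIMSEQ_iff[THEN iffD1] Cauchy_convergent)
  define v where "v w = lim (\<lambda>n. s n w)" for w
  have lim: "(\<lambda>n. s n w) \<longlonglongrightarrow> v w" if "w \<in> Z" for w
    using conv[OF that] by (simp add: v_def)
  have small: "\<exists>N. \<forall>i\<ge>N. (\<lambda>w. (cmod (s i w - v w))\<^sup>2 * m w) summable_on Z \<and> (\<Sum>\<^sub>\<infinity>w\<in>Z. (cmod (s i w - v w))\<^sup>2 * m w) \<le> e" if e: "e > 0" for e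
  proof -
    obtain N where N: "\<forall>i\<ge>N. \<forall>j\<ge>N. (\<Sum>\<^sub>\<infinity>w\<in>Z. (cmod (s i w - s j w))\<^sup>2 * m w) < e"
      using Cau[OF e] by blast
    have le: "(\<Sum>w\<in>F. (cmod (s i w - v w))\<^sup>2 * m w) \<le> e" if F: "finite F" "F \<subseteq> Z" and i: "i \<ge> N" for F i
    proof (rule LIMSEQ_le_const2)
      show "(\<lambda>j. \<Sum>w\<in>F. (cmod (s i w - s j w))\<^sup>2 * m w) \<longlonglongrightarrow> (\<Sum>w\<in>F. (cmod (s i w - v w))\<^sup>2 * m w)"
        using F by (intro tendsto_intros lim) auto
      show "\<exists>N. \<forall>j\<ge>N. (\<Sum>w\<in>F. (cmod (s i w - s j w))\<^sup>2 * m w) \<le> e"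
      proof (intro exI[of _ N] allI impI)
        fix j assume "N \<le> j"
        then have "(\<Sum>\<^sub>\<infinity>w\<in>Z. (cmod (s i w - s j w))\<^sup>2 * m w) < e" using N i by blast
        with fin[OF F, of i j] show "(\<Sum>w\<in>F. (cmod (s i w - s j w))\<^sup>2 * m w) \<le> e" by linarith
      qed
    qed
    have "(\<lambda>w. (cmod (s i w - v w))\<^sup>2 * m w) summable_on Z" if "i \<ge> N" for i
      by (rule nonneg_bdd_above_summable_on) (use m le that in \<open>auto intro!: bdd_aboveI2[where M = e]\<close>)
    moreover have "(\<Sum>\<^sub>\<infinity>w\<in>Z. (cmod (s i w - v w))\<^sup>2 * m w) \<le> e" if "i \<ge> N" for i
      by (rule infsum_le_finite_sums[OF calculation[OF that] le[OF _ _ that]])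
    ultimately show ?thesis by blast
  qed
  obtain N where "(\<lambda>w. (cmod (s N w - v w))\<^sup>2 * m w) summable_on Z"
    using small[of 1] by auto
  then have "weighted_l2 Z m (\<lambda>w. s N w - v w)" by (simp add: weighted_l2_def)
  from weighted_l2_lin[OF s[of N] this, of "-1"] have v: "weighted_l2 Z m v" by simp
  have "(\<lambda>n. \<Sum>\<^sub>\<infinity>w\<in>Z. (cmod (s n w - v w))\<^sup>2 * m w) \<longlonglongrightarrow> 0"
  proof (rule LIMSEQ_I)
    fix e :: real assume e: "e > 0"
    then obtain N where N: "\<And>i. i \<ge> N \<Longrightarrow> (\<Sum>\<^sub>\<infinity>w\<in>Z. (cmod (s i w - v w))\<^sup>2 * m w) \<le> e / 2"
      using small[of "e / 2"] by auto
    have "norm ((\<Sum>\<^sub>\<infinity>w\<in>Z. (cmod (s i w - v w))\<^sup>2 * m w) - 0) < e" if "i \<ge> N" for i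
    proof -
      have "0 \<le> (\<Sum>\<^sub>\<infinity>w\<in>Z. (cmod (s i w - v w))\<^sup>2 * m w)" by (rule infsum_nonneg) (use m in auto)
      then show ?thesis using N[OF that] e by simp
    qed
    then show "\<exists>N. \<forall>i\<ge>N. norm ((\<Sum>\<^sub>\<infinity>w\<in>Z. (cmod (s i w - v w))\<^sup>2 * m w) - 0) < e" by blast
  qed
  with v show ?thesis by (rule that)
qed

end

lemma AE_circle_notin_ball:
  assumes "Z \<subseteq> ball 0 1"
  shows "AE t in circle. t \<notin> Z"
  using AE_circle_norm by eventually_elim (use assms in auto)

context outer_symbol
begin

lemma nsq_cnj_E_le:
  assumes [measurable]: "f \<in> borel_measurable circle" "f2 \<in> borel_measurable circle"
    and 1: "(\<lambda>t. E t * f t) \<in> L2" and 2: "(\<lambda>t. S t * f t + f2 t) \<in> L2"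
  shows "(\<lambda>t. cnj (E t) * f2 t) \<in> L2"
    "nsq (\<lambda>t. cnj (E t) * f2 t) \<le> nsq (\<lambda>t. E t * f t) + nsq (\<lambda>t. S t * f t + f2 t)"
proof -
  have le: "AE t in circle. (cmod (cnj (E t) * f2 t))\<^sup>2 \<le> (cmod (E t * f t))\<^sup>2 + (cmod (S t * f t + f2 t))\<^sup>2"
    using E_S by eventually_elim (rule cnj_E_snd_le(1))
  have int: "integrable circle (\<lambda>t. (cmod (E t * f t))\<^sup>2 + (cmod (S t * f t + f2 t))\<^sup>2)"
    by (intro Bochner_Integration.integrable_add L2_square_integrable 1 2)
  show L: "(\<lambda>t. cnj (E t) * f2 t) \<in> L2"
    by (rule L2_I[OF _ int le]) measurable
  have "nsq (\<lambda>t. cnj (E t) * f2 t) \<le> (LINT t|circle. (cmod (E t * f t))\<^sup>2 + (cmod (S t * f t + f2 t))\<^sup>2)"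
    unfolding nsq_eq by (rule integral_mono_AE[OF L2_square_integrable[OF L] int le])
  also have "\<dots> = nsq (\<lambda>t. E t * f t) + nsq (\<lambda>t. S t * f t + f2 t)"
    unfolding nsq_eq by (rule Bochner_Integration.integral_add[OF L2_square_integrable[OF 1] L2_square_integrable[OF 2]])
  finally show "nsq (\<lambda>t. cnj (E t) * f2 t) \<le> nsq (\<lambda>t. E t * f t) + nsq (\<lambda>t. S t * f t + f2 t)" .
qed

text \<open>Only two of the three functions are assumed to converge; the equality of the two
  splittings bounds the third, \<open>cnj E * f2\<close>, by them.\<close>

lemma pair_closed:
  assumes s: "\<And>n. pair (s n) (s2 n)" and [measurable]: "f \<in> borel_measurable circle" "f2 \<in> borel_measurable circle"
    and 1: "(\<lambda>t. E t * f t) \<in> L2" and 2: "(\<lambda>t. S t * f t + f2 t) \<in> L2"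
    and lim1: "(\<lambda>n. L2_dist (\<lambda>t. E t * s n t) (\<lambda>t. E t * f t)) \<longlonglongrightarrow> 0"
    and lim2: "(\<lambda>n. L2_dist (\<lambda>t. S t * s n t + s2 n t) (\<lambda>t. S t * f t + f2 t)) \<longlonglongrightarrow> 0"
  shows "pair f f2"
proof -
  note [measurable] = pair_D(1,2)[OF s]
  note n = nsq_cnj_E_le[of "\<lambda>t. s n t - f t" "\<lambda>t. s2 n t - f2 t" for n]
  have d1: "(\<lambda>t. E t * (s n t - f t)) \<in> L2" for n
    using L2_diff[OF pair_D(3)[OF s] 1] by (simp add: algebra_simps)
  have d2: "(\<lambda>t. S t * (s n t - f t) + (s2 n t - f2 t)) \<in> L2" for n
    using L2_diff[OF H2_L2[OF pair_D(4)[OF s]] 2] by (simp add: algebra_simps)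
  have L: "(\<lambda>t. cnj (E t) * f2 t) \<in> L2"
    by (rule nsq_cnj_E_le(1)[OF _ _ 1 2]) measurable
  have "pair f f2 \<longleftrightarrow> (\<lambda>t. S t * f t + f2 t) \<in> H2 \<and> (\<lambda>t. cnj (E t) * f2 t) \<in> H2_minus"
    using 1 by (simp add: pair_def)
  moreover have "(\<lambda>t. S t * f t + f2 t) \<in> H2"
    by (rule H2_closed[OF pair_D(4)[OF s] 2 lim2])
  moreover have "(\<lambda>t. cnj (E t) * f2 t) \<in> H2_minus"
  proof (rule H2_minus_closed[OF pair_D(5)[OF s] L])
    show "(\<lambda>n. L2_dist (\<lambda>t. cnj (E t) * s2 n t) (\<lambda>t. cnj (E t) * f2 t)) \<longlonglongrightarrow> 0"
    proof (rule tendsto_sandwich[OF _ _ tendsto_const])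
      show "(\<lambda>n. L2_dist (\<lambda>t. E t * s n t) (\<lambda>t. E t * f t)
         + L2_dist (\<lambda>t. S t * s n t + s2 n t) (\<lambda>t. S t * f t + f2 t)) \<longlonglongrightarrow> 0"
        using tendsto_add[OF lim1 lim2] by simp
      show "\<forall>\<^sub>F n in sequentially. L2_dist (\<lambda>t. cnj (E t) * s2 n t) (\<lambda>t. cnj (E t) * f2 t)
         \<le> L2_dist (\<lambda>t. E t * s n t) (\<lambda>t. E t * f t)
         + L2_dist (\<lambda>t. S t * s n t + s2 n t) (\<lambda>t. S t * f t + f2 t)"
      proof (intro always_eventually allI)
        fix n
        have "nsq (\<lambda>t. cnj (E t) * (s2 n t - f2 t)) \<le> nsq (\<lambda>t. E t * (s n t - f t))
            + nsq (\<lambda>t. S t * (s n t - f t) + (s2 n t - f2 t))"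
          by (rule nsq_cnj_E_le(2)[OF _ _ d1 d2]) measurable
        then show "L2_dist (\<lambda>t. cnj (E t) * s2 n t) (\<lambda>t. cnj (E t) * f2 t)
         \<le> L2_dist (\<lambda>t. E t * s n t) (\<lambda>t. E t * f t)
         + L2_dist (\<lambda>t. S t * s n t + s2 n t) (\<lambda>t. S t * f t + f2 t)"
          by (simp add: L2_dist_eq nsq_eq algebra_simps)
      qed
      show "\<forall>\<^sub>F n in sequentially. 0 \<le> L2_dist (\<lambda>t. cnj (E t) * s2 n t) (\<lambda>t. cnj (E t) * f2 t)"
        by (intro always_eventually allI L2.dst_nonneg H2_minus_L2[OF pair_D(5)[OF s]] L)
    qed
  qed
  ultimately show ?thesis by simp
qed

end

section \<open>The space of pairs with values on the support\<close>

locale scattering = outer_symbol S E p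
  for S E :: "complex \<Rightarrow> complex" and p :: "nat \<Rightarrow> complex \<Rightarrow> complex" +
  fixes Z :: "complex set" and m :: "complex \<Rightarrow> real"
  assumes Z_ball: "Z \<subseteq> ball 0 1"
    and m_pos: "w \<in> Z \<Longrightarrow> 0 < m w"
begin

lemma m_nonneg: "w \<in> Z \<Longrightarrow> 0 \<le> m w"
  using m_pos by (simp add: less_imp_le)

text \<open>The second component is carried along explicitly: \<open>companion\<close> is a choice
  of representative and not linear, whereas pairs have an exact linear structure.\<close>

definition V :: "((complex \<Rightarrow> complex) \<times> (complex \<Rightarrow> complex)) set" where
  "V = {x. pair (fst x) (snd x) \<and> weighted_l2 Z m (fst x)}"

definition lin :: "(complex \<Rightarrow> complex) \<times> (complex \<Rightarrow> complex) \<Rightarrow> complex \<Rightarrow>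
    (complex \<Rightarrow> complex) \<times> (complex \<Rightarrow> complex) \<Rightarrow> (complex \<Rightarrow> complex) \<times> (complex \<Rightarrow> complex)" where
  "lin x c y = (\<lambda>t. fst x t + c * fst y t, \<lambda>t. snd x t + c * snd y t)"

definition ipd :: "(complex \<Rightarrow> complex) \<times> (complex \<Rightarrow> complex) \<Rightarrow> (complex \<Rightarrow> complex) \<times> (complex \<Rightarrow> complex) \<Rightarrow> complex" where
  "ipd x y = ip x y + weighted_inner Z m (fst x) (fst y)"

lemma V_D:
  assumes "x \<in> V"
  shows "pair (fst x) (snd x)" "weighted_l2 Z m (fst x)"
    "(\<lambda>t. E t * fst x t) \<in> L2" "(\<lambda>t. S t * fst x t + snd x t) \<in> L2"
  using assms pair_D(3,4)[of "fst x" "snd x"] H2_L2 by (auto simp: V_def)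

lemma weighted_self:
  "x \<in> V \<Longrightarrow> weighted_inner Z m (fst x) (fst x) = of_real (\<Sum>\<^sub>\<infinity>w\<in>Z. (cmod (fst x w))\<^sup>2 * m w)"
  by (rule weighted_inner_self[OF m_nonneg V_D(2)])

sublocale D: semi_inner V lin ipd
proof
  fix x y z :: "(complex \<Rightarrow> complex) \<times> (complex \<Rightarrow> complex)" and c
  assume x: "x \<in> V" and y: "y \<in> V"
  show "lin x c y \<in> V"
    using pair_lin[OF V_D(1)[OF x] V_D(1)[OF y]] weighted_l2_lin[OF m_nonneg V_D(2)[OF x] V_D(2)[OF y]]
    by (simp add: V_def lin_def)
  show "ipd y x = cnj (ipd x y)"
    unfolding ipd_def ip_def
    using L2.ip_cnj[OF V_D(3)[OF x] V_D(3)[OF y]] L2.ip_cnj[OF V_D(4)[OF x] V_D(4)[OF y]]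
      weighted_inner_cnj[OF m_nonneg V_D(2)[OF x] V_D(2)[OF y]] by simp
  assume z: "z \<in> V"
  have "L2_inner (\<lambda>t. E t * (fst x t + c * fst y t)) (\<lambda>t. E t * fst z t)
      = L2_inner (\<lambda>t. E t * fst x t) (\<lambda>t. E t * fst z t) + c * L2_inner (\<lambda>t. E t * fst y t) (\<lambda>t. E t * fst z t)"
    using L2.ip_lin[OF V_D(3)[OF x] V_D(3)[OF y] V_D(3)[OF z], of c] by (simp add: algebra_simps)
  moreover have "L2_inner (\<lambda>t. S t * (fst x t + c * fst y t) + (snd x t + c * snd y t)) (\<lambda>t. S t * fst z t + snd z t)
      = L2_inner (\<lambda>t. S t * fst x t + snd x t) (\<lambda>t. S t * fst z t + snd z t)
        + c * L2_inner (\<lambda>t. S t * fst y t + snd y t) (\<lambda>t. S t * fst z t + snd z t)"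
    using L2.ip_lin[OF V_D(4)[OF x] V_D(4)[OF y] V_D(4)[OF z], of c] by (simp add: algebra_simps)
  moreover have "weighted_inner Z m (\<lambda>w. fst x w + c * fst y w) (fst z)
      = weighted_inner Z m (fst x) (fst z) + c * weighted_inner Z m (fst y) (fst z)"
    by (rule weighted_inner_lin[OF m_nonneg V_D(2)[OF x] V_D(2)[OF y] V_D(2)[OF z]])
  ultimately show "ipd (lin x c y) z = ipd x z + c * ipd y z"
    unfolding ipd_def ip_def lin_def fst_conv snd_conv by (simp add: algebra_simps)
next
  fix x assume x: "x \<in> V"
  have "0 \<le> (\<Sum>\<^sub>\<infinity>w\<in>Z. (cmod (fst x w))\<^sup>2 * m w)" by (rule infsum_nonneg) (simp add: m_nonneg)
  then show "0 \<le> Re (ipd x x)"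
    unfolding ipd_def ip_def weighted_self[OF x] by (simp add: L2_inner_self)
qed

lemma sq_eq:
  assumes "x \<in> V"
  shows "D.sq x = nsq (\<lambda>t. E t * fst x t) + nsq (\<lambda>t. S t * fst x t + snd x t) + (\<Sum>\<^sub>\<infinity>w\<in>Z. (cmod (fst x w))\<^sup>2 * m w)"
  unfolding D.sq_def ipd_def ip_def weighted_self[OF assms]
  by (simp add: L2.sq_def)

lemma dst_eq':
  assumes "x \<in> V" "y \<in> V"
  shows "D.dst x y = L2_dist (\<lambda>t. E t * fst x t) (\<lambda>t. E t * fst y t)
    + L2_dist (\<lambda>t. S t * fst x t + snd x t) (\<lambda>t. S t * fst y t + snd y t)
    + (\<Sum>\<^sub>\<infinity>w\<in>Z. (cmod (fst x w - fst y w))\<^sup>2 * m w)"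
  unfolding D.dst_def sq_eq[OF D.lin_closed[OF assms]]
  by (simp add: lin_def L2_dist_eq nsq_eq algebra_simps)

lemma dst_le:
  assumes "x \<in> V" "y \<in> V"
  shows "L2_dist (\<lambda>t. E t * fst x t) (\<lambda>t. E t * fst y t) \<le> D.dst x y"
    "L2_dist (\<lambda>t. S t * fst x t + snd x t) (\<lambda>t. S t * fst y t + snd y t) \<le> D.dst x y"
    "(\<Sum>\<^sub>\<infinity>w\<in>Z. (cmod (fst x w - fst y w))\<^sup>2 * m w) \<le> D.dst x y"
proof -
  have "0 \<le> L2_dist (\<lambda>t. E t * fst x t) (\<lambda>t. E t * fst y t)"
    "0 \<le> L2_dist (\<lambda>t. S t * fst x t + snd x t) (\<lambda>t. S t * fst y t + snd y t)"
    "0 \<le> (\<Sum>\<^sub>\<infinity>w\<in>Z. (cmod (fst x w - fst y w))\<^sup>2 * m w)"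
    by (auto intro!: L2.dst_nonneg V_D assms infsum_nonneg simp: m_nonneg)
  then show "L2_dist (\<lambda>t. E t * fst x t) (\<lambda>t. E t * fst y t) \<le> D.dst x y"
    "L2_dist (\<lambda>t. S t * fst x t + snd x t) (\<lambda>t. S t * fst y t + snd y t) \<le> D.dst x y"
    "(\<Sum>\<^sub>\<infinity>w\<in>Z. (cmod (fst x w - fst y w))\<^sup>2 * m w) \<le> D.dst x y"
    unfolding dst_eq'[OF assms] by auto
qed

theorem V_complete:
  assumes s: "\<And>n. s n \<in> V"
    and Cau: "\<And>e. e > 0 \<Longrightarrow> \<exists>N. \<forall>i\<ge>N. \<forall>j\<ge>N. D.dst (s i) (s j) < e"
  shows "\<exists>x\<in>V. (\<lambda>n. D.dst (s n) x) \<longlonglongrightarrow> 0"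
proof -
  let ?u = "\<lambda>n t. E t * fst (s n) t" and ?g = "\<lambda>n t. S t * fst (s n) t + snd (s n) t"
  have C1: "\<exists>N. \<forall>i\<ge>N. \<forall>j\<ge>N. L2_dist (?u i) (?u j) < e" if "e > 0" for e
    using Cau[OF that] dst_le(1)[OF s s] by (meson le_less_trans)
  have C2: "\<exists>N. \<forall>i\<ge>N. \<forall>j\<ge>N. L2_dist (?g i) (?g j) < e" if "e > 0" for e
    using Cau[OF that] dst_le(2)[OF s s] by (meson le_less_trans)
  have C3: "\<exists>N. \<forall>i\<ge>N. \<forall>j\<ge>N. (\<Sum>\<^sub>\<infinity>w\<in>Z. (cmod (fst (s i) w - fst (s j) w))\<^sup>2 * m w) < e" if "e > 0" for e
    using Cau[OF that] dst_le(3)[OF s s] by (meson le_less_trans)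
  obtain u where u: "u \<in> L2" "(\<lambda>n. L2_dist (?u n) u) \<longlonglongrightarrow> 0"
    by (rule L2_complete[of ?u, OF V_D(3)[OF s] C1])
  obtain g where g: "g \<in> L2" "(\<lambda>n. L2_dist (?g n) g) \<longlonglongrightarrow> 0"
    by (rule L2_complete[of ?g, OF V_D(4)[OF s] C2])
  obtain v where v: "weighted_l2 Z m v" "(\<lambda>n. \<Sum>\<^sub>\<infinity>w\<in>Z. (cmod (fst (s n) w - v w))\<^sup>2 * m w) \<longlonglongrightarrow> 0"
    by (rule weighted_l2_complete[OF m_nonneg V_D(2)[OF s] m_pos C3])
  note [measurable] = L2_measurable[OF u(1)] L2_measurable[OF g(1)] pair_D(1,2)[OF V_D(1)[OF s]]
  \<comment> \<open>The limits on the support and on the circle are independent; they can be pasted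
    together because the support is a null set for \<open>circle\<close>.\<close>
  define f where "f t = (if t \<in> Z then v t else u t / E t)" for t
  have "AE t in circle. f t = u t / E t"
    using AE_circle_notin_ball[OF Z_ball] by eventually_elim (simp add: f_def)
  then have fm [measurable]: "f \<in> borel_measurable circle"
    by (rule borel_measurable_cong_AE[rotated]) measurable
  \<comment> \<open>Forced, since g has to be S f + f2.\<close>
  define f2 where "f2 t = g t - S t * f t" for t
  have f2m [measurable]: "f2 \<in> borel_measurable circle" unfolding f2_def[abs_def] by measurable
  have Ef: "AE t in circle. E t * f t = u t"
    using AE_circle_notin_ball[OF Z_ball] E_nonzero by eventually_elim (simp add: f_def)
  have EfL: "(\<lambda>t. E t * f t) \<in> L2"
    by (rule L2_cong_AE[OF u(1) _ Ef]) measurable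
  have Sf: "(\<lambda>t. S t * f t + f2 t) = g" by (auto simp: f2_def)
  have lim1: "(\<lambda>n. L2_dist (?u n) (\<lambda>t. E t * f t)) \<longlonglongrightarrow> 0"
  proof -
    have "L2_dist (?u n) (\<lambda>t. E t * f t) = L2_dist (?u n) u" for n
      by (rule L2_dist_cong_AE) (use Ef in auto)
    with u(2) show ?thesis by simp
  qed
  have pr: "pair f f2"
    by (rule pair_closed[OF V_D(1)[OF s] fm f2m EfL _ lim1]) (use g Sf in auto)
  have wf: "weighted_l2 Z m f"
    using v(1) unfolding weighted_l2_def by (rule summable_on_cong[THEN iffD1, rotated]) (simp add: f_def)
  have x: "(f, f2) \<in> V" using pr wf by (simp add: V_def)
  have "(\<lambda>n. L2_dist (?u n) (\<lambda>t. E t * f t) + L2_dist (?g n) g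
     + (\<Sum>\<^sub>\<infinity>w\<in>Z. (cmod (fst (s n) w - v w))\<^sup>2 * m w)) \<longlonglongrightarrow> 0 + 0 + 0"
    by (intro tendsto_add lim1 g v)
  moreover have "D.dst (s n) (f, f2) = L2_dist (?u n) (\<lambda>t. E t * f t) + L2_dist (?g n) g
     + (\<Sum>\<^sub>\<infinity>w\<in>Z. (cmod (fst (s n) w - v w))\<^sup>2 * m w)" for n
  proof -
    have "(\<Sum>\<^sub>\<infinity>w\<in>Z. (cmod (fst (s n) w - f w))\<^sup>2 * m w) = (\<Sum>\<^sub>\<infinity>w\<in>Z. (cmod (fst (s n) w - v w))\<^sup>2 * m w)"
      by (rule infsum_cong) (simp add: f_def)
    then show ?thesis by (simp add: dst_eq'[OF s x] Sf)
  qed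
  ultimately have "(\<lambda>n. D.dst (s n) (f, f2)) \<longlonglongrightarrow> 0" by simp
  with x show ?thesis by blast
qed

end

section \<open>Identification of the closure and link to the definitions\<close>

context outer_symbol
begin

lemma pair_generator:
  assumes "h \<in> L2" "q \<in> H2_minus" "(\<lambda>t. S t * h t + q t) \<in> H2"
  shows "pair h q"
  unfolding pair_def
  using assms E_mult_L2 cnj_E_mult_H2_minus by (auto dest: L2_measurable H2_minus_L2)

lemma pair_P_minus:
  assumes "h \<in> L2"
  shows "(\<lambda>t. - P_minus (\<lambda>s. S s * h s) t) \<in> H2_minus"
    "(\<lambda>t. S t * h t + (- P_minus (\<lambda>s. S s * h s) t)) \<in> H2"
    "pair h (\<lambda>t. - P_minus (\<lambda>s. S s * h s) t)"
proof -
  note P = P_minus_props[OF S_mult_L2[OF assms]]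
  show 1: "(\<lambda>t. - P_minus (\<lambda>s. S s * h s) t) \<in> H2_minus"
    using H2_minus_lin[OF P(1) P(1), of "-2"] by (simp add: algebra_simps)
  show 2: "(\<lambda>t. S t * h t + (- P_minus (\<lambda>s. S s * h s) t)) \<in> H2"
    using P(2) by simp
  show "pair h (\<lambda>t. - P_minus (\<lambda>s. S s * h s) t)"
    by (rule pair_generator[OF assms 1 2])
qed

lemma nn_integral_metric_form:
  assumes "pair f f2"
  shows "(\<integral>\<^sup>+t. ennreal (Re (metric_form S (f, f2) (f, f2) t)) \<partial>circle)
    = ennreal (nsq (\<lambda>t. E t * f t) + nsq (\<lambda>t. S t * f t + f2 t))"
proof -
  note L = pair_D(3)[OF assms] H2_L2[OF pair_D(4)[OF assms]]
  have "(\<integral>\<^sup>+t. ennreal (Re (metric_form S (f, f2) (f, f2) t)) \<partial>circle)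
     = (\<integral>\<^sup>+t. ennreal ((cmod (E t * f t))\<^sup>2 + (cmod (S t * f t + f2 t))\<^sup>2) \<partial>circle)"
    by (rule nn_integral_cong_AE) (use E_S in \<open>eventually_elim, simp only: metric_form_self(1)\<close>)
  also have "\<dots> = ennreal (LINT t|circle. (cmod (E t * f t))\<^sup>2 + (cmod (S t * f t + f2 t))\<^sup>2)"
    by (rule nn_integral_eq_integral) (auto intro!: L2_square_integrable L)
  also have "(LINT t|circle. (cmod (E t * f t))\<^sup>2 + (cmod (S t * f t + f2 t))\<^sup>2)
     = nsq (\<lambda>t. E t * f t) + nsq (\<lambda>t. S t * f t + f2 t)"
    unfolding nsq_eq by (rule Bochner_Integration.integral_add[OF L2_square_integrable[OF L(1)] L2_square_integrable[OF L(2)]])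
  finally show ?thesis .
qed

text \<open>The nonnegative integral controls both squares of the first splitting, so E f1 and S f1
  + f2 are \<open>L2\<close> limits of the functions coming from generators, and the conditions in
  \<open>pair\<close> are closed.\<close>

lemma pair_of_L2_pairs:
  assumes "(f1, f2) \<in> L2_pairs S"
  shows "pair f1 f2"
proof -
  have [measurable]: "f1 \<in> borel_measurable circle" "f2 \<in> borel_measurable circle"
    using assms by (auto simp: L2_pairs_def)
  define P where "P h = (\<lambda>t. - P_minus (\<lambda>s. S s * h s) t)" for h
  define N where "N h = (\<integral>\<^sup>+t. ennreal (Re (metric_form S (\<lambda>t. f1 t - h t, \<lambda>t. f2 t - P h t)
       (\<lambda>t. f1 t - h t, \<lambda>t. f2 t - P h t) t)) \<partial>circle)" for h
  have ex: "\<forall>e>0. \<exists>h\<in>L2. N h < ennreal e"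
    using assms unfolding L2_pairs_def Let_def N_def P_def by simp
  have "\<forall>n. \<exists>h. h \<in> L2 \<and> N h < ennreal (1 / Suc n)"
  proof
    fix n
    show "\<exists>h. h \<in> L2 \<and> N h < ennreal (1 / Suc n)"
      using ex[rule_format, of "1 / Suc n"] by auto
  qed
  from choice[OF this] obtain h where h': "\<forall>n. h n \<in> L2 \<and> N (h n) < ennreal (1 / Suc n)"
    by (rule exE)
  then have h: "h n \<in> L2" "N (h n) < ennreal (1 / Suc n)" for n by auto
  have pr: "pair (h n) (P (h n))" for n
    unfolding P_def by (rule pair_P_minus(3)[OF h(1)])
  note [measurable] = pair_D(1,2)[OF pr]
  have le1: "AE t in circle. (cmod (E t * (f1 t - h n t)))\<^sup>2 \<le> Re (metric_form S (\<lambda>t. f1 t - h n t, \<lambda>t. f2 t - P (h n) t)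
       (\<lambda>t. f1 t - h n t, \<lambda>t. f2 t - P (h n) t) t)" for n
    using E_S by eventually_elim (simp only: metric_form_self(1) le_add_same_cancel1 zero_le_power2)
  have le2: "AE t in circle. (cmod (S t * (f1 t - h n t) + (f2 t - P (h n) t)))\<^sup>2 \<le> Re (metric_form S (\<lambda>t. f1 t - h n t, \<lambda>t. f2 t - P (h n) t)
       (\<lambda>t. f1 t - h n t, \<lambda>t. f2 t - P (h n) t) t)" for n
    using E_S by eventually_elim (simp only: metric_form_self(1) le_add_same_cancel2 zero_le_power2)
  have d1: "(\<lambda>t. E t * (f1 t - h n t)) \<in> L2" "nsq (\<lambda>t. E t * (f1 t - h n t)) < 1 / Suc n" for n
    by (rule nsq_nn_integral[OF _ le1 h(2)[unfolded N_def]], measurable)+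
  have d2: "(\<lambda>t. S t * (f1 t - h n t) + (f2 t - P (h n) t)) \<in> L2" "nsq (\<lambda>t. S t * (f1 t - h n t) + (f2 t - P (h n) t)) < 1 / Suc n" for n
    by (rule nsq_nn_integral[OF _ le2 h(2)[unfolded N_def]], measurable)+
  have inv0: "(\<lambda>n. 1 / real (Suc n)) \<longlonglongrightarrow> 0"
    by (rule LIMSEQ_Suc[OF lim_1_over_n])
  have E1: "(\<lambda>t. E t * f1 t) \<in> L2"
    using L2_add[OF d1(1)[of 0] pair_D(3)[OF pr[of 0]]] by (simp add: algebra_simps)
  have E2: "(\<lambda>t. S t * f1 t + f2 t) \<in> L2"
    using L2_add[OF d2(1)[of 0] H2_L2[OF pair_D(4)[OF pr[of 0]]]] by (simp add: algebra_simps)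
  show ?thesis
  proof (rule pair_closed[OF pr _ _ E1 E2])
    show "(\<lambda>n. L2_dist (\<lambda>t. E t * h n t) (\<lambda>t. E t * f1 t)) \<longlonglongrightarrow> 0"
    proof (rule tendsto_sandwich[OF _ _ tendsto_const inv0])
      show "\<forall>\<^sub>F n in sequentially. L2_dist (\<lambda>t. E t * h n t) (\<lambda>t. E t * f1 t) \<le> 1 / real (Suc n)"
      proof (intro always_eventually allI)
        fix n
        have "L2_dist (\<lambda>t. E t * h n t) (\<lambda>t. E t * f1 t) = L2_dist (\<lambda>t. E t * f1 t) (\<lambda>t. E t * h n t)"
          by (rule L2.dst_sym[OF pair_D(3)[OF pr] E1])
        also have "\<dots> = nsq (\<lambda>t. E t * (f1 t - h n t))"
          by (simp add: L2_dist_eq nsq_eq algebra_simps)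
        finally show "L2_dist (\<lambda>t. E t * h n t) (\<lambda>t. E t * f1 t) \<le> 1 / real (Suc n)"
          using d1(2)[of n] by linarith
      qed
      show "\<forall>\<^sub>F n in sequentially. 0 \<le> L2_dist (\<lambda>t. E t * h n t) (\<lambda>t. E t * f1 t)"
        by (intro always_eventually allI L2.dst_nonneg pair_D(3)[OF pr] E1)
    qed
    show "(\<lambda>n. L2_dist (\<lambda>t. S t * h n t + P (h n) t) (\<lambda>t. S t * f1 t + f2 t)) \<longlonglongrightarrow> 0"
    proof (rule tendsto_sandwich[OF _ _ tendsto_const inv0])
      show "\<forall>\<^sub>F n in sequentially. L2_dist (\<lambda>t. S t * h n t + P (h n) t) (\<lambda>t. S t * f1 t + f2 t) \<le> 1 / real (Suc n)"
      proof (intro always_eventually allI)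
        fix n
        have "L2_dist (\<lambda>t. S t * h n t + P (h n) t) (\<lambda>t. S t * f1 t + f2 t)
           = L2_dist (\<lambda>t. S t * f1 t + f2 t) (\<lambda>t. S t * h n t + P (h n) t)"
          by (rule L2.dst_sym[OF H2_L2[OF pair_D(4)[OF pr]] E2])
        also have "\<dots> = nsq (\<lambda>t. S t * (f1 t - h n t) + (f2 t - P (h n) t))"
          by (simp add: L2_dist_eq nsq_eq algebra_simps)
        finally show "L2_dist (\<lambda>t. S t * h n t + P (h n) t) (\<lambda>t. S t * f1 t + f2 t) \<le> 1 / real (Suc n)"
          using d2(2)[of n] by linarith
      qed
      show "\<forall>\<^sub>F n in sequentially. 0 \<le> L2_dist (\<lambda>t. S t * h n t + P (h n) t) (\<lambda>t. S t * f1 t + f2 t)"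
        by (intro always_eventually allI L2.dst_nonneg H2_L2[OF pair_D(4)[OF pr]] E2)
    qed
  qed measurable
qed

text \<open>Density of the generating vectors: an element orthogonal to all of them has
  \<open>f + cnj S * f2 = 0\<close>, so that \<open>cnj E * f2\<close> lies in \<open>H2_minus\<close> and, by Smirnov's theorem, also in \<open>H2\<close>.\<close>

lemma L2_pairs_of_pair:
  assumes f: "pair f1 f2"
  shows "(f1, f2) \<in> L2_pairs S"
proof -
  \<comment> \<open>With an empty support, \<open>V_complete\<close> is the completeness of the
    pairs alone.\<close>
  interpret X: scattering S E p "{}" "\<lambda>_. 1"
    by unfold_locales auto
  have V: "x \<in> X.V \<longleftrightarrow> pair (fst x) (snd x)" for x
    by (simp add: X.V_def weighted_l2_def)
  have ipd: "X.ipd x y = ip x y" for x y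
    by (simp add: X.ipd_def weighted_inner_def)
  \<comment> \<open>Any admissible q is allowed beside h, not just the one from
    \<open>P_minus\<close>, which is chosen and hence linear only almost everywhere.\<close>
  define G where "G = {(h, q). h \<in> L2 \<and> q \<in> H2_minus \<and> (\<lambda>t. S t * h t + q t) \<in> H2}"
  have Glin: "(\<lambda>t. h t + c * h' t, \<lambda>t. q t + c * q' t) \<in> G" if "(h, q) \<in> G" "(h', q') \<in> G" for h q h' q' c
    using that L2_lin[of h h' c] H2_minus_lin[of q q' c] H2_lin[of "\<lambda>t. S t * h t + q t" "\<lambda>t. S t * h' t + q' t" c]
    by (simp add: G_def algebra_simps)
  have Gpair: "pair h q" if "(h, q) \<in> G" for h q
    using that pair_generator by (auto simp: G_def)
  \<comment> \<open>The coset of the given pair modulo G: its least norm is the distance to the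
    generators, to be shown 0.\<close>
  define C where "C = (\<lambda>(h, q). (\<lambda>t. f1 t + (-1) * h t, \<lambda>t. f2 t + (-1) * q t)) ` G"
  have C: "C \<subseteq> X.V"
    using pair_lin[OF f Gpair, where c = "-1"] by (auto simp: C_def V)
  have G0: "(\<lambda>t. 0, \<lambda>t. 0) \<in> G"
    using const_H2[of 0] L2_const[of 0] by (auto simp: G_def H2_minus_def L2_inner_def)
  have Clin: "X.lin z c (h, q) \<in> C" if z: "z \<in> C" and hq: "(h, q) \<in> G" for z c h q
  proof -
    obtain h0 q0 where z0: "(h0, q0) \<in> G" "z = (\<lambda>t. f1 t + (-1) * h0 t, \<lambda>t. f2 t + (-1) * q0 t)"
      using z by (auto simp: C_def)
    have "X.lin z c (h, q) = (\<lambda>(h, q). (\<lambda>t. f1 t + (-1) * h t, \<lambda>t. f2 t + (-1) * q t))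
        (\<lambda>t. h0 t + (- c) * h t, \<lambda>t. q0 t + (- c) * q t)"
      by (simp add: X.lin_def z0(2) algebra_simps)
    then show ?thesis
      unfolding C_def using Glin[OF z0(1) hq, of "- c"] by blast
  qed
  have mid: "X.lin (X.lin x (-1/2) x) (1/2) y \<in> C" if xy: "x \<in> C" "y \<in> C" for x y
  proof -
    obtain h q where x0: "(h, q) \<in> G" "x = (\<lambda>t. f1 t + (-1) * h t, \<lambda>t. f2 t + (-1) * q t)"
      using xy(1) by (auto simp: C_def)
    obtain h' q' where y0: "(h', q') \<in> G" "y = (\<lambda>t. f1 t + (-1) * h' t, \<lambda>t. f2 t + (-1) * q' t)"
      using xy(2) by (auto simp: C_def)
    have "X.lin (X.lin x (-1/2) x) (1/2) y = X.lin (X.lin x (1/2) (h, q)) (-1/2) (h', q')"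
      by (simp add: X.lin_def x0(2) y0(2) field_simps)
    then show ?thesis using Clin[OF Clin[OF xy(1) x0(1)] y0(1)] by simp
  qed
  have Cne: "C \<noteq> {}" using G0 by (auto simp: C_def)
  obtain y s where y: "y \<in> X.V" "\<And>n. s n \<in> C" "(\<lambda>n. X.D.dst (s n) y) \<longlonglongrightarrow> 0"
    "\<And>v. v \<in> X.V \<Longrightarrow> (\<And>z c. z \<in> C \<Longrightarrow> X.lin z c v \<in> C) \<Longrightarrow> X.ipd y v = 0"
  proof (rule X.D.minimizer[OF C Cne mid])
    fix s :: "nat \<Rightarrow> (complex \<Rightarrow> complex) \<times> (complex \<Rightarrow> complex)"
    assume s: "\<And>n. s n \<in> C" "\<And>e. e > 0 \<Longrightarrow> \<exists>N. \<forall>m\<ge>N. \<forall>n\<ge>N. X.D.dst (s m) (s n) < e"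
    have "s n \<in> X.V" for n using s(1) C by blast
    then show "\<exists>x\<in>X.V. (\<lambda>n. X.D.dst (s n) x) \<longlonglongrightarrow> 0"
      using s(2) by (rule X.V_complete)
  next
    fix x and s :: "nat \<Rightarrow> (complex \<Rightarrow> complex) \<times> (complex \<Rightarrow> complex)"
    assume a: "x \<in> X.V" "\<And>n. s n \<in> C" "(\<lambda>n. X.D.dst (s n) x) \<longlonglongrightarrow> 0"
      "\<And>y. y \<in> X.V \<Longrightarrow> (\<And>z c. z \<in> C \<Longrightarrow> X.lin z c y \<in> C) \<Longrightarrow> X.ipd x y = 0"
    show thesis
    proof (rule that[OF a(1-3)])
      fix v assume "v \<in> X.V" and v: "\<And>z c. z \<in> C \<Longrightarrow> X.lin z c v \<in> C"
      then show "X.ipd x v = 0" by (intro a(4))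
    qed
  qed
  obtain a d where ad: "y = (a, d)" by (cases y)
  have pad: "pair a d" using y(1) by (simp add: V ad)
  note [measurable] = pair_D(1,2)[OF pad]
  have orth: "L2_inner (\<lambda>t. a t + cnj (S t) * d t) h = 0" if h: "h \<in> L2" for h
  proof -
    let ?q = "\<lambda>t. - P_minus (\<lambda>s. S s * h s) t"
    note P = pair_P_minus[OF h]
    have "(h, ?q) \<in> G" using h P by (simp add: G_def)
    then have "X.ipd y (h, ?q) = 0"
      using Clin P(3) by (intro y(4)) (auto simp: V)
    then show ?thesis
      using ip_generator(2)[OF pad h P(1,2)] by (simp add: ipd ad)
  qed
  have aL: "(\<lambda>t. a t + cnj (S t) * d t) \<in> L2" by (rule pair_add_cnj_S_L2[OF pad])
  have "nsq (\<lambda>t. a t + cnj (S t) * d t) = 0"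
    using orth[OF aL] by (simp add: L2.sq_def)
  then have "AE t in circle. (cmod (a t + cnj (S t) * d t))\<^sup>2 = 0"
    unfolding nsq_eq by (subst (asm) integral_nonneg_eq_0_iff_AE) (auto intro: L2_square_integrable aL)
  then have a0: "AE t in circle. a t = - cnj (S t) * d t"
    by eventually_elim (simp add: add_eq_0_iff2)
  have "AE t in circle. S t * a t + d t = E t * (cnj (E t) * d t)"
    using a0 E_S
  proof eventually_elim
    fix t assume *: "a t = - cnj (S t) * d t" "(cmod (E t))\<^sup>2 = 1 - (cmod (S t))\<^sup>2"
    have "S t * a t + d t = (1 - S t * cnj (S t)) * d t" using *(1) by (simp add: algebra_simps)
    also have "1 - S t * cnj (S t) = E t * cnj (E t)"
      unfolding mult_cnj_cmod *(2) by simp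
    finally show "S t * a t + d t = E t * (cnj (E t) * d t)" by (simp add: mult.assoc)
  qed
  then have "(\<lambda>t. cnj (E t) * d t) \<in> H2"
    by (rule Smirnov[OF pair_D(4)[OF pad] H2_minus_L2[OF pair_D(5)[OF pad]]])
  then have "AE t in circle. cnj (E t) * d t = 0"
    by (rule H2_Int_H2_minus[OF _ pair_D(5)[OF pad]])
  then have d0: "AE t in circle. d t = 0"
    using E_nonzero by eventually_elim simp
  have "X.D.sq y = 0"
  proof -
    have "ip y y = L2_inner (\<lambda>t. 0) (\<lambda>t. 0) + L2_inner (\<lambda>t. 0) (\<lambda>t. 0)"
      unfolding ip_def ad fst_conv snd_conv
    proof (intro arg_cong2[of _ _ _ _ "(+)"] L2_inner_cong_AE)
      show "AE t in circle. E t * a t = 0" "AE t in circle. E t * a t = 0"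
        using a0 d0 by (eventually_elim, simp)+
      show "AE t in circle. S t * a t + d t = 0" "AE t in circle. S t * a t + d t = 0"
        using a0 d0 by (eventually_elim, simp)+
    qed measurable
    then show ?thesis by (simp add: X.D.sq_def ipd L2_inner_def)
  qed
  have "(\<lambda>n. X.D.sq (s n)) \<longlonglongrightarrow> X.D.sq y"
    using y C by (intro X.D.tendsto_sq) auto
  then have sq0: "(\<lambda>n. X.D.sq (s n)) \<longlonglongrightarrow> 0" using \<open>X.D.sq y = 0\<close> by simp
  show ?thesis
    unfolding L2_pairs_def
  proof (clarsimp simp: pair_D(1,2)[OF f] Let_def)
    fix e :: real assume "0 < e"
    then have "\<forall>\<^sub>F n in sequentially. X.D.sq (s n) < e" by (rule order_tendstoD(2)[OF sq0])
    then obtain n where n: "X.D.sq (s n) < e" by (auto simp: eventually_sequentially)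
    obtain h q where hq: "(h, q) \<in> G" "s n = (\<lambda>t. f1 t + (-1) * h t, \<lambda>t. f2 t + (-1) * q t)"
      using y(2)[of n] by (auto simp: C_def)
    have h: "h \<in> L2" using hq(1) by (simp add: G_def)
    have pq: "pair (\<lambda>t. f1 t + (-1) * h t) (\<lambda>t. f2 t + (-1) * q t)"
      by (rule pair_lin[OF f Gpair[OF hq(1)]])
    \<comment> \<open>Back from an arbitrary admissible q to the one in the definition: both are
      companions of h.\<close>
    have qP: "AE t in circle. q t = - P_minus (\<lambda>s. S s * h s) t"
      by (rule pair_unique[OF Gpair[OF hq(1)] pair_P_minus(3)[OF h]])
    have "(\<integral>\<^sup>+t. ennreal (Re (metric_form S (\<lambda>t. f1 t - h t, \<lambda>t. f2 t + P_minus (\<lambda>s. S s * h s) t)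
             (\<lambda>t. f1 t - h t, \<lambda>t. f2 t + P_minus (\<lambda>s. S s * h s) t) t)) \<partial>circle)
        = (\<integral>\<^sup>+t. ennreal (Re (metric_form S (\<lambda>t. f1 t + (-1) * h t, \<lambda>t. f2 t + (-1) * q t)
             (\<lambda>t. f1 t + (-1) * h t, \<lambda>t. f2 t + (-1) * q t) t)) \<partial>circle)"
      by (rule nn_integral_cong_AE) (use qP in \<open>eventually_elim, simp add: metric_form_def\<close>)
    also have "\<dots> = ennreal (X.D.sq (s n))"
      using X.sq_eq[OF subsetD[OF C y(2)], of n] unfolding nn_integral_metric_form[OF pq] by (simp add: hq(2))
    also have "\<dots> < ennreal e"
      using n \<open>0 < e\<close> by (simp add: ennreal_lessI)
    finally show "\<exists>h\<in>L2. (\<integral>\<^sup>+t. ennreal (Re (metric_form S (\<lambda>t. f1 t - h t, \<lambda>t. f2 t + P_minus (\<lambda>s. S s * h s) t)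
             (\<lambda>t. f1 t - h t, \<lambda>t. f2 t + P_minus (\<lambda>s. S s * h s) t) t)) \<partial>circle) < ennreal e"
      using h by blast
  qed
qed

theorem L2_pairs_iff: "(f1, f2) \<in> L2_pairs S \<longleftrightarrow> pair f1 f2"
  using L2_pairs_of_pair pair_of_L2_pairs by blast

lemma pair_companion:
  assumes "pair f f2"
  shows "pair f (companion S f)"
  unfolding companion_def L2_pairs_iff using assms by (rule someI[of "pair f"])

end

text \<open>The bridge between the record-based definitions and \<open>V\<close>: membership, inner
  products, norms and values at the origin are rewritten below in terms of pairs, and limits are
  then taken in \<open>V\<close>.\<close>

locale scattering_record = scattering S E p Z m
  for S E p Z m +
  fixes \<beta> :: scattering_data
  assumes symbol: "symbol \<beta> = S" and points: "points \<beta> = Z" and mass: "\<And>w. w \<in> Z \<Longrightarrow> mass \<beta> w = m w"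
    and E: "Te_bd \<beta> = E" and Te_ext: "\<And>z. cmod z < 1 \<Longrightarrow> Te \<beta> z = disc_ext E z"
begin

lemma L2_data_iff: "f \<in> L2_data \<beta> \<longleftrightarrow> (\<exists>f2. (f, f2) \<in> V)"
proof -
  have "(\<lambda>w. (cmod (f w))\<^sup>2 * mass \<beta> w) summable_on Z \<longleftrightarrow> weighted_l2 Z m f"
    unfolding weighted_l2_def by (rule summable_on_cong) (simp add: mass)
  then show ?thesis
    by (simp add: L2_data_def symbol points L2_pairs_iff V_def)
qed

text \<open>The companion chosen in the definition agrees almost everywhere with any admissible
  second component, so it never has to be known.\<close>

lemma inner_data_eq:
  assumes x: "(f, f2) \<in> V" and y: "(g, g2) \<in> V"
  shows "inner_data \<beta> f g = ipd (f, f2) (g, g2)"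
proof -
  have f: "pair f f2" and g: "pair g g2" using x y by (auto simp: V_def)
  have "(\<Sum>\<^sub>\<infinity>w\<in>Z. f w * cnj (g w) * complex_of_real (mass \<beta> w)) = weighted_inner Z m f g"
    unfolding weighted_inner_def by (rule infsum_cong) (simp add: mass)
  moreover have "ip (f, companion S f) (g, companion S g) = ip (f, f2) (g, g2)"
  proof -
    note cf = pair_companion[OF f] and cg = pair_companion[OF g]
    note [measurable] = pair_D(1,2)[OF f] pair_D(1,2)[OF g] pair_D(2)[OF cf] pair_D(2)[OF cg]
    have "AE t in circle. S t * f t + companion S f t = S t * f t + f2 t"
      using pair_unique[OF cf f] by eventually_elim simp
    moreover have "AE t in circle. S t * g t + companion S g t = S t * g t + g2 t"
      using pair_unique[OF cg g] by eventually_elim simp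
    ultimately have "L2_inner (\<lambda>t. S t * f t + companion S f t) (\<lambda>t. S t * g t + companion S g t)
      = L2_inner (\<lambda>t. S t * f t + f2 t) (\<lambda>t. S t * g t + g2 t)"
      by (rule L2_inner_cong_AE) measurable
    then show ?thesis by (simp add: ip_def)
  qed
  ultimately show ?thesis
    by (simp add: inner_data_def symbol points ipd_def integral_metric_form[OF pair_companion[OF f] pair_companion[OF g]])
qed

lemma norm_data_eq: "(f, f2) \<in> V \<Longrightarrow> norm_data \<beta> f = sqrt (D.sq (f, f2))"
  by (simp add: norm_data_def inner_data_eq D.sq_def)

lemma Te_0: "Te \<beta> 0 \<noteq> 0"
  by (simp add: Te_def outer_def)

lemma value_eq: "value_at_0 \<beta> f = fourier_coeff (\<lambda>t. E t * f t) 0 / Te \<beta> 0"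
  by (simp add: value_at_0_def E disc_ext_0)

lemma value_lin:
  assumes "(f, f2) \<in> V" "(g, g2) \<in> V"
  shows "value_at_0 \<beta> (\<lambda>t. f t + c * g t) = value_at_0 \<beta> f + c * value_at_0 \<beta> g"
proof -
  have "fourier_coeff (\<lambda>t. E t * (f t + c * g t)) 0 = fourier_coeff (\<lambda>t. E t * f t + c * (E t * g t)) 0"
    by (simp add: algebra_simps)
  also have "\<dots> = fourier_coeff (\<lambda>t. E t * f t) 0 + c * fourier_coeff (\<lambda>t. E t * g t) 0"
    using V_D(3)[OF assms(1)] V_D(3)[OF assms(2)] by (intro fourier_coeff_lin) auto
  finally show ?thesis by (simp add: value_eq add_divide_distrib)
qed

lemma value_scale: "value_at_0 \<beta> (\<lambda>t. c * f t) = c * value_at_0 \<beta> f"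
  using fourier_coeff_scale[of c "\<lambda>t. E t * f t" 0] by (simp add: value_eq mult_ac)

lemma tendsto_value:
  assumes s: "\<And>n. s n \<in> V" and x: "x \<in> V" and lim: "(\<lambda>n. D.dst (s n) x) \<longlonglongrightarrow> 0"
  shows "(\<lambda>n. value_at_0 \<beta> (fst (s n))) \<longlonglongrightarrow> value_at_0 \<beta> (fst x)"
proof -
  have "(\<lambda>n. L2_dist (\<lambda>t. E t * fst (s n) t) (\<lambda>t. E t * fst x t)) \<longlonglongrightarrow> 0"
  proof (rule tendsto_sandwich[OF _ _ tendsto_const lim])
    show "\<forall>\<^sub>F n in sequentially. L2_dist (\<lambda>t. E t * fst (s n) t) (\<lambda>t. E t * fst x t) \<le> D.dst (s n) x"
      by (intro always_eventually allI dst_le s x)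
    show "\<forall>\<^sub>F n in sequentially. 0 \<le> L2_dist (\<lambda>t. E t * fst (s n) t) (\<lambda>t. E t * fst x t)"
      by (intro always_eventually allI L2.dst_nonneg V_D s x)
  qed
  from tendsto_fourier_coeff[OF V_D(3)[OF s] V_D(3)[OF x] this, of 0]
  show ?thesis unfolding value_eq by (intro tendsto_divide tendsto_const Te_0)
qed

end

section \<open>The kernel of the check space\<close>

text \<open>Write g = g(z) + (t - z) q with q in \<open>H2\<close>. On the circle (t - z) times the
  conjugate kernel is t, so the second term contributes the coefficient of q of index -1, which is
  0.\<close>

lemma H2_reproducing:
  assumes g: "g \<in> H2" and z: "cmod z < 1"
  shows "L2_inner g (\<lambda>t. 1 / (1 - cnj z * t)) = disc_ext g z"
proof -
  define c where "c = disc_ext g z"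
  define q where "q t = (g t + (-1) * c) / (t - z)" for t
  have gc: "(\<lambda>t. g t + (-1) * c) \<in> H2" by (rule H2_lin[OF g const_H2])
  have "disc_ext (\<lambda>t. g t + (-1) * c) z = 0"
    using disc_ext_lin[OF H2_L2[OF g] L2_const z, of "-1" c] disc_ext_const[OF z, of c] by (simp add: c_def)
  then have q: "q \<in> H2"
    unfolding q_def[abs_def] by (rule H2_divide(1)[OF gc z])
  define k where "k t = 1 / (1 - cnj z * t)" for t
  have k: "k \<in> H2" unfolding k_def[abs_def] by (rule inverse_affine_H2(1)[OF z])
  note [measurable] = L2_measurable[OF H2_L2[OF q]] L2_measurable[OF H2_L2[OF g]] L2_measurable[OF H2_L2[OF k]]
  have "L2_inner g k = (LINT t|circle. c * cnj (k t) + q t * t powi (- (-1)))"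
    unfolding L2_inner_def
  proof (rule integral_cong_AE)
    show "AE t in circle. g t * cnj (k t) = c * cnj (k t) + q t * t powi (- (-1))"
      using AE_circle_norm
    proof eventually_elim
      fix t :: complex assume t: "cmod t = 1"
      have ne: "t - z \<noteq> 0" using cmod_circle_diff(1)[OF t, of z] z by auto
      have "t * cnj t = 1" using t by (simp add: mult_cnj_cmod)
      then have tD: "t * cnj (1 - cnj z * t) = t - z" by (simp add: algebra_simps)
      then have "cnj (1 - cnj z * t) \<noteq> 0" using ne by auto
      then have kt: "cnj (k t) * (t - z) = t"
        unfolding tD[symmetric] by (simp add: k_def)
      have "g t * cnj (k t) = (c + (t - z) * q t) * cnj (k t)" using ne by (simp add: q_def)
      also have "\<dots> = c * cnj (k t) + (cnj (k t) * (t - z)) * q t"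
        by (simp add: algebra_simps)
      finally show "g t * cnj (k t) = c * cnj (k t) + q t * t powi (- (-1))"
        unfolding kt by (simp add: mult.commute)
    qed
  qed measurable
  also have "\<dots> = (LINT t|circle. c * cnj (k t)) + (LINT t|circle. q t * t powi (- (-1)))"
    by (intro Bochner_Integration.integral_add integrable_mult_right integrable_L2 L2_cnj H2_L2[OF k]
        integrable_L2_mult H2_L2[OF q] powi_L2)
  also have "(LINT t|circle. q t * t powi (- (-1))) = fourier_coeff q (-1)"
    by (rule fourier_coeff_eq[symmetric]) measurable
  also have "\<dots> = 0" by (rule H2_coeff[OF q]) simp
  also have "(LINT t|circle. c * cnj (k t)) = c * cnj (fourier_coeff k 0)"
    by (simp add: fourier_coeff_eq)
  also have "fourier_coeff k 0 = 1"
    using inverse_affine_H2(2)[OF z, of 0] by (simp add: k_def[abs_def] disc_ext_0)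
  finally show ?thesis by (simp add: c_def k_def[abs_def])
qed

section \<open>Core functions and existence of the check kernel\<close>

locale scattering_blaschke = scattering_record S E p Z m \<beta>
  for S E p Z m \<beta> +
  fixes b :: "complex \<Rightarrow> complex"
  assumes b_H2: "b \<in> H2" and b_1: "AE t in circle. cmod (b t) = 1" and b_0: "disc_ext b 0 \<noteq> 0"
    and b_zero: "\<And>w. w \<in> Z \<Longrightarrow> disc_ext b w = 0"
    and b_div: "\<And>h. h \<in> H2 \<Longrightarrow> (\<And>w. w \<in> Z \<Longrightarrow> disc_ext h w = 0) \<Longrightarrow> (\<lambda>t. h t * cnj (b t)) \<in> H2"
begin

lemma Z_lt_1: "w \<in> Z \<Longrightarrow> cmod w < 1"
  using Z_ball by auto

lemma b_measurable [measurable]: "b \<in> borel_measurable circle"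
  by (rule L2_measurable[OF H2_L2[OF b_H2]])

lemma b_le_1: "AE t in circle. cmod (b t) \<le> 1"
  using b_1 by eventually_elim simp

definition bdiv :: "complex \<Rightarrow> complex \<Rightarrow> complex" where
  "bdiv w t = b t / (t - w)"

lemma bdiv:
  assumes w: "w \<in> Z"
  shows "bdiv w \<in> H2" "cmod z < 1 \<Longrightarrow> (z - w) * disc_ext (bdiv w) z = disc_ext b z"
    "v \<in> Z \<Longrightarrow> v \<noteq> w \<Longrightarrow> disc_ext (bdiv w) v = 0"
proof -
  show "bdiv w \<in> H2"
    unfolding bdiv_def[abs_def] by (rule H2_divide(1)[OF b_H2 Z_lt_1[OF w] b_zero[OF w]])
  show *: "(z - w) * disc_ext (bdiv w) z = disc_ext b z" if "cmod z < 1" for z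
    unfolding bdiv_def[abs_def] by (rule H2_divide(2)[OF b_H2 Z_lt_1[OF w] b_zero[OF w] that])
  show "disc_ext (bdiv w) v = 0" if "v \<in> Z" "v \<noteq> w" for v
    using *[OF Z_lt_1[OF that(1)]] b_zero[OF that(1)] that(2) by simp
qed

text \<open>The zeros of b are simple: otherwise \<open>bdiv w\<close> would vanish on all of Z, and
  division by b would put 1 / (t - w) into \<open>H2\<close>; multiplied by t - w this is 1, yet it
  would have to vanish at w.\<close>

lemma bdiv_nonzero:
  assumes w: "w \<in> Z"
  shows "disc_ext (bdiv w) w \<noteq> 0"
proof
  assume 0: "disc_ext (bdiv w) w = 0"
  have "disc_ext (bdiv w) v = 0" if "v \<in> Z" for v
    using 0 bdiv(3)[OF w that] by (cases "v = w") auto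
  then have q: "(\<lambda>t. bdiv w t * cnj (b t)) \<in> H2"
    by (rule b_div[OF bdiv(1)[OF w]])
  note [measurable] = L2_measurable[OF H2_L2[OF q]]
  have "AE t in circle. (- w + 1 * t) * (bdiv w t * cnj (b t)) = 1"
    using b_1 AE_circle_neq[OF Z_lt_1[OF w]]
  proof eventually_elim
    fix t assume t: "cmod (b t) = 1" "t \<noteq> w"
    have "b t * cnj (b t) = 1" using t by (simp add: mult_cnj_cmod)
    then show "(- w + 1 * t) * (bdiv w t * cnj (b t)) = 1"
      using t(2) by (simp add: bdiv_def)
  qed
  then have "disc_ext (\<lambda>t. (- w + 1 * t) * (bdiv w t * cnj (b t))) w = disc_ext (\<lambda>t. 1) w"
    by (rule disc_ext_cong_AE) measurable
  moreover have "disc_ext (\<lambda>t. (- w + 1 * t) * (bdiv w t * cnj (b t))) w = 0"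
    using H2_mult(2)[OF q affine_H2(1,2) Z_lt_1[OF w], of "-w" 1] affine_H2(3)[OF Z_lt_1[OF w], of "-w" 1] by simp
  ultimately show False using disc_ext_const[OF Z_lt_1[OF w], of 1] by simp
qed

lemma core_iff: "h \<in> H2_core \<beta> \<longleftrightarrow> h \<in> H2 \<and> (\<forall>w\<in>Z. h w = disc_ext h w) \<and> finite {w \<in> Z. h w \<noteq> 0}"
  by (simp add: H2_core_def points)

lemma core_lin:
  assumes "h \<in> H2_core \<beta>" "g \<in> H2_core \<beta>"
  shows "(\<lambda>t. h t + c * g t) \<in> H2_core \<beta>"
proof -
  have "{w \<in> Z. h w + c * g w \<noteq> 0} \<subseteq> {w \<in> Z. h w \<noteq> 0} \<union> {w \<in> Z. g w \<noteq> 0}" by auto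
  moreover have "h w + c * g w = disc_ext (\<lambda>t. h t + c * g t) w" if "w \<in> Z" for w
    using assms that by (subst disc_ext_lin) (auto simp: core_iff H2_L2 Z_lt_1)
  ultimately show ?thesis
    using assms by (auto simp: core_iff H2_lin intro: finite_subset)
qed

text \<open>A core function must carry its disc values on Z as part of the representative, which an
  arbitrary element of \<open>H2\<close> does not; changing it on the null set Z repairs
  this.\<close>

lemma core_modify:
  assumes h: "h \<in> H2" and fin: "finite {w \<in> Z. disc_ext h w \<noteq> 0}"
  obtains h' where "h' \<in> H2_core \<beta>" "AE t in circle. h' t = h t" "\<And>w. w \<in> Z \<Longrightarrow> h' w = disc_ext h w"
    "\<And>z. disc_ext h' z = disc_ext h z"
proof -
  define h' where "h' t = (if t \<in> Z then disc_ext h t else h t)" for t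
  note [measurable] = L2_measurable[OF H2_L2[OF h]]
  have ae: "AE t in circle. h' t = h t"
    using AE_circle_notin_ball[OF Z_ball] by eventually_elim (simp add: h'_def)
  have hm [measurable]: "h' \<in> borel_measurable circle"
    by (rule borel_measurable_cong_AE[OF _ ae]) measurable
  have ext: "disc_ext h' z = disc_ext h z" for z
    by (rule disc_ext_cong_AE[OF ae]) measurable
  have "{w \<in> Z. h' w \<noteq> 0} = {w \<in> Z. disc_ext h w \<noteq> 0}" by (auto simp: h'_def)
  then have core: "h' \<in> H2_core \<beta>"
    using fin H2_cong_AE[OF h hm ae] ext by (simp add: core_iff) (simp add: h'_def)
  show ?thesis
    by (rule that[OF core ae _ ext]) (simp add: h'_def)
qed

text \<open>All admissible q are included, so that the set is exactly closed under
  \<open>lin\<close>; with \<open>P_minus\<close> alone this would hold only up to null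
  sets.\<close>

definition core_pairs :: "((complex \<Rightarrow> complex) \<times> (complex \<Rightarrow> complex)) set" where
  "core_pairs = {(h, q). h \<in> H2_core \<beta> \<and> q \<in> H2_minus \<and> (\<lambda>t. S t * h t + q t) \<in> H2}"

lemma core_H2: "h \<in> H2_core \<beta> \<Longrightarrow> h \<in> H2"
  by (simp add: core_iff)

lemma core_pairs_P_minus:
  assumes "h \<in> H2_core \<beta>"
  shows "(h, \<lambda>t. - P_minus (\<lambda>s. S s * h s) t) \<in> core_pairs"
  using assms pair_P_minus(1,2)[OF H2_L2[OF core_H2[OF assms]]] by (simp add: core_pairs_def)

lemma core_pairs_V: "x \<in> core_pairs \<Longrightarrow> x \<in> V"
proof -
  assume x: "x \<in> core_pairs"
  obtain h q where hq: "x = (h, q)" by (cases x)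
  have h: "h \<in> H2_core \<beta>" "q \<in> H2_minus" "(\<lambda>t. S t * h t + q t) \<in> H2"
    using x by (auto simp: core_pairs_def hq)
  have "weighted_l2 Z m h"
    unfolding weighted_l2_def
  proof (rule summable_on_cong_neutral[THEN iffD1])
    show "(\<lambda>w. (cmod (h w))\<^sup>2 * m w) summable_on {w \<in> Z. h w \<noteq> 0}"
      using h(1) by (intro summable_on_finite) (simp add: core_iff)
  qed auto
  then show ?thesis
    using pair_generator[OF H2_L2[OF core_H2[OF h(1)]] h(2,3)] by (simp add: V_def hq)
qed

lemma core_pairs_lin:
  assumes "x \<in> core_pairs" "y \<in> core_pairs"
  shows "lin x c y \<in> core_pairs"
proof -
  obtain h q h' q' where xy: "x = (h, q)" "y = (h', q')" by (metis surj_pair)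
  show ?thesis
    using assms core_lin[of h h' c] H2_minus_lin[of q q' c]
      H2_lin[of "\<lambda>t. S t * h t + q t" "\<lambda>t. S t * h' t + q' t" c]
    by (simp add: xy core_pairs_def lin_def algebra_simps)
qed

lemma Te_0_eq: "Te \<beta> 0 = disc_ext E 0"
  using Te_ext[of 0] by simp

lemma value_core:
  assumes "h \<in> H2"
  shows "value_at_0 \<beta> h = disc_ext h 0"
proof -
  have "fourier_coeff (\<lambda>t. E t * h t) 0 = disc_ext E 0 * disc_ext h 0"
    using H2_mult(2)[OF assms E_H2 E_le_1, of 0] by (simp add: disc_ext_0)
  then show ?thesis using Te_0 by (simp add: value_eq Te_0_eq)
qed

lemma H2_check_iff:
  "f \<in> H2_check \<beta> \<longleftrightarrow> (\<exists>f2 s. (f, f2) \<in> V \<and> (\<forall>n::nat. s n \<in> core_pairs) \<and> (\<lambda>n. D.dst (s n) (f, f2)) \<longlonglongrightarrow> 0)"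
    (is "_ \<longleftrightarrow> ?R")
proof
  have nrm: "norm_data \<beta> (\<lambda>z. f z - h z) = sqrt (D.dst (h, q) (f, f2))"
    if "(f, f2) \<in> V" "(h, q) \<in> core_pairs" for f f2 h q
  proof -
    note hV = core_pairs_V[OF that(2)]
    have L: "lin (f, f2) (-1) (h, q) = (\<lambda>t. f t - h t, \<lambda>t. f2 t - q t)"
      by (simp add: lin_def)
    have "norm_data \<beta> (\<lambda>z. f z - h z) = sqrt (D.sq (lin (f, f2) (-1) (h, q)))"
      unfolding L by (rule norm_data_eq) (use D.lin_closed[OF that(1) hV, of "-1"] L in simp)
    also have "D.sq (lin (f, f2) (-1) (h, q)) = D.dst (h, q) (f, f2)"
      unfolding D.dst_def[symmetric] by (rule D.dst_sym[OF that(1) hV])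
    finally show ?thesis .
  qed
  {
    assume f: "f \<in> H2_check \<beta>"
    then obtain f2 where V: "(f, f2) \<in> V" by (auto simp: H2_check_def L2_data_iff)
    have "\<forall>n. \<exists>h. h \<in> H2_core \<beta> \<and> norm_data \<beta> (\<lambda>z. f z - h z) < 1 / Suc n"
    proof
      fix n
      have "\<exists>h\<in>H2_core \<beta>. norm_data \<beta> (\<lambda>z. f z - h z) < 1 / Suc n"
        using f unfolding H2_check_def by (simp del: of_nat_Suc)
      then show "\<exists>h. h \<in> H2_core \<beta> \<and> norm_data \<beta> (\<lambda>z. f z - h z) < 1 / Suc n" by blast
    qed
    from choice[OF this] obtain h where h: "\<forall>n. h n \<in> H2_core \<beta> \<and> norm_data \<beta> (\<lambda>z. f z - h n z) < 1 / Suc n"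
      by (rule exE)
    define s where "s n = (h n, \<lambda>t. - P_minus (\<lambda>s. S s * h n s) t)" for n
    have s: "s n \<in> core_pairs" for n
      unfolding s_def using h by (intro core_pairs_P_minus) auto
    have lt: "sqrt (D.dst (s n) (f, f2)) < 1 / Suc n" for n
      using nrm[OF V s[of n, unfolded s_def]] h[rule_format, of n] unfolding s_def by simp
    have "(\<lambda>n. D.dst (s n) (f, f2)) \<longlonglongrightarrow> 0"
    proof (rule tendsto_sandwich[OF _ _ tendsto_const])
      have "(\<lambda>n. 1 / real (Suc n)) \<longlonglongrightarrow> 0" by (rule LIMSEQ_Suc[OF lim_1_over_n])
      from tendsto_power[OF this, of 2] show "(\<lambda>n. (1 / real (Suc n))\<^sup>2) \<longlonglongrightarrow> 0" by simp
      have nn: "0 \<le> D.dst (s n) (f, f2)" for n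
        by (rule D.dst_nonneg[OF core_pairs_V[OF s] V])
      then show "\<forall>\<^sub>F n in sequentially. 0 \<le> D.dst (s n) (f, f2)" by simp
      have "D.dst (s n) (f, f2) \<le> (1 / real (Suc n))\<^sup>2" for n
      proof -
        have "(sqrt (D.dst (s n) (f, f2)))\<^sup>2 \<le> (1 / real (Suc n))\<^sup>2"
          using lt[of n] nn[of n] by (intro power_mono) auto
        then show ?thesis using nn[of n] by simp
      qed
      then show "\<forall>\<^sub>F n in sequentially. D.dst (s n) (f, f2) \<le> (1 / real (Suc n))\<^sup>2" by simp
    qed
    with V s show ?R by blast
  next
    assume ?R
    then obtain f2 s where V: "(f, f2) \<in> V" and s: "\<And>n::nat. s n \<in> core_pairs" and lim: "(\<lambda>n. D.dst (s n) (f, f2)) \<longlonglongrightarrow> 0"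
      by blast
    have "\<exists>h\<in>H2_core \<beta>. norm_data \<beta> (\<lambda>z. f z - h z) < e" if "e > 0" for e
    proof -
      have "(\<lambda>n. sqrt (D.dst (s n) (f, f2))) \<longlonglongrightarrow> 0" using tendsto_real_sqrt[OF lim] by simp
      then have "\<forall>\<^sub>F n in sequentially. sqrt (D.dst (s n) (f, f2)) < e"
        using \<open>e > 0\<close> by (rule order_tendstoD)
      then obtain n where n: "sqrt (D.dst (s n) (f, f2)) < e" by (auto simp: eventually_sequentially)
      obtain h q where hq: "s n = (h, q)" by (cases "s n")
      have "h \<in> H2_core \<beta>" using s[of n] by (simp add: hq core_pairs_def)
      moreover have "norm_data \<beta> (\<lambda>z. f z - h z) < e"
        using nrm[OF V s[of n, unfolded hq]] n by (simp add: hq)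
      ultimately show ?thesis by blast
    qed
    then show "f \<in> H2_check \<beta>" using V by (auto simp: H2_check_def L2_data_iff)
  }
qed

text \<open>Among core functions with value 1 at the origin there is a limit x of least norm,
  orthogonal to the core functions vanishing there; dividing x by its squared norm gives the kernel.
  This avoids forming a quotient Hilbert space and representing a functional on it.\<close>

lemma check_kernel_exists:
  "\<exists>k. k \<in> H2_check \<beta> \<and> (\<forall>f\<in>H2_check \<beta>. inner_data \<beta> f k = value_at_0 \<beta> f) \<and> value_at_0 \<beta> k \<noteq> 0"
proof -
  define C where "C = {x \<in> core_pairs. value_at_0 \<beta> (fst x) = 1}"
  have CV: "C \<subseteq> V" by (auto simp: C_def core_pairs_V)
  have vlin: "value_at_0 \<beta> (fst (lin x c y)) = value_at_0 \<beta> (fst x) + c * value_at_0 \<beta> (fst y)"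
    if "x \<in> V" "y \<in> V" for x y c
    using value_lin[of "fst x" "snd x" "fst y" "snd y" c] that by (simp add: lin_def)
  have "C \<noteq> {}"
  proof -
    \<comment> \<open>b vanishes on Z and not at 0, so a multiple of it is in C.\<close>
    have bz: "{w \<in> Z. disc_ext b w \<noteq> 0} = {}" using b_zero by auto
    obtain b' where b': "b' \<in> H2_core \<beta>" "\<And>z. disc_ext b' z = disc_ext b z"
      by (rule core_modify[OF b_H2, unfolded bz]) auto
    define x where "x = (b', \<lambda>t. - P_minus (\<lambda>s. S s * b' s) t)"
    have x: "x \<in> core_pairs" unfolding x_def by (rule core_pairs_P_minus[OF b'(1)])
    have vx: "value_at_0 \<beta> (fst x) = disc_ext b 0"
      using value_core[OF core_H2[OF b'(1)]] b'(2) by (simp add: x_def)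
    have "lin x (1 / disc_ext b 0 - 1) x \<in> C"
      using core_pairs_lin[OF x x] vlin[OF core_pairs_V[OF x] core_pairs_V[OF x]] b_0
      by (simp add: C_def vx field_simps)
    then show ?thesis by blast
  qed
  have mid: "lin (lin x (-1/2) x) (1/2) y \<in> C" if "x \<in> C" "y \<in> C" for x y
  proof -
    have "x \<in> core_pairs" "y \<in> core_pairs" using that by (auto simp: C_def)
    then show ?thesis
      using that core_pairs_lin core_pairs_V by (simp add: C_def vlin D.lin_closed)
  qed
  obtain x s where x: "x \<in> V" "\<And>n. s n \<in> C" "(\<lambda>n. D.dst (s n) x) \<longlonglongrightarrow> 0"
    "\<And>v. v \<in> V \<Longrightarrow> (\<And>z c. z \<in> C \<Longrightarrow> lin z c v \<in> C) \<Longrightarrow> ipd x v = 0"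
  proof (rule D.minimizer[OF CV \<open>C \<noteq> {}\<close> mid])
    fix s :: "nat \<Rightarrow> (complex \<Rightarrow> complex) \<times> (complex \<Rightarrow> complex)"
    assume s: "\<And>n. s n \<in> C" "\<And>e. e > 0 \<Longrightarrow> \<exists>N. \<forall>m\<ge>N. \<forall>n\<ge>N. D.dst (s m) (s n) < e"
    have "s n \<in> V" for n using s(1) CV by blast
    then show "\<exists>x\<in>V. (\<lambda>n. D.dst (s n) x) \<longlonglongrightarrow> 0"
      using s(2) by (rule V_complete)
  next
    fix x and s :: "nat \<Rightarrow> (complex \<Rightarrow> complex) \<times> (complex \<Rightarrow> complex)"
    assume a: "x \<in> V" "\<And>n. s n \<in> C" "(\<lambda>n. D.dst (s n) x) \<longlonglongrightarrow> 0"
      "\<And>y. y \<in> V \<Longrightarrow> (\<And>z c. z \<in> C \<Longrightarrow> lin z c y \<in> C) \<Longrightarrow> ipd x y = 0"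
    show thesis
    proof (rule that[OF a(1-3)])
      fix v assume "v \<in> V" and v: "\<And>z c. z \<in> C \<Longrightarrow> lin z c v \<in> C"
      then show "ipd x v = 0" by (intro a(4))
    qed
  qed
  have sc: "s n \<in> core_pairs" and sv: "value_at_0 \<beta> (fst (s n)) = 1" for n
    using x(2) by (auto simp: C_def)
  note sV = core_pairs_V[OF sc]
  \<comment> \<open>Evaluation at 0 is continuous: it is a Fourier coefficient of E f up to a
    constant.\<close>
  have vx: "value_at_0 \<beta> (fst x) = 1"
    using tendsto_value[OF sV x(1) x(3)] by (simp add: sv LIMSEQ_const_iff)
  have orth: "ipd v x = 0" if v: "v \<in> core_pairs" "value_at_0 \<beta> (fst v) = 0" for v
  proof -
    have "ipd x v = 0"
    proof (rule x(4)[OF core_pairs_V[OF v(1)]])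
      show "lin z c v \<in> C" if "z \<in> C" for z c
        using that v core_pairs_lin[of z v c] vlin[OF core_pairs_V core_pairs_V[OF v(1)], of z c] by (simp add: C_def)
    qed
    then show ?thesis using D.ip_cnj[OF x(1) core_pairs_V[OF v(1)]] by simp
  qed
  define N where "N = complex_of_real (D.sq x)"
  \<comment> \<open>h - h(0) * s n vanishes at the origin for each n; in the limit s n becomes
    x.\<close>
  have core: "ipd h x = value_at_0 \<beta> (fst h) * N" if h: "h \<in> core_pairs" for h
  proof -
    let ?v = "value_at_0 \<beta> (fst h)"
    have "ipd h x + (- ?v) * ipd (s n) x = 0" for n
    proof -
      have "ipd (lin h (- ?v) (s n)) x = 0"
        by (rule orth[OF core_pairs_lin[OF h sc]]) (simp add: vlin core_pairs_V h sV sv)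
      then show ?thesis by (simp add: D.ip_lin core_pairs_V h sV x(1))
    qed
    moreover have "(\<lambda>n. ipd h x + (- ?v) * ipd (s n) x) \<longlonglongrightarrow> ipd h x + (- ?v) * ipd x x"
      by (intro tendsto_intros D.tendsto_ip sV x)
    ultimately have "ipd h x + (- ?v) * ipd x x = 0"
      by (simp add: LIMSEQ_const_iff)
    then show ?thesis using D.ip_self[OF x(1)] by (simp add: N_def)
  qed
  \<comment> \<open>A vector of norm 0 has value 0 at the origin, whereas x has value 1.\<close>
  have "N \<noteq> 0"
  proof
    assume "N = 0"
    then have 0: "D.sq x = 0" by (simp add: N_def)
    have "nsq (\<lambda>t. E t * fst x t) \<le> D.sq x"
    proof -
      have "0 \<le> nsq (\<lambda>t. S t * fst x t + snd x t)" "0 \<le> (\<Sum>\<^sub>\<infinity>w\<in>Z. (cmod (fst x w))\<^sup>2 * m w)"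
        by (auto intro!: L2.sq_nonneg V_D x infsum_nonneg simp: m_nonneg)
      then show ?thesis unfolding sq_eq[OF x(1)] by simp
    qed
    with 0 L2.sq_nonneg[OF V_D(3)[OF x(1)]] have "nsq (\<lambda>t. E t * fst x t) = 0" by simp
    with fourier_coeff_bound[OF V_D(3)[OF x(1)], of 0] have "value_at_0 \<beta> (fst x) = 0"
      by (simp add: value_eq)
    with vx show False by simp
  qed
  \<comment> \<open>This is x / N: \<open>lin x (c - 1) x\<close> is scaling by c, and N is
    real.\<close>
  define k where "k = lin x (1 / cnj N - 1) x"
  have N: "cnj N = N" by (simp add: N_def)
  have k: "k \<in> V" unfolding k_def by (rule D.lin_closed[OF x(1) x(1)])
  have fk: "fst k = (\<lambda>t. (1 / N) * fst x t)"
    by (simp add: k_def lin_def N algebra_simps)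
  have ipk: "ipd y k = ipd y x / N" if "y \<in> V" for y
    using D.ip_lin_right[OF x(1) x(1) that, of "1 / cnj N - 1"] by (simp add: k_def N algebra_simps)
  have k_check: "fst k \<in> H2_check \<beta>"
    unfolding H2_check_iff
  proof (intro exI conjI allI)
    show "(fst k, snd k) \<in> V" using k by simp
    define s' where "s' n = lin (s n) (1 / cnj N - 1) (s n)" for n
    show "s' n \<in> core_pairs" for n unfolding s'_def by (rule core_pairs_lin[OF sc sc])
    have "D.dst (s' n) k = (cmod (1 / N))\<^sup>2 * D.dst (s n) x" for n
    proof -
      have "lin (s' n) (-1) k = lin (lin (s n) (-1) x) (1 / N - 1) (lin (s n) (-1) x)"
        by (simp add: s'_def k_def lin_def N algebra_simps)
      moreover have "D.sq (lin y (c - 1) y) = (cmod c)\<^sup>2 * D.sq y" if "y \<in> V" for y c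
      proof -
        have "ipd (lin y (c - 1) y) (lin y (c - 1) y) = c * cnj c * ipd y y"
          using that by (simp add: D.ip_lin D.ip_lin_right D.lin_closed algebra_simps)
        also have "\<dots> = of_real ((cmod c)\<^sup>2 * D.sq y)"
          unfolding mult_cnj_cmod D.ip_self[OF that] by simp
        finally show ?thesis unfolding D.sq_def[of "lin y (c - 1) y"] by (simp only: Re_complex_of_real)
      qed
      ultimately show ?thesis unfolding D.dst_def using D.lin_closed[OF sV x(1)] by simp
    qed
    then show "(\<lambda>n. D.dst (s' n) (fst k, snd k)) \<longlonglongrightarrow> 0"
      using tendsto_mult_right_zero[OF x(3), of "(cmod (1 / N))\<^sup>2"] by simp
  qed
  have "inner_data \<beta> f (fst k) = value_at_0 \<beta> f" if f: "f \<in> H2_check \<beta>" for f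
  proof -
    obtain f2 r where V: "(f, f2) \<in> V" and r: "\<And>n::nat. r n \<in> core_pairs" and lim: "(\<lambda>n. D.dst (r n) (f, f2)) \<longlonglongrightarrow> 0"
      using f unfolding H2_check_iff by blast
    note rV = core_pairs_V[OF r]
    have "(\<lambda>n. ipd (r n) k) \<longlonglongrightarrow> ipd (f, f2) k" by (rule D.tendsto_ip[OF rV V k lim])
    moreover have "(\<lambda>n. ipd (r n) k) \<longlonglongrightarrow> value_at_0 \<beta> f"
      using tendsto_value[OF rV V lim] \<open>N \<noteq> 0\<close> by (simp add: ipk[OF rV] core[OF r])
    ultimately have "ipd (f, f2) k = value_at_0 \<beta> f" by (rule LIMSEQ_unique)
    then show ?thesis using inner_data_eq[OF V, of "fst k" "snd k"] k by simp
  qed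
  moreover have "value_at_0 \<beta> (fst k) \<noteq> 0"
    using vx \<open>N \<noteq> 0\<close> unfolding fk value_scale by simp
  ultimately show ?thesis using k_check by blast
qed

theorem k_check:
  "k_check \<beta> \<in> H2_check \<beta>" "\<And>f. f \<in> H2_check \<beta> \<Longrightarrow> inner_data \<beta> f (k_check \<beta>) = value_at_0 \<beta> f"
  "value_at_0 \<beta> (k_check \<beta>) \<noteq> 0"
proof -
  obtain k0 where k0: "k0 \<in> H2_check \<beta>" "\<forall>f\<in>H2_check \<beta>. inner_data \<beta> f k0 = value_at_0 \<beta> f" "value_at_0 \<beta> k0 \<noteq> 0"
    using check_kernel_exists by blast
  have "k_check \<beta> \<in> H2_check \<beta> \<and> (\<forall>f\<in>H2_check \<beta>. inner_data \<beta> f (k_check \<beta>) = value_at_0 \<beta> f)"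
    unfolding k_check_def
    by (rule someI[of "\<lambda>k. k \<in> H2_check \<beta> \<and> (\<forall>f\<in>H2_check \<beta>. inner_data \<beta> f k = value_at_0 \<beta> f)" k0])
       (use k0 in blast)
  then show kc: "k_check \<beta> \<in> H2_check \<beta>"
    and kr: "\<And>f. f \<in> H2_check \<beta> \<Longrightarrow> inner_data \<beta> f (k_check \<beta>) = value_at_0 \<beta> f" by auto
  obtain k2 l2 where V: "(k_check \<beta>, k2) \<in> V" "(k0, l2) \<in> V"
    using kc k0(1) by (auto simp: H2_check_iff)
  \<comment> \<open>The chosen kernel and the constructed \<open>k0\<close> are evaluated on each
    other, which transfers the nonvanishing value at 0 without proving them equal.\<close>
  have "value_at_0 \<beta> (k_check \<beta>) = ipd (k_check \<beta>, k2) (k0, l2)"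
    using k0(2) kc inner_data_eq[OF V] by simp
  also have "\<dots> = cnj (ipd (k0, l2) (k_check \<beta>, k2))"
    by (rule D.ip_cnj[OF V(2,1)])
  also have "\<dots> = cnj (value_at_0 \<beta> k0)"
    using kr[OF k0(1)] inner_data_eq[OF V(2,1)] by simp
  finally show "value_at_0 \<beta> (k_check \<beta>) \<noteq> 0" using k0(3) by simp
qed

end

section \<open>The duality map\<close>

lemma AE_reflect:
  assumes "AE t in circle. f (cnj t) = g t"
  shows "AE t in circle. f t = g (cnj t)"
  using AE_circle_cnj[OF assms] by simp

lemma reflect:
  assumes ae: "AE t in circle. f (cnj t) = g t" and g: "g \<in> L2"
  shows "f \<in> L2" "fourier_coeff f n = fourier_coeff g (- n)"
proof -
  note [measurable] = L2_measurable[OF L2_reflect[OF g]]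
  have fm: "f \<in> borel_measurable circle"
    by (rule borel_measurable_cong_AE[OF _ AE_reflect[OF ae]]) measurable
  show "f \<in> L2" by (rule L2_cong_AE[OF L2_reflect[OF g] fm AE_reflect[OF ae]])
  have "fourier_coeff f n = fourier_coeff (\<lambda>t. g (cnj t)) n"
    by (rule fourier_coeff_cong_AE[OF AE_reflect[OF ae] fm]) measurable
  then show "fourier_coeff f n = fourier_coeff g (- n)"
    using fourier_coeff_reflect[OF L2_measurable[OF g]] by simp
qed

lemma L2_inner_reflect:
  assumes "AE t in circle. f (cnj t) = f' t" "AE t in circle. g (cnj t) = g' t" "f' \<in> L2" "g' \<in> L2"
  shows "L2_inner f g = L2_inner f' g'"
proof -
  note [measurable] = L2_measurable[OF reflect(1)[OF assms(1,3)]] L2_measurable[OF reflect(1)[OF assms(2,4)]]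
    L2_measurable[OF assms(3)] L2_measurable[OF assms(4)]
  have "L2_inner f g = (LINT t|circle. f (cnj t) * cnj (g (cnj t)))"
    unfolding L2_inner_def by (rule integral_circle_cnj[symmetric]) measurable
  also have "\<dots> = L2_inner f' g'"
    unfolding L2_inner_def
  proof (rule integral_cong_AE)
    show "(\<lambda>t. f (cnj t) * cnj (g (cnj t))) \<in> borel_measurable circle"
      by (rule measurable_compose[OF measurable_cnj_circle]) measurable
    show "AE t in circle. f (cnj t) * cnj (g (cnj t)) = f' t * cnj (g' t)"
      using assms(1,2) by eventually_elim simp
  qed measurable
  finally show ?thesis .
qed

text \<open>In \<open>dual_data\<close> the record \<open>\<beta>\<close> plays the role of the shifted data and \<open>\<gamma>\<close> that of the dual
  data; \<open>d w\<close> is the derivative of \<open>1 / T\<close> at \<open>w\<close>, and \<open>m\<close> stands for the shifted masses, whence the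
  additional factor \<open>\<bar>w\<bar>\<^sup>2\<close> in the formula for the dual masses.\<close>

locale dual_data =
  A: scattering_blaschke S E p Z m \<beta> b + B: scattering_record S' E' p' Z' m' \<gamma>
  for S E p Z m \<beta> b S' E' p' Z' m' \<gamma> +
  fixes d :: "complex \<Rightarrow> complex"
  assumes E'_eq: "AE t in circle. E' t = cnj (E (cnj t))"
    and S'_eq: "AE t in circle. S' (cnj t) = - (t * S t * cnj (E t) / E t) * b t"
    and Z'_eq: "Z' = cnj ` Z" and Z_0: "0 \<notin> Z"
    and m'_eq: "\<And>w. w \<in> Z \<Longrightarrow> m' (cnj w) = 1 / ((cmod w)\<^sup>2 * (cmod (d w))\<^sup>2 * m w)"
    and d_eq: "\<And>w. w \<in> Z \<Longrightarrow> d w * Te \<beta> w = disc_ext (A.bdiv w) w"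
    and Te'_eq: "\<And>z. cmod z < 1 \<Longrightarrow> Te \<gamma> z = cnj (Te \<beta> (cnj z))"
begin

lemma d_nonzero: "w \<in> Z \<Longrightarrow> d w \<noteq> 0"
  using A.bdiv_nonzero[of w] d_eq[of w] by auto

lemma Te_nonzero: "Te \<beta> w \<noteq> 0"
  by (simp add: Te_def outer_def)

lemma E'_cnj: "AE t in circle. E' (cnj t) = cnj (E t)"
  using AE_circle_cnj[OF E'_eq] by simp

text \<open>A relation instead of a function: on the circle both components are determined only
  almost everywhere, whereas the values on the support are prescribed pointwise. The latter carry
  the minus sign that makes the contributions of circle and support cancel in
  \<open>hat_zero_orthogonal\<close>.\<close>

definition dual_pairs :: "(complex \<Rightarrow> complex) \<times> (complex \<Rightarrow> complex) \<Rightarrow> (complex \<Rightarrow> complex) \<times> (complex \<Rightarrow> complex) \<Rightarrow> bool" where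
  "dual_pairs x y \<longleftrightarrow>
     (AE t in circle. fst y (cnj t) = cnj (b t) * (fst x t + cnj (S t) * snd x t) / cnj (E t)) \<and>
     (AE t in circle. snd y (cnj t) = t * (S t * fst x t + snd x t) / E t) \<and>
     (\<forall>w\<in>Z. fst y (cnj w) = - (fst x w * cnj w * of_real (m w) * cnj (d w)))"

text \<open>The quantities in the first splitting for the dual data are those in the second
  splitting for the original ones, up to unimodular factors. In the middle identity the sign and the
  factor b of the dual symbol cancel against the definition, leaving (1 - |S|^2) e2 = |E|^2
  e2.\<close>

lemma dual_identities:
  assumes "dual_pairs (e, e2) (f, f2)"
  shows "AE t in circle. E' (cnj t) * f (cnj t) = cnj (b t) * (e t + cnj (S t) * e2 t)"
    "AE t in circle. S' (cnj t) * f (cnj t) + f2 (cnj t) = t * (cnj (E t) * e2 t)"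
    "AE t in circle. cnj (E' (cnj t)) * f2 (cnj t) = t * (S t * e t + e2 t)"
proof -
  have 1: "AE t in circle. f (cnj t) = cnj (b t) * (e t + cnj (S t) * e2 t) / cnj (E t)"
    and 2: "AE t in circle. f2 (cnj t) = t * (S t * e t + e2 t) / E t"
    using assms by (auto simp: dual_pairs_def)
  show "AE t in circle. E' (cnj t) * f (cnj t) = cnj (b t) * (e t + cnj (S t) * e2 t)"
    using 1 E'_cnj A.E_nonzero by eventually_elim simp
  show "AE t in circle. cnj (E' (cnj t)) * f2 (cnj t) = t * (S t * e t + e2 t)"
    using 2 E'_cnj A.E_nonzero by eventually_elim simp
  show "AE t in circle. S' (cnj t) * f (cnj t) + f2 (cnj t) = t * (cnj (E t) * e2 t)"
    using 1 2 S'_eq A.E_nonzero A.E_S A.b_1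
  proof eventually_elim
    fix t assume f: "f (cnj t) = cnj (b t) * (e t + cnj (S t) * e2 t) / cnj (E t)"
      and f2: "f2 (cnj t) = t * (S t * e t + e2 t) / E t"
      and S': "S' (cnj t) = - (t * S t * cnj (E t) / E t) * b t" and E: "E t \<noteq> 0"
      and ES: "(cmod (E t))\<^sup>2 = 1 - (cmod (S t))\<^sup>2" and b: "cmod (b t) = 1"
    have bb: "b t * cnj (b t) = 1" using b by (simp add: mult_cnj_cmod)
    have EE: "1 - S t * cnj (S t) = E t * cnj (E t)" unfolding mult_cnj_cmod ES by simp
    have "S' (cnj t) * f (cnj t) = - (t * S t / E t) * (b t * cnj (b t)) * (e t + cnj (S t) * e2 t)"
      unfolding f S' using E by simp
    then have "S' (cnj t) * f (cnj t) + f2 (cnj t) = t / E t * ((1 - S t * cnj (S t)) * e2 t)"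
      unfolding bb f2 using E by (simp add: field_simps)
    also have "\<dots> = t * (cnj (E t) * e2 t)"
      unfolding EE using E by simp
    finally show "S' (cnj t) * f (cnj t) + f2 (cnj t) = t * (cnj (E t) * e2 t)" .
  qed
qed

lemma L2_b_mult: "u \<in> L2 \<Longrightarrow> (\<lambda>t. cnj (b t) * u t) \<in> L2"
  by (rule L2_mult_bounded[where C = 1]) (use A.b_le_1 in auto)

lemma L2_t_mult: "u \<in> L2 \<Longrightarrow> (\<lambda>t. t * u t) \<in> L2"
  using L2_powi_mult[of u 1] by simp

lemma coeff_t_mult: "u \<in> L2 \<Longrightarrow> fourier_coeff (\<lambda>t. t * u t) n = fourier_coeff u (n - 1)"
  using fourier_coeff_shift[OF L2_measurable, of u 1 n] by simp

text \<open>Multiplication by t followed by reflection sends index n to -n-1, which exchanges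
  negative and nonnegative frequencies. Thus \<open>cnj E * e2\<close> in \<open>H2_minus\<close>
  gives the condition in \<open>H2\<close> for the dual pair, and S e + e2 in \<open>H2\<close>
  gives the one in \<open>H2_minus\<close>.\<close>

lemma dual_pair:
  assumes rel: "dual_pairs (e, e2) (f, f2)" and e: "A.pair e e2"
  shows "B.pair f f2"
proof -
  note I = dual_identities[OF rel]
  note [measurable] = A.pair_D(1,2)[OF e] L2_measurable[OF L2_reflect]
  have 1: "AE t in circle. f (cnj t) = cnj (b t) * (e t + cnj (S t) * e2 t) / cnj (E t)"
    and 2: "AE t in circle. f2 (cnj t) = t * (S t * e t + e2 t) / E t"
    using rel by (auto simp: dual_pairs_def)
  have "(\<lambda>t. (\<lambda>t. cnj (b t) * (e t + cnj (S t) * e2 t) / cnj (E t)) (cnj t)) \<in> borel_measurable circle"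
    by (rule measurable_compose[OF measurable_cnj_circle]) measurable
  then have fm: "f \<in> borel_measurable circle"
    by (rule borel_measurable_cong_AE[OF _ AE_reflect[OF 1]])
  have "(\<lambda>t. (\<lambda>t. t * (S t * e t + e2 t) / E t) (cnj t)) \<in> borel_measurable circle"
    by (rule measurable_compose[OF measurable_cnj_circle]) measurable
  then have f2m: "f2 \<in> borel_measurable circle"
    by (rule borel_measurable_cong_AE[OF _ AE_reflect[OF 2]])
  show ?thesis
    unfolding B.pair_def
  proof (intro conjI fm f2m)
    show "(\<lambda>t. E' t * f t) \<in> L2"
      by (rule reflect(1)[OF I(1) L2_b_mult[OF A.pair_add_cnj_S_L2[OF e]]])
    note E2 = A.pair_D(5)[OF e]
    show "(\<lambda>t. S' t * f t + f2 t) \<in> H2"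
    proof (rule H2_I)
      show "(\<lambda>t. S' t * f t + f2 t) \<in> L2"
        by (rule reflect(1)[OF I(2) L2_t_mult[OF H2_minus_L2[OF E2]]])
      show "fourier_coeff (\<lambda>t. S' t * f t + f2 t) n = 0" if "n < 0" for n
        unfolding reflect(2)[OF I(2) L2_t_mult[OF H2_minus_L2[OF E2]]] coeff_t_mult[OF H2_minus_L2[OF E2]]
        using E2 that by (simp add: H2_minus_iff)
    qed
    note g = A.pair_D(4)[OF e]
    show "(\<lambda>t. cnj (E' t) * f2 t) \<in> H2_minus"
      unfolding H2_minus_iff
    proof (intro conjI allI impI)
      show "(\<lambda>t. cnj (E' t) * f2 t) \<in> L2"
        by (rule reflect(1)[OF I(3) L2_t_mult[OF H2_L2[OF g]]])
      show "fourier_coeff (\<lambda>t. cnj (E' t) * f2 t) n = 0" if "0 \<le> n" for n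
        unfolding reflect(2)[OF I(3) L2_t_mult[OF H2_L2[OF g]]] coeff_t_mult[OF H2_L2[OF g]]
        using H2_coeff[OF g] that by simp
    qed
  qed
qed

lemma dual_pair_inverse:
  assumes f: "B.pair f f2"
  obtains e e2 where "dual_pairs (e, e2) (f, f2)" "A.pair e e2"
proof -
  note [measurable] = B.pair_D(1,2)[OF f]
  \<comment> \<open>P and Q are the values that the relation forces on e + cnj S e2 and S e +
    e2.\<close>
  define P where "P t = b t * cnj (E t) * f (cnj t)" for t
  define Q where "Q t = E t * f2 (cnj t) / t" for t
  have [measurable]: "(\<lambda>t. f (cnj t)) \<in> borel_measurable circle" "(\<lambda>t. f2 (cnj t)) \<in> borel_measurable circle"
    by (rule measurable_compose[OF measurable_cnj_circle], measurable)+
  have [measurable]: "P \<in> borel_measurable circle" "Q \<in> borel_measurable circle"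
    unfolding P_def[abs_def] Q_def[abs_def] by measurable
  \<comment> \<open>On the circle e and e2 solve the linear system with right-hand sides P and Q,
    whose determinant 1 - |S|^2 is |E|^2; on the support the prescribed relation of values is
    inverted.\<close>
  define e where "e t = (if t \<in> Z then - f (cnj t) / (cnj t * of_real (m t) * cnj (d t))
     else (P t - cnj (S t) * Q t) / (E t * cnj (E t)))" for t
  define e2 where "e2 t = (Q t - S t * P t) / (E t * cnj (E t))" for t
  have ee: "AE t in circle. e t = (P t - cnj (S t) * Q t) / (E t * cnj (E t))"
    using AE_circle_notin_ball[OF A.Z_ball] by eventually_elim (simp add: e_def)
  have em [measurable]: "e \<in> borel_measurable circle"
    by (rule borel_measurable_cong_AE[OF _ ee]) measurable
  have e2m [measurable]: "e2 \<in> borel_measurable circle"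
    unfolding e2_def[abs_def] by measurable
  have PQ: "AE t in circle. e t + cnj (S t) * e2 t = P t \<and> S t * e t + e2 t = Q t"
    using ee A.E_nonzero A.E_S
  proof eventually_elim
    fix t assume et: "e t = (P t - cnj (S t) * Q t) / (E t * cnj (E t))" and E: "E t \<noteq> 0"
      and ES: "(cmod (E t))\<^sup>2 = 1 - (cmod (S t))\<^sup>2"
    have EE: "E t * cnj (E t) = 1 - S t * cnj (S t)" unfolding mult_cnj_cmod ES by simp
    have ne: "E t * cnj (E t) \<noteq> 0" using E by simp
    have "e t + cnj (S t) * e2 t = (P t - cnj (S t) * Q t + cnj (S t) * (Q t - S t * P t)) / (E t * cnj (E t))"
      unfolding et e2_def by (simp add: add_divide_distrib)
    also have "P t - cnj (S t) * Q t + cnj (S t) * (Q t - S t * P t) = (1 - S t * cnj (S t)) * P t"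
      by (simp add: algebra_simps)
    finally have 1: "e t + cnj (S t) * e2 t = P t" unfolding EE[symmetric] using ne by simp
    have "S t * e t + e2 t = (S t * (P t - cnj (S t) * Q t) + (Q t - S t * P t)) / (E t * cnj (E t))"
      unfolding et e2_def by (simp add: add_divide_distrib)
    also have "S t * (P t - cnj (S t) * Q t) + (Q t - S t * P t) = (1 - S t * cnj (S t)) * Q t"
      by (simp add: algebra_simps)
    finally show "e t + cnj (S t) * e2 t = P t \<and> S t * e t + e2 t = Q t"
      unfolding EE[symmetric] using ne 1 by simp
  qed
  have rel: "dual_pairs (e, e2) (f, f2)"
    unfolding dual_pairs_def fst_conv snd_conv
  proof (intro conjI ballI)
    show "AE t in circle. f (cnj t) = cnj (b t) * (e t + cnj (S t) * e2 t) / cnj (E t)"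
      using PQ A.E_nonzero A.b_1
    proof eventually_elim
      fix t assume *: "e t + cnj (S t) * e2 t = P t \<and> S t * e t + e2 t = Q t" "E t \<noteq> 0" "cmod (b t) = 1"
      have "b t * cnj (b t) = 1" using *(3) by (simp add: mult_cnj_cmod)
      moreover have "cnj (b t) * P t / cnj (E t) = (b t * cnj (b t)) * f (cnj t)"
        unfolding P_def using *(2) by simp
      ultimately show "f (cnj t) = cnj (b t) * (e t + cnj (S t) * e2 t) / cnj (E t)"
        using *(1) by simp
    qed
    show "AE t in circle. f2 (cnj t) = t * (S t * e t + e2 t) / E t"
      using PQ A.E_nonzero AE_circle_norm
      by eventually_elim (auto simp: Q_def)
    show "f (cnj w) = - (e w * cnj w * of_real (m w) * cnj (d w))" if "w \<in> Z" for w
    proof -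
      have "cnj w * of_real (m w) * cnj (d w) \<noteq> 0"
        using that d_nonzero[OF that] A.m_pos[OF that] Z_0 by auto
      moreover have "e w * cnj w * of_real (m w) * cnj (d w) = e w * (cnj w * of_real (m w) * cnj (d w))"
        by (simp only: mult.assoc)
      ultimately show ?thesis
        using that by (simp add: e_def)
    qed
  qed
  note I = dual_identities[OF rel]
  have g': "(\<lambda>t. S' t * f t + f2 t) \<in> H2" and u': "(\<lambda>t. cnj (E' t) * f2 t) \<in> H2_minus" and v': "(\<lambda>t. E' t * f t) \<in> L2"
    using B.pair_D[OF f] by auto
  have t1: "AE t in circle. t powi (-1) * t = 1"
  proof -
    have "AE t in circle. (t::complex) \<noteq> 0" by (rule AE_circle_neq) simp
    then show ?thesis by eventually_elim (simp add: power_int_minus)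
  qed
  have e2H: "(\<lambda>t. cnj (E t) * e2 t) \<in> H2_minus"
  proof -
    let ?r = "\<lambda>t. t powi (-1) * (\<lambda>t. S' (cnj t) * f (cnj t) + f2 (cnj t)) t"
    have gr: "(\<lambda>t. S' (cnj t) * f (cnj t) + f2 (cnj t)) \<in> L2"
      by (rule L2_reflect[OF H2_L2[OF g']])
    have r: "?r \<in> H2_minus"
      unfolding H2_minus_iff
    proof (intro conjI allI impI)
      show "?r \<in> L2" by (rule L2_powi_mult[OF gr])
      show "fourier_coeff ?r n = 0" if "0 \<le> n" for n
        using fourier_coeff_shift[OF L2_measurable[OF gr], of "-1" n]
          fourier_coeff_reflect[OF L2_measurable[OF H2_L2[OF g']], of "n + 1"] H2_coeff[OF g', of "- (n + 1)"] that
        by simp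
    qed
    show ?thesis
    proof (rule H2_minus_cong_AE[OF r])
      show "AE t in circle. cnj (E t) * e2 t = ?r t"
        using I(2) t1
      proof eventually_elim
        fix t :: complex assume *: "S' (cnj t) * f (cnj t) + f2 (cnj t) = t * (cnj (E t) * e2 t)" "t powi (-1) * t = 1"
        have "?r t = (t powi (-1) * t) * (cnj (E t) * e2 t)" by (simp only: *(1) mult.assoc)
        then show "cnj (E t) * e2 t = ?r t" by (simp only: *(2) mult_1_left)
      qed
    qed measurable
  qed
  have eH: "(\<lambda>t. S t * e t + e2 t) \<in> H2"
  proof -
    let ?r = "\<lambda>t. t powi (-1) * (\<lambda>t. cnj (E' (cnj t)) * f2 (cnj t)) t"
    have ur: "(\<lambda>t. cnj (E' (cnj t)) * f2 (cnj t)) \<in> L2"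
      by (rule L2_reflect[OF H2_minus_L2[OF u']])
    have r: "?r \<in> H2"
    proof (rule H2_I)
      show "?r \<in> L2" by (rule L2_powi_mult[OF ur])
      show "fourier_coeff ?r n = 0" if "n < 0" for n
        using fourier_coeff_shift[OF L2_measurable[OF ur], of "-1" n]
          fourier_coeff_reflect[OF L2_measurable[OF H2_minus_L2[OF u']], of "n + 1"] u' that
        by (simp add: H2_minus_iff)
    qed
    show ?thesis
    proof (rule H2_cong_AE[OF r])
      show "AE t in circle. S t * e t + e2 t = ?r t"
        using I(3) t1
      proof eventually_elim
        fix t :: complex assume *: "cnj (E' (cnj t)) * f2 (cnj t) = t * (S t * e t + e2 t)" "t powi (-1) * t = 1"
        have "?r t = (t powi (-1) * t) * (S t * e t + e2 t)" by (simp only: *(1) mult.assoc)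
        then show "S t * e t + e2 t = ?r t" by (simp only: *(2) mult_1_left)
      qed
    qed measurable
  qed
  have PL: "(\<lambda>t. e t + cnj (S t) * e2 t) \<in> L2"
  proof (rule L2_dominated[OF _ L2_reflect[OF v']])
    show "AE t in circle. cmod (e t + cnj (S t) * e2 t) \<le> cmod (E' (cnj t) * f (cnj t))"
      using I(1) A.b_1 by eventually_elim (simp add: norm_mult)
  qed measurable
  \<comment> \<open>Integrability has been obtained for both terms of the second splitting; the
    equality with the first one bounds E e.\<close>
  have "(\<lambda>t. E t * e t) \<in> L2"
  proof (rule L2_I)
    show "integrable circle (\<lambda>t. (cmod (cnj (E t) * e2 t))\<^sup>2 + (cmod (e t + cnj (S t) * e2 t))\<^sup>2)"
      by (intro Bochner_Integration.integrable_add L2_square_integrable H2_minus_L2[OF e2H] PL)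
    show "AE t in circle. (cmod (E t * e t))\<^sup>2 \<le> (cmod (cnj (E t) * e2 t))\<^sup>2 + (cmod (e t + cnj (S t) * e2 t))\<^sup>2"
      using A.E_S
    proof eventually_elim
      fix t assume "(cmod (E t))\<^sup>2 = 1 - (cmod (S t))\<^sup>2"
      note M = metric_form_self[of "E t" S t e e2, OF this]
      have "(cmod (E t * e t))\<^sup>2 \<le> (cmod (E t * e t))\<^sup>2 + (cmod (S t * e t + e2 t))\<^sup>2" by simp
      also have "\<dots> = (cmod (cnj (E t) * e2 t))\<^sup>2 + (cmod (e t + cnj (S t) * e2 t))\<^sup>2"
        using M by (simp only:)
      finally show "(cmod (E t * e t))\<^sup>2 \<le> (cmod (cnj (E t) * e2 t))\<^sup>2 + (cmod (e t + cnj (S t) * e2 t))\<^sup>2" .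
    qed
  qed measurable
  then have "A.pair e e2"
    unfolding A.pair_def using em e2m eH e2H by simp
  with rel show ?thesis by (rule that)
qed

text \<open>The dual mass is exactly what makes each point contribute the same: |f|^2 equals |e|^2
  |w|^2 m^2 |d|^2, and m' divides by |w|^2 |d|^2 m.\<close>

lemma dual_weighted:
  assumes rel: "\<And>w. w \<in> Z \<Longrightarrow> f (cnj w) = - (e w * cnj w * of_real (m w) * cnj (d w))"
    "\<And>w. w \<in> Z \<Longrightarrow> f' (cnj w) = - (e' w * cnj w * of_real (m w) * cnj (d w))"
  shows "weighted_l2 Z' m' f \<longleftrightarrow> weighted_l2 Z m e"
    "weighted_inner Z' m' f f' = weighted_inner Z m e e'"
proof -
  have inj: "inj_on cnj Z" by (auto simp: inj_on_def)
  have key: "f (cnj w) * cnj (f' (cnj w)) * of_real (m' (cnj w)) = e w * cnj (e' w) * of_real (m w)"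
    if rel: "f (cnj w) = - (e w * cnj w * of_real (m w) * cnj (d w))"
      "f' (cnj w) = - (e' w * cnj w * of_real (m w) * cnj (d w))" and w: "w \<in> Z" for f f' e e' w
  proof -
    define K where "K = (cmod w)\<^sup>2 * (cmod (d w))\<^sup>2 * m w"
    have K: "K \<noteq> 0"
      using d_nonzero[OF w] A.m_pos[OF w] w Z_0 by (auto simp: K_def)
    have "f (cnj w) * cnj (f' (cnj w)) = e w * cnj (e' w) * ((w * cnj w) * (d w * cnj (d w)) * of_real (m w)) * of_real (m w)"
      unfolding rel by (simp add: mult_ac)
    also have "(w * cnj w) * (d w * cnj (d w)) * of_real (m w) = of_real K"
      unfolding mult_cnj_cmod K_def by simp
    finally have "f (cnj w) * cnj (f' (cnj w)) * of_real (m' (cnj w))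
      = e w * cnj (e' w) * of_real (m w) * (of_real K * of_real (1 / K))"
      unfolding m'_eq[OF w] K_def[symmetric] by (simp only: mult_ac)
    also have "of_real K * of_real (1 / K) = (1::complex)"
      using K by (simp flip: of_real_mult)
    finally show ?thesis by simp
  qed
  have "weighted_inner Z' m' f f' = (\<Sum>\<^sub>\<infinity>w\<in>Z. f (cnj w) * cnj (f' (cnj w)) * of_real (m' (cnj w)))"
    unfolding weighted_inner_def Z'_eq by (subst infsum_reindex[OF inj]) (simp add: o_def)
  also have "\<dots> = weighted_inner Z m e e'"
    unfolding weighted_inner_def
  proof (rule infsum_cong)
    fix w assume w: "w \<in> Z"
    show "f (cnj w) * cnj (f' (cnj w)) * of_real (m' (cnj w)) = e w * cnj (e' w) * of_real (m w)"
      by (rule key[where f = f and f' = f' and e = e and e' = e' and w = w, OF rel(1)[OF w] rel(2)[OF w] w])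
  qed
  finally show "weighted_inner Z' m' f f' = weighted_inner Z m e e'" .
  have "(cmod (f (cnj w)))\<^sup>2 * m' (cnj w) = (cmod (e w))\<^sup>2 * m w" if w: "w \<in> Z" for w
  proof -
    have "complex_of_real ((cmod (f (cnj w)))\<^sup>2 * m' (cnj w)) = of_real ((cmod (e w))\<^sup>2 * m w)"
      unfolding of_real_mult mult_cnj_cmod[symmetric] 
      by (rule key[where f = f and f' = f and e = e and e' = e and w = w, OF rel(1)[OF w] rel(1)[OF w] w])
    then show ?thesis by (simp only: of_real_eq_iff)
  qed
  then have "weighted_l2 Z m e \<longleftrightarrow> (\<lambda>w. (cmod (f (cnj w)))\<^sup>2 * m' (cnj w)) summable_on Z"
    unfolding weighted_l2_def by (intro summable_on_cong) simp
  also have "\<dots> \<longleftrightarrow> weighted_l2 Z' m' f"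
    unfolding weighted_l2_def Z'_eq by (subst summable_on_reindex[OF inj]) (simp add: o_def)
  finally show "weighted_l2 Z' m' f \<longleftrightarrow> weighted_l2 Z m e" by simp
qed

lemma dual_V:
  assumes "dual_pairs x y" "x \<in> A.V"
  shows "y \<in> B.V"
proof -
  obtain e e2 f f2 where xy: "x = (e, e2)" "y = (f, f2)" by (metis surj_pair)
  have "weighted_l2 Z' m' f"
    using assms by (subst dual_weighted(1)[of f e f e]) (auto simp: xy dual_pairs_def A.V_def)
  then show ?thesis
    using dual_pair[of e e2 f f2] assms by (simp add: xy A.V_def B.V_def)
qed

lemma dual_V_inverse:
  assumes y: "y \<in> B.V"
  obtains x where "dual_pairs x y" "x \<in> A.V"
proof -
  obtain f f2 where fy: "y = (f, f2)" by (cases y)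
  have f: "B.pair f f2" "weighted_l2 Z' m' f" using y by (auto simp: fy B.V_def)
  obtain e e2 where e: "dual_pairs (e, e2) (f, f2)" "A.pair e e2"
    by (rule dual_pair_inverse[OF f(1)])
  have "weighted_l2 Z m e"
    using f(2) e(1) by (subst dual_weighted(1)[of f e f e, symmetric]) (auto simp: dual_pairs_def)
  then have "(e, e2) \<in> A.V" using e(2) by (simp add: A.V_def)
  show ?thesis by (rule that[OF _ \<open>(e, e2) \<in> A.V\<close>]) (simp add: fy e(1))
qed

text \<open>Term by term: the two \<open>L2\<close> inner products of the first splitting on the
  dual side are those of the second splitting on the other side, the unimodular factors
  \<open>cnj b\<close> and t dropping out.\<close>

theorem dual_ipd:
  assumes "dual_pairs x y" "dual_pairs x' y'" "x \<in> A.V" "x' \<in> A.V"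
  shows "B.ipd y y' = A.ipd x x'"
proof -
  obtain e e2 f f2 where xy: "x = (e, e2)" "y = (f, f2)" by (metis surj_pair)
  obtain e' e2' f' f2' where xy': "x' = (e', e2')" "y' = (f', f2')" by (metis surj_pair)
  note I = dual_identities[OF assms(1)[unfolded xy]] and I' = dual_identities[OF assms(2)[unfolded xy']]
  have e: "A.pair e e2" and e': "A.pair e' e2'" using assms(3,4) by (auto simp: xy xy' A.V_def)
  note L = A.pair_add_cnj_S_L2[OF e] A.pair_add_cnj_S_L2[OF e']
    H2_minus_L2[OF A.pair_D(5)[OF e]] H2_minus_L2[OF A.pair_D(5)[OF e']]
  have uni: "L2_inner (\<lambda>t. a t * u t) (\<lambda>t. a t * v t) = L2_inner u v"
    if "u \<in> L2" "v \<in> L2" "a \<in> borel_measurable circle" "AE t in circle. cmod (a t) = 1" for a u v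
  proof -
    note [measurable] = L2_measurable[OF that(1)] L2_measurable[OF that(2)] that(3)
    show ?thesis
      unfolding L2_inner_def
    proof (rule integral_cong_AE)
      show "AE t in circle. a t * u t * cnj (a t * v t) = u t * cnj (v t)"
        using that(4)
      proof eventually_elim
        fix t assume "cmod (a t) = 1"
        then have "a t * cnj (a t) = 1" by (simp add: mult_cnj_cmod)
        moreover have "a t * u t * cnj (a t * v t) = (a t * cnj (a t)) * (u t * cnj (v t))"
          by (simp add: mult_ac)
        ultimately show "a t * u t * cnj (a t * v t) = u t * cnj (v t)" by simp
      qed
    qed measurable
  qed
  have "L2_inner (\<lambda>t. E' t * f t) (\<lambda>t. E' t * f' t)
      = L2_inner (\<lambda>t. cnj (b t) * (e t + cnj (S t) * e2 t)) (\<lambda>t. cnj (b t) * (e' t + cnj (S t) * e2' t))"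
    by (rule L2_inner_reflect[OF I(1) I'(1)]) (intro L2_b_mult L)+
  also have "\<dots> = L2_inner (\<lambda>t. e t + cnj (S t) * e2 t) (\<lambda>t. e' t + cnj (S t) * e2' t)"
    by (rule uni[OF L(1,2)]) (use A.b_1 in auto)
  finally have 1: "L2_inner (\<lambda>t. E' t * f t) (\<lambda>t. E' t * f' t)
      = L2_inner (\<lambda>t. e t + cnj (S t) * e2 t) (\<lambda>t. e' t + cnj (S t) * e2' t)" .
  have "L2_inner (\<lambda>t. S' t * f t + f2 t) (\<lambda>t. S' t * f' t + f2' t)
      = L2_inner (\<lambda>t. t * (cnj (E t) * e2 t)) (\<lambda>t. t * (cnj (E t) * e2' t))"
    by (rule L2_inner_reflect[OF I(2) I'(2)]) (intro L2_t_mult L)+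
  also have "\<dots> = L2_inner (\<lambda>t. cnj (E t) * e2 t) (\<lambda>t. cnj (E t) * e2' t)"
    by (rule uni[OF L(3,4) measurable_id_circle AE_circle_norm])
  finally have 2: "L2_inner (\<lambda>t. S' t * f t + f2 t) (\<lambda>t. S' t * f' t + f2' t)
    = L2_inner (\<lambda>t. cnj (E t) * e2 t) (\<lambda>t. cnj (E t) * e2' t)" .
  have "weighted_inner Z' m' f f' = weighted_inner Z m e e'"
    using assms(1,2) by (intro dual_weighted(2)) (auto simp: xy xy' dual_pairs_def)
  then show ?thesis
    unfolding B.ipd_def A.ipd_def xy xy' B.ip_def A.ip_eq'[OF e e'] fst_conv snd_conv 1 2
    by simp
qed

lemma dual_pairs_exists: "\<exists>y. dual_pairs x y"
proof -
  define f where "f s = (if s \<in> Z' then - (fst x (cnj s) * s * of_real (m (cnj s)) * cnj (d (cnj s)))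
    else cnj (b (cnj s)) * (fst x (cnj s) + cnj (S (cnj s)) * snd x (cnj s)) / cnj (E (cnj s)))" for s
  define f2 where "f2 s = cnj s * (S (cnj s) * fst x (cnj s) + snd x (cnj s)) / E (cnj s)" for s
  have "dual_pairs x (f, f2)"
    unfolding dual_pairs_def fst_conv snd_conv
  proof (intro conjI ballI)
    show "AE t in circle. f (cnj t) = cnj (b t) * (fst x t + cnj (S t) * snd x t) / cnj (E t)"
      using AE_circle_cnj[OF AE_circle_notin_ball[OF B.Z_ball]] by eventually_elim (simp add: f_def)
    show "AE t in circle. f2 (cnj t) = t * (S t * fst x t + snd x t) / E t"
      by (simp add: f2_def)
    show "f (cnj w) = - (fst x w * cnj w * of_real (m w) * cnj (d w))" if "w \<in> Z" for w
      using that by (simp add: f_def Z'_eq)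
  qed
  then show ?thesis by blast
qed

text \<open>These test functions interpolate at a single point of Z; the factor t makes them vanish
  at 0, so the kernel at the origin gives 0 on them.\<close>

lemma t_bdiv:
  assumes w: "w \<in> Z"
  shows "(\<lambda>t. t * A.bdiv w t) \<in> H2"
    "cmod z < 1 \<Longrightarrow> disc_ext (\<lambda>t. t * A.bdiv w t) z = z * disc_ext (A.bdiv w) z"
  using H2_mult(1)[OF A.bdiv(1)[OF w] affine_H2(1,2), of 0 1]
    H2_mult(2)[OF A.bdiv(1)[OF w] affine_H2(1,2), of z 0 1] affine_H2(3)[of z 0 1] by simp_all

text \<open>On the circle t b / (t - w) = b / (1 - w cnj t). After reflection the second factor is
  the Szego kernel at cnj w, and b cancels the \<open>cnj b\<close> in the duality map, so that the
  pairing evaluates E' f.\<close>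

lemma inner_t_bdiv:
  assumes e: "A.pair e e2" and rel: "dual_pairs (e, e2) (f, f2)" and G: "(\<lambda>t. E' t * f t) \<in> H2" and w: "w \<in> Z"
  shows "L2_inner (\<lambda>t. e t + cnj (S t) * e2 t) (\<lambda>t. t * A.bdiv w t) = disc_ext (\<lambda>t. E' t * f t) (cnj w)"
proof -
  note u = A.pair_add_cnj_S_L2[OF e]
  have w1: "cmod (cnj w) < 1" using A.Z_lt_1[OF w] by simp
  have k: "(\<lambda>t. 1 / (1 - cnj (cnj w) * cnj t)) \<in> L2"
    by (rule L2_reflect[OF H2_L2[OF inverse_affine_H2(1)[OF w1]]])
  note [measurable] = L2_measurable[OF u] L2_measurable[OF k] L2_measurable[OF H2_L2[OF t_bdiv(1)[OF w]]]
  have "disc_ext (\<lambda>t. E' t * f t) (cnj w) = L2_inner (\<lambda>t. E' t * f t) (\<lambda>t. 1 / (1 - cnj (cnj w) * t))"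
    by (rule H2_reproducing[OF G w1, symmetric])
  also have "\<dots> = L2_inner (\<lambda>t. cnj (b t) * (e t + cnj (S t) * e2 t)) (\<lambda>t. 1 / (1 - cnj (cnj w) * cnj t))"
    by (rule L2_inner_reflect[OF dual_identities(1)[OF rel] _ L2_b_mult[OF u] k]) simp
  also have "\<dots> = L2_inner (\<lambda>t. e t + cnj (S t) * e2 t) (\<lambda>t. t * A.bdiv w t)"
    unfolding L2_inner_def
  proof (rule integral_cong_AE)
    show "AE t in circle. cnj (b t) * (e t + cnj (S t) * e2 t) * cnj (1 / (1 - cnj (cnj w) * cnj t))
      = (e t + cnj (S t) * e2 t) * cnj (t * A.bdiv w t)"
      using AE_circle_norm
    proof eventually_elim
      fix t :: complex assume t: "cmod t = 1"
      have ne: "t - w \<noteq> 0" using cmod_circle_diff(1)[OF t, of w] A.Z_lt_1[OF w] by auto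
      have "t * cnj t = 1" using t by (simp add: mult_cnj_cmod)
      then have tD: "t * (1 - w * cnj t) = t - w" by (simp add: algebra_simps)
      have "t * A.bdiv w t = b t * (t / (t * (1 - w * cnj t)))"
        unfolding tD A.bdiv_def by simp
      also have "\<dots> = b t * (1 / (1 - cnj (cnj w) * cnj t))"
        using t by auto
      finally show "cnj (b t) * (e t + cnj (S t) * e2 t) * cnj (1 / (1 - cnj (cnj w) * cnj t))
        = (e t + cnj (S t) * e2 t) * cnj (t * A.bdiv w t)"
        by (simp only: complex_cnj_mult mult_ac)
    qed
  qed measurable
  finally show ?thesis by simp
qed

lemma hat_iff:
  "f \<in> H2_hat \<gamma> \<longleftrightarrow> (\<exists>f2. (f, f2) \<in> B.V) \<and> (\<lambda>t. E' t * f t) \<in> H2 \<and>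
     (\<forall>w\<in>Z. f (cnj w) = disc_ext (\<lambda>t. E' t * f t) (cnj w) / Te \<gamma> (cnj w))"
  by (simp add: H2_hat_def B.L2_data_iff B.E B.points Z'_eq)

lemma hat_lin:
  assumes "f \<in> H2_hat \<gamma>" "g \<in> H2_hat \<gamma>"
  shows "(\<lambda>t. f t + c * g t) \<in> H2_hat \<gamma>"
proof -
  obtain f2 g2 where V: "(f, f2) \<in> B.V" "(g, g2) \<in> B.V" using assms by (auto simp: hat_iff)
  have "(\<lambda>t. f t + c * g t, \<lambda>t. f2 t + c * g2 t) \<in> B.V"
    using B.D.lin_closed[OF V, of c] by (simp add: B.lin_def)
  moreover have eq: "(\<lambda>t. E' t * (f t + c * g t)) = (\<lambda>t. E' t * f t + c * (E' t * g t))"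
    by (simp add: algebra_simps)
  moreover have "disc_ext (\<lambda>t. E' t * f t + c * (E' t * g t)) (cnj w)
     = disc_ext (\<lambda>t. E' t * f t) (cnj w) + c * disc_ext (\<lambda>t. E' t * g t) (cnj w)" if "w \<in> Z" for w
    using assms A.Z_lt_1[OF that] by (intro disc_ext_lin H2_L2) (auto simp: hat_iff)
  ultimately show ?thesis
    using assms by (auto simp: hat_iff H2_lin eq add_divide_distrib)
qed

lemma ipd_core:
  assumes e: "(e, e2) \<in> A.V" and h: "(h, q) \<in> A.core_pairs"
  shows "A.ipd (e, e2) (h, q) = L2_inner (\<lambda>t. e t + cnj (S t) * e2 t) h + weighted_inner Z m e h"
proof -
  have "A.pair e e2" using e by (simp add: A.V_def)
  from A.ip_generator(2)[OF this, of h q] show ?thesis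
    using h A.core_H2 H2_L2 by (auto simp: A.ipd_def A.core_pairs_def)
qed

lemma weighted_inner_single:
  assumes "w \<in> Z" "\<And>v. v \<in> Z \<Longrightarrow> v \<noteq> w \<Longrightarrow> h v = 0"
  shows "weighted_inner Z m e h = e w * cnj (h w) * of_real (m w)"
proof -
  have "weighted_inner Z m e h = (\<Sum>\<^sub>\<infinity>v\<in>{w}. e v * cnj (h v) * of_real (m v))"
    unfolding weighted_inner_def by (rule infsum_cong_neutral) (use assms in auto)
  then show ?thesis by simp
qed

text \<open>If \<open>f\<close> lies in the hat space and vanishes at the origin, then its preimage \<open>e\<close> is orthogonal to
  the core of the check space. A core function is a combination of the functions
  \<open>t * b t / (t - w)\<close> up to a multiple of \<open>b\<close>.\<close>

lemma hat_zero_orthogonal: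
  assumes e: "(e, e2) \<in> A.V" and rel: "dual_pairs (e, e2) (f, f2)" and f: "f \<in> H2_hat \<gamma>"
    and 0: "value_at_0 \<gamma> f = 0" and hq: "(h, q) \<in> A.core_pairs"
  shows "A.ipd (e, e2) (h, q) = 0"
proof -
  define u where "u t = e t + cnj (S t) * e2 t" for t
  have pe: "A.pair e e2" using e by (simp add: A.V_def)
  have u: "u \<in> L2" unfolding u_def[abs_def] by (rule A.pair_add_cnj_S_L2[OF pe])
  have G: "(\<lambda>t. E' t * f t) \<in> H2" and fw: "\<And>w. w \<in> Z \<Longrightarrow> f (cnj w) = disc_ext (\<lambda>t. E' t * f t) (cnj w) / Te \<gamma> (cnj w)"
    using f by (auto simp: hat_iff)
  have h: "h \<in> H2_core \<beta>" using hq by (simp add: A.core_pairs_def)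
  note hH = A.core_H2[OF h]
  define F where "F = {w \<in> Z. h w \<noteq> 0}"
  have F: "finite F" "F \<subseteq> Z" using h by (auto simp: F_def A.core_iff)
  \<comment> \<open>Lagrange interpolation: r takes the values of h on Z, so that h - r is divisible
    by b.\<close>
  define c where "c w = h w / (w * disc_ext (A.bdiv w) w)" for w
  have nz: "w * disc_ext (A.bdiv w) w \<noteq> 0" if "w \<in> Z" for w
    using that Z_0 A.bdiv_nonzero[OF that] by auto
  define r where "r t = (\<Sum>w\<in>F. c w * (t * A.bdiv w t))" for t
  have r: "r \<in> H2"
    unfolding r_def[abs_def] using F(2) by (intro H2_sum H2_scale t_bdiv) auto
  have rz: "disc_ext r v = (\<Sum>w\<in>F. c w * (v * disc_ext (A.bdiv w) v))" if v: "cmod v < 1" for v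
    unfolding r_def[abs_def] using F
  proof (induction F)
    case empty
    then show ?case by (simp add: disc_ext_const[OF v])
  next
    case (insert w F)
    have 1: "(\<lambda>t. t * A.bdiv w t) \<in> H2" using insert by (intro t_bdiv) auto
    have 2: "(\<lambda>t. \<Sum>w\<in>F. c w * (t * A.bdiv w t)) \<in> H2"
      using insert by (intro H2_sum H2_scale t_bdiv) auto
    have "disc_ext (\<lambda>t. (\<Sum>w\<in>F. c w * (t * A.bdiv w t)) + c w * (t * A.bdiv w t)) v
        = disc_ext (\<lambda>t. \<Sum>w\<in>F. c w * (t * A.bdiv w t)) v + c w * disc_ext (\<lambda>t. t * A.bdiv w t) v"
      by (rule disc_ext_lin[OF H2_L2[OF 2] H2_L2[OF 1] v])
    then show ?case using insert t_bdiv(2)[OF _ v] by (simp add: add.commute)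
  qed
  have rv: "disc_ext r v = h v" if v: "v \<in> Z" for v
  proof -
    have "disc_ext r v = (\<Sum>w\<in>F. if w = v then h v else 0)"
      unfolding rz[OF A.Z_lt_1[OF v]]
    proof (rule sum.cong[OF refl])
      fix w assume w: "w \<in> F"
      show "c w * (v * disc_ext (A.bdiv w) v) = (if w = v then h v else 0)"
        using nz[OF v] A.bdiv(3)[OF _ v, of w] w F(2) by (auto simp: c_def)
    qed
    also have "\<dots> = h v" using F v by (auto simp: F_def)
    finally show ?thesis .
  qed
  have hr: "(\<lambda>t. (h t - r t) * cnj (b t)) \<in> H2"
  proof (rule A.b_div[OF H2_diff[OF hH r]])
    fix w assume w: "w \<in> Z"
    show "disc_ext (\<lambda>t. h t - r t) w = 0"
      using disc_ext_lin[OF H2_L2[OF hH] H2_L2[OF r] A.Z_lt_1[OF w], of "-1"] rv[OF w] h w by (simp add: A.core_iff)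
  qed
  define g where "g t = (h t - r t) * cnj (b t)" for t
  have g: "g \<in> H2" using hr by (simp add: g_def[abs_def])
  note [measurable] = L2_measurable[OF H2_L2[OF g]] L2_measurable[OF u]
    L2_measurable[OF H2_L2[OF hH]] L2_measurable[OF H2_L2[OF r]]
  \<comment> \<open>Membership of E' f in \<open>H2\<close> removes the positive frequencies after
    reflection; the assumption that f vanishes at 0 removes frequency 0.\<close>
  have ub: "(\<lambda>t. cnj (b t) * u t) \<in> H2_minus"
    unfolding H2_minus_iff
  proof (intro conjI allI impI)
    show ubL: "(\<lambda>t. cnj (b t) * u t) \<in> L2" by (rule L2_b_mult[OF u])
    fix n :: int assume n: "0 \<le> n"
    have c: "fourier_coeff (\<lambda>t. E' t * f t) (- n) = fourier_coeff (\<lambda>t. cnj (b t) * u t) (- (- n))"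
      by (rule reflect(2)[OF dual_identities(1)[OF rel, folded u_def] ubL])
    show "fourier_coeff (\<lambda>t. cnj (b t) * u t) n = 0"
    proof (cases "n = 0")
      case True
      have "fourier_coeff (\<lambda>t. E' t * f t) 0 = 0"
        using 0 B.Te_0 by (simp add: B.value_eq)
      then show ?thesis using c True by simp
    next
      case False
      then show ?thesis using c H2_coeff[OF G, of "- n"] n by simp
    qed
  qed
  have ug: "L2_inner u (\<lambda>t. h t - r t) = 0"
  proof -
    have "L2_inner u (\<lambda>t. h t - r t) = L2_inner (\<lambda>t. cnj (b t) * u t) g"
      unfolding L2_inner_def
    proof (rule integral_cong_AE)
      show "AE t in circle. u t * cnj (h t - r t) = cnj (b t) * u t * cnj (g t)"
        using A.b_1
      proof eventually_elim
        fix t assume "cmod (b t) = 1"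
        then have bb: "b t * cnj (b t) = 1" by (simp add: mult_cnj_cmod)
        have "cnj (b t) * u t * cnj (g t) = (b t * cnj (b t)) * (u t * cnj (h t - r t))"
          by (simp add: g_def mult_ac)
        then show "u t * cnj (h t - r t) = cnj (b t) * u t * cnj (g t)"
          by (simp only: bb mult_1_left)
      qed
    qed measurable
    also have "\<dots> = 0" by (rule H2_orthogonal[OF ub g])
    finally show ?thesis .
  qed
  have uh: "L2_inner u h = L2_inner u r"
    using ug L2.ip_lin_right[OF H2_L2[OF hH] H2_L2[OF r] u, of "-1"] by simp
  have "L2_inner u r = cnj (L2_inner r u)"
    by (rule L2.ip_cnj[OF H2_L2[OF r] u])
  also have "L2_inner r u = (\<Sum>w\<in>F. L2_inner (\<lambda>t. c w * (t * A.bdiv w t)) u)"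
    unfolding r_def[abs_def] using F(2) by (intro L2_inner_sum L2_scale H2_L2 t_bdiv u) auto
  \<comment> \<open>The hat condition replaces the value of E' f at cnj w by f times the outer
    function, and the prescribed f(cnj w) turns this into minus the summand of the weighted inner
    product.\<close>
  also have "\<dots> = (\<Sum>w\<in>F. - (h w * cnj (e w) * of_real (m w)))"
  proof (rule sum.cong[OF refl])
    fix w assume "w \<in> F"
    then have w: "w \<in> Z" using F by auto
    have tb: "(\<lambda>t. t * A.bdiv w t) \<in> L2" by (rule H2_L2[OF t_bdiv(1)[OF w]])
    have Tw: "Te \<gamma> (cnj w) = cnj (Te \<beta> w)" using Te'_eq[of "cnj w"] A.Z_lt_1[OF w] by simp
    have "L2_inner u (\<lambda>t. t * A.bdiv w t) = disc_ext (\<lambda>t. E' t * f t) (cnj w)"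
      unfolding u_def[abs_def] by (rule inner_t_bdiv[OF pe rel G w])
    also have "\<dots> = f (cnj w) * cnj (Te \<beta> w)"
      using fw[OF w] Te_nonzero[of w] unfolding Tw by simp
    also have "\<dots> = - (e w * cnj w * of_real (m w) * cnj (d w * Te \<beta> w))"
      using rel w by (simp add: dual_pairs_def mult_ac)
    also have "\<dots> = - (e w * of_real (m w)) * cnj (w * disc_ext (A.bdiv w) w)"
      unfolding d_eq[OF w] by (simp add: mult_ac)
    finally have a: "L2_inner (\<lambda>t. t * A.bdiv w t) u = - (cnj (e w) * of_real (m w)) * (w * disc_ext (A.bdiv w) w)"
      using L2.ip_cnj[OF u tb] by simp
    have s: "L2_inner (\<lambda>t. c w * (t * A.bdiv w t)) u = c w * L2_inner (\<lambda>t. t * A.bdiv w t) u"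
      unfolding L2_inner_def by (simp add: mult.assoc)
    have ch: "c w * (w * disc_ext (A.bdiv w) w) = h w"
      using nz[OF w] by (simp add: c_def)
    have "L2_inner (\<lambda>t. c w * (t * A.bdiv w t)) u
        = - (cnj (e w) * of_real (m w)) * (c w * (w * disc_ext (A.bdiv w) w))"
      unfolding s a by (rule mult.left_commute)
    then show "L2_inner (\<lambda>t. c w * (t * A.bdiv w t)) u = - (h w * cnj (e w) * of_real (m w))"
      unfolding ch by (simp add: mult_ac)
  qed
  finally have "L2_inner u r = - (\<Sum>w\<in>F. e w * cnj (h w) * of_real (m w))"
    by (simp add: sum_negf mult_ac)
  moreover have "weighted_inner Z m e h = (\<Sum>w\<in>F. e w * cnj (h w) * of_real (m w))"
  proof -
    have "weighted_inner Z m e h = (\<Sum>\<^sub>\<infinity>w\<in>F. e w * cnj (h w) * of_real (m w))"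
      unfolding weighted_inner_def by (rule infsum_cong_neutral) (use F in \<open>auto simp: F_def\<close>)
    then show ?thesis using F(1) by simp
  qed
  ultimately show ?thesis
    using ipd_core[OF e hq] uh by (simp add: u_def[abs_def])
qed

text \<open>With N the squared norm of the check kernel and v = b0 / T0, the normalized kernels have
  the values sqrt N and v / sqrt N at 0, so N drops out of the product.\<close>

theorem kernels_at_0:
  assumes b0: "disc_ext b 0 = of_real b0" "b0 > 0" and T0: "Te \<beta> 0 = of_real T0" "T0 > 0"
  shows "of_real (T0 / b0) * value_at_0 \<beta> (K_check \<beta>) * value_at_0 \<gamma> (K_hat \<gamma>) = 1"
proof -
  let ?k = "k_check \<beta>"
  obtain k2 r where kV: "(?k, k2) \<in> A.V" and r: "\<And>n::nat. r n \<in> A.core_pairs"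
    and rlim: "(\<lambda>n. A.D.dst (r n) (?k, k2)) \<longlonglongrightarrow> 0"
    using A.k_check(1) unfolding A.H2_check_iff by blast
  have pk: "A.pair ?k k2" using kV by (simp add: A.V_def)
  define u where "u t = ?k t + cnj (S t) * k2 t" for t
  have u: "u \<in> L2" unfolding u_def[abs_def] by (rule A.pair_add_cnj_S_L2[OF pk])
  have core: "L2_inner u h + weighted_inner Z m ?k h = cnj (disc_ext h 0)" if h: "h \<in> H2_core \<beta>" for h
  proof -
    define q where "q t = - P_minus (\<lambda>s. S s * h s) t" for t
    have hq: "(h, q) \<in> A.core_pairs"
      using A.core_pairs_P_minus[OF h] by (simp add: q_def[abs_def])
    note hV = A.core_pairs_V[OF hq]
    have "A.D.dst (h, q) (h, q) = 0"
      using hV by (simp add: A.D.dst_eq A.D.sq_def)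
    then have "h \<in> H2_check \<beta>"
      unfolding A.H2_check_iff using hV hq by (intro exI[of _ q] exI[of _ "\<lambda>_. (h, q)"]) simp
    then have "A.ipd (h, q) (?k, k2) = disc_ext h 0"
      using A.k_check(2) A.inner_data_eq[OF hV kV] A.value_core[OF A.core_H2[OF h]] by simp
    then have "A.ipd (?k, k2) (h, q) = cnj (disc_ext h 0)"
      using A.D.ip_cnj[OF hV kV] by simp
    then show ?thesis using ipd_core[OF kV hq] by (simp add: u_def[abs_def])
  qed
  \<comment> \<open>Test functions given only as elements of \<open>H2\<close> enter with their disc
    values on Z.\<close>
  have core_AE: "L2_inner u h + weighted_inner Z m ?k (disc_ext h) = cnj (disc_ext h 0)"
    if h: "h \<in> H2" and fin: "finite {w \<in> Z. disc_ext h w \<noteq> 0}" for h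
  proof -
    obtain h' where h': "h' \<in> H2_core \<beta>" "AE t in circle. h' t = h t" "\<And>w. w \<in> Z \<Longrightarrow> h' w = disc_ext h w"
      "\<And>z. disc_ext h' z = disc_ext h z"
      by (rule A.core_modify[OF h fin]) blast
    have "L2_inner u h' = L2_inner u h"
      by (rule L2_inner_cong_AE) (use h'(2) u h A.core_H2[OF h'(1)] in \<open>auto intro: L2_measurable H2_L2\<close>)
    moreover have "weighted_inner Z m ?k h' = weighted_inner Z m ?k (disc_ext h)"
      unfolding weighted_inner_def by (rule infsum_cong) (simp add: h'(3))
    ultimately show ?thesis using core[OF h'(1)] h'(4) by simp
  qed
  obtain y where y: "dual_pairs (?k, k2) y" using dual_pairs_exists by blast
  obtain \<kappa> \<kappa>2 where y\<kappa>: "y = (\<kappa>, \<kappa>2)" by (cases y)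
  note rel = y[unfolded y\<kappa>]
  have \<kappa>V: "(\<kappa>, \<kappa>2) \<in> B.V" by (rule dual_V[OF rel kV])
  define G where "G t = E' t * \<kappa> t" for t
  note I1 = dual_identities(1)[OF rel, folded u_def G_def]
  note ub = L2_b_mult[OF u]
  \<comment> \<open>Tested against t^n b, which vanishes on Z, the reproducing property computes the
    coefficients of G of index -n: they are 0 for n > 0 and b(0) for n = 0.\<close>
  have Gc: "fourier_coeff G (- n) = cnj (disc_ext (\<lambda>t. t powi n * b t) 0)" if n: "0 \<le> n" for n
  proof -
    define h where "h t = t powi n * b t" for t
    have p1: "AE t in circle. cmod (t powi n) \<le> 1"
      using AE_circle_norm by eventually_elim (simp add: norm_power_int)
    have h: "h \<in> H2" unfolding h_def[abs_def] by (rule H2_mult(1)[OF A.b_H2 powi_H2[OF n] p1])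
    have hz: "disc_ext h w = 0" if "w \<in> Z" for w
      unfolding h_def[abs_def] using H2_mult(2)[OF A.b_H2 powi_H2[OF n] p1 A.Z_lt_1[OF that]] A.b_zero[OF that] by simp
    have "fourier_coeff G (- n) = fourier_coeff (\<lambda>t. cnj (b t) * u t) (- (- n))"
      by (rule reflect(2)[OF I1 ub])
    also have "\<dots> = L2_inner u h"
      unfolding fourier_coeff_def L2_inner_def h_def by (simp add: mult_ac)
    also have "\<dots> = L2_inner u h + weighted_inner Z m ?k (disc_ext h)"
    proof -
      have "weighted_inner Z m ?k (disc_ext h) = 0"
        unfolding weighted_inner_def by (rule infsum_0) (simp add: hz)
      then show ?thesis by simp
    qed
    also have "\<dots> = cnj (disc_ext h 0)"
    proof (rule core_AE[OF h])
      have none: "{w \<in> Z. disc_ext h w \<noteq> 0} = {}" using hz by auto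
      show "finite {w \<in> Z. disc_ext h w \<noteq> 0}" unfolding none by (rule finite.emptyI)
    qed
    finally show ?thesis by (simp add: h_def[abs_def])
  qed
  have GL: "G \<in> L2" by (rule reflect(1)[OF I1 ub])
  have G: "G \<in> H2"
  proof (rule H2_I[OF GL])
    fix n :: int assume n: "n < 0"
    have "disc_ext (\<lambda>t. t powi (- n) * b t) 0 = fourier_coeff b (n)"
      unfolding disc_ext_0 using fourier_coeff_shift[of b "- n" 0] by simp
    then show "fourier_coeff G n = 0"
      using Gc[of "- n"] n H2_coeff[OF A.b_H2 n] by simp
  qed
  have G0: "fourier_coeff G 0 = of_real b0"
    using Gc[of 0] b0 by simp
  \<comment> \<open>Tested against t * bdiv w, which vanishes at 0 and on Z except at w; this yields
    the value condition of the hat space.\<close>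
  have \<kappa>w: "\<kappa> (cnj w) = disc_ext G (cnj w) / Te \<gamma> (cnj w)" if w: "w \<in> Z" for w
  proof -
    let ?h = "\<lambda>t. t * A.bdiv w t"
    have hv: "disc_ext ?h v = 0" if "v \<in> Z" "v \<noteq> w" for v
      using t_bdiv(2)[OF w A.Z_lt_1[OF that(1)]] A.bdiv(3)[OF w that] by simp
    have "{v \<in> Z. disc_ext ?h v \<noteq> 0} \<subseteq> {w}" using hv by auto
    then have "L2_inner u ?h + weighted_inner Z m ?k (disc_ext ?h) = cnj (disc_ext ?h 0)"
      by (intro core_AE t_bdiv(1)[OF w]) (auto intro: finite_subset)
    moreover have "disc_ext ?h 0 = 0" using t_bdiv(2)[OF w, of 0] by simp
    moreover have "weighted_inner Z m ?k (disc_ext ?h) = ?k w * cnj (w * disc_ext (A.bdiv w) w) * of_real (m w)"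
      using weighted_inner_single[OF w hv, where e = ?k] t_bdiv(2)[OF w A.Z_lt_1[OF w]] by simp
    moreover have "L2_inner u ?h = disc_ext G (cnj w)"
      unfolding u_def[abs_def] G_def[abs_def]
      by (rule inner_t_bdiv[OF pk rel _ w]) (use G in \<open>simp add: G_def[abs_def]\<close>)
    ultimately have "disc_ext G (cnj w) = - (?k w * cnj (w * (d w * Te \<beta> w)) * of_real (m w))"
      unfolding d_eq[OF w] by (simp add: eq_neg_iff_add_eq_0)
    also have "\<dots> = \<kappa> (cnj w) * cnj (Te \<beta> w)"
      using rel w by (simp add: dual_pairs_def mult_ac)
    finally show ?thesis
      using Te'_eq[of "cnj w"] A.Z_lt_1[OF w] Te_nonzero[of w] by simp
  qed
  have \<kappa>: "\<kappa> \<in> H2_hat \<gamma>"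
    unfolding hat_iff using \<kappa>V G \<kappa>w by (auto simp: G_def[abs_def])
  define v where "v = b0 / T0"
  have v: "v > 0" using b0 T0 by (simp add: v_def)
  have "Te \<gamma> 0 = of_real T0" using Te'_eq[of 0] T0 by simp
  then have v\<kappa>: "value_at_0 \<gamma> \<kappa> = of_real v"
    using G0 by (simp add: B.value_eq G_def[abs_def] v_def)
  define N where "N = A.D.sq (?k, k2)"
  have kN: "value_at_0 \<beta> ?k = of_real N"
    using A.k_check(2)[OF A.k_check(1)] A.inner_data_eq[OF kV kV] A.D.ip_self[OF kV] by (simp add: N_def)
  have Npos: "N > 0"
    using A.k_check(3) kN A.D.sq_nonneg[OF kV] by (simp add: N_def less_le)
  have normk: "norm_data \<beta> ?k = sqrt N"
    unfolding N_def by (rule A.norm_data_eq[OF kV])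
  have \<kappa>\<kappa>: "B.ipd (\<kappa>, \<kappa>2) (\<kappa>, \<kappa>2) = of_real N"
    using dual_ipd[OF rel rel kV kV] A.D.ip_self[OF kV] by (simp add: N_def)
  \<comment> \<open>The check kernel is a limit of core pairs, so orthogonality to the core passes
    to it and then, by unitarity, to \<kappa>.\<close>
  have orth: "B.ipd (f, f2) (\<kappa>, \<kappa>2) = 0"
    if f: "f \<in> H2_hat \<gamma>" "value_at_0 \<gamma> f = 0" and fV: "(f, f2) \<in> B.V" for f f2
  proof -
    obtain x where x: "dual_pairs x (f, f2)" "x \<in> A.V" by (rule dual_V_inverse[OF fV])
    obtain e e2 where xe: "x = (e, e2)" by (cases x)
    have 0: "A.ipd (r n) (e, e2) = 0" for n
    proof -
      obtain h q where hq: "r n = (h, q)" by (cases "r n")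
      have hq': "(h, q) \<in> A.core_pairs" using r[of n] by (simp add: hq)
      have "A.ipd (e, e2) (h, q) = 0"
        by (rule hat_zero_orthogonal[OF x(2)[unfolded xe] x(1)[unfolded xe] f hq'])
      then show ?thesis
        using A.D.ip_cnj[OF x(2)[unfolded xe] A.core_pairs_V[OF hq']] by (simp add: hq)
    qed
    have "(\<lambda>n. A.ipd (r n) (e, e2)) \<longlonglongrightarrow> A.ipd (?k, k2) (e, e2)"
      by (rule A.D.tendsto_ip[OF A.core_pairs_V[OF r] kV x(2)[unfolded xe] rlim])
    then have "A.ipd (?k, k2) (e, e2) = 0" by (simp add: 0 LIMSEQ_const_iff)
    then have "A.ipd (e, e2) (?k, k2) = 0"
      using A.D.ip_cnj[OF kV x(2)[unfolded xe]] by simp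
    then show ?thesis
      using dual_ipd[OF x(1)[unfolded xe] rel x(2)[unfolded xe] kV] by simp
  qed
  have kernel: "B.ipd (f, f2) (\<kappa>, \<kappa>2) = value_at_0 \<gamma> f * of_real (N / v)"
    if f: "f \<in> H2_hat \<gamma>" and fV: "(f, f2) \<in> B.V" for f f2
  proof -
    \<comment> \<open>Subtracting this multiple of \<kappa> makes the value at 0 vanish, so
      \<open>orth\<close> applies.\<close>
    define c where "c = - value_at_0 \<gamma> f / of_real v"
    have "B.ipd (B.lin (f, f2) c (\<kappa>, \<kappa>2)) (\<kappa>, \<kappa>2) = 0"
      unfolding B.lin_def fst_conv snd_conv
    proof (rule orth[OF hat_lin[OF f \<kappa>]])
      show "value_at_0 \<gamma> (\<lambda>t. f t + c * \<kappa> t) = 0"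
        using B.value_lin[OF fV \<kappa>V, of c] v by (simp add: v\<kappa> c_def)
      show "(\<lambda>t. f t + c * \<kappa> t, \<lambda>t. f2 t + c * \<kappa>2 t) \<in> B.V"
        using B.D.lin_closed[OF fV \<kappa>V, of c] by (simp add: B.lin_def)
    qed
    then have "B.ipd (f, f2) (\<kappa>, \<kappa>2) + c * of_real N = 0"
      using B.D.ip_lin[OF fV \<kappa>V \<kappa>V, of c] \<kappa>\<kappa> by simp
    then show ?thesis by (simp add: c_def add_eq_0_iff2)
  qed
  \<comment> \<open>The factor v / N turns N / v in \<open>kernel\<close> into 1, so l has the
    reproducing property.\<close>
  define l where "l = (\<lambda>t. of_real (v / N) * \<kappa> t)"
  define l2 where "l2 = (\<lambda>t. of_real (v / N) * \<kappa>2 t)"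
  have lin: "B.lin (\<kappa>, \<kappa>2) (of_real (v / N) - 1) (\<kappa>, \<kappa>2) = (l, l2)"
    by (simp add: B.lin_def l_def l2_def algebra_simps)
  have lV: "(l, l2) \<in> B.V" unfolding lin[symmetric] by (rule B.D.lin_closed[OF \<kappa>V \<kappa>V])
  have lH: "l \<in> H2_hat \<gamma>"
    using hat_lin[OF \<kappa> \<kappa>, of "of_real (v / N) - 1"] by (simp add: l_def algebra_simps)
  have lrep: "B.ipd (f, f2) (l, l2) = value_at_0 \<gamma> f" if f: "f \<in> H2_hat \<gamma>" and fV: "(f, f2) \<in> B.V" for f f2
  proof -
    have "B.ipd (f, f2) (l, l2) = of_real (v / N) * B.ipd (f, f2) (\<kappa>, \<kappa>2)"
      unfolding lin[symmetric] using B.D.ip_lin_right[OF \<kappa>V \<kappa>V fV, of "of_real (v / N) - 1"]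
      by (simp add: algebra_simps)
    then show ?thesis using kernel[OF f fV] v Npos by simp
  qed
  have l_inner: "inner_data \<gamma> f l = value_at_0 \<gamma> f" if "f \<in> H2_hat \<gamma>" for f
  proof -
    obtain f2 where "(f, f2) \<in> B.V" using \<open>f \<in> H2_hat \<gamma>\<close> by (auto simp: hat_iff)
    then show ?thesis using lrep that B.inner_data_eq lV by simp
  qed
  let ?l = "k_hat \<gamma>"
  have "?l \<in> H2_hat \<gamma> \<and> (\<forall>f\<in>H2_hat \<gamma>. inner_data \<gamma> f ?l = value_at_0 \<gamma> f)"
    unfolding k_hat_def
    by (rule someI[of "\<lambda>k. k \<in> H2_hat \<gamma> \<and> (\<forall>f\<in>H2_hat \<gamma>. inner_data \<gamma> f k = value_at_0 \<gamma> f)" l])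
       (use lH l_inner in blast)
  then have kh: "?l \<in> H2_hat \<gamma>" and khr: "\<And>f. f \<in> H2_hat \<gamma> \<Longrightarrow> inner_data \<gamma> f ?l = value_at_0 \<gamma> f"
    by auto
  obtain kh2 where khV: "(?l, kh2) \<in> B.V" using kh by (auto simp: hat_iff)
  \<comment> \<open>As for the check kernel, the chosen kernel and l are evaluated on each other;
    the common value is real.\<close>
  have "value_at_0 \<gamma> ?l = B.ipd (?l, kh2) (l, l2)" using lrep[OF kh khV] by simp
  also have "\<dots> = cnj (B.ipd (l, l2) (?l, kh2))" by (rule B.D.ip_cnj[OF lV khV])
  also have "B.ipd (l, l2) (?l, kh2) = value_at_0 \<gamma> l"
    using khr[OF lH] B.inner_data_eq[OF lV khV] by simp
  also have "value_at_0 \<gamma> l = of_real (v / N * v)"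
    unfolding l_def B.value_scale v\<kappa> by simp
  finally have val_l: "value_at_0 \<gamma> ?l = of_real (v / N * v)" by simp
  have "B.D.sq (?l, kh2) = v / N * v"
  proof -
    have "complex_of_real (B.D.sq (?l, kh2)) = of_real (v / N * v)"
      using khr[OF kh] B.inner_data_eq[OF khV khV] B.D.ip_self[OF khV] val_l by simp
    then show ?thesis by (simp only: of_real_eq_iff)
  qed
  then have norml: "norm_data \<gamma> ?l = v / sqrt N"
    using B.norm_data_eq[OF khV] v Npos by (simp add: real_sqrt_mult real_sqrt_divide)
  have "value_at_0 \<beta> (K_check \<beta>) = (1 / of_real (sqrt N)) * of_real N"
    unfolding K_check_def normk using A.value_scale[of "1 / of_real (sqrt N)" ?k] kN by simp
  also have "\<dots> = of_real (sqrt N)"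
    using Npos by (simp flip: of_real_divide add: real_div_sqrt)
  finally have 1: "value_at_0 \<beta> (K_check \<beta>) = of_real (sqrt N)" .
  have "value_at_0 \<gamma> (K_hat \<gamma>) = (1 / of_real (v / sqrt N)) * of_real (v / N * v)"
    unfolding B.value_scale[of "1 / of_real (v / sqrt N)" ?l, unfolded val_l, symmetric] K_hat_def norml
    by (intro arg_cong[of _ _ "value_at_0 \<gamma>"] ext) simp
  also have "\<dots> = of_real (1 / (v / sqrt N) * (v / N * v))" by simp
  also have "1 / (v / sqrt N) * (v / N * v) = v / sqrt N"
    using v Npos real_div_sqrt[of N] by (simp add: field_simps)
  finally have 2: "value_at_0 \<gamma> (K_hat \<gamma>) = of_real (v / sqrt N)" .
  have "T0 / b0 * sqrt N * (v / sqrt N) = 1"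
    using Npos b0 T0 by (simp add: v_def)
  then show ?thesis
    unfolding 1 2 of_real_mult[symmetric] by (simp only: of_real_1)
qed

end

section \<open>Boundary functions of the given data\<close>

lemma boundary_unique:
  assumes "f \<in> H2" "\<And>z. cmod z < 1 \<Longrightarrow> disc_ext f z = F z"
  shows "boundary F \<in> H2" "\<And>z. cmod z < 1 \<Longrightarrow> disc_ext (boundary F) z = F z"
    "AE t in circle. boundary F t = f t"
proof -
  have "boundary F \<in> H2 \<and> (\<forall>z\<in>ball 0 1. disc_ext (boundary F) z = F z)"
    unfolding boundary_def
    by (rule someI[of "\<lambda>f. f \<in> H2 \<and> (\<forall>z\<in>ball 0 1. disc_ext f z = F z)" f]) (use assms in auto)
  then show 1: "boundary F \<in> H2" and 2: "\<And>z. cmod z < 1 \<Longrightarrow> disc_ext (boundary F) z = F z" by auto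
  show "AE t in circle. boundary F t = f t"
    by (rule disc_ext_unique[OF 1 assms(1)]) (simp add: 2 assms(2))
qed

lemma herglotz_cong_AE:
  assumes "AE t in circle. l t = l' t" "l \<in> borel_measurable circle" "l' \<in> borel_measurable circle"
  shows "herglotz l z = herglotz l' z"
  unfolding herglotz_def
proof (rule integral_cong_AE)
  note [measurable] = assms(2,3)
  show "AE t in circle. (t + z) / (t - z) * complex_of_real (l t) = (t + z) / (t - z) * complex_of_real (l' t)"
    using assms(1) by eventually_elim simp
  show "(\<lambda>t. (t + z) / (t - z) * complex_of_real (l t)) \<in> borel_measurable circle"
    "(\<lambda>t. (t + z) / (t - z) * complex_of_real (l' t)) \<in> borel_measurable circle" by measurable
qed

lemma herglotz_reflect:
  assumes [measurable]: "l \<in> borel_measurable circle"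
  shows "herglotz (\<lambda>t. l (cnj t)) z = cnj (herglotz l (cnj z))"
proof -
  have m: "(\<lambda>t. (cnj t + z) / (cnj t - z) * complex_of_real (l t)) \<in> borel_measurable circle" by measurable
  have "herglotz (\<lambda>t. l (cnj t)) z = (LINT t|circle. (\<lambda>t. (cnj t + z) / (cnj t - z) * complex_of_real (l t)) (cnj t))"
    unfolding herglotz_def by simp
  also have "\<dots> = (LINT t|circle. (cnj t + z) / (cnj t - z) * complex_of_real (l t))"
    by (rule integral_circle_cnj[OF m])
  also have "\<dots> = (LINT t|circle. cnj ((t + cnj z) / (t - cnj z) * complex_of_real (l t)))"
    by simp
  also have "\<dots> = cnj (herglotz l (cnj z))"
    unfolding herglotz_def by (rule Bochner_Integration.integral_cnj)
  finally show ?thesis .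
qed

lemma H2_reflect_cnj:
  assumes f: "f \<in> H2"
  shows "(\<lambda>t. cnj (f (cnj t))) \<in> H2"
    "cmod z < 1 \<Longrightarrow> disc_ext (\<lambda>t. cnj (f (cnj t))) z = cnj (disc_ext f (cnj z))"
proof -
  note r = L2_reflect[OF H2_L2[OF f]]
  have c: "fourier_coeff (\<lambda>t. cnj (f (cnj t))) n = cnj (fourier_coeff f n)" for n
    using fourier_coeff_cnj[OF L2_measurable[OF r], of n]
      fourier_coeff_reflect[OF L2_measurable[OF H2_L2[OF f]], of "- n"] by simp
  show "(\<lambda>t. cnj (f (cnj t))) \<in> H2"
    by (rule H2_I[OF L2_cnj[OF r]]) (simp add: c H2_coeff[OF f])
  assume z: "cmod z < 1"
  have "(\<lambda>n. fourier_coeff f (int n) * cnj z ^ n) sums disc_ext f (cnj z)"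
    using z by (intro disc_ext_sums H2_L2[OF f]) simp
  then have "(\<lambda>n. cnj (fourier_coeff f (int n) * cnj z ^ n)) sums cnj (disc_ext f (cnj z))"
    by (simp only: sums_cnj)
  then show "disc_ext (\<lambda>t. cnj (f (cnj t))) z = cnj (disc_ext f (cnj z))"
    unfolding disc_ext_def c by (simp add: sums_iff)
qed

definition log_weight :: "(complex \<Rightarrow> complex) \<Rightarrow> complex \<Rightarrow> real" where
  "log_weight S t = ln (sqrt (1 - (cmod (S t))\<^sup>2))"

lemma Te_eq: "Te \<alpha> z = exp (herglotz (log_weight (symbol \<alpha>)) z)"
  by (simp add: Te_def outer_eq log_weight_def[abs_def])

text \<open>\<open>Te_bd\<close> is defined by choice from the values in the disc. It agrees almost
  everywhere with the boundary function constructed in \<open>outer_H2\<close>, from which modulus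
  and approximants are inherited.\<close>

lemma outer_symbol_exists:
  assumes S [measurable]: "S \<in> borel_measurable circle" and lt: "AE t in circle. cmod (S t) < 1"
    and int: "integrable circle (log_weight S)" and sym: "symbol \<alpha> = S"
  obtains p where "outer_symbol S (Te_bd \<alpha>) p" "\<And>z. cmod z < 1 \<Longrightarrow> Te \<alpha> z = disc_ext (Te_bd \<alpha>) z"
proof -
  have pos: "AE t in circle. 0 < 1 - (cmod (S t))\<^sup>2 \<and> 1 - (cmod (S t))\<^sup>2 \<le> 1"
    using lt
  proof eventually_elim
    fix t assume "cmod (S t) < 1"
    then have "(cmod (S t))\<^sup>2 < 1\<^sup>2" by (intro power_strict_mono) auto
    then show "0 < 1 - (cmod (S t))\<^sup>2 \<and> 1 - (cmod (S t))\<^sup>2 \<le> 1" by simp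
  qed
  have neg: "AE t in circle. log_weight S t \<le> 0"
    using pos by eventually_elim (simp add: log_weight_def)
  have exp: "AE t in circle. exp (log_weight S t) = sqrt (1 - (cmod (S t))\<^sup>2)"
    using pos by eventually_elim (simp add: log_weight_def)
  have "\<exists>E p. E \<in> H2 \<and> (AE t in circle. cmod (E t) = exp (log_weight S t)) \<and>
    (\<forall>z. cmod z < 1 \<longrightarrow> disc_ext E z = exp (herglotz (log_weight S) z)) \<and>
    (\<forall>n::nat. p n \<in> H2) \<and> (\<forall>n. \<exists>C. AE t in circle. cmod (p n t) \<le> C) \<and>
    (\<forall>n. AE t in circle. cmod (p n t * E t) \<le> 1) \<and> (AE t in circle. (\<lambda>n. p n t * E t) \<longlonglongrightarrow> 1)"
    by (rule outer_H2[OF int neg]) blast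
  then obtain E p where E: "E \<in> H2" "AE t in circle. cmod (E t) = exp (log_weight S t)"
    "\<And>z. cmod z < 1 \<Longrightarrow> disc_ext E z = exp (herglotz (log_weight S) z)"
    and p: "\<And>n::nat. p n \<in> H2" "\<And>n. \<exists>C. AE t in circle. cmod (p n t) \<le> C"
    "\<And>n. AE t in circle. cmod (p n t * E t) \<le> 1" "AE t in circle. (\<lambda>n. p n t * E t) \<longlonglongrightarrow> 1"
    by auto
  have "disc_ext E z = Te \<alpha> z" if "cmod z < 1" for z
    using E(3)[OF that] by (simp add: Te_eq sym)
  then have bd: "Te_bd \<alpha> \<in> H2" "\<And>z. cmod z < 1 \<Longrightarrow> disc_ext (Te_bd \<alpha>) z = Te \<alpha> z"
    "AE t in circle. Te_bd \<alpha> t = E t"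
    unfolding Te_bd_def by (auto intro: boundary_unique[OF E(1)])
  have "outer_symbol S (Te_bd \<alpha>) p"
  proof
    show "AE t in circle. (cmod (Te_bd \<alpha> t))\<^sup>2 = 1 - (cmod (S t))\<^sup>2"
      using bd(3) E(2) exp pos by eventually_elim simp
    show "AE t in circle. Te_bd \<alpha> t \<noteq> 0"
      using bd(3) E(2) by eventually_elim auto
    show "AE t in circle. cmod (p n t * Te_bd \<alpha> t) \<le> 1" for n
      using bd(3) p(3)[of n] by eventually_elim simp
    show "AE t in circle. (\<lambda>n. p n t * Te_bd \<alpha> t) \<longlonglongrightarrow> 1"
      using bd(3) p(4) by eventually_elim simp
  qed (use S bd(1) p in auto)
  then show ?thesis using bd(2) by (intro that) auto
qed

text \<open>1 - |R|^2 factors as (1 - |R|) (1 + |R|), and the logarithm of the second factor lies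
  between 0 and ln 2.\<close>

lemma integrable_log_weight:
  assumes [measurable]: "R \<in> borel_measurable circle" and log: "log_integrable (\<lambda>t. 1 - cmod (R t))"
  shows "AE t in circle. cmod (R t) < 1" "integrable circle (log_weight R)"
proof -
  show lt: "AE t in circle. cmod (R t) < 1"
    using log unfolding log_integrable_def by auto
  have int: "integrable circle (\<lambda>t. ln (1 - cmod (R t)))"
    using log by (simp add: log_integrable_def)
  have int2: "integrable circle (\<lambda>t. ln (1 + cmod (R t)))"
  proof (rule circle.integrable_const_bound[where B = "ln 2"])
    show "AE t in circle. norm (ln (1 + cmod (R t))) \<le> ln 2"
      using lt
    proof eventually_elim
      fix t assume "cmod (R t) < 1"
      then have "0 \<le> ln (1 + cmod (R t))" "ln (1 + cmod (R t)) \<le> ln 2"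
        by (auto simp: add_pos_nonneg)
      then show "norm (ln (1 + cmod (R t))) \<le> ln 2" by simp
    qed
  qed measurable
  have "integrable circle (\<lambda>t. (1 / 2) * (ln (1 - cmod (R t)) + ln (1 + cmod (R t))))"
    using int int2 by auto
  moreover have "AE t in circle. (1 / 2) * (ln (1 - cmod (R t)) + ln (1 + cmod (R t))) = log_weight R t"
    using lt
  proof eventually_elim
    fix t assume lt: "cmod (R t) < 1"
    have pos: "0 < 1 - cmod (R t)" "0 < 1 + cmod (R t)" using lt by (auto simp: add_pos_nonneg)
    have "1 - (cmod (R t))\<^sup>2 = (1 - cmod (R t)) * (1 + cmod (R t))"
      by (simp add: power2_eq_square algebra_simps)
    then have "log_weight R t = ln ((1 - cmod (R t)) * (1 + cmod (R t))) / 2"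
      using pos by (simp add: log_weight_def ln_sqrt)
    then show "(1 / 2) * (ln (1 - cmod (R t)) + ln (1 + cmod (R t))) = log_weight R t"
      using pos by (simp add: ln_mult)
  qed
  moreover have "log_weight R \<in> borel_measurable circle"
    unfolding log_weight_def[abs_def] by measurable
  ultimately show "integrable circle (log_weight R)"
    by (subst integrable_cong_AE[where g = "\<lambda>t. (1 / 2) * (ln (1 - cmod (R t)) + ln (1 + cmod (R t)))"])
       (auto elim!: eventually_mono)
qed

theorem corollary1p6:
  fixes R :: "complex \<Rightarrow> complex" and Z :: "complex set" and \<nu> :: "complex \<Rightarrow> real"
    and \<alpha> :: scattering_data
  assumes "R \<in> borel_measurable circle"
    and "\<And>t. cmod t = 1 \<Longrightarrow> cmod (R t) \<le> 1"
    and "log_integrable (\<lambda>t. 1 - cmod (R t))"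
    and "countable Z"
    and "Z \<subseteq> ball 0 1 - {0}"
    and "(\<lambda>z. 1 - cmod z) summable_on Z"
    and "\<And>z. z \<in> Z \<Longrightarrow> \<nu> z > 0"
    and "\<alpha> = \<lparr>symbol = R, points = Z, mass = \<nu>\<rparr>"
  shows "T \<alpha> 0 * value_at_0 (shift \<alpha>) (K_check (shift \<alpha>)) * value_at_0 (dual \<alpha>) (K_hat (dual \<alpha>)) = 1"
proof -
  note R [measurable] = assms(1)
  define S where "S t = inverse t * R t" for t
  have [measurable]: "S \<in> borel_measurable circle" unfolding S_def[abs_def] by measurable
  have SR: "AE t in circle. cmod (S t) = cmod (R t)"
    using AE_circle_norm by eventually_elim (simp add: S_def norm_mult norm_inverse)
  have R_lt: "AE t in circle. cmod (R t) < 1" and R_int: "integrable circle (log_weight R)"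
    by (rule integrable_log_weight[OF R assms(3)])+
  have lR: "AE t in circle. log_weight S t = log_weight R t"
    using SR by eventually_elim (simp add: log_weight_def)
  have lm [measurable]: "log_weight S \<in> borel_measurable circle" "log_weight R \<in> borel_measurable circle"
    unfolding log_weight_def[abs_def] by measurable
  have S_lt: "AE t in circle. cmod (S t) < 1"
    using SR R_lt by eventually_elim simp
  have S_int: "integrable circle (log_weight S)"
    using R_int integrable_cong_AE[OF lm lR] by simp
  let ?\<beta> = "shift \<alpha>" and ?\<gamma> = "dual \<alpha>"
  have sym\<beta>: "symbol ?\<beta> = S" by (simp add: shift_def assms(8) S_def[abs_def])
  have sym\<alpha>: "symbol \<alpha> = R" "points \<alpha> = Z" "mass \<alpha> = \<nu>" by (simp_all add: assms(8))
  have Te_\<beta>: "Te ?\<beta> = Te \<alpha>"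
    unfolding fun_eq_iff Te_eq sym\<beta> sym\<alpha> using herglotz_cong_AE[OF lR lm] by simp
  define E where "E = Te_bd ?\<beta>"
  have E_\<alpha>: "Te_bd \<alpha> = E" by (simp add: E_def Te_bd_def Te_\<beta>)
  obtain p where p: "outer_symbol S E p" and ext: "\<And>z. cmod z < 1 \<Longrightarrow> Te ?\<beta> z = disc_ext E z"
    unfolding E_def by (rule outer_symbol_exists[OF _ S_lt S_int sym\<beta>]) auto
  interpret O: outer_symbol S E p by fact
  have "\<exists>b. b \<in> H2 \<and> (AE t in circle. cmod (b t) = 1) \<and> (\<forall>z. cmod z < 1 \<longrightarrow> disc_ext b z = blaschke Z z) \<and>
    0 < Re (blaschke Z 0) \<and> Im (blaschke Z 0) = 0 \<and> (\<forall>w\<in>Z. disc_ext b w = 0) \<and>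
    (\<forall>h. h \<in> H2 \<longrightarrow> (\<forall>w\<in>Z. disc_ext h w = 0) \<longrightarrow> (\<lambda>t. h t * cnj (b t)) \<in> H2)"
    by (rule blaschke_H2[OF assms(5,6)]) blast
  then obtain b0 where b0: "b0 \<in> H2" "AE t in circle. cmod (b0 t) = 1" "\<And>z. cmod z < 1 \<Longrightarrow> disc_ext b0 z = blaschke Z z"
    "0 < Re (blaschke Z 0)" "Im (blaschke Z 0) = 0" "\<forall>w\<in>Z. disc_ext b0 w = 0"
    "\<forall>h. h \<in> H2 \<longrightarrow> (\<forall>w\<in>Z. disc_ext h w = 0) \<longrightarrow> (\<lambda>t. h t * cnj (b0 t)) \<in> H2"
    by auto
  \<comment> \<open>The dual symbol refers to this chosen boundary function; the properties of
    \<open>b0\<close> are carried over almost everywhere.\<close>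
  define b where "b = boundary (blaschke Z)"
  have bd: "b \<in> H2" "\<And>z. cmod z < 1 \<Longrightarrow> disc_ext b z = blaschke Z z" "AE t in circle. b t = b0 t"
    unfolding b_def using b0(3) by (auto intro: boundary_unique[OF b0(1)])
  note [measurable] = L2_measurable[OF H2_L2[OF bd(1)]]
  have b1: "AE t in circle. cmod (b t) = 1"
    using bd(3) b0(2) by eventually_elim simp
  have bz: "disc_ext b w = 0" if "w \<in> Z" for w
  proof -
    have "cmod w < 1" using that assms(5) by auto
    then show ?thesis using that b0(3)[of w] b0(6) bd(2)[of w] by simp
  qed
  have bdiv: "(\<lambda>t. h t * cnj (b t)) \<in> H2" if h: "h \<in> H2" "\<And>w. w \<in> Z \<Longrightarrow> disc_ext h w = 0" for h
  proof (rule H2_cong_AE)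
    note [measurable] = L2_measurable[OF H2_L2[OF h(1)]]
    show "(\<lambda>t. h t * cnj (b0 t)) \<in> H2" using b0(7) h by blast
    show "(\<lambda>t. h t * cnj (b t)) \<in> borel_measurable circle" by measurable
    show "AE t in circle. h t * cnj (b t) = h t * cnj (b0 t)"
      using bd(3) by eventually_elim simp
  qed
  define m where "m w = \<nu> w / (cmod w)\<^sup>2" for w
  have Z: "Z \<subseteq> ball 0 1" "0 \<notin> Z" using assms(5) by auto
  have mpos: "0 < m w" if "w \<in> Z" for w
  proof -
    have "w \<noteq> 0" using that Z(2) by auto
    then show ?thesis using assms(7)[OF that] by (simp add: m_def)
  qed
  interpret A: scattering_blaschke S E p Z m ?\<beta> b
  proof
    show "points ?\<beta> = Z" "mass ?\<beta> w = m w" for w by (simp_all add: shift_def sym\<alpha> m_def)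
    show "disc_ext b 0 \<noteq> 0" using bd(2)[of 0] b0(4) by auto
  qed (use Z mpos sym\<beta> ext bd(1) b1 bz bdiv in \<open>auto simp: E_def\<close>)
  define S' where "S' = symbol ?\<gamma>"
  have S'_def': "S' = (\<lambda>s. - (R (cnj s) / E (cnj s)) * cnj (E (cnj s) / b (cnj s)))"
    by (simp add: S'_def dual_def sym\<alpha> E_\<alpha> T_bd_def b_def)
  have S'_eq: "AE t in circle. S' (cnj t) = - (t * S t * cnj (E t) / E t) * b t"
    using AE_circle_norm b1
  proof eventually_elim
    fix t assume t: "cmod t = 1" "cmod (b t) = 1"
    then have ne: "t \<noteq> 0" "b t \<noteq> 0" by auto
    have "b t * cnj (b t) = 1" using t by (simp add: mult_cnj_cmod)
    then have "inverse (cnj (b t)) = b t" using ne by (simp add: field_simps)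
    then have "cnj (E t / b t) = cnj (E t) * b t" by (simp add: divide_inverse)
    moreover have "t * S t = R t" using ne by (simp add: S_def)
    ultimately show "S' (cnj t) = - (t * S t * cnj (E t) / E t) * b t"
      unfolding S'_def' by simp
  qed
  have [measurable]: "S' \<in> borel_measurable circle"
  proof (rule borel_measurable_cong_AE[OF _ AE_reflect[OF S'_eq]])
    show "(\<lambda>t. (\<lambda>t. - (t * S t * cnj (E t) / E t) * b t) (cnj t)) \<in> borel_measurable circle"
      by (rule measurable_compose[OF measurable_cnj_circle]) measurable
  qed
  \<comment> \<open>The factors b and \<open>cnj E / E\<close> are unimodular, so the dual symbol
    has the reflected modulus of R, and its outer function is the reflected conjugate of the given
    one.\<close>
  have "AE t in circle. cmod (S' (cnj t)) = cmod (R t)"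
    using S'_eq AE_circle_norm b1 SR O.E_nonzero
    by eventually_elim (simp add: norm_mult norm_divide)
  from AE_reflect[OF this] have S'R: "AE t in circle. cmod (S' t) = cmod (R (cnj t))" .
  have S'_lt: "AE t in circle. cmod (S' t) < 1"
    using S'R AE_circle_cnj[OF R_lt] by eventually_elim simp
  have lm' [measurable]: "log_weight S' \<in> borel_measurable circle"
    unfolding log_weight_def[abs_def] by measurable
  have lRr: "(\<lambda>t. log_weight R (cnj t)) \<in> borel_measurable circle"
    by (rule measurable_compose[OF measurable_cnj_circle lm(2)])
  have lS': "AE t in circle. log_weight S' t = log_weight R (cnj t)"
    using S'R by eventually_elim (simp add: log_weight_def)
  have S'_int: "integrable circle (log_weight S')"
    using integrable_circle_cnj[OF R_int] integrable_cong_AE[OF lm' lRr lS'] by simp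
  define E' where "E' = Te_bd ?\<gamma>"
  obtain p' where p': "outer_symbol S' E' p'" and ext': "\<And>z. cmod z < 1 \<Longrightarrow> Te ?\<gamma> z = disc_ext E' z"
    unfolding E'_def by (rule outer_symbol_exists[OF _ S'_lt S'_int S'_def[symmetric]]) auto
  interpret O': outer_symbol S' E' p' by fact
  have Te_\<gamma>: "Te ?\<gamma> z = cnj (Te ?\<beta> (cnj z))" for z
    unfolding Te_\<beta> Te_eq sym\<alpha> S'_def[symmetric] herglotz_cong_AE[OF lS' lm' lRr] herglotz_reflect[OF lm(2)]
    by (simp add: exp_cnj)
  have E'_eq: "AE t in circle. E' t = cnj (E (cnj t))"
    by (rule disc_ext_unique[OF O'.E_H2 H2_reflect_cnj(1)[OF O.E_H2]])
       (simp add: H2_reflect_cnj(2)[OF O.E_H2] ext[symmetric] ext'[symmetric] Te_\<gamma>)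
  define d where "d w = deriv (\<lambda>z. 1 / T \<alpha> z) w" for w
  have d_eq: "d w * Te ?\<beta> w = disc_ext (A.bdiv w) w" if w: "w \<in> Z" for w
  proof -
    \<comment> \<open>1 / T is (z - w) * g z with g analytic near w, so its derivative at the simple
      zero w is g w.\<close>
    define g where "g z = disc_ext (A.bdiv w) z / disc_ext E z" for z
    have w1: "cmod w < 1" using w Z by auto
    have Ez: "disc_ext E z \<noteq> 0" if "cmod z < 1" for z
      unfolding ext[OF that, symmetric] by (simp add: Te_eq)
    have "g field_differentiable at w"
      unfolding g_def[abs_def]
      by (intro field_differentiable_divide disc_ext_differentiable H2_L2 A.bdiv(1)[OF w] O.E_H2 w1 Ez)
    then obtain g' where g': "(g has_field_derivative g') (at w)"
      by (auto simp: field_differentiable_def)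
    have "((\<lambda>z. (z - w) * g z) has_field_derivative g w) (at w)"
      by (rule derivative_eq_intros g' refl)+ simp
    \<comment> \<open>At z = w both sides are 0, the right one by the convention for division by 0;
      the equality therefore holds on a full neighbourhood.\<close>
    moreover have "\<forall>\<^sub>F z in nhds w. (z - w) * g z = 1 / T \<alpha> z"
    proof -
      have "\<forall>\<^sub>F z in nhds w. z \<in> ball 0 1"
        using w1 by (intro eventually_nhds_in_open) auto
      then show ?thesis
      proof eventually_elim
        fix z :: complex assume "z \<in> ball 0 1"
        then have z: "cmod z < 1" by simp
        have "(z - w) * g z = disc_ext b z / disc_ext E z"
          unfolding g_def using A.bdiv(2)[OF w z] by simp
        also have "\<dots> = 1 / T \<alpha> z"
          using ext[OF z] bd(2)[OF z] by (simp add: T_def sym\<alpha> Te_\<beta>)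
        finally show "(z - w) * g z = 1 / T \<alpha> z" .
      qed
    qed
    ultimately have "((\<lambda>z. 1 / T \<alpha> z) has_field_derivative g w) (at w)"
      by (subst DERIV_cong_ev[OF refl _ refl, symmetric])
    then have "d w = g w" unfolding d_def by (rule DERIV_imp_deriv)
    then show ?thesis using ext[OF w1] Ez[OF w1] by (simp add: g_def)
  qed
  define m' where "m' = mass ?\<gamma>"
  \<comment> \<open>m is \<nu> / |w|^2, so the factor |w|^2 restores the \<nu> that occurs in the
    dual masses.\<close>
  have m'_eq: "m' (cnj w) = 1 / ((cmod w)\<^sup>2 * (cmod (d w))\<^sup>2 * m w)" if w: "w \<in> Z" for w
    using w Z(2) by (auto simp: m'_def dual_def sym\<alpha> m_def d_def)
  have m'_pos: "0 < m' w" if w: "w \<in> cnj ` Z" for w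
  proof -
    obtain v where v: "v \<in> Z" "w = cnj v" using w by auto
    have "d v \<noteq> 0" using d_eq[OF v(1)] A.bdiv_nonzero[OF v(1)] by auto
    then show ?thesis using v mpos[OF v(1)] Z(2) by (auto simp: m'_eq intro!: divide_pos_pos mult_pos_pos)
  qed
  interpret B: scattering_record S' E' p' "cnj ` Z" m' ?\<gamma>
  proof
    show "points ?\<gamma> = cnj ` Z" by (simp add: dual_def sym\<alpha>)
  qed (use Z m'_pos ext' in \<open>auto simp: S'_def E'_def m'_def\<close>)
  interpret D: dual_data S E p Z m ?\<beta> b S' E' p' "cnj ` Z" m' ?\<gamma> d
    by unfold_locales (use E'_eq S'_eq Z(2) m'_eq d_eq Te_\<gamma> in auto)
  define B0 where "B0 = Re (blaschke Z 0)"
  define T0 where "T0 = exp (LINT t|circle. log_weight R t)"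
  have B0: "blaschke Z 0 = of_real B0" using b0(5) by (simp add: B0_def complex_eq_iff)
  have T0: "Te \<alpha> 0 = of_real T0"
    by (simp add: Te_eq sym\<alpha> herglotz_0 T0_def exp_of_real)
  have "of_real (T0 / B0) * value_at_0 ?\<beta> (K_check ?\<beta>) * value_at_0 ?\<gamma> (K_hat ?\<gamma>) = 1"
  proof (rule D.kernels_at_0)
    show "disc_ext b 0 = of_real B0" using bd(2)[of 0] B0 by simp
    show "B0 > 0" using b0(4) by (simp add: B0_def)
    show "Te ?\<beta> 0 = of_real T0" by (simp add: Te_\<beta> T0)
    show "T0 > 0" by (simp add: T0_def)
  qed
  moreover have "T \<alpha> 0 = of_real (T0 / B0)"
    by (simp add: T_def sym\<alpha> T0 B0)
  ultimately show ?thesis by simp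
qed

end
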